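(* Let $\mathcal{F}=(F_n)_{n\geq0}$ be a tower over $\mathbb{F}_q$ with $F:=F_0$, and let $E/F$ be a finite separable extension such that $\mathcal{E}:=E\cdot\mathcal{F}$ is a composite tower of $\mathcal{F}$ with $E/F$. Write $E=F(y)$, $m:=[E:F]$, and let $M$ be the set of places $P$ of $F$ such that $\{1,y,\ldots,y^{m-1}\}$ is an integral basis for $E/F$ at $P$. Let $P\in M$ be such that for every place $Q$ of $E$ with $Q\mid P$, $e(Q|P)$ is coprime to $e(P'|P)$ for every place $P'$ of $F_n$ lying over $P$, for every $n\geq1$. Then for every place $Q$ of $E$ with $Q\mid P$ and every $s\geq1$, \[\nu_s(Q,\mathcal{E})=\frac{f(Q|P)}{s}\sum_{\substack{d\in\mathbb{N}\\ \mathrm{lcm}(\deg Q,\,d)=s}} d\cdot\nu_d(P,\mathcal{F}).\]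
   Context: All algebraic function fields considered have $\mathbb{F}_q$ as full constant field. A tower over $\mathbb{F}_q$ is a sequence $\mathcal{T}=(T_n)_{n\geq0}$ of function fields with $T_0\subsetneq T_1\subsetneq\cdots$, all $T_{n+1}/T_n$ finite separable, and genus $g(T_n)\to\infty$. For a place $P$ of $T_0$, $\nu_r(P,\mathcal{T}):=\lim_n B_r(P,T_n)/[T_n:T_0]$, where $B_r(P,T_n)$ is the number of places of $T_n$ of degree $r$ over $P$ (the limit exists). Given a tower $\mathcal{F}$ with $F=F_0$ and a finite separable $E/F$ in a common algebraic closure, $E\cdot\mathcal{F}:=(EF_n)_{n\ge0}$ (whose $0$-th field is $E$); it is a composite tower of $\mathcal{F}$ with $E/F$ if it is a tower over $\mathbb{F}_q$ and $E/F$, $F_n/F$ are linearly disjoint for all $n\geq1$. $e(\cdot|\cdot)$, $f(\cdot|\cdot)$ denote ramification index and relative degree. An integral basis at $P$ is a basis of the integral closure of $\mathcal{O}_P$ in $E$ as $\mathcal{O}_P$-module. *)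

theory Defs
  imports Complex_Main "HOL-Algebra.Algebraic_Closure" "HOL-Algebra.Generated_Fields"
begin

text \<open>All fields are subfields, given as sets, of one ambient field \<open>L\<close>, which in the theorem is an
  algebraic closure of the bottom field of the tower. The constant field is \<open>k\<close>.\<close>

section \<open>Function fields and their extensions\<close>

definition full_constant_field :: "('a, 'b) ring_scheme \<Rightarrow> 'a set \<Rightarrow> 'a set \<Rightarrow> bool"
  where "full_constant_field L k F \<longleftrightarrow> (\<forall>z\<in>F. \<not> ring.transcendental L k z \<longrightarrow> z \<in> k)"

definition function_field :: "('a, 'b) ring_scheme \<Rightarrow> 'a set \<Rightarrow> 'a set \<Rightarrow> bool"
  where "function_field L k F \<longleftrightarrow>
    subfield k L \<and> subfield F L \<and> k \<subseteq> F \<and>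
    (\<exists>x\<in>F. ring.transcendental L k x \<and>
       ring.finite_dimension L (generate_field L (insert x k)) F)"

text \<open>Every minimal polynomial over \<open>K\<close> is required to have only simple roots in \<open>L\<close>. This is
  separability when \<open>L\<close> is algebraically closed.\<close>

definition separable_extension :: "('a, 'b) ring_scheme \<Rightarrow> 'a set \<Rightarrow> 'a set \<Rightarrow> bool"
  where "separable_extension L K E \<longleftrightarrow>
    (\<forall>x\<in>E. \<not> ring.transcendental L K x \<and>
       (\<forall>a\<in>carrier L. ring.alg_mult L (ring.Irr L K x) a \<le> 1))"

definition finite_separable_extension :: "('a, 'b) ring_scheme \<Rightarrow> 'a set \<Rightarrow> 'a set \<Rightarrow> bool"
  where "finite_separable_extension L K E \<longleftrightarrow>
    subfield K L \<and> subfield E L \<and> K \<subseteq> E \<and>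
    ring.finite_dimension L K E \<and> separable_extension L K E"

definition linearly_disjoint ::
    "('a, 'b) ring_scheme \<Rightarrow> 'a set \<Rightarrow> 'a set \<Rightarrow> 'a set \<Rightarrow> bool"
  where "linearly_disjoint L K E E' \<longleftrightarrow>
    (\<forall>Us. set Us \<subseteq> E \<longrightarrow> ring.independent L K Us \<longrightarrow> ring.independent L E' Us)"

definition composite_field :: "('a, 'b) ring_scheme \<Rightarrow> 'a set \<Rightarrow> 'a set \<Rightarrow> 'a set"
  where "composite_field L E E' = generate_field L (E \<union> E')"


section \<open>Places\<close>

definition valuation_ring :: "('a, 'b) ring_scheme \<Rightarrow> 'a set \<Rightarrow> 'a set \<Rightarrow> 'a set \<Rightarrow> bool"
  where "valuation_ring L k F V \<longleftrightarrow>
    subring V L \<and> k \<subset> V \<and> V \<subset> F \<and> (\<forall>z\<in>F - {\<zero>\<^bsub>L\<^esub>}. z \<in> V \<or> inv\<^bsub>L\<^esub> z \<in> V)"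

definition places :: "('a, 'b) ring_scheme \<Rightarrow> 'a set \<Rightarrow> 'a set \<Rightarrow> 'a set set"
  where "places L k F =
    {P. \<exists>V. valuation_ring L k F V \<and> maximalideal P (L\<lparr>carrier := V\<rparr>)}"

text \<open>The valuation ring \<open>V\<close> is recovered from its maximal ideal \<open>P\<close>; see
  \<open>valuation_ring_eq_ring_of_place\<close> below.\<close>

definition ring_of_place :: "('a, 'b) ring_scheme \<Rightarrow> 'a set \<Rightarrow> 'a set \<Rightarrow> 'a set"
  where "ring_of_place L F P = {z \<in> F. z = \<zero>\<^bsub>L\<^esub> \<or> inv\<^bsub>L\<^esub> z \<notin> P}"

abbreviation local_ring :: "('a, 'b) ring_scheme \<Rightarrow> 'a set \<Rightarrow> 'a set \<Rightarrow> ('a, 'b) ring_scheme"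
  where "local_ring L F P \<equiv> L\<lparr>carrier := ring_of_place L F P\<rparr>"

lemma valuation_ring_eq_ring_of_place:
  fixes L (structure)
  assumes "field L" and F: "subfield F L" and V: "valuation_ring L k F V"
    and P: "maximalideal P (L\<lparr>carrier := V\<rparr>)"
  shows "V = ring_of_place L F P"
proof -
  interpret field L by fact
  have Vr: "subring V L" using V by (simp add: valuation_ring_def)
  note V_zero = subringE(2)[OF Vr] and V_one = subringE(3)[OF Vr] and V_add = subringE(7)[OF Vr]
  interpret P: maximalideal P "L\<lparr>carrier := V\<rparr>" by fact
  have VF: "V \<subseteq> F" and val: "\<And>z. z \<in> F \<Longrightarrow> z \<noteq> \<zero> \<Longrightarrow> z \<in> V \<or> inv z \<in> V"
    using V by (auto simp: valuation_ring_def)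
  have FL: "F \<subseteq> carrier L" using subfieldE(3)[OF F] .
  have PV: "P \<subseteq> V" using P.a_subset by simp
  have one_notin: "\<one> \<notin> P"
    using P.I_notcarr P.one_imp_carrier by auto
  have unit: "z \<in> Units L" if "z \<in> F" "z \<noteq> \<zero>" for z
    using that FL field_Units by auto
  have Finv: "inv z \<in> F" "inv z \<noteq> \<zero>" if "z \<in> F" "z \<noteq> \<zero>" for z
    using subfield_m_inv(1)[OF F, of z] that by auto
  have PmultV: "a \<otimes> p \<in> P" "p \<otimes> a \<in> P" if "a \<in> V" "p \<in> P" for a p
    using P.I_l_closed[of p a] P.I_r_closed[of p a] that by auto
  show ?thesis
  proof (intro equalityI subsetI)
    fix z assume z: "z \<in> V"
    have "inv z \<notin> P" if "z \<noteq> \<zero>"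
    proof
      assume "inv z \<in> P"
      then have "z \<otimes> inv z \<in> P" using PmultV z by blast
      moreover have "z \<otimes> inv z = \<one>" using unit that z VF by (auto intro: Units_r_inv)
      ultimately show False using one_notin by simp
    qed
    then show "z \<in> ring_of_place L F P" using z VF by (auto simp: ring_of_place_def)
  next
    fix z assume "z \<in> ring_of_place L F P"
    then have zF: "z \<in> F" and zP: "z = \<zero> \<or> inv z \<notin> P" by (auto simp: ring_of_place_def)
    show "z \<in> V"
    proof (rule ccontr)
      assume zV: "z \<notin> V"
      then have z0: "z \<noteq> \<zero>" using V_zero by auto
      define w where "w = inv z"
      have w: "w \<in> V" "w \<notin> P" "w \<in> F" "w \<noteq> \<zero>"
        using val[OF zF z0] zV zP z0 Finv[OF zF z0] by (auto simp: w_def)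
      have wz: "w \<otimes> z = \<one>" and zw: "z \<otimes> w = \<one>" using unit[OF zF z0] by (auto simp: w_def)
      interpret VR: cring "L\<lparr>carrier := V\<rparr>"
        using subring_is_domain[OF Vr] by (simp add: domain_def)
      let ?J = "PIdl\<^bsub>L\<lparr>carrier := V\<rparr>\<^esub> w"
      have J: "ideal ?J (L\<lparr>carrier := V\<rparr>)" using VR.cgenideal_ideal w by simp
      have S: "ideal (P <+>\<^bsub>L\<lparr>carrier := V\<rparr>\<^esub> ?J) (L\<lparr>carrier := V\<rparr>)"
        using P.add_ideals[OF P.ideal_axioms J] .
      have wL: "w \<in> carrier L" and zL: "z \<in> carrier L" using w zF FL by auto
      have VL: "V \<subseteq> carrier L" using VF FL by auto
      have wJ: "w \<in> ?J" using P.cgenideal_self w by simp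
      have sub: "P \<subseteq> P <+>\<^bsub>L\<lparr>carrier := V\<rparr>\<^esub> ?J"
      proof
        fix p assume p: "p \<in> P"
        have "p \<oplus> \<zero> = p" using p PV VL by auto
        moreover have "\<zero> \<in> ?J" using additive_subgroup.zero_closed[OF ideal.axioms(1)[OF J]] by simp
        ultimately show "p \<in> P <+>\<^bsub>L\<lparr>carrier := V\<rparr>\<^esub> ?J"
          using p by (simp add: set_add_def') metis
      qed
      have win: "w \<in> P <+>\<^bsub>L\<lparr>carrier := V\<rparr>\<^esub> ?J"
      proof -
        have "\<zero> \<oplus> w = w" using wL by auto
        moreover have "\<zero> \<in> P" using additive_subgroup.zero_closed[OF P.additive_subgroup_axioms] by simp
        ultimately show ?thesis
          using wJ by (simp add: set_add_def') metis
      qed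
      have "P <+>\<^bsub>L\<lparr>carrier := V\<rparr>\<^esub> ?J = V"
        using P.I_maximal[OF S sub] win w(2) ideal.Icarr[OF S] by auto
      then have "\<one> \<in> P <+>\<^bsub>L\<lparr>carrier := V\<rparr>\<^esub> ?J" using V_one by simp
      then obtain p a where p: "p \<in> P" and a: "a \<in> V" and eq: "\<one> = p \<oplus> a \<otimes> w"
        by (auto simp: set_add_def' cgenideal_def)
      have pL: "p \<in> carrier L" and aL: "a \<in> carrier L" using p a PV VL by auto
      have zexp: "z = p \<otimes> z \<oplus> a"
      proof -
        have "z = \<one> \<otimes> z" using zL by simp
        also have "\<dots> = (p \<oplus> a \<otimes> w) \<otimes> z" using arg_cong[OF eq, of "\<lambda>x. x \<otimes> z"] .
        also have "\<dots> = p \<otimes> z \<oplus> a \<otimes> (w \<otimes> z)"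
          using pL aL wL zL by (simp add: l_distr m_assoc)
        finally show ?thesis using wz aL r_one[OF aL] by (simp only:)
      qed
      have pz: "p \<otimes> z \<notin> V"
        using V_add[OF _ a, of "p \<otimes> z"] zV unfolding zexp[symmetric] by blast
      have pzF: "p \<otimes> z \<in> F" using subringE(6)[OF subfieldE(1)[OF F], of p z] p PV VF zF by auto
      have pz0: "p \<otimes> z \<noteq> \<zero>" using pz V_zero by auto
      have iV: "inv (p \<otimes> z) \<in> V" using val[OF pzF pz0] pz by simp
      have iL: "inv (p \<otimes> z) \<in> carrier L" using iV VL by auto
      have "w = (p \<otimes> z \<otimes> inv (p \<otimes> z)) \<otimes> w"
        using unit[OF pzF pz0] wL by simp
      also have "\<dots> = (p \<otimes> inv (p \<otimes> z)) \<otimes> (z \<otimes> w)"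
        using pL zL wL iL by (simp add: m_ac)
      also have "\<dots> = p \<otimes> inv (p \<otimes> z)" using zw pL iL by simp
      finally have "w \<in> P" using PmultV(2)[OF iV p] by simp
      then show False using w by simp
    qed
  qed
qed

text \<open>\<open>Q\<close> lies over \<open>P\<close> iff \<open>P \<subseteq> Q\<close>.\<close>

definition places_over :: "('a, 'b) ring_scheme \<Rightarrow> 'a set \<Rightarrow> 'a set \<Rightarrow> 'a set \<Rightarrow> 'a set set"
  where "places_over L k E P = {Q \<in> places L k E. P \<subseteq> Q}"

definition prime_element :: "('a, 'b) ring_scheme \<Rightarrow> 'a set \<Rightarrow> 'a set \<Rightarrow> 'a \<Rightarrow> bool"
  where "prime_element L F P t \<longleftrightarrow> t \<in> P \<and> P = PIdl\<^bsub>local_ring L F P\<^esub> t"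

text \<open>The normalised discrete valuation, used only for \<open>z \<noteq> \<zero>\<close>.\<close>

definition place_valuation :: "('a, 'b) ring_scheme \<Rightarrow> 'a set \<Rightarrow> 'a set \<Rightarrow> 'a \<Rightarrow> int"
  where "place_valuation L F P z =
    (THE n. \<exists>t u. prime_element L F P t \<and> u \<in> Units (local_ring L F P) \<and>
       z = t [^]\<^bsub>L\<^esub> n \<otimes>\<^bsub>L\<^esub> u)"

definition residue_field :: "('a, 'b) ring_scheme \<Rightarrow> 'a set \<Rightarrow> 'a set \<Rightarrow> 'a set ring"
  where "residue_field L F P = local_ring L F P Quot P"

definition residue_image :: "('a, 'b) ring_scheme \<Rightarrow> 'a set \<Rightarrow> 'a set \<Rightarrow> 'a set \<Rightarrow> 'a set set"
  where "residue_image L F P A = (\<lambda>a. P +>\<^bsub>local_ring L F P\<^esub> a) ` A"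

definition place_degree :: "('a, 'b) ring_scheme \<Rightarrow> 'a set \<Rightarrow> 'a set \<Rightarrow> 'a set \<Rightarrow> nat"
  where "place_degree L k F P =
    ring.dim (residue_field L F P) (residue_image L F P k) (carrier (residue_field L F P))"

text \<open>In the next two definitions \<open>Q\<close> is a place of \<open>E\<close> lying over the place \<open>P\<close> of \<open>F\<close>.\<close>

definition ramification_index ::
    "('a, 'b) ring_scheme \<Rightarrow> 'a set \<Rightarrow> 'a set \<Rightarrow> 'a set \<Rightarrow> 'a set \<Rightarrow> nat"
  where "ramification_index L F P E Q =
    (THE e. \<forall>x\<in>F - {\<zero>\<^bsub>L\<^esub>}. place_valuation L E Q x = int e * place_valuation L F P x)"

definition relative_degree ::
    "('a, 'b) ring_scheme \<Rightarrow> 'a set \<Rightarrow> 'a set \<Rightarrow> 'a set \<Rightarrow> 'a set \<Rightarrow> nat"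
  where "relative_degree L F P E Q =
    ring.dim (residue_field L E Q) (residue_image L E Q (ring_of_place L F P))
      (carrier (residue_field L E Q))"


section \<open>Integral bases\<close>

definition integral_closure_in :: "('a, 'b) ring_scheme \<Rightarrow> 'a set \<Rightarrow> 'a set \<Rightarrow> 'a set"
  where "integral_closure_in L V E =
    {z \<in> E. \<exists>p. p \<noteq> [] \<and> polynomial\<^bsub>L\<^esub> V p \<and> lead_coeff p = \<one>\<^bsub>L\<^esub> \<and> ring.eval L p z = \<zero>\<^bsub>L\<^esub>}"

text \<open>\<^const>\<open>ring.Span\<close> and \<^const>\<open>ring.combine\<close> make sense over a subring \<open>V\<close>, but
  \<^const>\<open>ring.independent\<close> expresses linear independence only over a subfield.\<close>

definition module_basis :: "('a, 'b) ring_scheme \<Rightarrow> 'a set \<Rightarrow> 'a set \<Rightarrow> 'a list \<Rightarrow> bool"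
  where "module_basis L V B Us \<longleftrightarrow>
    set Us \<subseteq> carrier L \<and> ring.Span L V Us = B \<and>
    (\<forall>as. set as \<subseteq> V \<and> length as = length Us \<and> ring.combine L as Us = \<zero>\<^bsub>L\<^esub>
       \<longrightarrow> set as \<subseteq> {\<zero>\<^bsub>L\<^esub>})"

definition integral_basis_at ::
    "('a, 'b) ring_scheme \<Rightarrow> 'a set \<Rightarrow> 'a set \<Rightarrow> 'a set \<Rightarrow> 'a list \<Rightarrow> bool"
  where "integral_basis_at L F P E Us \<longleftrightarrow>
    module_basis L (ring_of_place L F P) (integral_closure_in L (ring_of_place L F P) E) Us"


section \<open>Divisors and the genus\<close>

definition divisors :: "('a, 'b) ring_scheme \<Rightarrow> 'a set \<Rightarrow> 'a set \<Rightarrow> ('a set \<Rightarrow> int) set"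
  where "divisors L k F = {A. finite {P. A P \<noteq> 0} \<and> {P. A P \<noteq> 0} \<subseteq> places L k F}"

definition divisor_degree ::
    "('a, 'b) ring_scheme \<Rightarrow> 'a set \<Rightarrow> 'a set \<Rightarrow> ('a set \<Rightarrow> int) \<Rightarrow> int"
  where "divisor_degree L k F A = (\<Sum>P | A P \<noteq> 0. A P * int (place_degree L k F P))"

definition riemann_roch_space ::
    "('a, 'b) ring_scheme \<Rightarrow> 'a set \<Rightarrow> 'a set \<Rightarrow> ('a set \<Rightarrow> int) \<Rightarrow> 'a set"
  where "riemann_roch_space L k F A =
    {x \<in> F. x = \<zero>\<^bsub>L\<^esub> \<or> (\<forall>P\<in>places L k F. place_valuation L F P x \<ge> - A P)}"

text \<open>\<open>g(F) = max {deg A - \<ell>(A) + 1}\<close> over all divisors \<open>A\<close>; by Riemann's theorem the set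
  is bounded above, so its supremum in the integers is attained.\<close>

definition genus :: "('a, 'b) ring_scheme \<Rightarrow> 'a set \<Rightarrow> 'a set \<Rightarrow> int"
  where "genus L k F =
    (SUP A\<in>divisors L k F.
       divisor_degree L k F A - int (ring.dim L k (riemann_roch_space L k F A)) + 1)"


section \<open>Towers\<close>

definition tower :: "('a, 'b) ring_scheme \<Rightarrow> 'a set \<Rightarrow> (nat \<Rightarrow> 'a set) \<Rightarrow> bool"
  where "tower L k T \<longleftrightarrow>
    (\<forall>n. function_field L k (T n) \<and> full_constant_field L k (T n)) \<and>
    (\<forall>n. T n \<subset> T (Suc n)) \<and>
    (\<forall>n. finite_separable_extension L (T n) (T (Suc n))) \<and>
    filterlim (\<lambda>n. genus L k (T n)) at_top sequentially"

definition composite_sequence ::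
    "('a, 'b) ring_scheme \<Rightarrow> 'a set \<Rightarrow> (nat \<Rightarrow> 'a set) \<Rightarrow> nat \<Rightarrow> 'a set"
  where "composite_sequence L E F n = composite_field L E (F n)"

definition is_composite_tower ::
    "('a, 'b) ring_scheme \<Rightarrow> 'a set \<Rightarrow> 'a set \<Rightarrow> (nat \<Rightarrow> 'a set) \<Rightarrow> bool"
  where "is_composite_tower L k E F \<longleftrightarrow>
    tower L k (composite_sequence L E F) \<and> (\<forall>n\<ge>1. linearly_disjoint L (F 0) E (F n))"

definition num_places_over ::
    "('a, 'b) ring_scheme \<Rightarrow> 'a set \<Rightarrow> 'a set \<Rightarrow> nat \<Rightarrow> 'a set \<Rightarrow> nat"
  where "num_places_over L k E r P = card {Q \<in> places_over L k E P. place_degree L k E Q = r}"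

definition nu ::
    "('a, 'b) ring_scheme \<Rightarrow> 'a set \<Rightarrow> nat \<Rightarrow> 'a set \<Rightarrow> (nat \<Rightarrow> 'a set) \<Rightarrow> real"
  where "nu L k r P T =
    lim (\<lambda>n. real (num_places_over L k (T n) r P) / real (ring.dim L (T 0) (T n)))"

end

theory Submission
  imports Defs "HOL-Computational_Algebra.Primes"
begin

text \<open>
  Let \<open>P'\<close> be a place of \<open>F\<^sub>n\<close> over \<open>P\<close> with local ring \<open>O'\<close> and residue field of order \<open>q\<close>, and let
  \<open>A\<close> be the integral closure of \<open>O\<^sub>P\<close> in \<open>E\<close>. By linear disjointness the given integral basis stays
  a basis of \<open>E F\<^sub>n\<close> over \<open>F\<^sub>n\<close>, so \<open>A' = O' A\<close> is free of rank \<open>m\<close> over \<open>O'\<close>. For each place \<open>Q\<close> over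
  \<open>P\<close> choose \<open>s\<^sub>Q \<in> A\<close> of valuation \<open>1\<close> at \<open>Q\<close> and \<open>0\<close> at the other places over \<open>P\<close>, and put
  \<open>I\<^sub>Q = s\<^sub>Q A' + P' A'\<close>. As the product of the \<open>s\<^sub>Q\<close> to the powers \<open>e(Q|P)\<close> lies in \<open>P A\<close>, one gets
  \<open>q^m \<le> \<Prod>\<^sub>Q |A'/I\<^sub>Q|^e(Q|P)\<close>, while \<open>|A'/I\<^sub>Q| \<le> q^f(Q|P)\<close>; the fundamental inequality
  \<open>\<Sum> e f \<le> m\<close> forces equality throughout.

  A power of Frobenius is the identity on \<open>A'/I\<^sub>Q\<close>, so this ring is reduced and embeds into the product of
  the residue fields at the places \<open>Q'\<close> of \<open>E F\<^sub>n\<close> over both \<open>Q\<close> and \<open>P'\<close>. By coprimality \<open>e(Q|P)\<close>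
  divides \<open>e(Q'|P')\<close>, and the fundamental inequality for \<open>E F\<^sub>n / F\<^sub>n\<close> now shows that \<open>A'\<close> maps onto each
  residue field at \<open>Q'\<close> and that \<open>f(Q|P)\<close> is the sum of the \<open>f(Q'|P')\<close>. Hence
  \<open>deg Q' = lcm (deg Q) (deg P')\<close>, which gives the formula at every level \<open>n\<close>.

  The limits exist because \<open>(\<Sum>\<^bsub>d dvd r\<^esub> d B\<^sub>d(P, T\<^sub>n)) / [T\<^sub>n : T\<^sub>0]\<close> decreases in \<open>n\<close>, again by the
  fundamental inequality.
\<close>

section \<open>Counting cosets\<close>

text \<open>Since the constant field is finite, the quotients that occur are finite, and lengths and
  dimensions can be traded for cardinalities: exact sequences become inequalities between products
  of natural numbers, and cosets of subsets of the ambient field stand in for tensor products and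
  quotient modules. The facts about A' that enter are that it is a ring, free over O', and contained
  in the valuation rings at the places Q'. The rest is forced, because the chain of estimates starts
  and ends with the same number q^m.

  A place is given only as the maximal ideal of a valuation ring V, so its arithmetic has to be
  supplied. The key is the finiteness of V/zV for nonzero z: it is pushed by linear algebra from a
  rational subfield k(x), where the residue field is k, up to F, and then yields uniformizers,
  valuations and finite residue fields. Places containing a prescribed ideal are needed twice, to
  describe the integral closure and to control the kernel of the map from A' to the residue fields;
  they come from Chevalley's extension theorem.\<close>

definition (in ring) finite_index :: "'a set \<Rightarrow> 'a set \<Rightarrow> bool"
  where "finite_index A I \<longleftrightarrow> finite ((\<lambda>a. I +> a) ` A)"

text \<open>\<open>I\<close> need not lie in \<open>A\<close>: the cosets of \<open>I\<close> that
  meet \<open>A\<close> are counted, which for subgroups gives [A : A \<inter> I]. This form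
  compares \<open>A1\<close> with a place of a larger ring. Infinitely many cosets would give 0,
  hence the separate predicate \<open>finite_index\<close>.\<close>

definition (in ring) index :: "'a set \<Rightarrow> 'a set \<Rightarrow> nat"
  where "index A I = card ((\<lambda>a. I +> a) ` A)"

lemma (in ring) additive_subgroupI:
  assumes "I \<subseteq> carrier R" "\<zero> \<in> I" "\<And>a b. a \<in> I \<Longrightarrow> b \<in> I \<Longrightarrow> a \<ominus> b \<in> I"
  shows "additive_subgroup I R"
proof -
  have inv: "\<ominus> a \<in> I" if "a \<in> I" for a
    using assms(3)[OF assms(2) that] assms(1) that by (auto simp: a_minus_def)
  have "a \<oplus> b \<in> I" if "a \<in> I" "b \<in> I" for a b
    using assms(3)[OF that(1) inv[OF that(2)]] assms(1) that by (auto simp: a_minus_def)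
  then show ?thesis
    using assms inv by (intro additive_subgroup.intro add.subgroupI) (auto simp: a_inv_def)
qed

lemma (in ring) additive_subgroup_minus:
  assumes "additive_subgroup I R" "a \<in> I" "b \<in> I"
  shows "a \<ominus> b \<in> I"
  using assms by (simp add: a_minus_def additive_subgroup.a_closed additive_subgroup.a_inv_closed)

lemma (in ring) additive_subgroup_minus_commute:
  assumes "additive_subgroup I R" "a \<in> carrier R" "b \<in> carrier R" "a \<ominus> b \<in> I"
  shows "b \<ominus> a \<in> I"
proof -
  have "b \<ominus> a = \<ominus> (a \<ominus> b)" using assms(2,3) by algebra
  then show ?thesis using assms(1,4) by (simp add: additive_subgroup.a_inv_closed)
qed

lemma (in ring) additive_subgroup_minus_trans:
  assumes "additive_subgroup I R" "a \<in> carrier R" "b \<in> carrier R" "c \<in> carrier R"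
    "a \<ominus> b \<in> I" "b \<ominus> c \<in> I"
  shows "a \<ominus> c \<in> I"
proof -
  have "a \<ominus> c = (a \<ominus> b) \<oplus> (b \<ominus> c)" using assms(2-4) by algebra
  then show ?thesis using assms by (simp add: additive_subgroup.a_closed)
qed

lemma (in ring) coset_eq_iff:
  assumes I: "additive_subgroup I R" and a: "a \<in> carrier R" and b: "b \<in> carrier R"
  shows "I +> a = I +> b \<longleftrightarrow> a \<ominus> b \<in> I"
proof
  note sub = additive_subgroup.a_subset[OF I] and cl = additive_subgroup.a_closed[OF I]
  show "I +> a = I +> b" if d: "a \<ominus> b \<in> I"
  proof -
    have *: "I +> x \<subseteq> I +> y" if x: "x \<in> carrier R" and y: "y \<in> carrier R" and xy: "x \<ominus> y \<in> I" for x y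
    proof
      fix z assume "z \<in> I +> x"
      then obtain h where h: "h \<in> I" "z = h \<oplus> x" by (auto simp: a_r_coset_def')
      have hc: "h \<in> carrier R" using h sub by auto
      have "z = (h \<oplus> (x \<ominus> y)) \<oplus> y" unfolding h(2) using hc x y by algebra
      then show "z \<in> I +> y" using cl[OF h(1) xy] by (auto simp: a_r_coset_def')
    qed
    show ?thesis using *[OF a b d] *[OF b a additive_subgroup_minus_commute[OF I a b d]] by simp
  qed
  show "a \<ominus> b \<in> I" if "I +> a = I +> b"
  proof -
    have "\<zero> \<oplus> a \<in> I +> a" using additive_subgroup.zero_closed[OF I] by (auto simp: a_r_coset_def')
    then have "a \<in> I +> b" using that a by simp
    then obtain h where h: "h \<in> I" "a = h \<oplus> b" by (auto simp: a_r_coset_def')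
    have "h \<in> carrier R" using h sub by auto
    then have "a \<ominus> b = h" unfolding h(2) using b by algebra
    then show ?thesis using h by simp
  qed
qed

text \<open>Covering sets bound an index from above, separated sets
  (\<open>index_ge_separated\<close>) from below. The counting arguments below rest on this
  pair.\<close>

lemma (in ring) index_le_cover:
  assumes I: "additive_subgroup I R" and A: "A \<subseteq> carrier R" and S: "finite S" "S \<subseteq> carrier R"
    and cov: "\<And>x. x \<in> A \<Longrightarrow> \<exists>r\<in>S. x \<ominus> r \<in> I"
  shows "finite_index A I" and "index A I \<le> card S"
proof -
  have sub: "(\<lambda>a. I +> a) ` A \<subseteq> (\<lambda>a. I +> a) ` S"
  proof (rule image_subsetI)
    fix x assume x: "x \<in> A"
    then obtain r where "r \<in> S" "x \<ominus> r \<in> I" using cov by blast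
    moreover from this have "I +> x = I +> r" using coset_eq_iff[OF I] A S x by auto
    ultimately show "I +> x \<in> (\<lambda>a. I +> a) ` S" by blast
  qed
  then show "finite_index A I" unfolding finite_index_def using S(1) finite_subset by blast
  show "index A I \<le> card S" unfolding index_def
    using card_mono[OF finite_imageI[OF S(1)] sub] card_image_le[OF S(1), of "\<lambda>a. I +> a"] by linarith
qed

lemma (in ring) index_ge_separated:
  assumes I: "additive_subgroup I R" and A: "A \<subseteq> carrier R" and f: "finite_index A I"
    and S: "S \<subseteq> A" and sep: "\<And>a b. a \<in> S \<Longrightarrow> b \<in> S \<Longrightarrow> a \<ominus> b \<in> I \<Longrightarrow> a = b"
  shows "finite S" and "card S \<le> index A I"
proof -
  have inj: "inj_on (\<lambda>a. I +> a) S"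
    by (rule inj_onI) (use coset_eq_iff[OF I] A S sep in blast)
  have sub: "(\<lambda>a. I +> a) ` S \<subseteq> (\<lambda>a. I +> a) ` A" using S by blast
  show "finite S" using inj sub f unfolding finite_index_def
    using finite_subset finite_imageD by blast
  show "card S \<le> index A I" unfolding index_def
    using card_mono[OF f[unfolded finite_index_def] sub] card_image[OF inj] by simp
qed

lemma (in ring) index_representatives:
  assumes I: "additive_subgroup I R" and A: "A \<subseteq> carrier R" and f: "finite_index A I"
  obtains S where "S \<subseteq> A" "finite S" "card S = index A I"
    "\<And>x. x \<in> A \<Longrightarrow> \<exists>r\<in>S. x \<ominus> r \<in> I"
    "\<And>a b. a \<in> S \<Longrightarrow> b \<in> S \<Longrightarrow> a \<ominus> b \<in> I \<Longrightarrow> a = b"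
proof -
  define h where "h = inv_into A (\<lambda>a. I +> a)"
  define S where "S = h ` ((\<lambda>a. I +> a) ` A)"
  have hA: "h (I +> a) \<in> A" "I +> h (I +> a) = I +> a" if "a \<in> A" for a
    unfolding h_def using that inv_into_into[of "I +> a" "\<lambda>a. I +> a" A]
      f_inv_into_f[of "I +> a" "\<lambda>a. I +> a" A] by blast+
  have inj: "inj_on h ((\<lambda>a. I +> a) ` A)" unfolding h_def by (rule inj_on_inv_into) simp
  show ?thesis
  proof (rule that[of S])
    show SA: "S \<subseteq> A" unfolding S_def using hA by auto
    show "finite S" using f by (simp add: S_def finite_index_def)
    show "card S = index A I" unfolding S_def index_def using card_image[OF inj] .
    show "\<exists>r\<in>S. x \<ominus> r \<in> I" if "x \<in> A" for x
    proof
      show "h (I +> x) \<in> S" using that by (auto simp: S_def)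
      show "x \<ominus> h (I +> x) \<in> I"
        using coset_eq_iff[OF I, of x "h (I +> x)"] hA[OF that] that A by auto
    qed
    show "a = b" if ab: "a \<in> S" "b \<in> S" "a \<ominus> b \<in> I" for a b
    proof -
      obtain x y where x: "x \<in> A" "a = h (I +> x)" and y: "y \<in> A" "b = h (I +> y)"
        using ab by (auto simp: S_def)
      have "I +> a = I +> b" using coset_eq_iff[OF I] ab SA A by auto
      then have "I +> x = I +> y" using hA x y by simp
      then show ?thesis using x y by simp
    qed
  qed
qed

lemma (in ring) index_pos:
  assumes "finite_index A I" "A \<noteq> {}"
  shows "0 < index A I"
  using assms by (auto simp: index_def finite_index_def card_gt_0_iff)

lemma (in ring) index_mono:
  assumes I: "additive_subgroup I R" and A: "A \<subseteq> carrier R" and f: "finite_index A I"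
    and B: "B \<subseteq> A"
  shows "finite_index B I" and "index B I \<le> index A I"
proof -
  have sub: "(\<lambda>a. I +> a) ` B \<subseteq> (\<lambda>a. I +> a) ` A" using B by (rule image_mono)
  show "finite_index B I" using f finite_subset[OF sub] unfolding finite_index_def by simp
  show "index B I \<le> index A I" using f card_mono[OF _ sub] unfolding finite_index_def index_def by simp
qed

lemma (in ring) index_antimono:
  assumes I: "additive_subgroup I R" and J: "additive_subgroup J R" and A: "A \<subseteq> carrier R"
    and f: "finite_index A I" and IJ: "I \<subseteq> J"
  shows "finite_index A J" and "index A J \<le> index A I"
proof -
  obtain S where S: "S \<subseteq> A" "finite S" "card S = index A I" "\<And>x. x \<in> A \<Longrightarrow> \<exists>r\<in>S. x \<ominus> r \<in> I"
    using index_representatives[OF I A f] by metis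
  have "S \<subseteq> carrier R" using S(1) A by simp
  moreover have "\<exists>r\<in>S. x \<ominus> r \<in> J" if "x \<in> A" for x using S(4)[OF that] IJ by blast
  ultimately show "finite_index A J" "index A J \<le> index A I"
    using index_le_cover[OF J A S(2)] S(3) by auto
qed

lemma (in ring) combine_minus_mem:
  assumes I: "additive_subgroup I R"
    and "length as = length Us" "length bs = length Us"
    and "set as \<subseteq> carrier R" "set bs \<subseteq> carrier R" "set Us \<subseteq> carrier R"
    and "\<And>i. i < length Us \<Longrightarrow> (as ! i \<ominus> bs ! i) \<otimes> Us ! i \<in> I"
  shows "combine as Us \<ominus> combine bs Us \<in> I"
  using assms(2-)
proof (induction as Us arbitrary: bs rule: combine.induct)
  case (1 a as u Us)
  obtain b bs' where bs: "bs = b # bs'" using 1(3) by (cases bs) auto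
  have c: "a \<in> carrier R" "b \<in> carrier R" "u \<in> carrier R" "combine as Us \<in> carrier R"
    "combine bs' Us \<in> carrier R" using 1 bs by auto
  have "combine as Us \<ominus> combine bs' Us \<in> I"
  proof (rule 1(1))
    fix i assume "i < length Us"
    then show "(as ! i \<ominus> bs' ! i) \<otimes> Us ! i \<in> I" using 1(7)[of "Suc i"] bs by simp
  qed (use 1 bs in auto)
  moreover have "(a \<ominus> b) \<otimes> u \<in> I" using 1(7)[of 0] bs by simp
  ultimately have "(a \<ominus> b) \<otimes> u \<oplus> (combine as Us \<ominus> combine bs' Us) \<in> I"
    using additive_subgroup.a_closed[OF I] by blast
  moreover have "combine (a # as) (u # Us) \<ominus> combine bs (u # Us)
      = (a \<ominus> b) \<otimes> u \<oplus> (combine as Us \<ominus> combine bs' Us)"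
    unfolding bs combine.simps using c by algebra
  ultimately show ?case by simp
qed (use additive_subgroup.zero_closed[OF I] in \<open>auto simp: a_minus_def\<close>)

text \<open>Rounding each coefficient of a combination to a representative modulo \<open>J\<close>
  changes it only by an element of \<open>I\<close>, so the combinations with coefficients in a
  transversal of \<open>V\<close> modulo \<open>J\<close> meet every coset.\<close>

lemma (in ring) index_le_span:
  assumes J: "additive_subgroup J R" and V: "V \<subseteq> carrier R" "finite_index V J"
    and I: "additive_subgroup I R" and C: "C \<subseteq> carrier R" and Us: "set Us \<subseteq> carrier R"
    and JI: "\<And>a u. a \<in> J \<Longrightarrow> u \<in> set Us \<Longrightarrow> a \<otimes> u \<in> I"
    and span: "\<And>c. c \<in> C \<Longrightarrow> \<exists>as. set as \<subseteq> V \<and> length as = length Us \<and> c \<ominus> combine as Us \<in> I"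
  shows "finite_index C I" and "index C I \<le> index V J ^ length Us"
proof -
  obtain S where S: "S \<subseteq> V" "finite S" "card S = index V J" "\<And>x. x \<in> V \<Longrightarrow> \<exists>r\<in>S. x \<ominus> r \<in> J"
    using index_representatives[OF J V] by metis
  define T where "T = (\<lambda>rs. combine rs Us) ` {rs. set rs \<subseteq> S \<and> length rs = length Us}"
  have fin: "finite {rs. set rs \<subseteq> S \<and> length rs = length Us}"
    using finite_lists_length_eq[OF S(2)] .
  have "card T \<le> card {rs. set rs \<subseteq> S \<and> length rs = length Us}"
    unfolding T_def by (rule card_image_le[OF fin])
  also have "\<dots> = index V J ^ length Us" using card_lists_length_eq[OF S(2)] S(3) by simp
  finally have cT: "card T \<le> index V J ^ length Us" .
  have fT: "finite T" unfolding T_def using fin by simp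
  have TC: "T \<subseteq> carrier R" unfolding T_def
  proof (rule image_subsetI)
    fix rs assume "rs \<in> {rs. set rs \<subseteq> S \<and> length rs = length Us}"
    then have "set rs \<subseteq> carrier R" using S(1) V(1) by blast
    then show "combine rs Us \<in> carrier R" using Us by simp
  qed
  have cov: "\<exists>r\<in>T. c \<ominus> r \<in> I" if c: "c \<in> C" for c
  proof -
    obtain as where as: "set as \<subseteq> V" "length as = length Us" "c \<ominus> combine as Us \<in> I"
      using span[OF c] by blast
    define rs where "rs = map (\<lambda>a. SOME r. r \<in> S \<and> a \<ominus> r \<in> J) as"
    have r: "(SOME r. r \<in> S \<and> a \<ominus> r \<in> J) \<in> S \<and> a \<ominus> (SOME r. r \<in> S \<and> a \<ominus> r \<in> J) \<in> J"
      if "a \<in> set as" for a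
    proof -
      have "\<exists>r. r \<in> S \<and> a \<ominus> r \<in> J" using S(4) as(1) that by blast
      then show ?thesis by (rule someI_ex)
    qed
    have rs: "set rs \<subseteq> S" "length rs = length Us" unfolding rs_def using r as(2) by auto
    have "combine as Us \<ominus> combine rs Us \<in> I"
    proof (rule combine_minus_mem[OF I as(2) rs(2)])
      fix i assume i: "i < length Us"
      have "as ! i \<ominus> rs ! i \<in> J" using r[of "as ! i"] i as(2) by (simp add: rs_def)
      then show "(as ! i \<ominus> rs ! i) \<otimes> Us ! i \<in> I" using JI i by simp
    qed (use as rs S(1) V(1) Us in auto)
    moreover have "c \<in> carrier R" "combine as Us \<in> carrier R" "combine rs Us \<in> carrier R"
      using c C as rs S(1) V(1) Us by (auto intro!: combine_in_carrier)
    ultimately have "c \<ominus> combine rs Us \<in> I"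
      using additive_subgroup_minus_trans[OF I] as(3) by blast
    moreover have "combine rs Us \<in> T" using rs by (auto simp: T_def)
    ultimately show ?thesis by blast
  qed
  show "finite_index C I" "index C I \<le> index V J ^ length Us"
    using index_le_cover[OF I C fT TC cov] cT by auto
qed

text \<open>Coefficient lists from a transversal give pairwise incongruent combinations: the
  difference of two congruent ones is a combination in \<open>I\<close>, so \<open>free\<close> puts
  all coefficient differences into \<open>J\<close>.\<close>

lemma (in ring) index_ge_free:
  assumes J: "additive_subgroup J R" and V: "V \<subseteq> carrier R" "finite_index V J"
    and Vm: "\<And>a b. a \<in> V \<Longrightarrow> b \<in> V \<Longrightarrow> a \<ominus> b \<in> V"
    and I: "additive_subgroup I R" and C: "C \<subseteq> carrier R" "finite_index C I"
    and Us: "set Us \<subseteq> carrier R"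
    and in_C: "\<And>as. set as \<subseteq> V \<Longrightarrow> length as = length Us \<Longrightarrow> combine as Us \<in> C"
    and free: "\<And>as. set as \<subseteq> V \<Longrightarrow> length as = length Us \<Longrightarrow> combine as Us \<in> I \<Longrightarrow> set as \<subseteq> J"
  shows "index V J ^ length Us \<le> index C I"
proof -
  obtain S where S: "S \<subseteq> V" "finite S" "card S = index V J"
    "\<And>a b. a \<in> S \<Longrightarrow> b \<in> S \<Longrightarrow> a \<ominus> b \<in> J \<Longrightarrow> a = b"
    using index_representatives[OF J V] by metis
  define D where "D = {rs. set rs \<subseteq> S \<and> length rs = length Us}"
  have eq: "as = bs" if as: "as \<in> D" and bs: "bs \<in> D" and d: "combine as Us \<ominus> combine bs Us \<in> I" for as bs
  proof -
    have l: "length as = length Us" "length bs = length Us" and s: "set as \<subseteq> V" "set bs \<subseteq> V"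
      using as bs S(1) by (auto simp: D_def)
    define cs where "cs = map2 (\<lambda>a b. a \<ominus> b) as bs"
    have cs: "set cs \<subseteq> V" "length cs = length Us"
    proof -
      show "length cs = length Us" using l by (simp add: cs_def)
      show "set cs \<subseteq> V"
      proof
        fix x assume "x \<in> set cs"
        then obtain p q where "(p, q) \<in> set (zip as bs)" "x = p \<ominus> q" by (auto simp: cs_def)
        moreover from this have "p \<in> V" "q \<in> V" using s by (auto dest: set_zip_leftD set_zip_rightD)
        ultimately show "x \<in> V" using Vm by blast
      qed
    qed
    have eq: "combine cs Us = combine as Us \<ominus> combine bs Us"
    proof -
      have "combine cs Us \<ominus> (combine as Us \<ominus> combine bs Us) = \<zero>"
        unfolding cs_def using l s Us
      proof (induction as Us arbitrary: bs rule: combine.induct)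
        case (1 a as u Us)
        obtain b bs' where bs: "bs = b # bs'" using 1(3) by (cases bs) auto
        have st: "set (map2 (\<lambda>a b. a \<ominus> b) as bs') \<subseteq> carrier R"
        proof
          fix x assume "x \<in> set (map2 (\<lambda>a b. a \<ominus> b) as bs')"
          then obtain p q where "(p, q) \<in> set (zip as bs')" "x = p \<ominus> q" by auto
          moreover from this have "p \<in> carrier R" "q \<in> carrier R"
            using 1(4,5) bs V(1) by (auto dest: set_zip_leftD set_zip_rightD)
          ultimately show "x \<in> carrier R" by simp
        qed
        have "set as \<subseteq> carrier R" "set bs' \<subseteq> carrier R" using 1 bs V(1) by auto
        then have c: "a \<in> carrier R" "b \<in> carrier R" "u \<in> carrier R" "combine as Us \<in> carrier R"
          "combine bs' Us \<in> carrier R" "combine (map2 (\<lambda>a b. a \<ominus> b) as bs') Us \<in> carrier R"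
          using 1 bs V(1) st by (auto intro!: combine_in_carrier)
        have IH: "combine (map2 (\<lambda>a b. a \<ominus> b) as bs') Us \<ominus> (combine as Us \<ominus> combine bs' Us) = \<zero>"
          by (rule 1(1)) (use 1 bs in auto)
        have "combine (map2 (\<lambda>a b. a \<ominus> b) (a # as) bs) (u # Us)
            \<ominus> (combine (a # as) (u # Us) \<ominus> combine bs (u # Us))
            = (a \<ominus> b) \<otimes> u \<oplus> combine (map2 (\<lambda>a b. a \<ominus> b) as bs') Us
              \<ominus> ((a \<otimes> u \<oplus> combine as Us) \<ominus> (b \<otimes> u \<oplus> combine bs' Us))"
          by (simp add: bs)
        also have "\<dots> = combine (map2 (\<lambda>a b. a \<ominus> b) as bs') Us \<ominus> (combine as Us \<ominus> combine bs' Us)"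
        proof -
          have "(a \<ominus> b) \<otimes> u \<oplus> m \<ominus> ((a \<otimes> u \<oplus> x) \<ominus> (b \<otimes> u \<oplus> y)) = m \<ominus> (x \<ominus> y)"
            if "m \<in> carrier R" "x \<in> carrier R" "y \<in> carrier R" for m x y
            using that c(1-3) by algebra
          then show ?thesis using c(4-6) by blast
        qed
        finally show ?case using IH by simp
      qed (auto simp: a_minus_def)
      moreover have "combine cs Us \<in> carrier R" "combine as Us \<ominus> combine bs Us \<in> carrier R"
        using cs l s Us V(1) by (auto intro!: combine_in_carrier minus_closed)
      ultimately show ?thesis by (simp add: r_right_minus_eq)
    qed
    have "set cs \<subseteq> J" using free[OF cs] eq d by simp
    then have "as ! i = bs ! i" if "i < length Us" for i
    proof -
      have "cs ! i \<in> J" using that cs(2) \<open>set cs \<subseteq> J\<close> by auto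
      then have "as ! i \<ominus> bs ! i \<in> J" using that l by (simp add: cs_def)
      moreover have "as ! i \<in> S" "bs ! i \<in> S" using as bs that l by (auto simp: D_def)
      ultimately show ?thesis using S(4) by blast
    qed
    then show ?thesis using l by (metis nth_equalityI)
  qed
  have inj: "inj_on (\<lambda>rs. combine rs Us) D"
  proof (rule inj_onI)
    fix as bs assume *: "as \<in> D" "bs \<in> D" "combine as Us = combine bs Us"
    then have "combine bs Us \<in> carrier R"
      using in_C[of bs] C(1) S(1) by (auto simp: D_def)
    then have "combine as Us \<ominus> combine bs Us = \<zero>" using *(3) by (simp add: r_right_minus_eq)
    then show "as = bs" using eq[OF *(1,2)] additive_subgroup.zero_closed[OF I] by simp
  qed
  have "card ((\<lambda>rs. combine rs Us) ` D) \<le> index C I"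
  proof (rule index_ge_separated(2)[OF I C])
    show "(\<lambda>rs. combine rs Us) ` D \<subseteq> C" using in_C S(1) by (auto simp: D_def)
    fix a b assume "a \<in> (\<lambda>rs. combine rs Us) ` D" "b \<in> (\<lambda>rs. combine rs Us) ` D" "a \<ominus> b \<in> I"
    then show "a = b" using eq by blast
  qed
  then have "card D \<le> index C I" using card_image[OF inj] by simp
  then show ?thesis using card_lists_length_eq[OF S(2), of "length Us"] S(3) by (simp add: D_def)
qed

section \<open>Valuation rings\<close>

definition (in field) val_ring :: "'a set \<Rightarrow> 'a set \<Rightarrow> bool"
  where "val_ring F V \<longleftrightarrow> subfield F R \<and> subring V R \<and> V \<subseteq> F \<and> (\<forall>z\<in>F - {\<zero>}. z \<in> V \<or> inv z \<in> V)"

lemma (in ring) l_coset_mem: "x \<in> t <# A \<longleftrightarrow> (\<exists>a\<in>A. x = t \<otimes> a)"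
  by (auto simp: l_coset_def)

lemma (in cring) l_coset_additive_subgroup:
  assumes "subring A R" "t \<in> carrier R"
  shows "additive_subgroup (t <# A) R"
proof (rule additive_subgroupI)
  have A: "A \<subseteq> carrier R" "\<zero> \<in> A" using subringE[OF assms(1)] by auto
  show "t <# A \<subseteq> carrier R" using A(1) assms(2) by (auto simp: l_coset_mem subset_iff)
  have "\<zero> = t \<otimes> \<zero>" using assms(2) by simp
  then show "\<zero> \<in> t <# A" using A(2) unfolding l_coset_mem by blast
  fix a b assume "a \<in> t <# A" "b \<in> t <# A"
  then obtain c d where cd: "c \<in> A" "d \<in> A" "a = t \<otimes> c" "b = t \<otimes> d" by (auto simp: l_coset_mem)
  have "a \<ominus> b = t \<otimes> (c \<ominus> d)" unfolding cd(3,4) using cd(1,2) A(1) assms(2)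
    by (simp add: a_minus_def r_distr r_minus subset_iff)
  moreover have "c \<ominus> d \<in> A" using cd subringE(5,7)[OF assms(1)] by (simp add: a_minus_def)
  ultimately show "a \<ominus> b \<in> t <# A" unfolding l_coset_mem by blast
qed

lemma (in ring) subring_minus: "subring A R \<Longrightarrow> a \<in> A \<Longrightarrow> b \<in> A \<Longrightarrow> a \<ominus> b \<in> A"
  using subringE(5)[of A R b] subringE(7)[of A R a "\<ominus> b"] by (simp add: a_minus_def)

lemma (in field) subfield_inv:
  assumes "subfield F R" "a \<in> F" "a \<noteq> \<zero>"
  shows "inv a \<in> F" "inv a \<noteq> \<zero>" "a \<otimes> inv a = \<one>" "inv a \<otimes> a = \<one>"
  using subfield_m_inv[OF assms(1), of a] assms by auto

text \<open>Divisibility with respect to a valuation ring is total, so a finite family has a member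
  dividing all the others. Here \<open>inv b \<otimes> a \<in> V\<close> means that \<open>b\<close>
  divides \<open>a\<close>.\<close>

lemma (in field) val_ring_scale:
  assumes V: "val_ring K V" and as: "set as \<subseteq> K" "\<not> set as \<subseteq> {\<zero>}"
  shows "\<exists>b\<in>set as. b \<noteq> \<zero> \<and> (\<forall>a\<in>set as. inv b \<otimes> a \<in> V)"
  using as
proof (induction as)
  case (Cons c as)
  have K: "subfield K R" and Vr: "subring V R" and val: "\<And>z. z \<in> K \<Longrightarrow> z \<noteq> \<zero> \<Longrightarrow> z \<in> V \<or> inv z \<in> V"
    using V by (auto simp: val_ring_def)
  note KL = subfieldE(3)[OF K]
  have z: "\<zero> \<in> V" "\<one> \<in> V" using subringE[OF Vr] by auto
  have [simp]: "inv b \<in> carrier R" "b \<in> carrier R" if "b \<in> K" "b \<noteq> \<zero>" for b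
    using subfield_inv[OF K that] KL that by auto
  show ?case
  proof (cases "set as \<subseteq> {\<zero>}")
    case True
    then have c: "c \<noteq> \<zero>" "c \<in> K" using Cons by auto
    have "inv c \<otimes> a \<in> V" if "a \<in> set (c # as)" for a
    proof -
      have "a = c \<or> a = \<zero>" using that True by auto
      then show ?thesis using subfield_inv[OF K c(2,1)] z c by auto
    qed
    then show ?thesis using c by auto
  next
    case False
    then obtain b where b: "b \<in> set as" "b \<noteq> \<zero>" "\<forall>a\<in>set as. inv b \<otimes> a \<in> V" using Cons by auto
    have bK: "b \<in> K" and cK: "c \<in> K" using Cons b by auto
    have [simp]: "c \<in> carrier R" using cK KL by auto
    show ?thesis
    \<comment> \<open>If \<open>b\<close> does not divide \<open>c\<close>, then \<open>c\<close>
      divides \<open>b\<close> and hence, by transitivity, everything that \<open>b\<close>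
      divides.\<close>
    proof (cases "inv b \<otimes> c \<in> V")
      case True
      then show ?thesis using b by auto
    next
      case False
      have c0: "c \<noteq> \<zero>" using False z bK b by auto
      have bc: "inv b \<otimes> c \<in> K" using subfield_inv[OF K bK b(2)] cK subringE(6)[OF subfieldE(1)[OF K]] by auto
      moreover have "inv b \<otimes> c \<noteq> \<zero>" using False z by auto
      ultimately have "inv (inv b \<otimes> c) \<in> V" using val False by blast
      moreover have "inv (inv b \<otimes> c) = inv c \<otimes> b"
      proof (rule comm_inv_char)
        have "inv b \<otimes> c \<otimes> (inv c \<otimes> b) = inv b \<otimes> (c \<otimes> inv c) \<otimes> b"
          using bK cK b c0 by (simp add: m_assoc)
        then show "inv b \<otimes> c \<otimes> (inv c \<otimes> b) = \<one>"
          using subfield_inv[OF K cK c0] subfield_inv[OF K bK b(2)] bK b(2) by simp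
      qed (use bK cK b c0 in auto)
      ultimately have cb: "inv c \<otimes> b \<in> V" by simp
      have "inv c \<otimes> a \<in> V" if "a \<in> set (c # as)" for a
      proof (cases "a = c")
        case True then show ?thesis using subfield_inv[OF K cK c0] z by simp
      next
        case False
        then have a: "a \<in> set as" "a \<in> carrier R" using that Cons KL by auto
        have "(inv c \<otimes> b) \<otimes> (inv b \<otimes> a) \<in> V" using cb b(3) a subringE(6)[OF Vr] by blast
        moreover have "(inv c \<otimes> b) \<otimes> (inv b \<otimes> a) = inv c \<otimes> (b \<otimes> inv b) \<otimes> a"
          using bK cK b c0 a(2) by (simp add: m_assoc)
        ultimately show ?thesis using subfield_inv[OF K bK b(2)] cK c0 a(2) by simp
      qed
      then show ?thesis using c0 by auto
    qed
  qed
qed simp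

text \<open>Dividing a relation over \<open>K\<close> by a coefficient that divides all the others
  turns it into a relation over \<open>V\<close> with a coefficient \<one>, so it suffices to
  exclude relations normalised in this way.\<close>

lemma (in field) trivial_combine_val_ring:
  assumes V: "val_ring K V" and Us: "set Us \<subseteq> carrier R"
    and triv: "\<And>as. set as \<subseteq> V \<Longrightarrow> length as = length Us \<Longrightarrow> \<one> \<in> set as \<Longrightarrow> combine as Us \<noteq> \<zero>"
  shows "independent K Us"
proof -
  have K: "subfield K R" using V by (simp add: val_ring_def)
  show ?thesis
  proof (rule trivial_combine_imp_independent[OF K Us], rule ccontr)
    fix Ks assume Ks: "set Ks \<subseteq> K" "combine Ks Us = \<zero>" "\<not> set (take (length Us) Ks) \<subseteq> {\<zero>}"
    \<comment> \<open>The criterion for independence allows coefficient lists of any length; padding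
      with zeros and cutting brings the list to the length of \<open>Us\<close> without changing the
      combination.\<close>
    define bs where "bs = take (length Us) (Ks @ replicate (length Us) \<zero>)"
    have bs: "set bs \<subseteq> K" "length bs = length Us" "combine bs Us = \<zero>" "\<not> set bs \<subseteq> {\<zero>}"
    proof -
      show "set bs \<subseteq> K" unfolding bs_def using Ks(1) subringE(2)[OF subfieldE(1)[OF K]]
        by (auto dest!: in_set_takeD split: if_splits)
      show "length bs = length Us" unfolding bs_def by simp
      show "combine bs Us = \<zero>" unfolding bs_def
        using combine_take combine_append_replicate[OF Us] Ks(2) by simp
      have "set (take (length Us) Ks) \<subseteq> set bs" unfolding bs_def by auto
      then show "\<not> set bs \<subseteq> {\<zero>}" using Ks(3) by blast
    qed
    obtain b where b: "b \<in> set bs" "b \<noteq> \<zero>" "\<forall>a\<in>set bs. inv b \<otimes> a \<in> V"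
      using val_ring_scale[OF V bs(1,4)] by blast
    have bK: "b \<in> K" using b bs by auto
    have ib: "inv b \<in> carrier R" "inv b \<otimes> b = \<one>"
      using subfield_inv[OF K bK b(2)] subfieldE(3)[OF K] by auto
    define cs where "cs = map ((\<otimes>) (inv b)) bs"
    have "combine cs Us = inv b \<otimes> combine bs Us"
      unfolding cs_def using combine_r_distr[of bs Us] bs(1) Us ib subfieldE(3)[OF K] by auto
    then have "combine cs Us = \<zero>" using bs(3) ib by simp
    moreover have "set cs \<subseteq> V" "length cs = length Us" using b(3) bs by (auto simp: cs_def)
    moreover have "\<one> \<in> set cs" using b(1) ib(2) by (force simp: cs_def)
    ultimately show False using triv by blast
  qed
qed

text \<open>Independence over the residue field V/J is expressed without forming it: a combination
  in \<open>I\<close> has all coefficients in \<open>J\<close>. The bound \<open>len\<close> yields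
  a longest independent list; adjoining any \<open>c\<close> creates a relation in which the
  coefficient of \<open>c\<close> lies outside \<open>J\<close>, hence is a unit of \<open>V\<close>
  and can be divided out.\<close>

lemma (in field) spanning_list:
  assumes V: "val_ring K V" and C: "subring C R" "V \<subseteq> C" and I: "additive_subgroup I R"
    and CI: "\<And>c a. c \<in> C \<Longrightarrow> a \<in> I \<Longrightarrow> c \<otimes> a \<in> I"
    and JI: "\<And>a c. a \<in> J \<Longrightarrow> c \<in> C \<Longrightarrow> a \<otimes> c \<in> I"
    and J: "\<zero> \<in> J" "\<And>z. z \<in> V \<Longrightarrow> z \<noteq> \<zero> \<Longrightarrow> inv z \<notin> V \<Longrightarrow> z \<in> J"
    and len: "\<And>Us. set Us \<subseteq> C \<Longrightarrow>
      (\<And>as. set as \<subseteq> V \<Longrightarrow> length as = length Us \<Longrightarrow> combine as Us \<in> I \<Longrightarrow> set as \<subseteq> J) \<Longrightarrow> length Us \<le> m"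
  shows "\<exists>Us. set Us \<subseteq> C \<and> length Us \<le> m \<and>
    (\<forall>c\<in>C. \<exists>as. set as \<subseteq> V \<and> length as = length Us \<and> c \<ominus> combine as Us \<in> I)"
proof -
  have K: "subfield K R" and Vr: "subring V R" and VK: "V \<subseteq> K" using V by (auto simp: val_ring_def)
  have VC: "V \<subseteq> carrier R" and CC: "C \<subseteq> carrier R"
    using subringE(1)[OF Vr] subringE(1)[OF C(1)] by auto
  define good where "good Us \<longleftrightarrow> set Us \<subseteq> C \<and>
    (\<forall>as. set as \<subseteq> V \<longrightarrow> length as = length Us \<longrightarrow> combine as Us \<in> I \<longrightarrow> set as \<subseteq> J)" for Us
  have "good []" by (simp add: good_def)
  moreover have "\<forall>Us. good Us \<longrightarrow> length Us < Suc m" using len by (auto simp: good_def less_Suc_eq_le)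
  ultimately have "\<exists>Us. good Us \<and> (\<forall>Vs. good Vs \<longrightarrow> length Vs \<le> length Us)"
    by (rule ex_has_greatest_nat)
  then obtain Us where Us: "good Us" and max: "\<And>Vs. good Vs \<Longrightarrow> length Vs \<le> length Us"
    by auto
  have UsC: "set Us \<subseteq> C" and UsR: "set Us \<subseteq> carrier R" using Us CC by (auto simp: good_def)
  have span: "\<exists>as. set as \<subseteq> V \<and> length as = length Us \<and> c \<ominus> combine as Us \<in> I" if c: "c \<in> C" for c
  proof -
    have cR: "c \<in> carrier R" using c CC by auto
    have "\<not> good (c # Us)" using max[of "c # Us"] by auto
    then obtain bs where bs: "set bs \<subseteq> V" "length bs = length (c # Us)" "combine bs (c # Us) \<in> I"
      "\<not> set bs \<subseteq> J" using c UsC by (auto simp: good_def)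
    obtain a as where eq: "bs = a # as" using bs(2) by (cases bs) auto
    have as: "a \<in> V" "set as \<subseteq> V" "length as = length Us" "a \<otimes> c \<oplus> combine as Us \<in> I"
      using bs eq by auto
    have R: "a \<in> carrier R" "set as \<subseteq> carrier R" "combine as Us \<in> carrier R"
      using as VC UsR by (auto intro!: combine_in_carrier)
    have aJ: "a \<notin> J"
    proof
      assume a: "a \<in> J"
      then have "a \<otimes> c \<in> I" using JI c by blast
      then have "(a \<otimes> c \<oplus> combine as Us) \<ominus> a \<otimes> c \<in> I"
        using additive_subgroup_minus[OF I as(4)] by blast
      moreover have "(a \<otimes> c \<oplus> combine as Us) \<ominus> a \<otimes> c = combine as Us" using R cR by algebra
      ultimately have "combine as Us \<in> I" by simp
      then have "set as \<subseteq> J" using Us as by (auto simp: good_def)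
      then show False using bs(4) a eq by auto
    qed
    then have a0: "a \<noteq> \<zero>" using J(1) by auto
    then have ia: "inv a \<in> V" using J(2) as(1) aJ by blast
    have iaa: "inv a \<otimes> a = \<one>" "inv a \<in> carrier R" using subfield_inv[OF K _ a0] as(1) VK ia VC by auto
    define ds where "ds = map ((\<otimes>) (\<ominus> (inv a))) as"
    have ds: "set ds \<subseteq> V" "length ds = length Us"
      unfolding ds_def using ia as subringE(5,6)[OF Vr] by (auto simp: subset_iff)
    have "combine ds Us = (\<ominus> (inv a)) \<otimes> combine as Us"
      unfolding ds_def using combine_r_distr[of as Us] R UsR iaa by auto
    then have "c \<ominus> combine ds Us = inv a \<otimes> (a \<otimes> c \<oplus> combine as Us)"
      using iaa R cR by (simp add: a_minus_def l_minus r_distr m_assoc[symmetric])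
    moreover have "inv a \<otimes> (a \<otimes> c \<oplus> combine as Us) \<in> I" using CI as(4) ia C(2) by blast
    ultimately show ?thesis using ds by auto
  qed
  then show ?thesis using UsC len Us by (auto simp: good_def)
qed

text \<open>A family of \<open>C\<close> that is independent modulo \<open>tC\<close> over the residue field of \<open>V\<close> is independent over \<open>K\<close>.\<close>

lemma (in field) index_le_dimension:
  assumes V: "val_ring K V" and t: "t \<in> V" "\<one> \<notin> t <# V"
    and loc: "\<And>z. z \<in> V \<Longrightarrow> z \<noteq> \<zero> \<Longrightarrow> inv z \<notin> V \<Longrightarrow> z \<in> t <# V"
    and fin: "finite_index V (t <# V)"
    and C: "subring C R" "V \<subseteq> C" "C \<subseteq> F" and dim: "dimension m K F"
  shows "finite_index C (t <# C)" and "index C (t <# C) \<le> index V (t <# V) ^ m"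
proof -
  have K: "subfield K R" and Vr: "subring V R" and VK: "V \<subseteq> K" using V by (auto simp: val_ring_def)
  have VC: "V \<subseteq> carrier R" and CC: "C \<subseteq> carrier R" and tC: "t \<in> carrier R" "t \<in> C"
    using subringE(1)[OF Vr] subringE(1)[OF C(1)] t(1) C(2) by auto
  note IC = l_coset_additive_subgroup[OF C(1) tC(1)] and IV = l_coset_additive_subgroup[OF Vr tC(1)]
  have JI: "a \<otimes> u \<in> t <# C" if au: "a \<in> t <# V" "u \<in> C" for a u
  proof -
    obtain a' where a': "a' \<in> V" "a = t \<otimes> a'" using au(1) by (auto simp: l_coset_mem)
    have "a \<otimes> u = t \<otimes> (a' \<otimes> u)" unfolding a'(2) using a'(1) VC tC au(2) CC by (simp add: m_assoc subset_iff)
    moreover have "a' \<otimes> u \<in> C" using a' C(2) au(2) subringE(6)[OF C(1)] by auto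
    ultimately show ?thesis by (auto simp: l_coset_mem)
  qed
  have CI: "c \<otimes> a \<in> t <# C" if ca: "c \<in> C" "a \<in> t <# C" for c a
  proof -
    obtain d where d: "d \<in> C" "a = t \<otimes> d" using ca(2) by (auto simp: l_coset_mem)
    have "c \<otimes> a = t \<otimes> (c \<otimes> d)" unfolding d(2) using tC d(1) ca(1) CC by (simp add: m_lcomm subset_iff)
    moreover have "c \<otimes> d \<in> C" using d ca(1) subringE(6)[OF C(1)] by auto
    ultimately show ?thesis by (auto simp: l_coset_mem)
  qed
  \<comment> \<open>A relation over \<open>K\<close>, rescaled to have a coefficient \<one>, has the
    value \<zero>, which lies in \<open>t <# C\<close>; independence modulo \<open>t <# C\<close>
    would then put \<one> into \<open>t <# V\<close>.\<close>
  have len: "length Us \<le> m"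
    if UC: "set Us \<subseteq> C" and g: "\<And>as. set as \<subseteq> V \<Longrightarrow> length as = length Us \<Longrightarrow> combine as Us \<in> t <# C \<Longrightarrow> set as \<subseteq> t <# V" for Us
  proof (rule independent_length_le_dimension[OF K dim])
    show "set Us \<subseteq> F" using UC C(3) by (rule subset_trans)
    show "independent K Us"
    proof (rule trivial_combine_val_ring[OF V])
      show "set Us \<subseteq> carrier R" using UC CC by (rule subset_trans)
      fix as assume as: "set as \<subseteq> V" "length as = length Us" "\<one> \<in> set as"
      show "combine as Us \<noteq> \<zero>" using g[OF as(1,2)] as(3) t(2) additive_subgroup.zero_closed[OF IC] by auto
    qed
  qed
  obtain Us where Us: "set Us \<subseteq> C" "length Us \<le> m"
    and span: "\<And>c. c \<in> C \<Longrightarrow> \<exists>as. set as \<subseteq> V \<and> length as = length Us \<and> c \<ominus> combine as Us \<in> t <# C"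
    using spanning_list[OF V C(1,2) IC CI JI additive_subgroup.zero_closed[OF IV] loc len] by blast
  have UsR: "set Us \<subseteq> carrier R" using Us(1) CC by (rule subset_trans)
  have JU: "a \<otimes> u \<in> t <# C" if "a \<in> t <# V" "u \<in> set Us" for a u using JI that Us(1) by blast
  note b = index_le_span[OF IV VC fin IC CC UsR JU span]
  show "finite_index C (t <# C)" using b(1) .
  have "index V (t <# V) > 0" using index_pos[OF fin] t(1) by auto
  then have "index V (t <# V) ^ length Us \<le> index V (t <# V) ^ m"
    using Us(2) by (intro power_increasing) auto
  then show "index C (t <# C) \<le> index V (t <# V) ^ m" using b(2) by linarith
qed

section \<open>The ideal of non-units of a valuation ring\<close>

context field
begin

text \<open>One of the two quotients of the summands, say a/b, lies in \<open>V\<close>, and a + b =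
  (a/b + 1) b shows that an inverse of a + b would invert b. Being a non-unit is spelled
  \<open>x = \<zero> \<or> inv x \<notin> V\<close>, because \<open>inv \<zero>\<close> has no
  useful value.\<close>

lemma val_ring_nonunits_add:
  assumes V: "val_ring F V" and x: "x \<in> V" "x = \<zero> \<or> inv x \<notin> V" and y: "y \<in> V" "y = \<zero> \<or> inv y \<notin> V"
  shows "x \<oplus> y = \<zero> \<or> inv (x \<oplus> y) \<notin> V"
proof -
  have F: "subfield F R" and Vr: "subring V R" and VF: "V \<subseteq> F"
    and val: "\<And>z. z \<in> F \<Longrightarrow> z \<noteq> \<zero> \<Longrightarrow> z \<in> V \<or> inv z \<in> V"
    using V by (auto simp: val_ring_def)
  have VR: "V \<subseteq> carrier R" using subringE(1)[OF Vr] .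
  have *: "inv (a \<oplus> b) \<notin> V"
    if a: "a \<in> V" "a \<noteq> \<zero>" and b: "b \<in> V" "b \<noteq> \<zero>" "inv b \<notin> V" and ab: "a \<otimes> inv b \<in> V" and s: "a \<oplus> b \<noteq> \<zero>" for a b
  proof
    assume i: "inv (a \<oplus> b) \<in> V"
    have R: "a \<in> carrier R" "b \<in> carrier R" "inv b \<in> carrier R" "inv b \<otimes> b = \<one>"
      using subfield_inv[OF F _ b(2)] a b VF VR subfieldE(3)[OF F] by auto
    have sV: "a \<oplus> b \<in> F" using a b subringE(7)[OF Vr] VF by blast
    have iR: "inv (a \<oplus> b) \<in> carrier R" "inv (a \<oplus> b) \<otimes> (a \<oplus> b) = \<one>"
      using subfield_inv[OF F sV s] i VR by auto
    have "a \<oplus> b = (a \<otimes> inv b \<oplus> \<one>) \<otimes> b"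
      using R by (simp add: l_distr m_assoc)
    then have "inv (a \<oplus> b) \<otimes> ((a \<otimes> inv b \<oplus> \<one>) \<otimes> b) = \<one>" using iR by simp
    then have e: "(inv (a \<oplus> b) \<otimes> (a \<otimes> inv b \<oplus> \<one>)) \<otimes> b = \<one>" using iR(1) R by (simp add: m_assoc)
    have w: "inv (a \<oplus> b) \<otimes> (a \<otimes> inv b \<oplus> \<one>) \<in> V"
      using i ab subringE(3,6,7)[OF Vr] by blast
    have "inv b = inv (a \<oplus> b) \<otimes> (a \<otimes> inv b \<oplus> \<one>)"
      using comm_inv_char[of b "inv (a \<oplus> b) \<otimes> (a \<otimes> inv b \<oplus> \<one>)"] e w R VR by (auto simp: m_comm)
    then show False using w b(3) by simp
  qed
  show ?thesis
  proof (cases "x = \<zero> \<or> y = \<zero> \<or> x \<oplus> y = \<zero>")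
    case True
    then show ?thesis using x y VR by auto
  next
    case False
    then have nz: "x \<noteq> \<zero>" "y \<noteq> \<zero>" "x \<oplus> y \<noteq> \<zero>" by auto
    have R: "x \<in> carrier R" "y \<in> carrier R" "inv x \<in> F" "inv y \<in> F" "x \<in> F" "y \<in> F"
      using subfield_inv[OF F] x y nz VF VR by auto
    have R': "inv x \<in> carrier R" "inv y \<in> carrier R" using R subfieldE(3)[OF F] by auto
    have q: "x \<otimes> inv y \<in> F" using R subringE(6)[OF subfieldE(1)[OF F]] by auto
    have q0: "x \<otimes> inv y \<noteq> \<zero>" using nz R R' subfield_inv(2)[OF F] integral by blast
    have "inv (x \<otimes> inv y) = y \<otimes> inv x"
    proof (rule comm_inv_char)
      have "x \<otimes> inv y \<otimes> (y \<otimes> inv x) = x \<otimes> (inv y \<otimes> y) \<otimes> inv x" using R R' by (simp add: m_assoc)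
      then show "x \<otimes> inv y \<otimes> (y \<otimes> inv x) = \<one>" using subfield_inv[OF F] R nz R' by simp
    qed (use R R' in auto)
    then have "x \<otimes> inv y \<in> V \<or> y \<otimes> inv x \<in> V" using val[OF q q0] by simp
    then show ?thesis
    proof
      assume "x \<otimes> inv y \<in> V"
      then show ?thesis using *[of x y] x y nz by blast
    next
      assume "y \<otimes> inv x \<in> V"
      then have "inv (y \<oplus> x) \<notin> V" using *[of y x] x y nz R by (simp add: a_comm)
      then show ?thesis using R by (simp add: a_comm)
    qed
  qed
qed

lemma val_ring_nonunits_mult:
  assumes V: "val_ring F V" and x: "x \<in> V" "x = \<zero> \<or> inv x \<notin> V" and a: "a \<in> V"
  shows "a \<otimes> x = \<zero> \<or> inv (a \<otimes> x) \<notin> V"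
proof (rule ccontr)
  have F: "subfield F R" and Vr: "subring V R" and VF: "V \<subseteq> F" using V by (auto simp: val_ring_def)
  have VR: "V \<subseteq> carrier R" using subringE(1)[OF Vr] .
  assume "\<not> (a \<otimes> x = \<zero> \<or> inv (a \<otimes> x) \<notin> V)"
  then have i: "inv (a \<otimes> x) \<in> V" and n: "a \<otimes> x \<noteq> \<zero>" by auto
  have R: "a \<in> carrier R" "x \<in> carrier R" "inv (a \<otimes> x) \<in> carrier R" using x a i VR by auto
  have x0: "x \<noteq> \<zero>" using n R by auto
  have axF: "a \<otimes> x \<in> F" using a x subringE(6)[OF Vr] VF by blast
  have "inv x = inv (a \<otimes> x) \<otimes> a"
  proof (rule comm_inv_char)
    have "x \<otimes> (inv (a \<otimes> x) \<otimes> a) = inv (a \<otimes> x) \<otimes> (a \<otimes> x)" using R by (simp add: m_ac)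
    then show "x \<otimes> (inv (a \<otimes> x) \<otimes> a) = \<one>" using subfield_inv[OF F axF n] by simp
  qed (use R in auto)
  then have "inv x \<in> V" using i a subringE(6)[OF Vr] by simp
  then show False using x x0 by simp
qed

end

section \<open>Places and valuation rings determine each other\<close>

lemma (in field) valuation_ring_val_ring:
  assumes "subfield F R" "valuation_ring R k F V"
  shows "val_ring F V"
  using assms by (auto simp: valuation_ring_def val_ring_def)

text \<open>This is how places are constructed below: a valuation ring arises by restriction or from
  Chevalley's theorem, and its non-units form the place.\<close>

lemma (in field) place_of_valuation_ring:
  assumes F: "subfield F R" and V: "valuation_ring R k F V"
  shows "{z \<in> V. z = \<zero> \<or> inv z \<notin> V} \<in> places R k F"
    and "ring_of_place R F {z \<in> V. z = \<zero> \<or> inv z \<notin> V} = V"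
proof -
  define P where "P = {z \<in> V. z = \<zero> \<or> inv z \<notin> V}"
  have VV: "val_ring F V" using valuation_ring_val_ring[OF F V] .
  have Vr: "subring V R" and VF: "V \<subseteq> F" using VV by (auto simp: val_ring_def)
  have VR: "V \<subseteq> carrier R" using subringE(1)[OF Vr] .
  interpret VR: cring "R\<lparr>carrier := V\<rparr>" using subring_is_domain[OF Vr] by (simp add: domain_def)
  have add: "x \<oplus> y \<in> P" if "x \<in> P" "y \<in> P" for x y
    using that val_ring_nonunits_add[OF VV, of x y] subringE(7)[OF Vr] by (auto simp: P_def)
  have mult: "a \<otimes> x \<in> P" if "x \<in> P" "a \<in> V" for x a
    using that val_ring_nonunits_mult[OF VV, of x a] subringE(6)[OF Vr] by (auto simp: P_def)
  have neg: "\<ominus> x \<in> P" if "x \<in> P" for x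
  proof -
    have "(\<ominus> \<one>) \<otimes> x \<in> P" using mult that subringE(3,5)[OF Vr] by blast
    then show ?thesis using that VR by (auto simp: P_def l_minus)
  qed
  have P0: "\<zero> \<in> P" using subringE(2)[OF Vr] by (simp add: P_def)
  have as: "additive_subgroup P (R\<lparr>carrier := V\<rparr>)"
  proof (rule VR.additive_subgroupI)
    show "P \<subseteq> carrier (R\<lparr>carrier := V\<rparr>)" "\<zero>\<^bsub>R\<lparr>carrier := V\<rparr>\<^esub> \<in> P" using P0 by (auto simp: P_def)
    fix a b assume ab: "a \<in> P" "b \<in> P"
    have "\<ominus>\<^bsub>R\<lparr>carrier := V\<rparr>\<^esub> b = \<ominus> b"
      using VR.minus_equality[of "\<ominus> b" b] ab VR neg[OF ab(2)] by (auto simp: P_def l_neg)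
    then show "a \<ominus>\<^bsub>R\<lparr>carrier := V\<rparr>\<^esub> b \<in> P" using add[OF ab(1) neg[OF ab(2)]]
      by (simp add: a_minus_def)
  qed
  have id: "ideal P (R\<lparr>carrier := V\<rparr>)"
  proof (rule idealI)
    show "ring (R\<lparr>carrier := V\<rparr>)" by (rule VR.ring_axioms)
    show "subgroup P (add_monoid (R\<lparr>carrier := V\<rparr>))" using as by (rule additive_subgroup.a_subgroup)
    fix a x assume ax: "a \<in> P" "x \<in> carrier (R\<lparr>carrier := V\<rparr>)"
    then show "x \<otimes>\<^bsub>R\<lparr>carrier := V\<rparr>\<^esub> a \<in> P" using mult by simp
    moreover have "a \<otimes> x = x \<otimes> a" using ax VR by (auto simp: P_def m_comm subset_iff)
    ultimately show "a \<otimes>\<^bsub>R\<lparr>carrier := V\<rparr>\<^esub> x \<in> P" by simp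
  qed
  have max: "maximalideal P (R\<lparr>carrier := V\<rparr>)"
  proof (rule maximalidealI[OF id])
    have "\<one> \<notin> P" using inv_one subringE(3)[OF Vr] by (simp add: P_def)
    then show "carrier (R\<lparr>carrier := V\<rparr>) \<noteq> P" using subringE(3)[OF Vr] by auto
    fix J assume J: "ideal J (R\<lparr>carrier := V\<rparr>)" "P \<subseteq> J" "J \<subseteq> carrier (R\<lparr>carrier := V\<rparr>)"
    show "J = P \<or> J = carrier (R\<lparr>carrier := V\<rparr>)"
    proof (cases "J = P")
      case False
      then obtain x where x: "x \<in> J" "x \<in> V" "x \<notin> P" using J by auto
      then have "inv x \<in> V" "x \<noteq> \<zero>" by (auto simp: P_def)
      then have "inv x \<otimes> x \<in> J" using ideal.I_l_closed[OF J(1) x(1)] by simp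
      moreover have "inv x \<otimes> x = \<one>" using subfield_inv[OF F] x VF \<open>x \<noteq> \<zero>\<close> by auto
      ultimately show ?thesis using ideal.one_imp_carrier[OF J(1)] by simp
    qed simp
  qed
  show "{z \<in> V. z = \<zero> \<or> inv z \<notin> V} \<in> places R k F" using V max by (auto simp: places_def P_def)
  show "ring_of_place R F {z \<in> V. z = \<zero> \<or> inv z \<notin> V} = V"
    using valuation_ring_eq_ring_of_place[OF field_axioms F V max] by (simp add: P_def)
qed

lemma (in field) placeE:
  assumes F: "subfield F R" and P: "P \<in> places R k F"
  shows "valuation_ring R k F (ring_of_place R F P)"
    and "P = {z \<in> ring_of_place R F P. z = \<zero> \<or> inv z \<notin> ring_of_place R F P}"
proof -
  obtain V where V: "valuation_ring R k F V" and max: "maximalideal P (R\<lparr>carrier := V\<rparr>)"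
    using P by (auto simp: places_def)
  have eq: "ring_of_place R F P = V" using valuation_ring_eq_ring_of_place[OF field_axioms F V max] by simp
  show "valuation_ring R k F (ring_of_place R F P)" using V eq by simp
  have Vr: "subring V R" and VF: "V \<subseteq> F" using V by (auto simp: valuation_ring_def)
  interpret P: maximalideal P "R\<lparr>carrier := V\<rparr>" by fact
  have PV: "P \<subseteq> V" using P.a_subset by simp
  have one: "\<one> \<notin> P" using P.I_notcarr P.one_imp_carrier by auto
  show "P = {z \<in> ring_of_place R F P. z = \<zero> \<or> inv z \<notin> ring_of_place R F P}"
    unfolding eq
  proof (intro equalityI subsetI CollectI conjI)
    fix z assume z: "z \<in> P"
    show "z \<in> V" using z PV by auto
    show "z = \<zero> \<or> inv z \<notin> V"
    proof (rule ccontr)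
      assume "\<not> (z = \<zero> \<or> inv z \<notin> V)"
      then have "inv z \<otimes> z \<in> P" "inv z \<otimes> z = \<one>"
        using P.I_l_closed[OF z, of "inv z"] subfield_inv[OF F, of z] z PV VF by auto
      then show False using one by simp
    qed
  next
    fix z assume "z \<in> {z \<in> V. z = \<zero> \<or> inv z \<notin> V}"
    then have z: "z \<in> V" "z = \<zero> \<or> inv z \<notin> V" by auto
    show "z \<in> P"
    proof (cases "z = \<zero>")
      case True
      then show ?thesis using additive_subgroup.zero_closed[OF P.additive_subgroup_axioms] by simp
    next
      case False
      then have iz: "inv z \<in> F" "inv z \<noteq> \<zero>" "inv z \<notin> V" using subfield_inv[OF F] z VF by auto
      then have "inv z \<notin> ring_of_place R F P" using eq by simp
      then have "inv (inv z) \<in> P" using iz by (auto simp: ring_of_place_def)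
      moreover have "inv (inv z) = z" using False z VF subfieldE(3)[OF F] field_Units by (intro Units_inv_inv) auto
      ultimately show ?thesis by simp
    qed
  qed
qed

section \<open>Discrete places\<close>

text \<open>Discreteness is encoded by the finiteness of V/zV for every nonzero z in V, a property
  that can be carried along finite field extensions by counting. Uniformizer and valuation are
  derived from it, and it makes the residue field finite as well.\<close>

definition (in field) discrete_place :: "'a set \<Rightarrow> 'a set \<Rightarrow> bool"
  where "discrete_place F P \<longleftrightarrow> val_ring F (ring_of_place R F P) \<and> ring_of_place R F P \<noteq> F \<and>
    P = {z \<in> ring_of_place R F P. z = \<zero> \<or> inv z \<notin> ring_of_place R F P} \<and>
    (\<forall>z\<in>ring_of_place R F P - {\<zero>}. finite_index (ring_of_place R F P) (z <# ring_of_place R F P))"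

text \<open>Moves integer powers into the multiplicative group, where the laws of exponents for
  groups apply.\<close>

lemma (in field) int_pow_mult_of:
  assumes "a \<in> carrier R" "a \<noteq> \<zero>"
  shows "a [^]\<^bsub>Multiplicative_Group.mult_of R\<^esub> (n::int) = a [^] n"
proof -
  interpret M: group "Multiplicative_Group.mult_of R" by (rule field_mult_group)
  have n: "a [^]\<^bsub>Multiplicative_Group.mult_of R\<^esub> (m::nat) = a [^] m" for m
    by (simp only: Multiplicative_Group.nat_pow_mult_of)
  have c: "a [^] (m::nat) \<in> carrier (Multiplicative_Group.mult_of R)" for m
    using M.nat_pow_closed[of a m] assms unfolding n by simp
  show ?thesis
    unfolding int_pow_def2 n m_inv_mult_of[OF c] ..
qed

lemma (in field) int_pow_simps:
  fixes m n :: int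
  assumes a: "a \<in> carrier R" "a \<noteq> \<zero>"
  shows "a [^] (m + n) = a [^] m \<otimes> a [^] n" "a [^] n \<in> carrier R" "a [^] n \<noteq> \<zero>"
    "a [^] (- n) = inv (a [^] n)" "a [^] (1::int) = a" "a [^] int j = a [^] j" "a [^] (0::int) = \<one>"
proof -
  interpret M: group "Multiplicative_Group.mult_of R" by (rule field_mult_group)
  have aM: "a \<in> carrier (Multiplicative_Group.mult_of R)" using a by simp
  show "a [^] (m + n) = a [^] m \<otimes> a [^] n"
    using M.int_pow_mult[OF aM, of m n] int_pow_mult_of[OF a] by simp
  have "a [^] n \<in> carrier (Multiplicative_Group.mult_of R)" using M.int_pow_closed[OF aM, of n] int_pow_mult_of[OF a] by simp
  then show "a [^] n \<in> carrier R" "a [^] n \<noteq> \<zero>" by auto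
  then show "a [^] (- n) = inv (a [^] n)"
    using M.int_pow_neg[OF aM, of n] int_pow_mult_of[OF a] m_inv_mult_of by simp
  show "a [^] (1::int) = a" using M.int_pow_1[OF aM] int_pow_mult_of[OF a] by simp
  show "a [^] int j = a [^] j" by (simp add: int_pow_int)
  show "a [^] (0::int) = \<one>" using int_pow_mult_of[OF a, of 0] by simp
qed

lemma (in field) inv_mult_field:
  assumes "a \<in> carrier R" "a \<noteq> \<zero>" "b \<in> carrier R" "b \<noteq> \<zero>"
  shows "inv (a \<otimes> b) = inv a \<otimes> inv b"
proof (rule comm_inv_char)
  have i: "inv a \<in> carrier R" "inv b \<in> carrier R" "a \<otimes> inv a = \<one>" "b \<otimes> inv b = \<one>"
    using assms field_Units by auto
  have "a \<otimes> b \<otimes> (inv a \<otimes> inv b) = (a \<otimes> inv a) \<otimes> (b \<otimes> inv b)" using i assms by (simp add: m_ac)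
  then show "a \<otimes> b \<otimes> (inv a \<otimes> inv b) = \<one>" using i by simp
qed (use assms field_Units in auto)

lemma (in field) inv_field:
  assumes "a \<in> carrier R" "a \<noteq> \<zero>"
  shows "inv a \<in> carrier R" "inv a \<noteq> \<zero>" "a \<otimes> inv a = \<one>" "inv a \<otimes> a = \<one>" "inv (inv a) = a"
  using assms field_Units by auto

context field
begin

context
  fixes F P
  assumes D: "discrete_place F P"
begin

abbreviation (input) "OP \<equiv> ring_of_place R F P"

lemma dp_facts:
  shows "subfield F R" "subring OP R" "OP \<subseteq> F" "F \<subseteq> carrier R" "OP \<subseteq> carrier R" "val_ring F OP"
    and "\<And>z. z \<in> F \<Longrightarrow> z \<notin> OP \<Longrightarrow> inv z \<in> P"
    and "\<And>z. z \<in> P \<longleftrightarrow> z \<in> OP \<and> (z = \<zero> \<or> inv z \<notin> OP)"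
    and "P \<subseteq> OP"
proof -
  show 1: "subfield F R" "subring OP R" "OP \<subseteq> F" "val_ring F OP"
    using D by (auto simp: discrete_place_def val_ring_def)
  show "F \<subseteq> carrier R" using subfieldE(3)[OF 1(1)] .
  then show "OP \<subseteq> carrier R" using 1 by blast
  show P: "z \<in> P \<longleftrightarrow> z \<in> OP \<and> (z = \<zero> \<or> inv z \<notin> OP)" for z
    using D unfolding discrete_place_def by blast
  then show "P \<subseteq> OP" by blast
  fix z assume z: "z \<in> F" "z \<notin> OP"
  then show "inv z \<in> P" by (auto simp: ring_of_place_def)
qed

text \<open>Fix a nonzero x in \<open>P\<close>. Among the divisors t of x in \<open>P\<close>, one
  for which tV contains the most cosets of xV generates \<open>P\<close>: since divisibility is
  total, an element of \<open>P\<close> outside tV would generate a larger ideal.\<close>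

lemma dp_uniformizer: "\<exists>t. t \<in> P \<and> t \<noteq> \<zero> \<and> P = t <# OP"
proof -
  note f = dp_facts
  obtain z where z: "z \<in> F" "z \<notin> OP" using D f(3) by (auto simp: discrete_place_def)
  have z0: "z \<noteq> \<zero>" using z f(2) subringE(2) by blast
  define x where "x = inv z"
  have x: "x \<in> P" "x \<noteq> \<zero>" using f(7)[OF z] subfield_inv[OF f(1) z(1) z0] by (auto simp: x_def)
  have xO: "x \<in> OP" "x \<in> carrier R" using x f(5,9) by auto
  have Ix: "additive_subgroup (x <# OP) R" using l_coset_additive_subgroup[OF f(2) xO(2)] .
  have fin: "finite_index OP (x <# OP)" using D x xO by (auto simp: discrete_place_def)
  define good where "good t \<longleftrightarrow> t \<in> P \<and> x \<in> t <# OP" for t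
  have sub: "t <# OP \<subseteq> OP" if "t \<in> OP" for t using that subringE(6)[OF f(2)] by (auto simp: l_coset_mem)
  have self: "t \<in> t <# OP" if "t \<in> OP" for t
  proof -
    have "t = t \<otimes> \<one>" using that f(5) by auto
    then show ?thesis using subringE(3)[OF f(2)] unfolding l_coset_mem by blast
  qed
  have "good x" using x self xO by (simp add: good_def)
  moreover have "\<forall>t. good t \<longrightarrow> index (t <# OP) (x <# OP) < Suc (index OP (x <# OP))"
    using index_mono(2)[OF Ix f(5) fin sub] f(9) by (auto simp: good_def less_Suc_eq_le)
  ultimately have "\<exists>t. good t \<and> (\<forall>s. good s \<longrightarrow> index (s <# OP) (x <# OP) \<le> index (t <# OP) (x <# OP))"
    by (rule ex_has_greatest_nat)
  then obtain t where t: "good t" and max: "\<And>s. good s \<Longrightarrow> index (s <# OP) (x <# OP) \<le> index (t <# OP) (x <# OP)"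
    by auto
  have tP: "t \<in> P" "x \<in> t <# OP" "t \<in> OP" "t \<in> carrier R" using t f(5,9) by (auto simp: good_def)
  have t0: "t \<noteq> \<zero>" using tP(2) x(2) f(5) by (auto simp: l_coset_mem)
  have trans: "a <# OP \<subseteq> b <# OP" if ab: "a \<in> b <# OP" "b \<in> carrier R" for a b
  proof
    fix c assume "c \<in> a <# OP"
    then obtain d where d: "d \<in> OP" "c = a \<otimes> d" by (auto simp: l_coset_mem)
    obtain e where e: "e \<in> OP" "a = b \<otimes> e" using ab(1) by (auto simp: l_coset_mem)
    note de = d(1) e(1) d(2) e(2)
    then have "c = b \<otimes> (e \<otimes> d)" using ab(2) f(5) by (simp add: m_assoc subset_iff)
    then show "c \<in> b <# OP" using de subringE(6)[OF f(2)] by (auto simp: l_coset_mem)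
  qed
  have "P \<subseteq> t <# OP"
  proof (rule ccontr)
    assume "\<not> P \<subseteq> t <# OP"
    then obtain z where z: "z \<in> P" "z \<notin> t <# OP" by blast
    have zO: "z \<in> OP" "z \<in> F" "z \<in> carrier R" and tF: "t \<in> F" using z f(3,4,9) tP by auto
    have z0: "z \<noteq> \<zero>" using z(2) additive_subgroup.zero_closed[OF l_coset_additive_subgroup[OF f(2) tP(4)]] by auto
    note it = inv_field[OF tP(4) t0] and iz = inv_field[OF zO(3) z0]
    have "inv t \<otimes> z \<notin> OP"
    proof
      assume "inv t \<otimes> z \<in> OP"
      moreover have "z = t \<otimes> (inv t \<otimes> z)" using it zO tP by (simp add: m_assoc[symmetric])
      ultimately show False using z(2) unfolding l_coset_mem by blast
    qed
    moreover have "inv t \<otimes> z \<in> F" using subfield_inv[OF f(1) tF t0] zO subringE(6)[OF subfieldE(1)[OF f(1)]] by blast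
    ultimately have "inv (inv t \<otimes> z) \<in> OP" using f(7,9) by blast
    moreover have "inv (inv t \<otimes> z) = t \<otimes> inv z" using inv_mult_field[of "inv t" z] it zO z0 by simp
    ultimately have "t \<otimes> inv z \<in> OP" by simp
    moreover have "t = z \<otimes> (t \<otimes> inv z)" using iz zO(3) tP(4) by (simp add: m_lcomm)
    ultimately have tz: "t \<in> z <# OP" unfolding l_coset_mem by blast
    have "good z" using z trans[OF tz zO(3)] tP(2) by (auto simp: good_def)
    have inc: "t <# OP \<subseteq> z <# OP" using trans[OF tz zO(3)] .
    have zsub: "z <# OP \<subseteq> carrier R" using sub[OF zO(1)] f(5) by blast
    have finz: "finite_index (z <# OP) (x <# OP)" using index_mono(1)[OF Ix f(5) fin sub[OF zO(1)]] .
    \<comment> \<open>Maximality of \<open>t\<close> forces the two nested sets of cosets to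
      coincide; as xV lies in tV, this puts \<open>z\<close> into tV.\<close>
    have "(\<lambda>a. (x <# OP) +> a) ` (t <# OP) = (\<lambda>a. (x <# OP) +> a) ` (z <# OP)"
    proof (rule card_seteq)
      show "finite ((\<lambda>a. (x <# OP) +> a) ` (z <# OP))" using finz by (simp add: finite_index_def)
      show "card ((\<lambda>a. (x <# OP) +> a) ` (z <# OP)) \<le> card ((\<lambda>a. (x <# OP) +> a) ` (t <# OP))"
        using max[OF \<open>good z\<close>] by (simp add: index_def)
    qed (use inc in blast)
    then have "(x <# OP) +> z \<in> (\<lambda>a. (x <# OP) +> a) ` (t <# OP)" using self[OF zO(1)] by blast
    then obtain a where a: "a \<in> t <# OP" "(x <# OP) +> z = (x <# OP) +> a" by blast
    have aR: "a \<in> carrier R" using a(1) sub[OF tP(3)] f(5) by blast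
    have "z \<ominus> a \<in> x <# OP" using coset_eq_iff[OF Ix zO(3) aR] a(2) by simp
    then have "z \<ominus> a \<in> t <# OP" using trans[OF tP(2,4)] by blast
    then have "(z \<ominus> a) \<oplus> a \<in> t <# OP"
      using additive_subgroup.a_closed[OF l_coset_additive_subgroup[OF f(2) tP(4)]] a(1) by blast
    moreover have "(z \<ominus> a) \<oplus> a = z" using zO aR by algebra
    ultimately show False using z(2) by simp
  qed
  moreover have "t <# OP \<subseteq> P"
  proof
    fix y assume "y \<in> t <# OP"
    then obtain a where a: "a \<in> OP" "y = t \<otimes> a" by (auto simp: l_coset_mem)
    have "y = a \<otimes> t" using a tP f(5) by (auto simp: m_comm)
    then show "y \<in> P" using val_ring_nonunits_mult[OF f(6) tP(3) _ a(1)] f(8) tP a subringE(6)[OF f(2)] by auto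
  qed
  ultimately show ?thesis using tP t0 by blast
qed

lemma dp_units:
  "Units (local_ring R F P) = {u \<in> OP. u \<noteq> \<zero> \<and> inv u \<in> OP}"
proof -
  note f = dp_facts
  have "u \<noteq> \<zero> \<and> inv u \<in> OP" if "u \<in> OP" "x \<in> OP" "x \<otimes> u = \<one>" for u x
  proof
    have R: "u \<in> carrier R" "x \<in> carrier R" using that f(5) by auto
    show "u \<noteq> \<zero>" using that R by auto
    show "inv u \<in> OP" using comm_inv_char[of u x] R that by (simp add: m_comm)
  qed
  moreover have "u \<otimes> inv u = \<one> \<and> inv u \<otimes> u = \<one>" if "u \<in> OP" "u \<noteq> \<zero>" for u
    using inv_field[of u] that f(5) by auto
  ultimately show ?thesis by (auto simp: Units_def)
qed

lemma dp_prime_element: "prime_element R F P t \<longleftrightarrow> t \<in> P \<and> P = t <# OP"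
proof -
  note f = dp_facts
  have "PIdl\<^bsub>local_ring R F P\<^esub> t = t <# OP" if "t \<in> P"
  proof -
    have "t \<in> carrier R" using that f(5,9) by auto
    then have "x \<otimes> t = t \<otimes> x" if "x \<in> OP" for x using that f(5) by (auto simp: m_comm)
    then show ?thesis unfolding cgenideal_def l_coset_def by (simp add: Setcompr_eq_image UNION_singleton_eq_range)
  qed
  then show ?thesis by (auto simp: prime_element_def)
qed

lemma dp_prime_nonzero:
  assumes "prime_element R F P t"
  shows "t \<noteq> \<zero>"
proof
  assume "t = \<zero>"
  have "P \<subseteq> t <# OP" using assms dp_prime_element by blast
  moreover obtain r where r: "r \<in> P" "r \<noteq> \<zero>" using dp_uniformizer by blast
  ultimately have "r \<in> t <# OP" by blast
  then obtain a where "a \<in> OP" "r = t \<otimes> a" by (auto simp: l_coset_mem)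
  then show False using \<open>t = \<zero>\<close> r dp_facts(5) by auto
qed

text \<open>Were \<open>z\<close> divisible by all powers of \<open>t\<close>, these powers would be
  pairwise incongruent modulo zV, against the finiteness of V/zV. The last power dividing
  \<open>z\<close> leaves a cofactor outside \<open>P\<close>.\<close>

lemma dp_pow_repr:
  assumes t: "t \<in> P" "t \<noteq> \<zero>" "P = t <# OP" and z: "z \<in> OP" "z \<noteq> \<zero>"
  shows "\<exists>n u. u \<in> Units (local_ring R F P) \<and> z = t [^] (n::nat) \<otimes> u"
proof -
  note f = dp_facts
  have tO: "t \<in> OP" "t \<in> carrier R" and zR: "z \<in> carrier R" using t z f(5,9) by auto
  have pw: "t [^] (n::nat) \<in> OP" "t [^] n \<in> carrier R" "t [^] n \<noteq> \<zero>" for n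
  proof -
    show "t [^] n \<in> OP" by (induction n) (use tO subringE(3,6)[OF f(2)] in auto)
    then show "t [^] n \<in> carrier R" using f(5) by auto
    show "t [^] n \<noteq> \<zero>" using int_pow_simps(3,6)[OF tO(2) t(2)] by metis
  qed
  have one: "\<one> \<notin> t <# OP" using f(8)[of \<one>] equalityD2[OF t(3)] by auto
  have "\<exists>n. z \<notin> t [^] (n::nat) <# OP"
  proof (rule ccontr)
    assume "\<not> ?thesis"
    then have all: "\<And>n. z \<in> t [^] (n::nat) <# OP" by blast
    have Iz: "additive_subgroup (z <# OP) R" using l_coset_additive_subgroup[OF f(2) zR] .
    have fin: "finite_index OP (z <# OP)" using D z by (auto simp: discrete_place_def)
    \<comment> \<open>As t^(i+1) divides \<open>z\<close>, cancelling t^i in the congruence leaves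
      \<one> in tV.\<close>
    have lt: "t [^] i \<ominus> t [^] j \<notin> z <# OP" if ij: "i < j" for i j :: nat
    proof
      assume "t [^] i \<ominus> t [^] j \<in> z <# OP"
      then obtain a where a: "a \<in> OP" "t [^] i \<ominus> t [^] j = z \<otimes> a" by (auto simp: l_coset_mem)
      obtain b where b: "b \<in> OP" "z = t [^] (Suc i) \<otimes> b" using all[of "Suc i"] by (auto simp: l_coset_mem)
      obtain d where d: "j = i + Suc d" using ij less_iff_Suc_add by auto
      have R: "a \<in> carrier R" "b \<in> carrier R" using a b f(5) by auto
      have tj: "t [^] j = t [^] i \<otimes> (t \<otimes> t [^] d)" unfolding d using tO pw(2)[of i] pw(2)[of d] by (simp add: nat_pow_mult[symmetric] m_ac)
      have "t [^] i \<otimes> \<one> = t [^] j \<oplus> z \<otimes> a"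
      proof -
        have "t [^] i = t [^] j \<oplus> (t [^] i \<ominus> t [^] j)" using pw(2)[of i] pw(2)[of j] by algebra
        then show ?thesis using a(2) pw(2)[of i] by simp
      qed
      also have "\<dots> = t [^] i \<otimes> (t \<otimes> (t [^] d \<oplus> b \<otimes> a))"
        unfolding tj b(2) using R tO pw(2)[of i] pw(2)[of d] by (simp add: r_distr m_assoc)
      finally have "\<one> = t \<otimes> (t [^] d \<oplus> b \<otimes> a)"
        using m_lcancel[OF pw(3)[of i] pw(2)[of i], of \<one> "t \<otimes> (t [^] d \<oplus> b \<otimes> a)"] R tO pw(2)[of d] by simp
      moreover have "t [^] d \<oplus> b \<otimes> a \<in> OP" using pw(1) a b subringE(6,7)[OF f(2)] by blast
      ultimately show False using one unfolding l_coset_mem by blast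
    qed
    have ne: "t [^] i \<ominus> t [^] j \<notin> z <# OP" if "i \<noteq> j" for i j :: nat
      using lt[of i j] lt[of j i] additive_subgroup_minus_commute[OF Iz pw(2)[of i] pw(2)[of j]] that
      by (cases i j rule: linorder_cases) auto
    have inj: "inj (\<lambda>i::nat. t [^] i)"
    proof (rule injI, rule ccontr)
      fix i j :: nat assume "t [^] i = t [^] j" "i \<noteq> j"
      then show False using ne[of i j] pw(2)[of j] additive_subgroup.zero_closed[OF Iz]
        by (simp add: a_minus_def r_neg)
    qed
    have "finite (range (\<lambda>i::nat. t [^] i))"
    proof (rule index_ge_separated(1)[OF Iz f(5) fin])
      show "range (\<lambda>i::nat. t [^] i) \<subseteq> OP" using pw(1) by auto
      fix a b assume "a \<in> range (\<lambda>i::nat. t [^] i)" "b \<in> range (\<lambda>i::nat. t [^] i)" "a \<ominus> b \<in> z <# OP"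
      then obtain i j :: nat where "a = t [^] i" "b = t [^] j" "t [^] i \<ominus> t [^] j \<in> z <# OP" by auto
      then show "a = b" using ne[of i j] by auto
    qed
    then show False using finite_imageD[OF _ inj] by simp
  qed
  then have "z \<notin> t [^] (LEAST n::nat. z \<notin> t [^] n <# OP) <# OP" by (rule LeastI_ex)
  moreover define n where "n = (LEAST n::nat. z \<notin> t [^] n <# OP)"
  ultimately have n: "z \<notin> t [^] n <# OP" by simp
  have "n \<noteq> 0"
  proof
    assume "n = 0"
    moreover have "z = t [^] (0::nat) \<otimes> z" using zR by simp
    ultimately show False using n z(1) unfolding l_coset_mem by blast
  qed
  then obtain m where m: "n = Suc m" by (cases n) auto
  then have "z \<in> t [^] m <# OP" using not_less_Least[of m "\<lambda>n. z \<notin> t [^] n <# OP"] n_def by simp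
  then obtain u where u: "u \<in> OP" "z = t [^] m \<otimes> u" by (auto simp: l_coset_mem)
  have "u \<notin> P"
  proof
    assume "u \<in> P"
    then have "u \<in> t <# OP" using equalityD1[OF t(3)] by blast
    then obtain a where a: "a \<in> OP" "u = t \<otimes> a" by (auto simp: l_coset_mem)
    have "z = t [^] n \<otimes> a" unfolding u(2) a(2) m using a(1) f(5) tO pw(2)[of m] by (auto simp: m_assoc)
    then show False using n a(1) unfolding l_coset_mem by blast
  qed
  then have "u \<in> Units (local_ring R F P)" using u(1) f(8) by (auto simp: dp_units)
  then show ?thesis using u by blast
qed


lemma dp_units_mult:
  assumes "u \<in> Units (local_ring R F P)" "w \<in> Units (local_ring R F P)"
  shows "u \<otimes> w \<in> Units (local_ring R F P)" "inv u \<in> Units (local_ring R F P)"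
proof -
  note f = dp_facts
  have u: "u \<in> OP" "u \<noteq> \<zero>" "inv u \<in> OP" "u \<in> carrier R" and w: "w \<in> OP" "w \<noteq> \<zero>" "inv w \<in> OP" "w \<in> carrier R"
    using assms f(5) by (auto simp: dp_units)
  show "u \<otimes> w \<in> Units (local_ring R F P)"
    using u w inv_mult_field[of u w] subringE(6)[OF f(2)] integral[of u w] by (auto simp: dp_units)
  show "inv u \<in> Units (local_ring R F P)" using u inv_field[of u] by (auto simp: dp_units)
qed

text \<open>\<open>place_valuation\<close> leaves the prime element free, so uniqueness of the
  exponent has to compare two of them: they differ by a unit \<open>a\<close>, and
  \<open>a [^] m\<close> is absorbed into the unit factor.\<close>

lemma dp_val_unique:
  fixes n m :: int
  assumes t: "prime_element R F P t" and s: "prime_element R F P s"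
    and u: "u \<in> Units (local_ring R F P)" and w: "w \<in> Units (local_ring R F P)"
    and eq: "t [^] n \<otimes> u = s [^] m \<otimes> w"
  shows "n = m"
proof -
  note f = dp_facts
  have t': "t \<in> P" "P = t <# OP" and s': "s \<in> P" "P = s <# OP"
    using iffD1[OF dp_prime_element t] iffD1[OF dp_prime_element s] by blast+
  have tR: "t \<in> carrier R" "t \<noteq> \<zero>" and sR: "s \<in> carrier R" "s \<noteq> \<zero>"
    using dp_prime_nonzero[OF t] dp_prime_nonzero[OF s] t'(1) s'(1) f(5,9) by auto
  have st: "s \<in> t <# OP" and ts: "t \<in> s <# OP"
    using s'(1) t'(1) equalityD1[OF t'(2)] equalityD1[OF s'(2)] by blast+
  obtain a where a: "a \<in> OP" "s = t \<otimes> a" using st by (auto simp: l_coset_mem)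
  obtain b where b: "b \<in> OP" "t = s \<otimes> b" using ts by (auto simp: l_coset_mem)
  have abR: "a \<in> carrier R" "b \<in> carrier R" using a b f(5) by auto
  have "t \<otimes> (a \<otimes> b) = s \<otimes> b" using abR tR by (simp add: a(2) m_assoc)
  then have "t \<otimes> \<one> = t \<otimes> (a \<otimes> b)" using tR unfolding b(2)[symmetric] by simp
  then have ab: "a \<otimes> b = \<one>" using m_lcancel[OF tR(2,1), of \<one> "a \<otimes> b"] abR by simp
  have aU: "a \<in> Units (local_ring R F P)" 
  proof -
    have "b \<otimes> a = \<one>" using ab abR by (simp add: m_comm)
    then show ?thesis unfolding Units_def using a(1) b(1) ab by auto
  qed
  have npow: "c [^] (j::nat) \<in> Units (local_ring R F P)" if "c \<in> Units (local_ring R F P)" for c j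
  proof (induction j)
    case 0
    show ?case using subringE(3)[OF f(2)] by (simp add: dp_units)
  qed (use that dp_units_mult in auto)
  have ipow: "c [^] (j::int) \<in> Units (local_ring R F P)" if "c \<in> Units (local_ring R F P)" for c j
  proof (cases "j < 0")
    case True
    show ?thesis unfolding int_pow_def2 if_P[OF True]
      by (rule dp_units_mult(2)[OF npow[OF that] npow[OF that]])
  next
    case False
    show ?thesis unfolding int_pow_def2 if_not_P[OF False] by (rule npow[OF that])
  qed
  interpret M: comm_group "Multiplicative_Group.mult_of R"
    using field_mult_group m_comm by (intro group.group_comm_groupI) auto
  have a0: "a \<noteq> \<zero>" using aU by (simp add: dp_units)
  have "s [^] m = t [^] m \<otimes> a [^] m"
    using M.int_pow_mult_distrib[of t a m] M.m_comm[of t a] tR abR a0 sR a(2) int_pow_mult_of by simp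
  then have eq2: "t [^] n \<otimes> u = t [^] m \<otimes> (a [^] m \<otimes> w)"
    using eq ipow[OF aU] w f(5) int_pow_simps(2)[OF tR] by (auto simp: dp_units m_assoc subset_iff)
  have aw: "a [^] m \<otimes> w \<in> Units (local_ring R F P)" using dp_units_mult ipow[OF aU] w by blast
  have le: "\<not> i < j" if e: "t [^] i \<otimes> x = t [^] j \<otimes> y"
    and x: "x \<in> Units (local_ring R F P)" and y: "y \<in> Units (local_ring R F P)" for i j :: int and x y
  proof
    assume "i < j"
    then obtain d where d: "j = i + int (Suc d)" using zless_iff_Suc_zadd by auto
    have xR: "x \<in> carrier R" "x \<noteq> \<zero>" "x \<in> OP" "inv x \<in> OP" and yR: "y \<in> carrier R" "y \<in> OP"
      using x y f(5) by (auto simp: dp_units)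
    have td: "t [^] d \<in> OP" for d :: nat
      by (induction d) (use t'(1) f(9) subringE(3,6)[OF f(2)] in auto)
    have "t [^] j = t [^] i \<otimes> t [^] int (Suc d)" unfolding d by (rule int_pow_simps(1)[OF tR])
    also have "t [^] int (Suc d) = t [^] Suc d" by (rule int_pow_simps(6)[OF tR])
    finally have "t [^] i \<otimes> x = t [^] i \<otimes> (t [^] Suc d \<otimes> y)"
      using e int_pow_simps(2)[OF tR] tR yR by (simp add: m_assoc)
    then have "x = t [^] Suc d \<otimes> y"
      using m_lcancel[OF int_pow_simps(3)[OF tR, of i] int_pow_simps(2)[OF tR, of i], of x "t [^] Suc d \<otimes> y"] xR yR tR by simp
    then have "x = t \<otimes> (t [^] d \<otimes> y)" using tR yR by (simp add: m_ac)
    moreover have "t [^] d \<otimes> y \<in> OP" using td yR subringE(6)[OF f(2)] by blast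
    ultimately have "x \<in> t <# OP" unfolding l_coset_mem by blast
    then have "x \<in> P" using equalityD2[OF t'(2)] by blast
    then show False using f(8) xR by auto
  qed
  show ?thesis using le[OF eq2 u aw] le[OF eq2[symmetric] aw u] by simp
qed

lemma dp_val_eqI:
  assumes "prime_element R F P t" "u \<in> Units (local_ring R F P)" "z = t [^] (n::int) \<otimes> u"
  shows "place_valuation R F P z = n"
  unfolding place_valuation_def
proof (rule the_equality)
  show "\<exists>t u. prime_element R F P t \<and> u \<in> Units (local_ring R F P) \<and> z = t [^] n \<otimes> u" using assms by blast
  fix m assume "\<exists>t u. prime_element R F P t \<and> u \<in> Units (local_ring R F P) \<and> z = t [^] (m::int) \<otimes> u"
  then show "m = n" using dp_val_unique assms by metis
qed

lemma dp_val_repr: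
  assumes t: "prime_element R F P t" and z: "z \<in> F" "z \<noteq> \<zero>"
  shows "\<exists>u\<in>Units (local_ring R F P). z = t [^] place_valuation R F P z \<otimes> u"
proof -
  note f = dp_facts
  have t': "t \<in> P" "P = t <# OP" using iffD1[OF dp_prime_element t] by blast+
  have tR: "t \<in> carrier R" "t \<noteq> \<zero>"
    using dp_prime_nonzero[OF t] t'(1) f(5,9) by auto
  have "\<exists>n::int. \<exists>u\<in>Units (local_ring R F P). z = t [^] n \<otimes> u"
  proof (cases "z \<in> OP")
    case True
    then obtain n u where "u \<in> Units (local_ring R F P)" "z = t [^] (n::nat) \<otimes> u"
      using dp_pow_repr[OF t'(1) tR(2) t'(2) True z(2)] by blast
    then have "z = t [^] int n \<otimes> u" using int_pow_simps(6)[OF tR] by simp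
    then show ?thesis using \<open>u \<in> _\<close> by blast
  next
    case False
    have zR: "z \<in> carrier R" using z f(4) by auto
    have "inv z \<in> OP" using f(7,9) z False by blast
    then obtain n u where u: "u \<in> Units (local_ring R F P)" "inv z = t [^] (n::nat) \<otimes> u"
      using dp_pow_repr[OF t'(1) tR(2) t'(2), of "inv z"] inv_field[OF zR z(2)] by blast
    have uR: "u \<in> carrier R" "u \<noteq> \<zero>" using u f(5) by (auto simp: dp_units)
    have "z = inv (t [^] int n \<otimes> u)" using u(2) inv_field(5)[OF zR z(2)] int_pow_simps(6)[OF tR] by simp
    also have "\<dots> = t [^] (- int n) \<otimes> inv u"
      unfolding int_pow_simps(4)[OF tR] by (rule inv_mult_field[OF int_pow_simps(2,3)[OF tR] uR])
    finally show ?thesis using dp_units_mult u(1) by blast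
  qed
  then obtain n :: int and u where "u \<in> Units (local_ring R F P)" "z = t [^] n \<otimes> u" by blast
  then show ?thesis using dp_val_eqI[OF t] by metis
qed

lemma dp_prime: 
  obtains t where "prime_element R F P t" "t \<in> F" "t \<in> carrier R" "t \<noteq> \<zero>" "t \<in> P" "P = t <# OP"
proof -
  obtain t where t: "t \<in> P" "t \<noteq> \<zero>" "P = t <# OP" using dp_uniformizer by blast
  have tF: "t \<in> F" "t \<in> carrier R" using t(1) dp_facts(3,5,9) by auto
  have "prime_element R F P t" using iffD2[OF dp_prime_element] t(1,3) by blast
  then show ?thesis using that tF t by blast
qed

lemma dp_val_mult:
  assumes z: "z \<in> F" "z \<noteq> \<zero>" and y: "y \<in> F" "y \<noteq> \<zero>"
  shows "place_valuation R F P (z \<otimes> y) = place_valuation R F P z + place_valuation R F P y"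
proof -
  note f = dp_facts
  obtain t where t: "prime_element R F P t" "t \<in> carrier R" "t \<noteq> \<zero>" by (rule dp_prime)
  let ?v = "place_valuation R F P"
  obtain u where u: "u \<in> Units (local_ring R F P)" "z = t [^] ?v z \<otimes> u" using dp_val_repr[OF t(1) z] by blast
  obtain w where w: "w \<in> Units (local_ring R F P)" "y = t [^] ?v y \<otimes> w" using dp_val_repr[OF t(1) y] by blast
  define n m where "n = ?v z" "m = ?v y"
  have R: "u \<in> carrier R" "w \<in> carrier R" using u w f(5) by (auto simp: dp_units)
  have "z \<otimes> y = (t [^] n \<otimes> u) \<otimes> (t [^] m \<otimes> w)" using u w by (simp add: n_m_def)
  also have "\<dots> = t [^] (n + m) \<otimes> (u \<otimes> w)"
    using R int_pow_simps(1,2)[OF t(2,3)] by (simp add: m_ac)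
  finally show ?thesis using dp_val_eqI[OF t(1) dp_units_mult(1)[OF u(1) w(1)]] by (simp add: n_m_def)
qed

lemma dp_val_one: "place_valuation R F P \<one> = 0"
  using dp_val_mult[of \<one> \<one>] subringE(3)[OF subfieldE(1)[OF dp_facts(1)]] by simp

lemma dp_val_prime: "prime_element R F P t \<Longrightarrow> place_valuation R F P t = 1"
proof (rule dp_val_eqI)
  assume t: "prime_element R F P t"
  then show "prime_element R F P t" .
  have "t \<in> P" using iffD1[OF dp_prime_element t] by blast
  then have tR: "t \<in> carrier R" using dp_facts(5,9) by blast
  show "\<one> \<in> Units (local_ring R F P)" using subringE(3)[OF dp_facts(2)] by (simp add: dp_units)
  show "t = t [^] (1::int) \<otimes> \<one>" using tR int_pow_int[of R t 1] by simp
qed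

lemma dp_val_inv:
  assumes "z \<in> F" "z \<noteq> \<zero>"
  shows "place_valuation R F P (inv z) = - place_valuation R F P z"
  using dp_val_mult[OF assms, of "inv z"] subfield_inv[OF dp_facts(1) assms] dp_val_one by simp

lemma dp_val_pow:
  assumes "z \<in> F" "z \<noteq> \<zero>"
  shows "z [^] n \<in> F" "z [^] n \<noteq> \<zero>" "place_valuation R F P (z [^] n) = int n * place_valuation R F P z"
proof -
  have "z [^] n \<in> F \<and> z [^] n \<noteq> \<zero> \<and> place_valuation R F P (z [^] n) = int n * place_valuation R F P z"
  proof (induction n)
    case 0
    then show ?case using dp_val_one subringE(3)[OF subfieldE(1)[OF dp_facts(1)]] by simp
  next
    case (Suc n)
    have "z \<in> carrier R" using assms dp_facts(4) by auto
    then have "z [^] Suc n \<noteq> \<zero>" using Suc assms integral[of "z [^] n" z] by auto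
    then show ?case using Suc dp_val_mult[of "z [^] n" z] assms subringE(6)[OF subfieldE(1)[OF dp_facts(1)]]
      by (auto simp: algebra_simps)
  qed
  then show "z [^] n \<in> F" "z [^] n \<noteq> \<zero>" "place_valuation R F P (z [^] n) = int n * place_valuation R F P z" by auto
qed

lemma dp_val_nonneg_iff:
  assumes z: "z \<in> F" "z \<noteq> \<zero>"
  shows "z \<in> OP \<longleftrightarrow> 0 \<le> place_valuation R F P z"
proof -
  note f = dp_facts
  obtain t where t: "prime_element R F P t" "t \<in> carrier R" "t \<noteq> \<zero>" "t \<in> P" "P = t <# OP" by (rule dp_prime)
  have *: "0 \<le> place_valuation R F P y" if y: "y \<in> OP" "y \<noteq> \<zero>" for y
  proof -
    obtain n u where u: "u \<in> Units (local_ring R F P)" "y = t [^] (n::nat) \<otimes> u"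
      using dp_pow_repr[OF t(4,3,5) y] by blast
    then have "y = t [^] int n \<otimes> u" using int_pow_simps(6)[OF t(2,3)] by simp
    then show ?thesis using dp_val_eqI[OF t(1) u(1)] by simp
  qed
  have "z \<in> OP" if v: "0 \<le> place_valuation R F P z"
  proof -
    obtain u where u: "u \<in> Units (local_ring R F P)" "z = t [^] place_valuation R F P z \<otimes> u"
      using dp_val_repr[OF t(1) z] by blast
    obtain n where n: "place_valuation R F P z = int n" using v by (metis nonneg_int_cases)
    have "z = t [^] n \<otimes> u" using u(2) n int_pow_simps(6)[OF t(2,3)] by simp
    moreover have "t [^] n \<in> OP" by (induction n) (use t(4) f(9) subringE(3,6)[OF f(2)] in auto)
    ultimately show ?thesis using u(1) subringE(6)[OF f(2)] by (auto simp: dp_units)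
  qed
  then show ?thesis using * z by blast
qed

lemma dp_val_pos_iff:
  assumes z: "z \<in> F" "z \<noteq> \<zero>"
  shows "z \<in> P \<longleftrightarrow> 1 \<le> place_valuation R F P z"
proof -
  note f = dp_facts
  have "inv z \<in> OP \<longleftrightarrow> 0 \<le> - place_valuation R F P z"
    using dp_val_nonneg_iff[of "inv z"] dp_val_inv[OF z] subfield_inv[OF f(1) z] by simp
  then show ?thesis using f(8)[of z] z dp_val_nonneg_iff[OF z] by auto
qed

text \<open>Factor the sum as (z/y + 1) y with z/y integral, or with the roles exchanged. The common
  lower bound \<open>n\<close> replaces a minimum, and a vanishing sum is excluded because
  \<open>place_valuation\<close> says nothing about \<zero>.\<close>

lemma dp_val_add:
  assumes z: "z \<in> F" "z \<noteq> \<zero>" and y: "y \<in> F" "y \<noteq> \<zero>" and s: "z \<oplus> y \<noteq> \<zero>"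
    and n: "n \<le> place_valuation R F P z" "n \<le> place_valuation R F P y"
  shows "n \<le> place_valuation R F P (z \<oplus> y)"
proof -
  note f = dp_facts
  note Fr = subfieldE(1)[OF f(1)]
  have *: "place_valuation R F P b \<le> place_valuation R F P (a \<oplus> b)"
    if a: "a \<in> F" "a \<noteq> \<zero>" and b: "b \<in> F" "b \<noteq> \<zero>" and s: "a \<oplus> b \<noteq> \<zero>"
      and le: "place_valuation R F P b \<le> place_valuation R F P a" for a b
  proof -
    note ib = subfield_inv[OF f(1) b]
    have R: "a \<in> carrier R" "b \<in> carrier R" "inv b \<in> carrier R" using a b ib f(4) by auto
    define c where "c = a \<otimes> inv b \<oplus> \<one>"
    have ab: "a \<otimes> inv b \<in> F" "a \<otimes> inv b \<noteq> \<zero>" using subringE(6)[OF Fr] a ib integral[of a "inv b"] R by auto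
    have "place_valuation R F P (a \<otimes> inv b) \<ge> 0" using dp_val_mult[OF a ib(1,2)] dp_val_inv[OF b] le by simp
    then have "a \<otimes> inv b \<in> OP" using dp_val_nonneg_iff[OF ab] by simp
    then have cO: "c \<in> OP" using subringE(3,7)[OF f(2)] by (simp add: c_def)
    have e: "a \<oplus> b = c \<otimes> b" unfolding c_def using R ib by (simp add: l_distr m_assoc)
    have c: "c \<in> F" "c \<noteq> \<zero>" using cO f(3) e s R by auto
    then have "0 \<le> place_valuation R F P c" using cO dp_val_nonneg_iff by blast
    then show ?thesis using e dp_val_mult[OF c b] by simp
  qed
  show ?thesis
  proof (cases "place_valuation R F P y \<le> place_valuation R F P z")
    case True
    then show ?thesis using *[OF z y s] n by linarith
  next
    case False
    have "z \<oplus> y = y \<oplus> z" using z y f(4) by (simp add: a_comm subset_iff)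
    then show ?thesis using *[OF y z] s False n by simp
  qed
qed

end

end

text \<open>The fractional ideal P^n. The element \<zero> is adjoined by hand, having no value of
  its own; with it these sets are additive groups that decrease with n.\<close>

definition (in field) val_ge :: "'a set \<Rightarrow> 'a set \<Rightarrow> int \<Rightarrow> 'a set"
  where "val_ge F P n = {z \<in> F. z = \<zero> \<or> n \<le> place_valuation R F P z}"

context field
begin

context
  fixes F P
  assumes D: "discrete_place F P"
begin

lemma dp_val_uminus:
  assumes z: "z \<in> F" "z \<noteq> \<zero>"
  shows "\<ominus> z \<in> F" "\<ominus> z \<noteq> \<zero>" "place_valuation R F P (\<ominus> z) = place_valuation R F P z"
proof -
  note f = dp_facts[OF D]
  have one: "\<ominus> \<one> \<in> F" "\<ominus> \<one> \<noteq> \<zero>"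
    using subringE(3,5)[OF subfieldE(1)[OF f(1)]] by (auto simp: minus_equality)
  have zR: "z \<in> carrier R" using z f(4) by auto
  have "(\<ominus> \<one>) \<otimes> (\<ominus> \<one>) = \<one>" by (simp add: l_minus)
  then have "place_valuation R F P (\<ominus> \<one>) = 0"
    using dp_val_mult[OF D one one] dp_val_one[OF D] by simp
  moreover have e: "\<ominus> z = (\<ominus> \<one>) \<otimes> z" using zR by (simp add: l_minus)
  ultimately show "place_valuation R F P (\<ominus> z) = place_valuation R F P z"
    using dp_val_mult[OF D one z] by simp
  show "\<ominus> z \<in> F" using z subringE(5)[OF subfieldE(1)[OF f(1)]] by simp
  show "\<ominus> z \<noteq> \<zero>" using z zR minus_minus[of z] by force
qed

lemma vg_subset: "val_ge F P n \<subseteq> F" "\<zero> \<in> val_ge F P n" "val_ge F P n \<subseteq> carrier R"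
proof -
  show F: "val_ge F P n \<subseteq> F" by (auto simp: val_ge_def)
  then show "val_ge F P n \<subseteq> carrier R" using dp_facts(4)[OF D] by blast
  show "\<zero> \<in> val_ge F P n" using subringE(2)[OF subfieldE(1)[OF dp_facts(1)[OF D]]] by (simp add: val_ge_def)
qed

lemma vg_add:
  assumes "x \<in> val_ge F P n" "y \<in> val_ge F P n"
  shows "x \<oplus> y \<in> val_ge F P n"
proof -
  have "x \<in> F" "y \<in> F" "x \<in> carrier R" "y \<in> carrier R" using assms vg_subset by blast+
  then show ?thesis
    using assms dp_val_add[OF D, of x y n] subringE(7)[OF subfieldE(1)[OF dp_facts(1)[OF D]]]
      vg_subset(2)[of n]
    by (cases "x = \<zero>"; cases "y = \<zero>"; cases "x \<oplus> y = \<zero>") (auto simp: val_ge_def)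
qed

lemma vg_uminus:
  assumes "x \<in> val_ge F P n"
  shows "\<ominus> x \<in> val_ge F P n"
  using assms dp_val_uminus[of x] vg_subset(2)[of n] by (cases "x = \<zero>") (auto simp: val_ge_def)

lemma vg_subgroup: "additive_subgroup (val_ge F P n) R"
  by (rule additive_subgroupI) (use vg_subset vg_add vg_uminus in \<open>auto simp: a_minus_def\<close>)

lemma vg_minus: "x \<in> val_ge F P n \<Longrightarrow> y \<in> val_ge F P n \<Longrightarrow> x \<ominus> y \<in> val_ge F P n"
  by (rule additive_subgroup_minus[OF vg_subgroup])

lemma vg_mult:
  assumes "x \<in> val_ge F P n" "y \<in> val_ge F P m"
  shows "x \<otimes> y \<in> val_ge F P (n + m)"
proof -
  have "x \<in> F" "y \<in> F" "x \<in> carrier R" "y \<in> carrier R" using assms vg_subset by blast+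
  then show ?thesis
    using assms dp_val_mult[OF D, of x y] subringE(6)[OF subfieldE(1)[OF dp_facts(1)[OF D]]] vg_subset(2)[of "n + m"]
    by (cases "x = \<zero>"; cases "y = \<zero>") (auto simp: val_ge_def)
qed

lemma vg_mono: "n \<le> m \<Longrightarrow> val_ge F P m \<subseteq> val_ge F P n"
  by (auto simp: val_ge_def)

lemma vg_0: "val_ge F P 0 = ring_of_place R F P"
proof -
  have "\<zero> \<in> ring_of_place R F P" using subringE(2)[OF dp_facts(2)[OF D]] .
  then show ?thesis using dp_val_nonneg_iff[OF D] dp_facts(3)[OF D] by (auto simp: val_ge_def)
qed

lemma vg_1: "val_ge F P 1 = P"
proof -
  have "\<zero> \<in> P" "P \<subseteq> F" using subringE(2)[OF dp_facts(2)[OF D]] dp_facts(3,8,9)[OF D] by auto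
  then show ?thesis using dp_val_pos_iff[OF D] by (auto simp: val_ge_def)
qed

lemma vg_l_coset:
  assumes s: "s \<in> F" "s \<noteq> \<zero>"
  shows "s <# ring_of_place R F P = val_ge F P (place_valuation R F P s)"
proof (intro equalityI subsetI)
  note f = dp_facts[OF D]
  have sR: "s \<in> carrier R" using s f(4) by auto
  have s': "s \<in> val_ge F P (place_valuation R F P s)" using s by (simp add: val_ge_def)
  fix x
  show "x \<in> val_ge F P (place_valuation R F P s)" if x: "x \<in> s <# ring_of_place R F P"
  proof -
    obtain a where "a \<in> val_ge F P 0" "x = s \<otimes> a" using x by (auto simp: l_coset_mem vg_0)
    then show ?thesis using vg_mult[OF s', of a 0] by simp
  qed
  assume x: "x \<in> val_ge F P (place_valuation R F P s)"
  have xR: "x \<in> carrier R" using x vg_subset by blast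
  note i = subfield_inv[OF f(1) s]
  have "inv s \<in> val_ge F P (- place_valuation R F P s)" using i dp_val_inv[OF D s] by (simp add: val_ge_def)
  then have "inv s \<otimes> x \<in> ring_of_place R F P" using vg_mult[OF _ x] vg_0 by fastforce
  moreover have "x = s \<otimes> (inv s \<otimes> x)" using i xR sR f(4) by (simp add: m_assoc[symmetric] subset_iff)
  ultimately show "x \<in> s <# ring_of_place R F P" unfolding l_coset_mem by blast
qed

text \<open>Otherwise \<open>z = (z \<oplus> y) \<ominus> y\<close> would itself have a larger
  value.\<close>

lemma dp_val_add_eq:
  assumes z: "z \<in> F" "z \<noteq> \<zero>" and y: "y \<in> val_ge F P (place_valuation R F P z + 1)"
  shows "z \<oplus> y \<noteq> \<zero>" "place_valuation R F P (z \<oplus> y) = place_valuation R F P z"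
proof -
  let ?n = "place_valuation R F P z"
  have R: "z \<in> carrier R" "y \<in> carrier R" using z y vg_subset dp_facts(4)[OF D] by blast+
  have zn: "z \<notin> val_ge F P (?n + 1)" "z \<in> val_ge F P ?n" using z by (auto simp: val_ge_def)
  have s: "z \<oplus> y \<notin> val_ge F P (?n + 1)"
  proof
    assume "z \<oplus> y \<in> val_ge F P (?n + 1)"
    then have "(z \<oplus> y) \<ominus> y \<in> val_ge F P (?n + 1)" using vg_minus y by blast
    moreover have "(z \<oplus> y) \<ominus> y = z" using R by algebra
    ultimately show False using zn by simp
  qed
  have "y \<in> val_ge F P ?n" using y vg_mono[of ?n "?n + 1"] by auto
  then have s2: "z \<oplus> y \<in> val_ge F P ?n" using vg_add zn by blast
  show "z \<oplus> y \<noteq> \<zero>" using s vg_subset(2) by metis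
  then show "place_valuation R F P (z \<oplus> y) = ?n" using s s2 by (auto simp: val_ge_def)
qed

text \<open>An element z of negative value in \<open>W\<close> supplies arbitrarily large
  denominators: every y in \<open>F\<close> equals (y / z^n) z^n, with y / z^n integral once n is
  large.\<close>

lemma dp_maximal:
  assumes W: "val_ring F W" "ring_of_place R F P \<subseteq> W" "W \<noteq> F"
  shows "W = ring_of_place R F P"
proof (rule ccontr)
  note f = dp_facts[OF D]
  assume "W \<noteq> ring_of_place R F P"
  then obtain z where z: "z \<in> W" "z \<notin> ring_of_place R F P" using W by blast
  have Wr: "subring W R" and WF: "W \<subseteq> F" using W by (auto simp: val_ring_def)
  have zF: "z \<in> F" "z \<noteq> \<zero>" using z WF subringE(2)[OF f(2)] by auto
  have zR: "z \<in> carrier R" using zF f(4) by auto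
  have vz: "place_valuation R F P z \<le> - 1" using dp_val_nonneg_iff[OF D zF] z by simp
  obtain y where y: "y \<in> F" "y \<notin> W" using W(3) WF by blast
  have y0: "y \<noteq> \<zero>" using y subringE(2)[OF Wr] by auto
  \<comment> \<open>Dividing by \<open>z\<close> raises the value by at least 1, so |v(y)| divisions
    reach a nonnegative value.\<close>
  define n where "n = nat \<bar>place_valuation R F P y\<bar>"
  note p = dp_val_pow[OF D zF, of n]
  note ip = subfield_inv[OF f(1) p(1,2)]
  have R: "y \<in> carrier R" "z [^] n \<in> carrier R" "inv (z [^] n) \<in> carrier R" using y p ip f(4) by auto
  have "y \<otimes> inv (z [^] n) \<in> F" using y ip subringE(6)[OF subfieldE(1)[OF f(1)]] by blast
  moreover have "y \<otimes> inv (z [^] n) \<noteq> \<zero>" using y0 ip integral[of y "inv (z [^] n)"] R by auto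
  moreover have "place_valuation R F P (y \<otimes> inv (z [^] n)) \<ge> 0"
  proof -
    have "int n * place_valuation R F P z \<le> int n * (- 1)" using vz by (intro mult_left_mono) auto
    then show ?thesis
      using dp_val_mult[OF D y(1) y0 ip(1,2)] dp_val_inv[OF D p(1,2)] p(3) by (simp add: n_def)
  qed
  ultimately have "y \<otimes> inv (z [^] n) \<in> W" using dp_val_nonneg_iff[OF D] W(2) by blast
  moreover have "z [^] n \<in> W" by (induction n) (use z subringE(3,6)[OF Wr] in auto)
  ultimately have "y \<otimes> inv (z [^] n) \<otimes> z [^] n \<in> W" using subringE(6)[OF Wr] by blast
  moreover have "y \<otimes> inv (z [^] n) \<otimes> z [^] n = y" using R ip by (simp add: m_assoc)
  ultimately show False using y by simp
qed

end

section \<open>Approximation\<close>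

text \<open>By \<open>dp_maximal\<close> neither ring contains the other; the quotient of an element
  of the first ring outside the second by an element of the second outside the first has the
  required signs.\<close>

lemma dp_incomparable:
  assumes P: "discrete_place E P" and Q: "discrete_place E Q" and ne: "P \<noteq> Q"
  obtains z where "z \<in> E" "z \<noteq> \<zero>" "0 < place_valuation R E P z" "place_valuation R E Q z < 0"
proof -
  note fP = dp_facts[OF P] and fQ = dp_facts[OF Q]
  have "ring_of_place R E P \<noteq> ring_of_place R E Q" using ne fP(8) fQ(8) by blast
  then have "\<not> ring_of_place R E P \<subseteq> ring_of_place R E Q" "\<not> ring_of_place R E Q \<subseteq> ring_of_place R E P"
    using dp_maximal[OF P fQ(6)] dp_maximal[OF Q fP(6)] P Q unfolding discrete_place_def by blast+
  then obtain a b where a: "a \<in> ring_of_place R E P" "a \<notin> ring_of_place R E Q"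
    and b: "b \<in> ring_of_place R E Q" "b \<notin> ring_of_place R E P" by blast
  have a': "a \<in> E" "a \<noteq> \<zero>" and b': "b \<in> E" "b \<noteq> \<zero>"
    using a b fP(3) fQ(3) subringE(2)[OF fP(2)] subringE(2)[OF fQ(2)] by auto
  note ib = subfield_inv[OF fP(1) b']
  have R: "a \<in> carrier R" "inv b \<in> carrier R" using a' ib fP(4) by auto
  show ?thesis
  proof (rule that[of "a \<otimes> inv b"])
    show "a \<otimes> inv b \<in> E" using a' ib subringE(6)[OF subfieldE(1)[OF fP(1)]] by blast
    show "a \<otimes> inv b \<noteq> \<zero>" using a' ib integral[of a "inv b"] R by auto
    show "0 < place_valuation R E P (a \<otimes> inv b)"
      using dp_val_mult[OF P a' ib(1,2)] dp_val_inv[OF P b'] dp_val_nonneg_iff[OF P a'] dp_val_nonneg_iff[OF P b'] a b by simp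
    show "place_valuation R E Q (a \<otimes> inv b) < 0"
      using dp_val_mult[OF Q a' ib(1,2)] dp_val_inv[OF Q b'] dp_val_nonneg_iff[OF Q a'] dp_val_nonneg_iff[OF Q b'] a b by simp
  qed
qed

text \<open>High powers of such a u become small at \<open>P\<close> and large at the places of
  \<open>S\<close>, which is what makes 1/(1 + u^r) an approximate idempotent.\<close>

lemma dp_separate:
  assumes P: "discrete_place E P" and S: "finite S" "\<And>Q. Q \<in> S \<Longrightarrow> discrete_place E Q \<and> Q \<noteq> P"
  shows "\<exists>u. u \<in> E \<and> u \<noteq> \<zero> \<and> 0 < place_valuation R E P u \<and> (\<forall>Q\<in>S. place_valuation R E Q u < 0)"
  using S
proof (induction S rule: finite_induct)
  case empty
  obtain t where "prime_element R E P t" "t \<in> E" "t \<noteq> \<zero>" by (rule dp_prime[OF P])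
  then show ?case using dp_val_prime[OF P] by force
next
  case (insert Q S)
  note Er = subfieldE(1)[OF dp_facts(1)[OF P]]
  obtain y where y: "y \<in> E" "y \<noteq> \<zero>" "0 < place_valuation R E P y" "\<And>Q. Q \<in> S \<Longrightarrow> place_valuation R E Q y < 0"
    using insert by auto
  have dQ: "discrete_place E Q" "P \<noteq> Q" using insert(4)[of Q] by auto
  obtain z where z: "z \<in> E" "z \<noteq> \<zero>" "0 < place_valuation R E P z" "place_valuation R E Q z < 0"
    by (rule dp_incomparable[OF P dQ])
  show ?case
  proof (cases "place_valuation R E Q y < 0")
    case True
    then show ?thesis using y by auto
  next
    case False
    \<comment> \<open>The exponent exceeds |v(y)| at every place of \<open>S\<close>. So z^r
      dominates y wherever z has a pole, y dominates z^r at the other places of \<open>S\<close>,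
      and no cancellation occurs in the sum.\<close>
    define r where "r = Suc (\<Sum>Q\<in>S. nat \<bar>place_valuation R E Q y\<bar>)"
    have rpos: "0 < int r" unfolding r_def by linarith
    have zr: "z [^] r \<in> E" "z [^] r \<noteq> \<zero>" and vzr: "\<And>T. discrete_place E T \<Longrightarrow> place_valuation R E T (z [^] r) = int r * place_valuation R E T z"
      using dp_val_pow z(1,2) P by blast+
    have comm: "y \<oplus> z [^] r = z [^] r \<oplus> y" using y(1) zr(1) dp_facts(4)[OF P] by (simp add: a_comm subset_iff)
    have r: "- int r < place_valuation R E T y" if "T \<in> S" for T
    proof -
      have "nat \<bar>place_valuation R E T y\<bar> \<le> (\<Sum>Q\<in>S. nat \<bar>place_valuation R E Q y\<bar>)"
        using that insert(1) by (intro member_le_sum) auto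
      then have "\<bar>place_valuation R E T y\<bar> < int r" unfolding r_def by linarith
      then show ?thesis by linarith
    qed
    have neg: "y \<oplus> z [^] r \<noteq> \<zero> \<and> place_valuation R E T (y \<oplus> z [^] r) < 0" if T: "T \<in> insert Q S" for T
    proof -
      have dS: "discrete_place E T" using insert(4) T by blast
      show ?thesis
      proof (cases "place_valuation R E T z < 0")
        case True
        have "int r * place_valuation R E T z \<le> int r * (- 1)" using True by (intro mult_left_mono) auto
        moreover have "- int r < place_valuation R E T y"
        proof (cases "T = Q")
          case True
          then have "0 \<le> place_valuation R E T y" using False by simp
          then show ?thesis using rpos by linarith
        next
          case False
          then show ?thesis using T r by blast
        qed
        ultimately have *: "place_valuation R E T (z [^] r) + 1 \<le> place_valuation R E T y" "place_valuation R E T (z [^] r) < 0"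
          using vzr[OF dS] rpos by linarith+
        then have "y \<in> val_ge E T (place_valuation R E T (z [^] r) + 1)" using y by (simp add: val_ge_def)
        then show ?thesis using dp_val_add_eq[OF dS zr] * comm by simp
      next
        case nz: False
        then have "T \<in> S" using z(4) T by auto
        have "place_valuation R E T (z [^] r) \<ge> 0" using vzr[OF dS] nz by simp
        then have "z [^] r \<in> val_ge E T (place_valuation R E T y + 1)" using y(4)[OF \<open>T \<in> S\<close>] zr by (simp add: val_ge_def)
        then show ?thesis using dp_val_add_eq[OF dS y(1,2)] y(4)[OF \<open>T \<in> S\<close>] by simp
      qed
    qed
    have nz: "y \<oplus> z [^] r \<noteq> \<zero>" using neg by blast
    have "0 < int r * place_valuation R E P z" using rpos z(3) by (rule mult_pos_pos)
    then have "1 \<le> place_valuation R E P (y \<oplus> z [^] r)"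
      using y(3) vzr[OF P] by (intro dp_val_add[OF P y(1,2) zr nz]) auto
    moreover have "y \<oplus> z [^] r \<in> E" using y(1) zr(1) subringE(7)[OF Er] by blast
    ultimately show ?thesis using neg nz by (intro exI[of _ "y \<oplus> z [^] r"]) auto
  qed
qed

text \<open>Take w = 1/(1 + u^r) with u from \<open>dp_separate\<close>: then w - 1 = -u^r w is
  small at \<open>P\<close>, and w is as small as 1/u^r at the places of \<open>S\<close>.\<close>

lemma dp_idempotent:
  assumes P: "discrete_place E P" and S: "finite S" "\<And>Q. Q \<in> S \<Longrightarrow> discrete_place E Q \<and> Q \<noteq> P"
  shows "\<exists>w\<in>E. w \<ominus> \<one> \<in> val_ge E P n \<and> (\<forall>Q\<in>S. w \<in> val_ge E Q n)"
proof -
  note f = dp_facts[OF P]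
  note Er = subfieldE(1)[OF f(1)]
  obtain u where u: "u \<in> E" "u \<noteq> \<zero>" "0 < place_valuation R E P u" "\<And>Q. Q \<in> S \<Longrightarrow> place_valuation R E Q u < 0"
    using dp_separate[OF P S] by blast
  define r where "r = Suc (nat n)"
  have r1: "1 \<le> r" "n \<le> int r" by (auto simp: r_def)
  have ur: "u [^] r \<in> E" "u [^] r \<noteq> \<zero>" and vur: "\<And>T. discrete_place E T \<Longrightarrow> place_valuation R E T (u [^] r) = int r * place_valuation R E T u"
    using dp_val_pow u(1,2) P by blast+
  have one: "\<one> \<in> E" using subringE(3)[OF Er] .
  have urR: "u [^] r \<in> carrier R" using ur f(4) by auto
  have vP: "place_valuation R E P (u [^] r) \<ge> int r"
    using vur[OF P] u(3) mult_left_mono[of 1 "place_valuation R E P u" "int r"] by simp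
  then have "u [^] r \<in> val_ge E P (place_valuation R E P \<one> + 1)"
    using ur r1 dp_val_one[OF P] by (simp add: val_ge_def)
  then have c: "\<one> \<oplus> u [^] r \<noteq> \<zero>" "place_valuation R E P (\<one> \<oplus> u [^] r) = 0"
    using dp_val_add_eq[OF P one] dp_val_one[OF P] by auto
  have cE: "\<one> \<oplus> u [^] r \<in> E" using one ur subringE(7)[OF Er] by blast
  define w where "w = inv (\<one> \<oplus> u [^] r)"
  have w: "w \<in> E" "w \<noteq> \<zero>" "(\<one> \<oplus> u [^] r) \<otimes> w = \<one>" using subfield_inv[OF f(1) cE c(1)] by (auto simp: w_def)
  have wR: "w \<in> carrier R" using w f(4) by auto
  have "w \<oplus> u [^] r \<otimes> w = \<one>" using w(3) wR urR by (simp add: l_distr)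
  moreover have "w \<ominus> (w \<oplus> u [^] r \<otimes> w) = \<ominus> (u [^] r \<otimes> w)" using wR urR by algebra
  ultimately have e: "w \<ominus> \<one> = \<ominus> (u [^] r \<otimes> w)" by simp
  have "w \<in> val_ge E P 0" using w dp_val_inv[OF P cE c(1)] c(2) by (simp add: val_ge_def w_def)
  moreover have "u [^] r \<in> val_ge E P n" using ur vP r1 by (simp add: val_ge_def)
  ultimately have "w \<ominus> \<one> \<in> val_ge E P n" using vg_uminus[OF P] vg_mult[OF P, of "u [^] r" n w 0] e by simp
  moreover have "w \<in> val_ge E Q n" if "Q \<in> S" for Q
  proof -
    have dQ: "discrete_place E Q" using S that by blast
    have vQ: "place_valuation R E Q (u [^] r) \<le> - int r"
      using vur[OF dQ] u(4)[OF that] mult_left_mono[of "place_valuation R E Q u" "- 1" "int r"] by simp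
    then have "\<one> \<in> val_ge E Q (place_valuation R E Q (u [^] r) + 1)"
      using one r1 dp_val_one[OF dQ] by (simp add: val_ge_def)
    then have "place_valuation R E Q (u [^] r \<oplus> \<one>) = place_valuation R E Q (u [^] r)"
      using dp_val_add_eq[OF dQ ur] by simp
    moreover have "u [^] r \<oplus> \<one> = \<one> \<oplus> u [^] r" using urR by (simp add: a_comm)
    ultimately have "place_valuation R E Q w \<ge> int r" using dp_val_inv[OF dQ cE c(1)] vQ by (simp add: w_def)
    then show ?thesis using w r1 by (simp add: val_ge_def)
  qed
  ultimately show ?thesis using w(1) by blast
qed

lemma weak_approximation:
  assumes S: "finite S" "\<And>Q. Q \<in> S \<Longrightarrow> discrete_place E Q" and E: "subfield E R" and g: "\<And>Q. Q \<in> S \<Longrightarrow> g Q \<in> E"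
  shows "\<exists>c\<in>E. \<forall>Q\<in>S. c \<ominus> g Q \<in> val_ge E Q n"
proof -
  note Er = subfieldE(1)[OF E] and ER = subfieldE(3)[OF E]
  \<comment> \<open>A bound for all poles of the targets: multiplication by any \<open>g Q\<close>
    costs at most \<open>N\<close> in precision, so idempotents of precision n + N are used.\<close>
  define N where "N = (\<Sum>Q\<in>S. \<Sum>T\<in>S. \<bar>place_valuation R E T (g Q)\<bar>)"
  have N: "g Q \<in> val_ge E T (- N)" if "Q \<in> S" "T \<in> S" for Q T
  proof -
    have "\<bar>place_valuation R E T (g Q)\<bar> \<le> (\<Sum>T\<in>S. \<bar>place_valuation R E T (g Q)\<bar>)"
      using that S(1) by (intro member_le_sum) auto
    also have "\<dots> \<le> N" unfolding N_def
      using that S(1) by (intro member_le_sum[of Q S "\<lambda>Q. \<Sum>T\<in>S. \<bar>place_valuation R E T (g Q)\<bar>"]) (auto intro: sum_nonneg)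
    finally have "- N \<le> place_valuation R E T (g Q)" by linarith
    then show ?thesis using g[OF that(1)] by (simp add: val_ge_def)
  qed
  \<comment> \<open>Induction over the set \<open>Y\<close> of places already treated;
    \<open>c\<close> stays small at the remaining ones, where the next correction
    \<open>w \<otimes> g Q\<close> then supplies the whole target.\<close>
  have "\<exists>c\<in>E. (\<forall>Q\<in>Y. c \<ominus> g Q \<in> val_ge E Q n) \<and> (\<forall>Q\<in>S - Y. c \<in> val_ge E Q n)" if "finite Y" "Y \<subseteq> S" for Y
    using that
  proof (induction Y rule: finite_induct)
    case empty
    then show ?case using subringE(2)[OF Er] vg_subset(2)[OF S(2)] by auto
  next
    case (insert Q Y)
    obtain c where c: "c \<in> E" "\<And>T. T \<in> Y \<Longrightarrow> c \<ominus> g T \<in> val_ge E T n" "\<And>T. T \<in> S - Y \<Longrightarrow> c \<in> val_ge E T n"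
      using insert by auto
    have QX: "Q \<in> S" "Q \<notin> Y" using insert by auto
    obtain w where w: "w \<in> E" "w \<ominus> \<one> \<in> val_ge E Q (n + N)" "\<And>T. T \<in> S - {Q} \<Longrightarrow> w \<in> val_ge E T (n + N)"
      using dp_idempotent[OF S(2)[OF QX(1)], of "S - {Q}" "n + N"] S by auto
    have R: "c \<in> carrier R" "w \<in> carrier R" "g Q \<in> carrier R" using c w g[OF QX(1)] ER by auto
    have other: "w \<otimes> g Q \<in> val_ge E T n" if "T \<in> S" "T \<noteq> Q" for T
      using vg_mult[OF S(2)[OF that(1)] w(3) N[OF QX(1) that(1)]] that by simp
    show ?case
    proof (intro bexI[of _ "c \<oplus> w \<otimes> g Q"] conjI ballI)
      show "c \<oplus> w \<otimes> g Q \<in> E" using c w g[OF QX(1)] subringE(6,7)[OF Er] by blast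
      fix T assume T: "T \<in> S - insert Q Y"
      then have "c \<in> val_ge E T n" "w \<otimes> g Q \<in> val_ge E T n" using c(3) other by auto
      then show "c \<oplus> w \<otimes> g Q \<in> val_ge E T n" using vg_add[OF S(2)] T by blast
    next
      fix T assume T: "T \<in> insert Q Y"
      show "c \<oplus> w \<otimes> g Q \<ominus> g T \<in> val_ge E T n"
      proof (cases "T = Q")
        case True
        have "(w \<ominus> \<one>) \<otimes> g Q \<in> val_ge E Q n"
          using vg_mult[OF S(2)[OF QX(1)] w(2) N[OF QX(1) QX(1)]] by simp
        moreover have "c \<in> val_ge E Q n" using c(3) QX by simp
        ultimately have "c \<oplus> (w \<ominus> \<one>) \<otimes> g Q \<in> val_ge E Q n" using vg_add[OF S(2)[OF QX(1)]] by blast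
        moreover have "c \<oplus> (w \<ominus> \<one>) \<otimes> g Q = c \<oplus> w \<otimes> g Q \<ominus> g Q" using R by algebra
        ultimately show ?thesis using True by simp
      next
        case False
        have SX: "T \<in> S" "T \<in> Y" using T False insert by auto
        have SR: "g T \<in> carrier R" using g[OF SX(1)] ER by auto
        have "(c \<ominus> g T) \<oplus> w \<otimes> g Q \<in> val_ge E T n"
          using c(2)[OF SX(2)] other[OF SX(1) False] vg_add[OF S(2)[OF SX(1)]] by blast
        moreover have "(c \<ominus> g T) \<oplus> w \<otimes> g Q = c \<oplus> w \<otimes> g Q \<ominus> g T" using R SR by algebra
        ultimately show ?thesis by simp
      qed
    qed
  qed
  from this[OF S(1) subset_refl] show ?thesis by auto
qed

end

section \<open>Places of function fields are discrete\<close>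

context field
begin

text \<open>Clearing denominators in p(1/z). The length of a coefficient list exceeds the formal
  degree by 1, so multiplying by that power of z leaves a spare factor: every coefficient a occurs
  as a z times a further power of z.\<close>

lemma eval_inv_scaled:
  assumes z: "z \<in> carrier R" "z \<noteq> \<zero>" and J: "J \<subseteq> carrier R" "\<zero> \<in> J"
    and add: "\<And>a b. a \<in> J \<Longrightarrow> b \<in> J \<Longrightarrow> a \<oplus> b \<in> J" and mult: "\<And>a. a \<in> J \<Longrightarrow> z \<otimes> a \<in> J"
    and p: "set p \<subseteq> carrier R" "\<And>a. a \<in> set p \<Longrightarrow> a \<otimes> z \<in> J"
  shows "z [^] length p \<otimes> eval p (inv z) \<in> J"
  using p
proof (induction p)
  case Nil
  then show ?case using z J by simp
next
  case (Cons a p)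
  note iz = inv_field[OF z]
  have c: "a \<in> carrier R" "set p \<subseteq> carrier R" "eval p (inv z) \<in> carrier R"
    using Cons eval_in_carrier[of p "inv z"] iz by auto
  have zn: "z [^] length p \<otimes> inv z [^] length p = \<one>"
    using nat_pow_distrib[of z "inv z" "length p"] z iz by simp
  have "z [^] length (a # p) \<otimes> eval (a # p) (inv z)
      = z \<otimes> (z [^] length p \<otimes> (a \<otimes> inv z [^] length p \<oplus> eval p (inv z)))"
    using z iz c by (simp add: m_ac)
  also have "\<dots> = z \<otimes> (a \<otimes> (z [^] length p \<otimes> inv z [^] length p) \<oplus> z [^] length p \<otimes> eval p (inv z))"
    using z iz c by (simp add: r_distr m_lcomm)
  also have "\<dots> = a \<otimes> z \<oplus> z \<otimes> (z [^] length p \<otimes> eval p (inv z))"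
    unfolding zn using z c by (simp add: r_distr m_comm)
  finally show ?case using Cons add mult by simp
qed

text \<open>If \<open>z\<close> were outside \<open>V\<close>, then 1/z would lie in
  \<open>V\<close>, and dividing the monic equation by a power of z would exhibit z as the negative
  of an element of \<open>V\<close>.\<close>

lemma integral_in_val_ring:
  assumes V: "val_ring F V" and z: "z \<in> F" and p: "set p \<subseteq> V" "p \<noteq> []" "lead_coeff p = \<one>" "eval p z = \<zero>"
  shows "z \<in> V"
proof (rule ccontr)
  assume nz: "z \<notin> V"
  have F: "subfield F R" and Vr: "subring V R" and VF: "V \<subseteq> F" using V by (auto simp: val_ring_def)
  have z0: "z \<noteq> \<zero>" using nz subringE(2)[OF Vr] by auto
  have iz: "inv z \<in> V" using V z z0 nz by (auto simp: val_ring_def)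
  have zR: "z \<in> carrier R" and VR: "V \<subseteq> carrier R" using z subfieldE(3)[OF F] VF by auto
  note i = inv_field[OF zR z0]
  obtain q where q: "p = \<one> # q" using p(2,3) by (cases p) auto
  note Jg = l_coset_additive_subgroup[OF Vr i(1)]
  have "inv z [^] length q \<otimes> eval q (inv (inv z)) \<in> inv z <# V"
  proof (rule eval_inv_scaled[OF i(1,2)])
    show "inv z <# V \<subseteq> carrier R" "\<zero> \<in> inv z <# V"
      using additive_subgroup.a_subset[OF Jg] additive_subgroup.zero_closed[OF Jg] by auto
    show "set q \<subseteq> carrier R" using p(1) q VR by auto
    show "a \<oplus> b \<in> inv z <# V" if "a \<in> inv z <# V" "b \<in> inv z <# V" for a b
      using additive_subgroup.a_closed[OF Jg that] .
    show "inv z \<otimes> a \<in> inv z <# V" if a: "a \<in> inv z <# V" for a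
    proof -
      have "a \<in> V" using a iz subringE(6)[OF Vr] by (auto simp: l_coset_mem)
      then show ?thesis by (auto simp: l_coset_mem)
    qed
    show "a \<otimes> inv z \<in> inv z <# V" if a: "a \<in> set q" for a
    proof -
      have "a \<in> V" "a \<in> carrier R" using a p(1) q VR by auto
      then show ?thesis using i m_comm[of a "inv z"] by (auto simp: l_coset_mem)
    qed
  qed
  then obtain v where v: "v \<in> V" "inv z [^] length q \<otimes> eval q z = inv z \<otimes> v" by (auto simp: l_coset_mem i(5))
  have c: "eval q z \<in> carrier R" "v \<in> carrier R" using p(1) q VR zR v eval_in_carrier[of q z] by auto
  have zn: "inv z [^] length q \<otimes> z [^] length q = \<one>"
    using nat_pow_distrib[of "inv z" z "length q"] zR i by simp
  have "\<zero> = inv z [^] length q \<otimes> (z [^] length q \<oplus> eval q z)" using p(4) q zR i c by simp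
  also have "\<dots> = \<one> \<oplus> inv z \<otimes> v" using zR i c zn v(2) by (simp add: r_distr)
  finally have e: "\<one> \<oplus> inv z \<otimes> v = \<zero>" by (rule sym)
  have "z \<otimes> (\<one> \<oplus> inv z \<otimes> v) = \<zero>" unfolding e using zR by simp
  moreover have "z \<otimes> (\<one> \<oplus> inv z \<otimes> v) = z \<oplus> v"
    using zR i c by (simp add: r_distr m_assoc[symmetric])
  ultimately have "\<ominus> v = z" using minus_equality[of z v] zR c by simp
  then show False using nz v(1) subringE(5)[OF Vr] by blast
qed

lemma generate_field_fraction:
  assumes k: "subfield k R" and w: "w \<in> carrier R" and z: "z \<in> generate_field R (insert w k)"
  shows "\<exists>g\<in>simple_extension k w. \<exists>h\<in>simple_extension k w. h \<noteq> \<zero> \<and> z = g \<otimes> inv h"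
proof -
  note kr = subfieldE(1)[OF k] and kR = subfieldE(3)[OF k]
  let ?S = "simple_extension k w"
  have S: "subring ?S R" using simple_extension_is_subring[OF kr w] .
  note SR = subringE(1)[OF S]
  define Q where "Q = {g \<otimes> inv h | g h. g \<in> ?S \<and> h \<in> ?S \<and> h \<noteq> \<zero>}"
  have kS: "k \<subseteq> ?S" "w \<in> ?S" using simple_extension_incl[OF kR w] simple_extension_mem[OF kr w] by auto
  have QI: "g \<otimes> inv h \<in> Q" if "g \<in> ?S" "h \<in> ?S" "h \<noteq> \<zero>" for g h unfolding Q_def using that by blast
  have SQ: "a \<in> Q" if "a \<in> ?S" for a
    using QI[OF that subringE(3)[OF S] one_not_zero] that SR by auto
  have "subfield Q R"
  proof (rule subfieldI')
    show "subring Q R"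
    proof (rule subringI)
      show "Q \<subseteq> carrier R" unfolding Q_def using SR inv_field by auto
      show "\<one> \<in> Q" using SQ subringE(3)[OF S] by blast
      fix a assume "a \<in> Q"
      then obtain g h where g: "g \<in> ?S" "h \<in> ?S" "h \<noteq> \<zero>" "a = g \<otimes> inv h" by (auto simp: Q_def)
      have gR: "g \<in> carrier R" "h \<in> carrier R" using g SR by auto
      note ih = inv_field[OF gR(2) g(3)]
      have "\<ominus> a = (\<ominus> g) \<otimes> inv h" using g(4) gR ih by (simp add: l_minus)
      then show "\<ominus> a \<in> Q" using QI[OF subringE(5)[OF S g(1)] g(2,3)] by simp
      fix b assume "b \<in> Q"
      then obtain g' h' where g': "g' \<in> ?S" "h' \<in> ?S" "h' \<noteq> \<zero>" "b = g' \<otimes> inv h'" by (auto simp: Q_def)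
      have gR': "g' \<in> carrier R" "h' \<in> carrier R" using g' SR by auto
      note ih' = inv_field[OF gR'(2) g'(3)]
      have hh: "h \<otimes> h' \<in> ?S" "h \<otimes> h' \<noteq> \<zero>" using g g' subringE(6)[OF S] integral gR gR' by auto
      have ihh: "inv (h \<otimes> h') = inv h \<otimes> inv h'" using inv_mult_field gR gR' g g' by simp
      have "a \<otimes> b = (g \<otimes> g') \<otimes> inv (h \<otimes> h')" unfolding ihh g(4) g'(4) using gR gR' ih ih' by (simp add: m_ac)
      then show "a \<otimes> b \<in> Q" using QI[OF subringE(6)[OF S g(1) g'(1)] hh] by simp
      have "(g \<otimes> h' \<oplus> g' \<otimes> h) \<otimes> (inv h \<otimes> inv h') = g \<otimes> inv h \<otimes> (h' \<otimes> inv h') \<oplus> g' \<otimes> inv h' \<otimes> (h \<otimes> inv h)"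
        using gR gR' ih(1) ih'(1) by (simp add: l_distr r_distr m_ac)
      also have "\<dots> = a \<oplus> b" unfolding g(4) g'(4) using ih ih' gR gR' by simp
      finally have "a \<oplus> b = (g \<otimes> h' \<oplus> g' \<otimes> h) \<otimes> inv (h \<otimes> h')" using ihh by simp
      then show "a \<oplus> b \<in> Q"
        using QI[OF subringE(7)[OF S subringE(6)[OF S g(1) g'(2)] subringE(6)[OF S g'(1) g(2)]] hh] by simp
    qed
    fix a assume "a \<in> Q - {\<zero>}"
    then obtain g h where g: "g \<in> ?S" "h \<in> ?S" "h \<noteq> \<zero>" "a = g \<otimes> inv h" "a \<noteq> \<zero>" by (auto simp: Q_def)
    have gR: "g \<in> carrier R" "h \<in> carrier R" using g SR by auto
    note ih = inv_field[OF gR(2) g(3)]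
    have g0: "g \<noteq> \<zero>" using g(4,5) ih by auto
    have "inv a = h \<otimes> inv g" unfolding g(4) using inv_mult_field[OF gR(1) g0 ih(1,2)] ih gR inv_field[OF gR(1) g0] by (simp add: m_comm)
    then show "inv a \<in> Q" using QI[OF g(2,1) g0] by simp
  qed
  moreover have "insert w k \<subseteq> Q" using SQ kS by blast
  ultimately have "generate_field R (insert w k) \<subseteq> Q"
    using generate_field_min_subfield1[of "insert w k" Q] kR w by auto
  then show ?thesis using z unfolding Q_def by blast
qed

text \<open>The order of vanishing at x = 0, read off from the Horner form in which
  \<open>simple_extension\<close> is generated.\<close>

lemma simple_extension_order:
  assumes k: "subfield k R" and x: "x \<in> carrier R" and h: "h \<in> simple_extension k x" "h \<noteq> \<zero>"
  shows "\<exists>n g b. g \<in> simple_extension k x \<and> b \<in> k \<and> b \<noteq> \<zero> \<and> h = x [^] (n::nat) \<otimes> (g \<otimes> x \<oplus> b)"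
  using h
proof (induction h rule: simple_extension.induct)
  case (lin g b)
  have R: "g \<in> carrier R" "b \<in> carrier R"
    using lin subringE(1)[OF simple_extension_is_subring[OF subfieldE(1)[OF k] x]] subfieldE(3)[OF k] by auto
  show ?case
  proof (cases "b = \<zero>")
    case False
    have "g \<otimes> x \<oplus> b = x [^] (0::nat) \<otimes> (g \<otimes> x \<oplus> b)" using R x by simp
    then show ?thesis using lin False by blast
  next
    case True
    then have "g \<noteq> \<zero>" using lin x by auto
    then obtain n g' b' where g': "g' \<in> simple_extension k x" "b' \<in> k" "b' \<noteq> \<zero>" "g = x [^] (n::nat) \<otimes> (g' \<otimes> x \<oplus> b')"
      using lin by blast
    have R': "g' \<in> carrier R" "b' \<in> carrier R"
      using g' subringE(1)[OF simple_extension_is_subring[OF subfieldE(1)[OF k] x]] subfieldE(3)[OF k] by auto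
    have "g \<otimes> x \<oplus> b = g \<otimes> x" using True R x by simp
    also have "\<dots> = x [^] Suc n \<otimes> (g' \<otimes> x \<oplus> b')" unfolding g'(4) using R' x by (simp add: m_ac)
    finally show ?thesis using g' by blast
  qed
qed simp

text \<open>The valuation ring induced on the rational function field \<open>k(x)\<close> by a place with \<open>x \<in> P\<close>
  has uniformizer \<open>x\<close> and residue field \<open>k\<close>.\<close>

lemma rational_residue:
  assumes k: "subfield k R" and V: "val_ring F V" and kV: "k \<subseteq> V"
    and x: "x \<in> V" "x \<noteq> \<zero>" "inv x \<notin> V"
    and u: "u \<in> V" "u \<in> generate_field R (insert x k)"
  shows "\<exists>b\<in>k. u \<ominus> b \<in> x <# (V \<inter> generate_field R (insert x k))"
proof -
  have F: "subfield F R" and Vr: "subring V R" and VF: "V \<subseteq> F" using V by (auto simp: val_ring_def)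
  have FR: "F \<subseteq> carrier R" using subfieldE(3)[OF F] .
  have VR: "V \<subseteq> carrier R" using VF FR by blast
  have xR: "x \<in> carrier R" and kR: "k \<subseteq> carrier R" using x VR kV by auto
  let ?K = "generate_field R (insert x k)" and ?S = "simple_extension k x"
  have K: "subfield ?K R" using generate_field_is_subfield[of "insert x k"] xR kR by auto
  have Kr: "subring ?K R" using subfieldE(1)[OF K] .
  have kK: "k \<subseteq> ?K" "x \<in> ?K" by (auto intro: generate_field.incl)
  have SV: "?S \<subseteq> V" using simple_extension_subring_incl[OF Vr kV x(1)] .
  have SK: "?S \<subseteq> ?K" using simple_extension_subring_incl[OF Kr kK] .
  note Sr = simple_extension_is_subring[OF subfieldE(1)[OF k] xR]
  have kS: "k \<subseteq> ?S" "x \<in> ?S" using simple_extension_incl[OF kR xR] simple_extension_mem[OF subfieldE(1)[OF k] xR] by auto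
  \<comment> \<open>A nonzero constant plus a multiple of \<open>x\<close> is a unit plus a
    non-unit, hence a unit of \<open>V\<close>.\<close>
  have unit: "g \<otimes> x \<oplus> b \<noteq> \<zero> \<and> inv (g \<otimes> x \<oplus> b) \<in> V \<inter> ?K" if gb: "g \<in> ?S" "b \<in> k" "b \<noteq> \<zero>" for g b
  proof -
    have R: "g \<in> carrier R" "b \<in> carrier R" "g \<in> V" "b \<in> V" using gb SV kV VR by auto
    have ib: "inv b \<in> V" using subfield_inv[OF k gb(2,3)] kV by auto
    have gx: "g \<otimes> x = \<zero> \<or> inv (g \<otimes> x) \<notin> V" using val_ring_nonunits_mult[OF V x(1) _ R(3)] x by auto
    have gxV: "g \<otimes> x \<in> V" using R x subringE(6)[OF Vr] by blast
    have inV: "g \<otimes> x \<oplus> b \<in> V" using gxV R subringE(7)[OF Vr] by blast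
    have "\<not> (g \<otimes> x \<oplus> b = \<zero> \<or> inv (g \<otimes> x \<oplus> b) \<notin> V)"
    proof
      assume *: "g \<otimes> x \<oplus> b = \<zero> \<or> inv (g \<otimes> x \<oplus> b) \<notin> V"
      have n: "(\<ominus> \<one>) \<otimes> (g \<otimes> x) = \<zero> \<or> inv ((\<ominus> \<one>) \<otimes> (g \<otimes> x)) \<notin> V"
        using val_ring_nonunits_mult[OF V gxV gx] subringE(3,5)[OF Vr] by blast
      have e: "(\<ominus> \<one>) \<otimes> (g \<otimes> x) \<in> V" using gxV subringE(3,5,6)[OF Vr] by blast
      have "(g \<otimes> x \<oplus> b) \<oplus> (\<ominus> \<one>) \<otimes> (g \<otimes> x) = b" using R xR by algebra
      then have "b = \<zero> \<or> inv b \<notin> V" using val_ring_nonunits_add[OF V inV * e n] by simp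
      then show False using gb ib by simp
    qed
    moreover have "inv (g \<otimes> x \<oplus> b) \<in> ?K" if "g \<otimes> x \<oplus> b \<noteq> \<zero>"
    proof -
      have "g \<otimes> x \<oplus> b \<in> ?K" using gb SK kK subringE(6,7)[OF Kr] by blast
      then show ?thesis using subfield_inv[OF K] that by blast
    qed
    ultimately show ?thesis by blast
  qed
  show ?thesis
  proof (cases "u = \<zero>")
    case True
    have "u \<ominus> \<zero> = x \<otimes> \<zero>" using True xR by (simp add: a_minus_def)
    moreover have "\<zero> \<in> V \<inter> ?K" using subringE(2)[OF Vr] subringE(2)[OF Kr] by simp
    ultimately show ?thesis using subringE(2)[OF subfieldE(1)[OF k]] unfolding l_coset_mem by blast
  next
    case u0: False
    obtain g h where gh: "g \<in> ?S" "h \<in> ?S" "h \<noteq> \<zero>" "u = g \<otimes> inv h"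
      using generate_field_fraction[OF k xR u(2)] by blast
    have ghR: "g \<in> carrier R" "h \<in> carrier R" using gh SV VR by auto
    have g0: "g \<noteq> \<zero>" using gh u0 inv_field[OF ghR(2) gh(3)] by auto
    obtain m g1 b where g1: "g1 \<in> ?S" "b \<in> k" "b \<noteq> \<zero>" "g = x [^] (m::nat) \<otimes> (g1 \<otimes> x \<oplus> b)"
      using simple_extension_order[OF k xR gh(1) g0] by blast
    obtain n h1 d where h1: "h1 \<in> ?S" "d \<in> k" "d \<noteq> \<zero>" "h = x [^] (n::nat) \<otimes> (h1 \<otimes> x \<oplus> d)"
      using simple_extension_order[OF k xR gh(2,3)] by blast
    define G H where "G = g1 \<otimes> x \<oplus> b" "H = h1 \<otimes> x \<oplus> d"
    have G: "G \<noteq> \<zero>" "inv G \<in> V" "inv G \<in> ?K" and H: "H \<noteq> \<zero>" "inv H \<in> V" "inv H \<in> ?K"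
      using unit[OF g1(1-3)] unit[OF h1(1-3)] by (auto simp: G_H_def)
    have GS: "G \<in> ?S" "H \<in> ?S" unfolding G_H_def using g1 h1 kS subringE(6,7)[OF Sr] by blast+
    have GR: "G \<in> carrier R" "H \<in> carrier R" "inv G \<in> carrier R" "inv H \<in> carrier R"
      using GS SV VR G H by auto
    have xn: "x [^] j \<in> carrier R" "x [^] j \<noteq> \<zero>" "x [^] j \<in> V" "x [^] j \<in> ?K" for j :: nat
    proof -
      show "x [^] j \<in> carrier R" using xR by simp
      show "x [^] j \<in> V" by (induction j) (use x subringE(3,6)[OF Vr] in auto)
      show "x [^] j \<in> ?K" by (induction j) (use kK subringE(3,6)[OF Kr] in auto)
      show "x [^] j \<noteq> \<zero>" by (induction j) (use x xR integral in auto)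
    qed
    have uh: "u \<otimes> h = g"
    proof -
      have "u \<otimes> h = g \<otimes> (inv h \<otimes> h)" unfolding gh(4) using ghR inv_field[OF ghR(2) gh(3)] by (simp add: m_assoc)
      then show ?thesis using inv_field[OF ghR(2) gh(3)] ghR by simp
    qed
    have uR: "u \<in> carrier R" using u VR by auto
    have eq: "x [^] n \<otimes> (u \<otimes> H) = x [^] m \<otimes> G"
      using uh g1(4) h1(4) GR uR xn by (simp add: G_H_def m_lcomm)
    \<comment> \<open>If the denominator vanished to higher order than the numerator,
      \<open>inv x\<close> would lie in \<open>V\<close>.\<close>
    have nm: "n \<le> m"
    proof (rule ccontr)
      assume "\<not> n \<le> m"
      then obtain i where i: "n = m + Suc i" using less_iff_Suc_add by (auto simp: not_le)
      have "x [^] m \<otimes> (x [^] Suc i \<otimes> (u \<otimes> H)) = x [^] m \<otimes> G"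
        using eq unfolding i using GR uR xR by (simp only: nat_pow_mult[OF xR, symmetric] m_assoc xn m_closed)
      then have "x [^] Suc i \<otimes> (u \<otimes> H) = G" using m_lcancel[OF xn(2)[of m] xn(1)[of m]] GR uR xR by simp
      then have e: "x \<otimes> (x [^] i \<otimes> (u \<otimes> H)) = G" using GR uR xR by (simp add: m_ac)
      have "x \<otimes> (x [^] i \<otimes> (u \<otimes> H) \<otimes> inv G) = \<one>"
      proof -
        have "x \<otimes> (x [^] i \<otimes> (u \<otimes> H) \<otimes> inv G) = (x \<otimes> (x [^] i \<otimes> (u \<otimes> H))) \<otimes> inv G"
          using GR uR xR by (simp add: m_assoc)
        then show ?thesis unfolding e using inv_field[OF GR(1) G(1)] by simp
      qed
      then have "inv x = x [^] i \<otimes> (u \<otimes> H) \<otimes> inv G" using comm_inv_char[of x] xR GR uR by simp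
      moreover have "x [^] i \<otimes> (u \<otimes> H) \<otimes> inv G \<in> V" using xn(3) u(1) GS SV G subringE(6)[OF Vr] by blast
      ultimately show False using x(3) by simp
    qed
    then obtain i where i: "m = n + i" using le_Suc_ex by blast
    have "x [^] n \<otimes> (u \<otimes> H) = x [^] n \<otimes> (x [^] i \<otimes> G)"
      using eq unfolding i using GR xR by (simp only: nat_pow_mult[OF xR, symmetric] m_assoc xn)
    then have e: "u \<otimes> H = x [^] i \<otimes> G" using m_lcancel[OF xn(2)[of n] xn(1)[of n]] GR uR xR by simp
    have "u = u \<otimes> (H \<otimes> inv H)" using inv_field[OF GR(2) H(1)] uR by simp
    also have "\<dots> = (u \<otimes> H) \<otimes> inv H" using uR GR by (simp add: m_assoc)
    also have "\<dots> = x [^] i \<otimes> (G \<otimes> inv H)" unfolding e using GR xR by (simp add: m_assoc)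
    finally have ue: "u = x [^] i \<otimes> (G \<otimes> inv H)" .
    have GV: "G \<in> V \<inter> ?K" "inv H \<in> V \<inter> ?K" using GS SV SK H by auto
    have VK: "a \<otimes> b \<in> V \<inter> ?K" "a \<ominus> b \<in> V \<inter> ?K" if "a \<in> V \<inter> ?K" "b \<in> V \<inter> ?K" for a b
      using that subringE(6)[OF Vr] subringE(6)[OF Kr] subring_minus[OF Vr] subring_minus[OF Kr] by auto
    show ?thesis
    proof (cases i)
      case (Suc j)
      have "u = x \<otimes> (x [^] j \<otimes> (G \<otimes> inv H))" using ue GR xR Suc by (simp add: m_ac)
      moreover have "x [^] j \<otimes> (G \<otimes> inv H) \<in> V \<inter> ?K" using VK GV xn by auto
      ultimately have "u \<in> x <# (V \<inter> ?K)" unfolding l_coset_mem by blast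
      moreover have "u \<ominus> \<zero> = u" using uR by (simp add: a_minus_def)
      ultimately show ?thesis using subringE(2)[OF subfieldE(1)[OF k]] by (metis)
    next
      case 0
      have uH: "u \<otimes> H = G" using e 0 GR by simp
      have idk: "inv d \<in> k" "d \<otimes> inv d = \<one>" using subfield_inv[OF k h1(2,3)] by auto
      have R: "g1 \<in> carrier R" "h1 \<in> carrier R" "b \<in> carrier R" "d \<in> carrier R" "inv d \<in> carrier R"
        using g1 h1 SV VR kR idk by auto
      \<comment> \<open>With equal orders, the residue is the quotient of the constant terms of
        numerator and denominator after removal of the powers of \<open>x\<close>.\<close>
      define c where "c = b \<otimes> inv d"
      have c: "c \<in> k" using g1 idk subringE(6)[OF subfieldE(1)[OF k]] by (auto simp: c_def)
      have cR: "c \<in> carrier R" using c kR by auto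
      have cd: "c \<otimes> d = b" unfolding c_def using R idk by (simp add: m_assoc m_comm[of "inv d"])
      have "(u \<ominus> c) \<otimes> H = u \<otimes> H \<ominus> c \<otimes> H" using uR cR GR by algebra
      also have "\<dots> = (g1 \<otimes> x \<oplus> b) \<ominus> c \<otimes> (h1 \<otimes> x \<oplus> d)" using uH by (simp add: G_H_def)
      also have "\<dots> = x \<otimes> (g1 \<ominus> c \<otimes> h1) \<oplus> (b \<ominus> c \<otimes> d)" using R cR xR by algebra
      also have "\<dots> = x \<otimes> (g1 \<ominus> c \<otimes> h1)" using cd R cR xR by (simp add: a_minus_def r_neg)
      finally have "(u \<ominus> c) \<otimes> H = x \<otimes> (g1 \<ominus> c \<otimes> h1)" .
      then have "(u \<ominus> c) \<otimes> H \<otimes> inv H = x \<otimes> ((g1 \<ominus> c \<otimes> h1) \<otimes> inv H)" using GR R cR xR by (simp add: m_assoc)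
      moreover have "(u \<ominus> c) \<otimes> H \<otimes> inv H = u \<ominus> c" using uR cR GR inv_field[OF GR(2) H(1)] by (simp add: m_assoc)
      ultimately have "u \<ominus> c = x \<otimes> ((g1 \<ominus> c \<otimes> h1) \<otimes> inv H)" by simp
      moreover have "(g1 \<ominus> c \<otimes> h1) \<otimes> inv H \<in> V \<inter> ?K"
      proof -
        have "g1 \<in> V \<inter> ?K" "h1 \<in> V \<inter> ?K" "c \<in> V \<inter> ?K" using g1 h1 c SV SK kV kK by auto
        then show ?thesis using VK(1)[OF VK(2)[OF _ VK(1)] GV(2)] by simp
      qed
      ultimately have "u \<ominus> c \<in> x <# (V \<inter> ?K)" unfolding l_coset_mem by blast
      then show ?thesis using c by blast
    qed
  qed
qed

end

section \<open>Finiteness of V/zV, from rational subfields to function fields\<close>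

context field
begin

lemma finite_dimension_larger_base:
  assumes K: "subfield K R" and K': "subfield K' R" and sub: "K \<subseteq> K'" "K' \<subseteq> F" and F: "subring F R"
    and fd: "finite_dimension K F"
  shows "finite_dimension K' F"
proof -
  obtain n where "dimension n K F" using fd by auto
  then obtain Us where Us: "set Us \<subseteq> carrier R" "Span K Us = F" using exists_base[OF K] by blast
  have UF: "set Us \<subseteq> F" using Span_base_incl[OF K Us(1)] Us(2) by simp
  have "subalgebra K' F R"
    using subringE(6)[OF F] sub(2) subring.axioms(1)[OF F]
    by (auto simp: subalgebra_def subalgebra_axioms_def intro: subgroup.intro)
  then have "Span K' Us \<subseteq> F" using subalgebra_Span_incl[OF K' _ UF] by blast
  moreover have "F \<subseteq> Span K' Us"
  proof -
    have "Span K Us \<subseteq> Span K' Us"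
    proof
      fix a assume "a \<in> Span K Us"
      then obtain Ks where "set Ks \<subseteq> K" "length Ks = length Us" "a = combine Ks Us"
        using Span_mem_iff_length_version[OF K Us(1)] by blast
      then show "a \<in> Span K' Us" using Span_mem_iff_length_version[OF K' Us(1)] sub(1) by blast
    qed
    then show ?thesis using Us(2) by simp
  qed
  ultimately have "Span K' Us = F" by blast
  then show ?thesis using Span_finite_dimension[OF K' Us(1)] by simp
qed

lemma val_ring_inter_subfield:
  assumes V: "val_ring F V" and K: "subfield K R" "K \<subseteq> F"
  shows "val_ring K (V \<inter> K)"
proof -
  have Vr: "subring V R" using V by (simp add: val_ring_def)
  have "subring (V \<inter> K) R"
    using subringE[OF Vr] subringE[OF subfieldE(1)[OF K(1)]] by (intro subringI) auto
  moreover have "z \<in> V \<inter> K \<or> inv z \<in> V \<inter> K" if "z \<in> K - {\<zero>}" for z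
  proof -
    have "inv z \<in> K" using subfield_inv[OF K(1)] that by auto
    moreover have "z \<in> V \<or> inv z \<in> V" using V that K(2) by (auto simp: val_ring_def)
    ultimately show ?thesis using that by auto
  qed
  ultimately show ?thesis using K(1) unfolding val_ring_def by blast
qed

lemma constants_meet_place:
  assumes k: "subfield k R" "k \<subseteq> V" and b: "b \<in> k" "b = \<zero> \<or> inv b \<notin> V"
  shows "b = \<zero>"
  using subfield_inv(1)[OF k(1) b(1)] k(2) b(2) by blast

text \<open>If x = p(w) is not a constant, then w is a root of p(T) - x, so k(x)(w) is finite over
  k(x); it contains k(w), over which \<open>F\<close> is finite.\<close>

lemma finite_dimension_rational:
  assumes k: "subfield k R" and w: "w \<in> carrier R" and F: "subfield F R"
    and fd: "finite_dimension (generate_field R (insert w k)) F" and sub: "generate_field R (insert w k) \<subseteq> F"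
    and x: "x \<in> simple_extension k w" "x \<notin> k"
  shows "finite_dimension (generate_field R (insert x k)) F"
proof -
  let ?K0 = "generate_field R (insert w k)" and ?K1 = "generate_field R (insert x k)"
  note kr = subfieldE(1)[OF k] and kR = subfieldE(3)[OF k]
  have K0: "subfield ?K0 R" using generate_field_is_subfield[of "insert w k"] w kR by auto
  have kK0: "k \<subseteq> ?K0" "w \<in> ?K0" by (auto intro: generate_field.incl)
  have xK0: "x \<in> ?K0" using simple_extension_subring_incl[OF subfieldE(1)[OF K0] kK0] x by blast
  have xR: "x \<in> carrier R" using xK0 subfieldE(3)[OF K0] by auto
  have K1: "subfield ?K1 R" using generate_field_is_subfield[of "insert x k"] xR kR by auto
  have kK1: "k \<subseteq> ?K1" "x \<in> ?K1" by (auto intro: generate_field.incl)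
  note K1r = subfieldE(1)[OF K1]
  obtain p where p: "p \<in> carrier (k[X])" "eval p w = x"
    using x(1) simple_extension_as_eval_img[OF kR w] by auto
  have pk: "set p \<subseteq> k" "p \<noteq> [] \<Longrightarrow> lead_coeff p \<noteq> \<zero>"
    using p(1) by (auto simp: univ_poly_carrier[symmetric] polynomial_def)
  have "x \<noteq> \<zero>" using x subringE(2)[OF kr] by auto
  then have "p \<noteq> []" using p(2) by auto
  then obtain p0 b where pb: "p = p0 @ [b]" by (metis rev_exhaust)
  have p0: "p0 \<noteq> []"
  proof
    assume "p0 = []"
    then have "x = b" using p(2) pb pk kR by auto
    then show False using pb pk x by auto
  qed
  \<comment> \<open>The polynomial p(T) - x: only the constant coefficient \<open>b\<close> changes,
    and because \<open>p0\<close> is nonempty the leading coefficient of p is kept.\<close>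
  define r where "r = p0 @ [b \<ominus> x]"
  have bK: "b \<in> ?K1" "b \<in> carrier R" using pb pk kK1 kR by auto
  have "r \<in> carrier (?K1[X])"
  proof -
    have "set r \<subseteq> ?K1" using pb pk kK1 bK subring_minus[OF K1r] by (auto simp: r_def)
    moreover have "lead_coeff r \<noteq> \<zero>" using pk pb p0 by (auto simp: r_def)
    ultimately have "polynomial ?K1 r" unfolding polynomial_def by blast
    then show ?thesis by (simp add: univ_poly_carrier)
  qed
  moreover have "r \<noteq> []" by (simp add: r_def)
  moreover have "eval r w = \<zero>"
  proof -
    have c: "set p0 \<subseteq> carrier R" "eval p0 w \<in> carrier R" using pb pk kR eval_in_carrier[of p0 w] w by auto
    have "eval r w = eval p0 w \<otimes> w \<oplus> (b \<ominus> x)"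
      unfolding r_def using eval_append_aux[OF c(1) _ w] bK xR by simp
    moreover have "x = eval p0 w \<otimes> w \<oplus> b" using p(2) unfolding pb using eval_append_aux[OF c(1) bK(2) w] by simp
    moreover have "a \<otimes> w \<oplus> (b \<ominus> (a \<otimes> w \<oplus> b)) = \<zero>" if "a \<in> carrier R" for a using that bK(2) w by algebra
    ultimately show ?thesis using c by simp
  qed
  ultimately have alg: "(algebraic over ?K1) w" by (rule algebraicI)
  let ?K2 = "simple_extension ?K1 w"
  have K2: "subfield ?K2 R" using simple_extension_is_subfield[OF K1 w] alg by simp
  have fd12: "finite_dimension ?K1 ?K2" using finite_dimension_simple_extension[OF K1 w] alg by simp
  have "insert w k \<subseteq> ?K2"
    using simple_extension_incl[OF subfieldE(3)[OF K1] w] simple_extension_mem[OF K1r w] kK1 by auto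
  then have K02: "?K0 \<subseteq> ?K2" using generate_field_min_subfield1[of "insert w k" ?K2] K2 w kR by auto
  have "?K1 \<subseteq> F" using generate_field_min_subfield1[of "insert x k" F] F xR kR xK0 sub kK0 by auto
  then have K2F: "?K2 \<subseteq> F" using simple_extension_subring_incl[OF subfieldE(1)[OF F]] kK0 sub by blast
  have "finite_dimension ?K2 F" using finite_dimension_larger_base[OF K0 K2 K02 K2F subfieldE(1)[OF F] fd] .
  then show ?thesis using telescopic_base_dim(1)[OF K1 K2 fd12] by simp
qed

text \<open>By \<open>rational_residue\<close> the valuation ring induced on k(x) has the finite set
  \<open>k\<close> of representatives modulo x; \<open>index_le_dimension\<close> carries the
  finiteness over to \<open>F\<close>.\<close>

lemma finite_index_rational:
  assumes k: "subfield k R" "finite k" and V: "val_ring F V" "k \<subseteq> V"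
    and x: "x \<in> V" "x \<noteq> \<zero>" "inv x \<notin> V" and fd: "finite_dimension (generate_field R (insert x k)) F"
  shows "finite_index V (x <# V)"
proof -
  have F: "subfield F R" and Vr: "subring V R" and VF: "V \<subseteq> F" using V by (auto simp: val_ring_def)
  have FR: "F \<subseteq> carrier R" using subfieldE(3)[OF F] .
  have xR: "x \<in> carrier R" and kR: "k \<subseteq> carrier R" using x VF FR V by auto
  let ?K = "generate_field R (insert x k)"
  have K: "subfield ?K R" using generate_field_is_subfield[of "insert x k"] xR kR by auto
  have kK: "k \<subseteq> ?K" "x \<in> ?K" by (auto intro: generate_field.incl)
  have KF: "?K \<subseteq> F" using generate_field_min_subfield1[of "insert x k" F] F xR kR VF V x by auto
  have W: "val_ring ?K (V \<inter> ?K)" using val_ring_inter_subfield[OF V(1) K KF] .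
  have Wr: "subring (V \<inter> ?K) R" using W by (simp add: val_ring_def)
  note I = l_coset_additive_subgroup[OF Wr xR]
  have res: "\<exists>b\<in>k. u \<ominus> b \<in> x <# (V \<inter> ?K)" if "u \<in> V \<inter> ?K" for u
    using rational_residue[OF k(1) V x] that by blast
  have WR: "V \<inter> ?K \<subseteq> carrier R" using subringE(1)[OF Wr] .
  have one: "\<one> \<notin> x <# (V \<inter> ?K)"
  proof
    assume "\<one> \<in> x <# (V \<inter> ?K)"
    then obtain a where "a \<in> V" "\<one> = x \<otimes> a" by (auto simp: l_coset_mem)
    then have "inv x = a" using comm_inv_char[of x a] xR WR VF FR by auto
    then show False using x \<open>a \<in> V\<close> by simp
  qed
  have xP: "z = \<zero> \<or> inv z \<notin> V" if z: "z \<in> x <# (V \<inter> ?K)" for z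
  proof -
    obtain a where a: "a \<in> V" "z = x \<otimes> a" using z by (auto simp: l_coset_mem)
    then have "z = a \<otimes> x" using xR VF FR by (auto simp: m_comm)
    then show ?thesis using val_ring_nonunits_mult[OF V(1) x(1) _ a(1)] x by auto
  qed
  have fin: "finite_index (V \<inter> ?K) (x <# (V \<inter> ?K))" using index_le_cover(1)[OF I WR k(2) kR res] .
  \<comment> \<open>If the non-unit z is congruent to a constant b modulo x, then b is a non-unit
    too, so b = \<zero>.\<close>
  have loc: "z \<in> x <# (V \<inter> ?K)" if z: "z \<in> V \<inter> ?K" "z \<noteq> \<zero>" "inv z \<notin> V \<inter> ?K" for z
  proof -
    obtain b where b: "b \<in> k" "z \<ominus> b \<in> x <# (V \<inter> ?K)" using res[OF z(1)] by blast
    have zR: "z \<in> carrier R" and bR: "b \<in> carrier R" using z WR b kR by auto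
    have "inv z \<notin> V" using z subfield_inv(1)[OF K] by blast
    then have z': "z = \<zero> \<or> inv z \<notin> V" by simp
    have mV: "\<ominus> \<one> \<in> V" using subringE(3,5)[OF Vr] by blast
    have zbV: "z \<ominus> b \<in> V" using z b V subring_minus[OF Vr] by auto
    have m: "(\<ominus> \<one>) \<otimes> (z \<ominus> b) \<in> V" using mV zbV subringE(6)[OF Vr] by blast
    have "(\<ominus> \<one>) \<otimes> (z \<ominus> b) = \<zero> \<or> inv ((\<ominus> \<one>) \<otimes> (z \<ominus> b)) \<notin> V"
      using val_ring_nonunits_mult[OF V(1) zbV xP[OF b(2)] mV] .
    then have "z \<oplus> (\<ominus> \<one>) \<otimes> (z \<ominus> b) = \<zero> \<or> inv (z \<oplus> (\<ominus> \<one>) \<otimes> (z \<ominus> b)) \<notin> V"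
      using val_ring_nonunits_add[OF V(1) _ z' m] z by blast
    moreover have "z \<oplus> (\<ominus> \<one>) \<otimes> (z \<ominus> b) = b" using zR bR by algebra
    ultimately have "b = \<zero>" using constants_meet_place[OF k(1) V(2) b(1)] by simp
    then show ?thesis using b(2) zR by (simp add: a_minus_def)
  qed
  obtain m where m: "dimension m ?K F" using fd by auto
  show ?thesis
    using index_le_dimension(1)[OF W _ one loc fin Vr _ VF m] x kK by auto
qed

lemma generate_field_inv:
  assumes k: "subfield k R" and x: "x \<in> carrier R" "x \<noteq> \<zero>"
  shows "generate_field R (insert (inv x) k) = generate_field R (insert x k)"
proof -
  have kR: "k \<subseteq> carrier R" using subfieldE(3)[OF k] .
  have sub: "generate_field R (insert (inv y) k) \<subseteq> generate_field R (insert y k)"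
    if y: "y \<in> carrier R" "y \<noteq> \<zero>" for y
  proof -
    have G: "subfield (generate_field R (insert y k)) R" using generate_field_is_subfield[of "insert y k"] y kR by auto
    have "inv y \<in> generate_field R (insert y k)"
      using subfield_inv(1)[OF G _ y(2)] by (auto intro: generate_field.incl)
    then have "insert (inv y) k \<subseteq> generate_field R (insert y k)" by (auto intro: generate_field.incl)
    then show ?thesis using generate_field_min_subfield1[OF _ G] inv_field(1)[OF y] kR by auto
  qed
  show ?thesis using sub[OF x] sub[OF inv_field(1,2)[OF x]] inv_field(5)[OF x] by simp
qed

text \<open>Scale the minimal polynomial of 1/z over \<open>K\<close> by a power of z. If no nonzero
  element of \<open>K\<close> were divisible by z, then a z would be a non-unit for every
  coefficient a, and the equation would say that \<one> plus a non-unit is \<zero>.\<close>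

lemma place_multiple_in_base:
  assumes V: "val_ring F V" and K: "subfield K R" "K \<subseteq> F" "finite_dimension K F"
    and z: "z \<in> V" "z \<noteq> \<zero>" "inv z \<notin> V"
  shows "\<exists>c\<in>K. c \<noteq> \<zero> \<and> c \<in> z <# V"
proof (rule ccontr)
  assume no: "\<not> ?thesis"
  have F: "subfield F R" and Vr: "subring V R" and VF: "V \<subseteq> F" using V by (auto simp: val_ring_def)
  have FR: "F \<subseteq> carrier R" and KR: "K \<subseteq> carrier R" using subfieldE(3)[OF F] K by auto
  have VR: "V \<subseteq> carrier R" using VF FR by blast
  have zR: "z \<in> carrier R" using z VR by auto
  note iz = inv_field[OF zR z(2)]
  have izF: "inv z \<in> F" using subfield_inv(1)[OF F _ z(2)] z VF by auto
  have alg: "(algebraic over K) (inv z)" using finite_dimension_imp_algebraic[OF K(1) subfieldE(1)[OF F] K(3) izF] .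
  note irr = IrrE[OF K(1) iz(1) alg]
  define p where "p = Irr K (inv z)"
  have pK: "set p \<subseteq> K" using irr(1) by (auto simp: p_def univ_poly_carrier[symmetric] polynomial_def)
  have "p \<noteq> []" using irr(2) by (auto simp: p_def ring_irreducible_def univ_poly_zero)
  then obtain q where q: "p = \<one> # q" using irr(3) by (cases p) (auto simp: p_def)
  define P where "P = {y \<in> V. y = \<zero> \<or> inv y \<notin> V}"
  have az: "a \<otimes> z \<in> P" if a: "a \<in> set q" for a
  proof (cases "a = \<zero>")
    case True
    then show ?thesis using zR subringE(2)[OF Vr] by (simp add: P_def)
  next
    case False
    have aK: "a \<in> K" "a \<in> carrier R" using a q pK KR by auto
    note ia = subfield_inv[OF K(1) aK(1) False]
    have iaR: "inv a \<in> carrier R" using ia KR by auto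
    have "inv a \<notin> z <# V" using no ia by blast
    have "inv (a \<otimes> z) \<notin> V"
    proof
      assume "inv (a \<otimes> z) \<in> V"
      moreover have "inv a = z \<otimes> inv (a \<otimes> z)"
        using inv_mult_field[OF aK(2) False zR z(2)] iz iaR zR m_lcomm[of z "inv a" "inv z"] by simp
      ultimately show False using \<open>inv a \<notin> z <# V\<close> unfolding l_coset_mem by blast
    qed
    moreover have "a \<otimes> z \<in> F" using aK K z VF subringE(6)[OF subfieldE(1)[OF F]] by blast
    moreover have "a \<otimes> z \<noteq> \<zero>" using False z aK zR integral by blast
    ultimately show ?thesis using V unfolding P_def val_ring_def by blast
  qed
  have "z [^] length q \<otimes> eval q (inv z) \<in> P"
  proof (rule eval_inv_scaled[OF zR z(2)])
    show "P \<subseteq> carrier R" "\<zero> \<in> P" using VR subringE(2)[OF Vr] by (auto simp: P_def)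
    show "set q \<subseteq> carrier R" using q pK KR by auto
    show "a \<oplus> b \<in> P" if "a \<in> P" "b \<in> P" for a b
      using that val_ring_nonunits_add[OF V, of a b] subringE(7)[OF Vr] by (auto simp: P_def)
    show "z \<otimes> a \<in> P" if "a \<in> P" for a
      using that val_ring_nonunits_mult[OF V, of a z] subringE(6)[OF Vr] z by (auto simp: P_def)
  qed (use az in blast)
  then have nP: "(\<ominus> \<one>) \<otimes> (z [^] length q \<otimes> eval q (inv z)) = \<zero> \<or> inv ((\<ominus> \<one>) \<otimes> (z [^] length q \<otimes> eval q (inv z))) \<notin> V"
    using val_ring_nonunits_mult[OF V] subringE(3,5)[OF Vr] unfolding P_def by blast
  have c: "eval q (inv z) \<in> carrier R" using q pK KR eval_in_carrier[of q "inv z"] iz by auto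
  have "z [^] length q \<otimes> inv z [^] length q = \<one>" using nat_pow_distrib[of z "inv z" "length q"] zR iz by simp
  moreover have "inv z [^] length q \<oplus> eval q (inv z) = \<zero>" using irr(4) q iz by (simp add: p_def)
  ultimately have "\<one> \<oplus> z [^] length q \<otimes> eval q (inv z) = \<zero>"
    using r_distr[of "inv z [^] length q" "eval q (inv z)" "z [^] length q"] zR iz c by simp
  then have "(\<ominus> \<one>) \<otimes> (z [^] length q \<otimes> eval q (inv z)) = \<one>"
    using minus_equality[of \<one> "z [^] length q \<otimes> eval q (inv z)"] c zR by (simp add: l_minus)
  then show False using nP subringE(3)[OF Vr] by simp
qed

text \<open>For a non-unit z, some nonzero c in k(w) is divisible by z, and so is its numerator g in
  k[w]. Being a nonzero non-unit, g is not constant; hence \<open>F\<close> is finite over k(g),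
  V/gV is finite, and V/zV is a quotient of it.\<close>

theorem function_field_place_discrete:
  assumes F: "function_field R k F" and fk: "finite k" and P: "P \<in> places R k F"
  shows "discrete_place F P"
proof -
  let ?V = "ring_of_place R F P"
  have k: "subfield k R" and Ff: "subfield F R" and kF: "k \<subseteq> F" using F by (auto simp: function_field_def)
  obtain x0 where x0: "x0 \<in> F" "(transcendental over k) x0" "finite_dimension (generate_field R (insert x0 k)) F"
    using F by (auto simp: function_field_def over_def)
  note kR = subfieldE(3)[OF k] and FR = subfieldE(3)[OF Ff]
  note pl = placeE[OF Ff P]
  have V: "val_ring F ?V" using valuation_ring_val_ring[OF Ff pl(1)] .
  have kV: "k \<subseteq> ?V" "?V \<noteq> F" using pl(1) by (auto simp: valuation_ring_def)
  have Vr: "subring ?V R" and VF: "?V \<subseteq> F" using V by (auto simp: val_ring_def)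
  have VR: "?V \<subseteq> carrier R" using VF FR by blast
  have x00: "x0 \<noteq> \<zero>" using x0(2) zero_is_algebraic[OF subfieldE(1)[OF k]] by (auto simp: over_def)
  \<comment> \<open>Either \<open>x0\<close> or its inverse lies in the valuation ring, and both
    generate the same rational subfield; the choice makes k[w] a subring of the valuation
    ring.\<close>
  obtain w where w: "w \<in> ?V" "generate_field R (insert w k) = generate_field R (insert x0 k)"
    using generate_field_inv[OF k _ x00] x0(1) FR V x00 unfolding val_ring_def by blast
  let ?K = "generate_field R (insert w k)"
  have wR: "w \<in> carrier R" using w VR by auto
  have K: "subfield ?K R" using generate_field_is_subfield[of "insert w k"] wR kR by auto
  have KF: "?K \<subseteq> F" using generate_field_min_subfield1[of "insert w k" F] Ff wR kR kF w(1) VF by auto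
  have fd: "finite_dimension ?K F" using x0(3) w(2) by simp
  have fin: "finite_index ?V (z <# ?V)" if z: "z \<in> ?V - {\<zero>}" for z
  proof (cases "inv z \<in> ?V")
    case True
    have zR: "z \<in> carrier R" "z \<noteq> \<zero>" using z VR by auto
    show ?thesis
    proof (rule index_le_cover(1)[OF l_coset_additive_subgroup[OF Vr zR(1)] VR, of "{\<zero>}"])
      fix a assume a: "a \<in> ?V"
      have "a \<ominus> \<zero> = z \<otimes> (inv z \<otimes> a)"
        using a VR inv_field[OF zR] zR by (simp add: a_minus_def m_assoc[symmetric] subset_iff)
      then have "a \<ominus> \<zero> \<in> z <# ?V" using True a subringE(6)[OF Vr] unfolding l_coset_mem by blast
      then show "\<exists>r\<in>{\<zero>}. a \<ominus> r \<in> z <# ?V" by simp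
    qed auto
  next
    case False
    have zR: "z \<in> carrier R" "z \<noteq> \<zero>" using z VR by auto
    obtain c where c: "c \<in> ?K" "c \<noteq> \<zero>" "c \<in> z <# ?V"
      using place_multiple_in_base[OF V K KF fd _ zR(2) False] z by blast
    obtain g h where gh: "g \<in> simple_extension k w" "h \<in> simple_extension k w" "h \<noteq> \<zero>" "c = g \<otimes> inv h"
      using generate_field_fraction[OF k wR c(1)] by blast
    have SV: "simple_extension k w \<subseteq> ?V" using simple_extension_subring_incl[OF Vr kV(1) w(1)] .
    have gR: "g \<in> carrier R" "h \<in> carrier R" using gh SV VR by auto
    note ih = inv_field[OF gR(2) gh(3)]
    have g0: "g \<noteq> \<zero>" using c(2) gh(4) ih by auto
    obtain a where a: "a \<in> ?V" "c = z \<otimes> a" using c(3) by (auto simp: l_coset_mem)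
    have aR: "a \<in> carrier R" using a VR by auto
    have "g = c \<otimes> h" unfolding gh(4) using gR ih by (simp add: m_assoc)
    then have "g = z \<otimes> (a \<otimes> h)" using a(2) aR zR gR by (simp add: m_assoc)
    moreover have ah: "a \<otimes> h \<in> ?V" using a gh SV subringE(6)[OF Vr] by blast
    ultimately have gz: "g \<in> z <# ?V" and ge: "g = (a \<otimes> h) \<otimes> z"
      using aR gR zR by (auto simp: l_coset_mem m_comm)
    have gV: "g \<in> ?V" using gh SV by blast
    have ig: "inv g \<notin> ?V" using val_ring_nonunits_mult[OF V _ _ ah, of z] z False g0 ge by auto
    have "g \<notin> k" using constants_meet_place[OF k kV(1), of g] ig g0 by blast
    then have "finite_dimension (generate_field R (insert g k)) F"
      using finite_dimension_rational[OF k wR Ff fd KF gh(1)] by blast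
    then have fg: "finite_index ?V (g <# ?V)" using finite_index_rational[OF k fk V kV(1) gV g0 ig] by blast
    have "g <# ?V \<subseteq> z <# ?V"
    proof
      fix y assume "y \<in> g <# ?V"
      then obtain b where b: "b \<in> ?V" "y = g \<otimes> b" by (auto simp: l_coset_mem)
      obtain d where d: "d \<in> ?V" "g = z \<otimes> d" using gz by (auto simp: l_coset_mem)
      have "y = z \<otimes> (d \<otimes> b)" unfolding b(2) d(2) using b(1) d(1) VR zR by (simp add: m_assoc subset_iff)
      then show "y \<in> z <# ?V" using b d subringE(6)[OF Vr] unfolding l_coset_mem by blast
    qed
    then show ?thesis
      using index_antimono(1)[OF l_coset_additive_subgroup[OF Vr gR(1)] l_coset_additive_subgroup[OF Vr zR(1)] VR fg] by blast
  qed
  then show ?thesis using V kV(2) pl(2) unfolding discrete_place_def by blast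
qed

end

section \<open>Extension of places\<close>

context field
begin

text \<open>The polynomials in \<open>z\<close> of degree below n with coefficients in
  \<open>J\<close>, in Horner form. For an ideal \<open>J\<close> of S, the union over n is the
  ideal of S[z] generated by \<open>J\<close>.\<close>

fun pow_span :: "'a set \<Rightarrow> 'a \<Rightarrow> nat \<Rightarrow> 'a set"
  where "pow_span J z 0 = {\<zero>}"
  | "pow_span J z (Suc n) = {d \<otimes> z \<oplus> a | d a. d \<in> pow_span J z n \<and> a \<in> J}"

lemma pow_span_SucI: "d \<in> pow_span J z n \<Longrightarrow> a \<in> J \<Longrightarrow> d \<otimes> z \<oplus> a \<in> pow_span J z (Suc n)"
  by auto

context
  fixes S J
  assumes S: "subring S R" and J: "additive_subgroup J R" and JS: "J \<subseteq> S"
    and mult: "\<And>s a. s \<in> S \<Longrightarrow> a \<in> J \<Longrightarrow> s \<otimes> a \<in> J" and one: "\<one> \<notin> J"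
begin

lemma pow_span_carrier:
  assumes z: "z \<in> carrier R"
  shows "d \<in> pow_span J z n \<Longrightarrow> d \<in> carrier R"
  by (induction n arbitrary: d) (use z JS subringE(1)[OF S] in auto)

lemma pow_span_add:
  assumes z: "z \<in> carrier R"
  shows "d \<in> pow_span J z n \<Longrightarrow> e \<in> pow_span J z n \<Longrightarrow> d \<oplus> e \<in> pow_span J z n"
proof (induction n arbitrary: d e)
  case (Suc n)
  obtain d' a where d: "d' \<in> pow_span J z n" "a \<in> J" "d = d' \<otimes> z \<oplus> a" using Suc(2) by auto
  obtain e' b where e: "e' \<in> pow_span J z n" "b \<in> J" "e = e' \<otimes> z \<oplus> b" using Suc(3) by auto
  have R: "d' \<in> carrier R" "e' \<in> carrier R" "a \<in> carrier R" "b \<in> carrier R"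
    using pow_span_carrier[OF z] d e JS subringE(1)[OF S] by auto
  have "d \<oplus> e = (d' \<oplus> e') \<otimes> z \<oplus> (a \<oplus> b)" unfolding d(3) e(3) using R z by algebra
  then show ?case
    using pow_span_SucI[OF Suc(1)[OF d(1) e(1)] additive_subgroup.a_closed[OF J d(2) e(2)]] by simp
qed simp

lemma pow_span_mult:
  assumes z: "z \<in> carrier R" and s: "s \<in> S"
  shows "d \<in> pow_span J z n \<Longrightarrow> s \<otimes> d \<in> pow_span J z n"
proof (induction n arbitrary: d)
  case 0
  then show ?case using s subringE(1)[OF S] by auto
next
  case (Suc n)
  obtain d' a where d: "d' \<in> pow_span J z n" "a \<in> J" "d = d' \<otimes> z \<oplus> a" using Suc(2) by auto
  have R: "d' \<in> carrier R" "a \<in> carrier R" "s \<in> carrier R"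
    using pow_span_carrier[OF z] d s JS subringE(1)[OF S] by auto
  have "s \<otimes> d = (s \<otimes> d') \<otimes> z \<oplus> s \<otimes> a" unfolding d(3) using R z by (simp add: r_distr m_assoc)
  then show ?case using pow_span_SucI[OF Suc(1)[OF d(1)] mult[OF s d(2)]] by simp
qed

lemma pow_span_zero:
  assumes z: "z \<in> carrier R"
  shows "\<zero> \<in> pow_span J z n"
proof (induction n)
  case (Suc n)
  have "\<zero> = \<zero> \<otimes> z \<oplus> \<zero>" using z by simp
  then show ?case using pow_span_SucI[OF Suc additive_subgroup.zero_closed[OF J]] by simp
qed simp

lemma pow_span_Suc:
  assumes z: "z \<in> carrier R"
  shows "d \<in> pow_span J z n \<Longrightarrow> d \<in> pow_span J z (Suc n)"
proof (induction n arbitrary: d)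
  case 0
  then show ?case using pow_span_zero[OF z, of 1] by simp
next
  case (Suc n)
  obtain d' a where d: "d' \<in> pow_span J z n" "a \<in> J" "d = d' \<otimes> z \<oplus> a" using Suc(2) by auto
  show ?case using pow_span_SucI[OF Suc(1)[OF d(1)] d(2)] d(3) by simp
qed

lemma pow_span_mono:
  assumes z: "z \<in> carrier R" and d: "d \<in> pow_span J z n" and nm: "n \<le> m"
  shows "d \<in> pow_span J z m"
  using nm d by (induction m rule: dec_induct) (use pow_span_Suc[OF z] in auto)

lemma pow_span_base:
  assumes z: "z \<in> carrier R" and a: "a \<in> J"
  shows "a \<in> pow_span J z (Suc n)"
proof -
  have "a = \<zero> \<otimes> z \<oplus> a" using z a JS subringE(1)[OF S] by auto
  then show ?thesis using pow_span_SucI[OF pow_span_zero[OF z] a] by simp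
qed

lemma pow_span_monom:
  assumes z: "z \<in> carrier R" and a: "a \<in> J"
  shows "a \<otimes> z [^] n \<in> pow_span J z (Suc n)"
proof (induction n)
  case 0
  have "a \<in> carrier R" using a JS subringE(1)[OF S] by auto
  then show ?case using pow_span_base[OF z a, of 0] by (simp del: pow_span.simps(2))
next
  case (Suc n)
  have aR: "a \<in> carrier R" using a JS subringE(1)[OF S] by auto
  have "a \<otimes> z [^] Suc n = (a \<otimes> z [^] n) \<otimes> z \<oplus> \<zero>" using aR z by (simp add: m_assoc)
  then show ?case using pow_span_SucI[OF Suc additive_subgroup.zero_closed[OF J]] by simp
qed

lemma pow_span_top:
  assumes z: "z \<in> carrier R"
  shows "d \<in> pow_span J z (Suc n) \<Longrightarrow> \<exists>a\<in>J. \<exists>e\<in>pow_span J z n. d = a \<otimes> z [^] n \<oplus> e"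
proof (induction n arbitrary: d)
  case 0
  then obtain a where a: "a \<in> J" "d = \<zero> \<otimes> z \<oplus> a" by auto
  have "a \<in> carrier R" using a JS subringE(1)[OF S] by auto
  then have "d = a \<otimes> z [^] (0::nat) \<oplus> \<zero>" using z a(2) by simp
  then show ?case using a(1) by (intro bexI[of _ a] bexI[of _ \<zero>]) auto
next
  case (Suc n)
  obtain d' b where d: "d' \<in> pow_span J z (Suc n)" "b \<in> J" "d = d' \<otimes> z \<oplus> b"
    using Suc(2) pow_span.simps(2)[of J z "Suc n"] by blast
  obtain a e where a: "a \<in> J" "e \<in> pow_span J z n" "d' = a \<otimes> z [^] n \<oplus> e" using Suc(1)[OF d(1)] by blast
  have R: "a \<in> carrier R" "b \<in> carrier R" "e \<in> carrier R"
    using pow_span_carrier[OF z a(2)] a d JS subringE(1)[OF S] by auto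
  have "d = a \<otimes> z [^] Suc n \<oplus> (e \<otimes> z \<oplus> b)" unfolding d(3) a(3) using R z by (simp add: l_distr m_assoc a_assoc)
  then show ?case using a(1) pow_span_SucI[OF a(2) d(2)] by blast
qed

text \<open>Multiplication by z^j reverses a polynomial in 1/z of degree at most j into one in
  z.\<close>

lemma pow_span_flip:
  assumes z: "z \<in> carrier R" "z \<noteq> \<zero>"
  shows "d \<in> pow_span J (inv z) n \<Longrightarrow> n \<le> Suc j \<Longrightarrow> z [^] j \<otimes> d \<in> pow_span J z (Suc j)"
proof (induction n arbitrary: d j)
  case 0
  then show ?case using pow_span_zero[OF z(1), of "Suc j"] z(1) by (simp del: pow_span.simps(2))
next
  case (Suc n)
  note iz = inv_field[OF z]
  obtain d' a where d: "d' \<in> pow_span J (inv z) n" "a \<in> J" "d = d' \<otimes> inv z \<oplus> a" using Suc(2) by auto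
  have R: "a \<in> carrier R" "d' \<in> carrier R" using pow_span_carrier[OF iz(1) d(1)] d JS subringE(1)[OF S] by auto
  have az: "z [^] j \<otimes> a \<in> pow_span J z (Suc j)" using pow_span_monom[OF z(1) d(2), of j] R z by (simp add: m_comm)
  show ?case
  proof (cases j)
    case 0
    then have "d' = \<zero>" using d(1) Suc(3) by simp
    then have "d = a" using d(3) R iz by simp
    then show ?thesis using az by simp
  next
    case (Suc i)
    have "z [^] j \<otimes> d = z [^] i \<otimes> (z \<otimes> inv z) \<otimes> d' \<oplus> z [^] j \<otimes> a"
      unfolding d(3) Suc using R z(1) iz(1) by (simp add: r_distr m_ac)
    then have e: "z [^] j \<otimes> d = z [^] i \<otimes> d' \<oplus> z [^] j \<otimes> a" using iz z R by simp
    have "z [^] i \<otimes> d' \<in> pow_span J z (Suc i)" using Suc.IH[OF d(1), of i] Suc.prems(2) Suc by simp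
    then have "z [^] i \<otimes> d' \<in> pow_span J z (Suc j)" using pow_span_Suc[OF z(1)] unfolding Suc by blast
    then show ?thesis unfolding e using pow_span_add[OF z(1)] az by blast
  qed
qed

text \<open>Degree descent in Chevalley's theorem: by the relation in 1/z, whose constant term is b,
  the product (1 - b) z^(n-1) is a polynomial of smaller degree, and this replaces the leading term
  of the relation in z.\<close>

lemma pow_span_reduce:
  assumes z: "z \<in> carrier R" "z \<noteq> \<zero>" and p: "\<one> \<in> pow_span J z n" and r: "\<one> \<in> pow_span J (inv z) m" and mn: "m \<le> n"
  shows "\<exists>n'<n. \<one> \<in> pow_span J z n'"
proof -
  note iz = inv_field[OF z]
  have "n \<noteq> 0" "m \<noteq> 0" using p r by (metis pow_span.simps(1) singletonD one_not_zero)+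
  then obtain n0 m0 where nm: "n = Suc n0" "m = Suc m0" by (meson not0_implies_Suc)
  obtain a e where a: "a \<in> J" "e \<in> pow_span J z n0" "\<one> = a \<otimes> z [^] n0 \<oplus> e"
    using pow_span_top[OF z(1), of \<one> n0] p nm by auto
  obtain d b where b: "d \<in> pow_span J (inv z) m0" "b \<in> J" "\<one> = d \<otimes> inv z \<oplus> b" using r nm by auto
  have R: "a \<in> carrier R" "b \<in> carrier R" "d \<in> carrier R" "e \<in> carrier R"
    using pow_span_carrier[OF z(1) a(2)] pow_span_carrier[OF iz(1) b(1)] a b JS subringE(1)[OF S] by auto
  have n0: "n0 \<noteq> 0"
  proof
    assume "n0 = 0"
    then have "d = \<zero>" using b(1) mn nm by simp
    then show False using b one R iz by simp
  qed
  then obtain n1 where n1: "n0 = Suc n1" by (cases n0) auto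
  have b1: "\<one> \<ominus> b = d \<otimes> inv z"
  proof -
    have "\<one> \<ominus> b = (d \<otimes> inv z \<oplus> b) \<ominus> b" using b(3) by simp
    then show ?thesis using R iz(1) by (simp add: a_minus_def a_assoc r_neg)
  qed
  have zz: "(\<one> \<ominus> b) \<otimes> z [^] n0 = z [^] n1 \<otimes> d"
  proof -
    have "(\<one> \<ominus> b) \<otimes> z [^] n0 = z [^] n1 \<otimes> d \<otimes> (inv z \<otimes> z)"
      unfolding b1 n1 using R z(1) iz(1) by (simp add: m_ac)
    then show ?thesis using iz z R by simp
  qed
  \<comment> \<open>Multiplying the relation in z by \<open>\<one> \<ominus> b\<close> and adding
    \<open>b\<close> back avoids dividing by \<open>\<one> \<ominus> b\<close>, which need not be a
    unit of \<open>S\<close>.\<close>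
  have "\<one> = b \<oplus> (\<one> \<ominus> b) \<otimes> (a \<otimes> z [^] n0 \<oplus> e)"
  proof -
    have "\<one> = b \<oplus> (\<one> \<ominus> b) \<otimes> \<one>" using R by algebra
    then show ?thesis using a(3) by simp
  qed
  also have "\<dots> = b \<oplus> (a \<otimes> ((\<one> \<ominus> b) \<otimes> z [^] n0) \<oplus> (\<one> \<ominus> b) \<otimes> e)"
    using R z(1) by (simp add: r_distr m_lcomm)
  finally have e1: "\<one> = b \<oplus> (a \<otimes> (z [^] n1 \<otimes> d) \<oplus> (\<one> \<ominus> b) \<otimes> e)" unfolding zz .
  have "z [^] n1 \<otimes> d \<in> pow_span J z n0" using pow_span_flip[OF z b(1), of n1] mn nm n1 by simp
  then have "a \<otimes> (z [^] n1 \<otimes> d) \<in> pow_span J z n0" using pow_span_mult[OF z(1)] a(1) JS by blast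
  moreover have "(\<one> \<ominus> b) \<otimes> e \<in> pow_span J z n0"
    using pow_span_mult[OF z(1) _ a(2)] subring_minus[OF S subringE(3)[OF S]] b(2) JS by blast
  moreover have "b \<in> pow_span J z n0" using pow_span_base[OF z(1) b(2)] n1 by simp
  ultimately have "\<one> \<in> pow_span J z n0" using e1 pow_span_add[OF z(1)] by metis
  then show ?thesis using nm by auto
qed

text \<open>Descent on n + m: the larger of the two degree bounds can always be lowered, z and 1/z
  being interchangeable.\<close>

lemma pow_span_not_both:
  assumes z: "z \<in> carrier R" "z \<noteq> \<zero>"
  shows "\<not> (\<one> \<in> pow_span J z n \<and> \<one> \<in> pow_span J (inv z) m)"
proof (induction "n + m" arbitrary: n m rule: less_induct)
  case less
  show ?case
  proof
    assume *: "\<one> \<in> pow_span J z n \<and> \<one> \<in> pow_span J (inv z) m"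
    note iz = inv_field[OF z]
    show False
    proof (cases "m \<le> n")
      case True
      then obtain n' where "n' < n" "\<one> \<in> pow_span J z n'" using pow_span_reduce[OF z] * by blast
      then show False using less[of n' m] * by auto
    next
      case False
      then obtain m' where "m' < m" "\<one> \<in> pow_span J (inv z) m'"
        using pow_span_reduce[OF iz(1,2), of m n] iz(5) * by auto
      then show False using less[of n m'] * by auto
    qed
  qed
qed

text \<open>Enlarges the pair (S, J) in the maximality argument of
  \<open>chevalley_extension\<close>; \<open>J'\<close> is the ideal of S[z] generated by
  \<open>J\<close>.\<close>

lemma pow_span_extend:
  assumes z: "z \<in> carrier R" and no: "\<And>n. \<one> \<notin> pow_span J z n"
  defines "J' \<equiv> (\<Union>n. pow_span J z n)"
  shows "subring (simple_extension S z) R" "additive_subgroup J' R" "J' \<subseteq> simple_extension S z" "\<one> \<notin> J'" "J \<subseteq> J'"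
    and "\<And>s a. s \<in> simple_extension S z \<Longrightarrow> a \<in> J' \<Longrightarrow> s \<otimes> a \<in> J'"
proof -
  show sub: "subring (simple_extension S z) R" using simple_extension_is_subring[OF S z] .
  have add: "a \<oplus> b \<in> J'" if ab: "a \<in> J'" "b \<in> J'" for a b
  proof -
    obtain n m where "a \<in> pow_span J z n" "b \<in> pow_span J z m" using ab unfolding J'_def by blast
    then have "a \<in> pow_span J z (max n m)" "b \<in> pow_span J z (max n m)" using pow_span_mono[OF z] by auto
    then show ?thesis using pow_span_add[OF z] by (auto simp: J'_def)
  qed
  have sm: "s \<otimes> a \<in> J'" if "s \<in> S" "a \<in> J'" for s a using that pow_span_mult[OF z] by (auto simp: J'_def)
  have J'R: "J' \<subseteq> carrier R" using pow_span_carrier[OF z] by (auto simp: J'_def)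
  show "additive_subgroup J' R"
  proof (rule additive_subgroupI[OF J'R])
    show "\<zero> \<in> J'" unfolding J'_def using pow_span_zero[OF z, of 0] by blast
    fix a b assume ab: "a \<in> J'" "b \<in> J'"
    have "(\<ominus> \<one>) \<otimes> b \<in> J'" using sm[OF _ ab(2)] subringE(3,5)[OF S] by blast
    moreover have "(\<ominus> \<one>) \<otimes> b = \<ominus> b" using ab(2) J'R by (auto simp: l_minus)
    ultimately show "a \<ominus> b \<in> J'" using add ab(1) by (simp add: a_minus_def)
  qed
  have zm: "a \<otimes> z \<in> J'" if a: "a \<in> J'" for a
  proof -
    obtain n where n: "a \<in> pow_span J z n" using a by (auto simp: J'_def)
    have "a \<otimes> z = a \<otimes> z \<oplus> \<zero>" using z a J'R by auto
    then have "a \<otimes> z \<in> pow_span J z (Suc n)" using pow_span_SucI[OF n additive_subgroup.zero_closed[OF J]] by simp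
    then show ?thesis unfolding J'_def by blast
  qed
  show "s \<otimes> a \<in> J'" if "s \<in> simple_extension S z" "a \<in> J'" for s a
    using that(1)
  proof (induction s rule: simple_extension.induct)
    case zero
    have "\<zero> \<in> J'" unfolding J'_def using pow_span_zero[OF z, of 0] by blast
    moreover have "\<zero> \<otimes> a = \<zero>" using that(2) J'R by auto
    ultimately show ?case by simp
  next
    case (lin s1 s2)
    have R: "s1 \<in> carrier R" "s2 \<in> carrier R" "a \<in> carrier R"
      using lin that(2) J'R subringE(1)[OF sub] subringE(1)[OF S] by auto
    have "(s1 \<otimes> z \<oplus> s2) \<otimes> a = (s1 \<otimes> a) \<otimes> z \<oplus> s2 \<otimes> a" using R z by (simp add: l_distr r_distr m_ac)
    then show ?case using add zm[OF lin(3)] sm[OF lin(2) that(2)] by simp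
  qed
  show "J' \<subseteq> simple_extension S z"
  proof
    fix d assume "d \<in> J'"
    then obtain n where "d \<in> pow_span J z n" by (auto simp: J'_def)
    then show "d \<in> simple_extension S z"
      by (induction n arbitrary: d) (use JS simple_extension.lin in \<open>auto\<close>)
  qed
  show "\<one> \<notin> J'" using no by (auto simp: J'_def)
  show "J \<subseteq> J'" unfolding J'_def using pow_span_base[OF z, of _ 0] by blast
qed

end

text \<open>A pair of a subring and a proper ideal that is maximal above (A, I) has a valuation ring
  as its first component: if neither z nor 1/z belonged to it, the ideal would generate \<one> after
  adjoining either of them, which \<open>pow_span_not_both\<close> forbids.\<close>

theorem chevalley_extension:
  assumes E: "subfield E R" and A: "subring A R" "A \<subseteq> E" and I: "additive_subgroup I R" "I \<subseteq> A"
    and IA: "\<And>s a. s \<in> A \<Longrightarrow> a \<in> I \<Longrightarrow> s \<otimes> a \<in> I" and one: "\<one> \<notin> I"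
  shows "\<exists>V. val_ring E V \<and> A \<subseteq> V \<and> (\<forall>a\<in>I. a = \<zero> \<or> inv a \<notin> V)"
proof -
  note ER = subfieldE(3)[OF E]
  define good where "good S J \<longleftrightarrow> subring S R \<and> S \<subseteq> E \<and> A \<subseteq> S \<and> additive_subgroup J R \<and> J \<subseteq> S \<and> I \<subseteq> J \<and>
    (\<forall>s\<in>S. \<forall>a\<in>J. s \<otimes> a \<in> J) \<and> \<one> \<notin> J" for S J
  \<comment> \<open>A pair is coded as one subset of a disjoint sum, \<open>S\<close> through
    \<open>Inl\<close> and \<open>J\<close> through \<open>Inr\<close>, so that Zorn's lemma for
    inclusion of sets applies to the componentwise order.\<close>
  define G where "G = {T. good (Inl -` T) (Inr -` T)}"
  have inG: "Inl ` S \<union> Inr ` J \<in> G" if "good S J" for S J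
  proof -
    have "Inl -` (Inl ` S \<union> Inr ` J) = S" "Inr -` (Inl ` S \<union> Inr ` J) = J" by auto
    then show ?thesis using that by (simp add: G_def)
  qed
  have "\<exists>M\<in>G. \<forall>T\<in>G. M \<subseteq> T \<longrightarrow> T = M"
  proof (rule subset_Zorn_nonempty)
    have "good A I" using A I IA one by (auto simp: good_def)
    then show "G \<noteq> {}" using inG by blast
    fix \<C> assume ne: "\<C> \<noteq> {}" and ch: "subset.chain G \<C>"
    have g: "good (Inl -` T) (Inr -` T)" if "T \<in> \<C>" for T
      using ch that by (auto simp: subset.chain_def G_def)
    have two: "\<exists>T\<in>\<C>. x \<in> T \<and> y \<in> T" if xy: "x \<in> \<Union>\<C>" "y \<in> \<Union>\<C>" for x y
    proof -
      obtain T1 T2 where "T1 \<in> \<C>" "x \<in> T1" "T2 \<in> \<C>" "y \<in> T2" using xy by blast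
      moreover from this have "T1 \<subseteq> T2 \<or> T2 \<subseteq> T1" using ch by (auto simp: subset.chain_def)
      ultimately show ?thesis by blast
    qed
    obtain T0 where T0: "T0 \<in> \<C>" using ne by blast
    have g0: "subring (Inl -` T0) R" "A \<subseteq> Inl -` T0" "additive_subgroup (Inr -` T0) R" "I \<subseteq> Inr -` T0"
      using g[OF T0] by (auto simp: good_def)
    have SE: "Inl -` \<Union>\<C> \<subseteq> E"
    proof
      fix a assume "a \<in> Inl -` \<Union>\<C>"
      then obtain T where "T \<in> \<C>" "a \<in> Inl -` T" by auto
      then show "a \<in> E" using g[of T] by (auto simp: good_def)
    qed
    have JS: "Inr -` \<Union>\<C> \<subseteq> Inl -` \<Union>\<C>"
    proof
      fix a assume "a \<in> Inr -` \<Union>\<C>"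
      then obtain T where T: "T \<in> \<C>" "a \<in> Inr -` T" by auto
      then have "a \<in> Inl -` T" using g[of T] by (auto simp: good_def)
      then show "a \<in> Inl -` \<Union>\<C>" using T by auto
    qed
    have "good (Inl -` \<Union>\<C>) (Inr -` \<Union>\<C>)"
      unfolding good_def
    proof (intro conjI ballI)
      show "subring (Inl -` \<Union>\<C>) R"
      proof (rule subringI)
        show "Inl -` \<Union>\<C> \<subseteq> carrier R" using SE ER by (rule subset_trans)
        show "\<one> \<in> Inl -` \<Union>\<C>" using subringE(3)[OF g0(1)] T0 by auto
        fix a b assume ab: "a \<in> Inl -` \<Union>\<C>" "b \<in> Inl -` \<Union>\<C>"
        then obtain T where T: "T \<in> \<C>" "Inl a \<in> T" "Inl b \<in> T" using two[of "Inl a" "Inl b"] by auto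
        have Tr: "subring (Inl -` T) R" using g[OF T(1)] by (simp add: good_def)
        show "\<ominus> a \<in> Inl -` \<Union>\<C>" using subringE(5)[OF Tr, of a] T by auto
        show "a \<oplus> b \<in> Inl -` \<Union>\<C>" using subringE(7)[OF Tr, of a b] T by auto
        show "a \<otimes> b \<in> Inl -` \<Union>\<C>" using subringE(6)[OF Tr, of a b] T by auto
      qed
      show "Inl -` \<Union>\<C> \<subseteq> E" by (rule SE)
      show "A \<subseteq> Inl -` \<Union>\<C>" "I \<subseteq> Inr -` \<Union>\<C>" using g0(2,4) T0 by auto
      show "Inr -` \<Union>\<C> \<subseteq> Inl -` \<Union>\<C>" by (rule JS)
      show "\<one> \<notin> Inr -` \<Union>\<C>"
      proof
        assume "\<one> \<in> Inr -` \<Union>\<C>"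
        then obtain T where "T \<in> \<C>" "\<one> \<in> Inr -` T" by auto
        then show False using g[of T] by (auto simp: good_def)
      qed
      show "additive_subgroup (Inr -` \<Union>\<C>) R"
      proof (rule additive_subgroupI)
        show "Inr -` \<Union>\<C> \<subseteq> carrier R" using JS SE ER by (meson subset_trans)
        show "\<zero> \<in> Inr -` \<Union>\<C>" using additive_subgroup.zero_closed[OF g0(3)] T0 by auto
        fix a b assume "a \<in> Inr -` \<Union>\<C>" "b \<in> Inr -` \<Union>\<C>"
        then obtain T where T: "T \<in> \<C>" "Inr a \<in> T" "Inr b \<in> T" using two[of "Inr a" "Inr b"] by auto
        have "additive_subgroup (Inr -` T) R" using g[OF T(1)] by (simp add: good_def)
        then show "a \<ominus> b \<in> Inr -` \<Union>\<C>" using additive_subgroup_minus[of "Inr -` T" a b] T by auto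
      qed
      fix s a assume "s \<in> Inl -` \<Union>\<C>" "a \<in> Inr -` \<Union>\<C>"
      then obtain T where T: "T \<in> \<C>" "Inl s \<in> T" "Inr a \<in> T" using two[of "Inl s" "Inr a"] by auto
      have "\<forall>s\<in>Inl -` T. \<forall>a\<in>Inr -` T. s \<otimes> a \<in> Inr -` T" using g[OF T(1)] by (simp add: good_def)
      then show "s \<otimes> a \<in> Inr -` \<Union>\<C>" using T by auto
    qed
    then show "\<Union>\<C> \<in> G" by (simp add: G_def)
  qed
  then obtain M where M: "M \<in> G" and max: "\<And>T. T \<in> G \<Longrightarrow> M \<subseteq> T \<Longrightarrow> T = M" by blast
  define S J where "S = Inl -` M" "J = Inr -` M"
  have gM: "good S J" using M by (simp add: G_def S_J_def)
  have Meq: "M = Inl ` S \<union> Inr ` J"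
  proof (intro equalityI subsetI)
    fix x assume "x \<in> M" then show "x \<in> Inl ` S \<union> Inr ` J" by (cases x) (auto simp: S_J_def)
  qed (auto simp: S_J_def)
  have maxS: "S' = S" if "good S' J'" "S \<subseteq> S'" "J \<subseteq> J'" for S' J'
  proof -
    have "Inl ` S' \<union> Inr ` J' = M" using max[OF inG[OF that(1)]] that(2,3) Meq by blast
    then show ?thesis unfolding S_J_def by auto
  qed
  have S: "subring S R" "S \<subseteq> E" "A \<subseteq> S" and J: "additive_subgroup J R" "J \<subseteq> S" "I \<subseteq> J" "\<one> \<notin> J"
    and SJ: "\<And>s a. s \<in> S \<Longrightarrow> a \<in> J \<Longrightarrow> s \<otimes> a \<in> J" using gM by (auto simp: good_def)
  \<comment> \<open>Otherwise adjoining \<open>z\<close> would give a strictly larger pair.\<close>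
  have ext: "\<exists>n. \<one> \<in> pow_span J z n" if z: "z \<in> E" "z \<notin> S" for z
  proof (rule ccontr)
    assume "\<not> ?thesis"
    then have no: "\<And>n. \<one> \<notin> pow_span J z n" by blast
    have zR: "z \<in> carrier R" using z ER by auto
    note x = pow_span_extend[OF S(1) J(1,2) SJ J(4) zR no]
    have SS: "S \<subseteq> simple_extension S z" "z \<in> simple_extension S z"
      using simple_extension_incl[OF subringE(1)[OF S(1)] zR] simple_extension_mem[OF S(1) zR] by auto
    have SE: "simple_extension S z \<subseteq> E" using simple_extension_subring_incl[OF subfieldE(1)[OF E] S(2) z(1)] .
    have "good (simple_extension S z) (\<Union>n. pow_span J z n)"
      unfolding good_def
    proof (intro conjI ballI)
      show "A \<subseteq> simple_extension S z" using S(3) SS(1) by (rule subset_trans)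
      show "I \<subseteq> (\<Union>n. pow_span J z n)" using J(3) x(5) by (rule subset_trans)
      show "subring (simple_extension S z) R" by (rule x(1))
      show "simple_extension S z \<subseteq> E" by (rule SE)
      show "additive_subgroup (\<Union>n. pow_span J z n) R" by (rule x(2))
      show "(\<Union>n. pow_span J z n) \<subseteq> simple_extension S z" by (rule x(3))
      show "\<one> \<notin> (\<Union>n. pow_span J z n)" by (rule x(4))
      fix s a assume "s \<in> simple_extension S z" "a \<in> (\<Union>n. pow_span J z n)"
      then show "s \<otimes> a \<in> (\<Union>n. pow_span J z n)" using x(6) by blast
    qed
    then have "simple_extension S z = S" using maxS[OF _ SS(1) x(5)] by blast
    then show False using SS z by simp
  qed
  have "val_ring E S"
    unfolding val_ring_def
  proof (intro conjI ballI E S(1,2))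
    fix z assume z: "z \<in> E - {\<zero>}"
    have zR: "z \<in> carrier R" "z \<noteq> \<zero>" using z ER by auto
    have izE: "inv z \<in> E" using subfield_inv[OF E] z by auto
    show "z \<in> S \<or> inv z \<in> S"
    proof (rule ccontr)
      assume "\<not> (z \<in> S \<or> inv z \<in> S)"
      then obtain n m where "\<one> \<in> pow_span J z n" "\<one> \<in> pow_span J (inv z) m"
        using ext[of z] ext[OF izE] z by auto
      then show False using pow_span_not_both[OF S(1) J(1,2) SJ J(4) zR] by blast
    qed
  qed
  moreover have "a = \<zero> \<or> inv a \<notin> S" if "a \<in> I" for a
  proof (rule ccontr)
    assume "\<not> ?thesis"
    then have "inv a \<in> S" "a \<noteq> \<zero>" "a \<in> J" "a \<in> carrier R" using that J S ER by blast+
    then have "\<one> \<in> J" using SJ[of "inv a" a] inv_field(4)[of a] by simp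
    then show False using J(4) by simp
  qed
  ultimately show ?thesis using S(3) by blast
qed

end

section \<open>Restriction and ramification of places over a finite constant field\<close>

locale constant_field = field R for R (structure) +
  fixes k
  assumes subfield_k: "subfield k R" and finite_k: "finite k"
begin

abbreviation "ff \<equiv> function_field R k"
abbreviation "val_of \<equiv> ring_of_place R"

lemma ff_subfield: "ff F \<Longrightarrow> subfield F R"
  by (simp add: function_field_def)

lemma place_discrete: "ff F \<Longrightarrow> P \<in> places R k F \<Longrightarrow> discrete_place F P"
  using function_field_place_discrete finite_k by blast

lemma places_overD:
  assumes "Q \<in> places_over R k E P"
  shows "Q \<in> places R k E" "P \<subseteq> Q"
  using assms by (auto simp: places_over_def)

lemma place_contains_k:
  assumes "ff F" "P \<in> places R k F"
  shows "k \<subseteq> val_of F P"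
  using placeE(1)[OF ff_subfield[OF assms(1)] assms(2)] by (auto simp: valuation_ring_def)

text \<open>Were an element z of the ring of \<open>P\<close> to have a pole at \<open>Q\<close>,
  then z^n p with p in \<open>P\<close> would stay in \<open>P\<close>, hence in \<open>Q\<close>,
  although its value at \<open>Q\<close> decreases without bound. The resulting inclusion of rings
  is an equality by \<open>dp_maximal\<close>.\<close>

lemma places_over_restrict:
  assumes F: "ff F" and E: "ff E" and FE: "F \<subseteq> E" and P: "P \<in> places R k F" and Q: "Q \<in> places_over R k E P"
  shows "val_of E Q \<inter> F = val_of F P" "Q \<inter> F = P"
proof -
  have dP: "discrete_place F P" using place_discrete[OF F P] .
  have dQ: "discrete_place E Q" using place_discrete[OF E] places_overD[OF Q] by blast
  have PQ: "P \<subseteq> Q" using places_overD[OF Q] by blast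
  note fP = dp_facts[OF dP] and fQ = dp_facts[OF dQ]
  obtain p where p: "p \<in> P" "p \<noteq> \<zero>" using dp_uniformizer[OF dP] by blast
  have pF: "p \<in> F" "p \<in> E" "p \<in> Q" using p fP PQ FE by auto
  have W: "val_ring F (val_of E Q \<inter> F)" using val_ring_inter_subfield[OF fQ(6) fP(1) FE] .
  have "inv p \<in> F" "inv p \<notin> val_of E Q" using subfield_inv(1)[OF fP(1) pF(1) p(2)] fQ(8) pF p by auto
  then have ne: "val_of E Q \<inter> F \<noteq> F" by blast
  have "val_of F P \<subseteq> val_of E Q \<inter> F"
  proof (rule subsetI, rule ccontr)
    fix z assume z: "z \<in> val_of F P" "z \<notin> val_of E Q \<inter> F"
    have zF: "z \<in> F" "z \<in> E" "z \<notin> val_of E Q" using z fP(3) FE by auto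
    have z0: "z \<noteq> \<zero>" using zF subringE(2)[OF fQ(2)] by auto
    have vz: "place_valuation R E Q z \<le> - 1" using dp_val_nonneg_iff[OF dQ zF(2) z0] zF by simp
    \<comment> \<open>This many factors bring the value of z^n p at \<open>Q\<close> down to at most
      0, whereas elements of \<open>Q\<close> have value at least 1.\<close>
    define n where "n = nat \<bar>place_valuation R E Q p\<bar>"
    note zn = dp_val_pow[OF dQ zF(2) z0, of n]
    have znP: "z [^] n \<in> val_of F P" by (induction n) (use z subringE(3,6)[OF fP(2)] in auto)
    have "z [^] n \<otimes> p \<in> P"
      using val_ring_nonunits_mult[OF fP(6) _ _ znP, of p] fP(8) p subringE(6)[OF fP(2)] znP by auto
    then have inQ: "z [^] n \<otimes> p \<in> Q" using PQ by blast
    have nz: "z [^] n \<otimes> p \<noteq> \<zero>" using integral[of "z [^] n" p] zn p fQ(4) pF by auto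
    have "1 \<le> place_valuation R E Q (z [^] n \<otimes> p)" using dp_val_pos_iff[OF dQ _ nz] inQ fQ(3,9) by auto
    moreover have "place_valuation R E Q (z [^] n \<otimes> p) = int n * place_valuation R E Q z + place_valuation R E Q p"
      using dp_val_mult[OF dQ zn(1,2) pF(2) p(2)] zn(3) by simp
    moreover have "int n * place_valuation R E Q z \<le> int n * (- 1)" using vz by (intro mult_left_mono) auto
    ultimately show False by (simp add: n_def)
  qed
  then show eq: "val_of E Q \<inter> F = val_of F P" using dp_maximal[OF dP W _ ne] by blast
  show "Q \<inter> F = P"
  proof (intro equalityI subsetI)
    fix z assume z: "z \<in> Q \<inter> F"
    then have "z \<in> val_of E Q" "z = \<zero> \<or> inv z \<notin> val_of E Q" using fQ(8) by auto
    then show "z \<in> P" using z eq fP(8) by blast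
  qed (use PQ fP(3,9) in auto)
qed

text \<open>The nonzero element \<open>a\<close> keeps the restriction of \<open>Q\<close> to
  \<open>F\<close> from being trivial.\<close>

lemma restrict_place:
  assumes F: "ff F" and E: "ff E" and FE: "F \<subseteq> E" and Q: "Q \<in> places R k E" and a: "a \<in> Q" "a \<in> F" "a \<noteq> \<zero>"
  shows "Q \<inter> F \<in> places R k F" "Q \<in> places_over R k E (Q \<inter> F)"
proof -
  have dQ: "discrete_place E Q" using place_discrete[OF E Q] .
  note fQ = dp_facts[OF dQ]
  have Ff: "subfield F R" using ff_subfield[OF F] .
  let ?V = "val_of E Q \<inter> F"
  have V: "val_ring F ?V" using val_ring_inter_subfield[OF fQ(6) Ff FE] .
  have ia: "inv a \<notin> val_of E Q" "inv a \<in> F" "a \<in> val_of E Q" using fQ(8) a subfield_inv(1)[OF Ff] by auto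
  have kV: "k \<subseteq> ?V" using place_contains_k[OF E Q] F by (auto simp: function_field_def)
  have "a \<notin> k"
    using constants_meet_place[OF subfield_k place_contains_k[OF E Q], of a] ia a by blast
  then have kneq: "k \<noteq> ?V" using ia a by blast
  have "?V \<noteq> F" using ia by blast
  then have "valuation_ring R k F ?V" using V kV kneq unfolding valuation_ring_def val_ring_def by blast
  then have "{z \<in> ?V. z = \<zero> \<or> inv z \<notin> ?V} \<in> places R k F" using place_of_valuation_ring[OF Ff] by blast
  moreover have "{z \<in> ?V. z = \<zero> \<or> inv z \<notin> ?V} = Q \<inter> F"
  proof -
    have "inv z \<in> F" if "z \<in> F" "z \<noteq> \<zero>" for z using subfield_inv(1)[OF Ff that] .
    then show ?thesis using fQ(8) by blast
  qed
  ultimately show "Q \<inter> F \<in> places R k F" by simp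
  then show "Q \<in> places_over R k E (Q \<inter> F)" using Q by (simp add: places_over_def)
qed

lemma places_over_trans:
  assumes F: "ff F" and K: "ff K" and E: "ff E" and FK: "F \<subseteq> K" and KE: "K \<subseteq> E"
    and P: "P \<in> places R k F" and Q: "Q \<in> places_over R k E P"
  shows "Q \<inter> K \<in> places_over R k K P" "Q \<in> places_over R k E (Q \<inter> K)"
proof -
  have dP: "discrete_place F P" using place_discrete[OF F P] .
  obtain p where p: "p \<in> P" "p \<noteq> \<zero>" using dp_uniformizer[OF dP] by blast
  have PK: "P \<subseteq> K" using dp_facts(3,9)[OF dP] FK by blast
  have PQ: "P \<subseteq> Q" using places_overD[OF Q] by blast
  have "Q \<inter> K \<in> places R k K" "Q \<in> places_over R k E (Q \<inter> K)"
    using restrict_place[OF K E KE, of Q p] places_overD[OF Q] p PK by auto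
  then show "Q \<inter> K \<in> places_over R k K P" "Q \<in> places_over R k E (Q \<inter> K)"
    using PQ PK by (auto simp: places_over_def)
qed

text \<open>Units of the ring of \<open>P\<close> remain units at \<open>Q\<close>, so the value at
  \<open>Q\<close> of an element of \<open>F\<close> is governed by that of a uniformizer. Hence the
  number described by \<open>ramification_index\<close> exists and is unique.\<close>

lemma ramification:
  assumes F: "ff F" and E: "ff E" and FE: "F \<subseteq> E" and P: "P \<in> places R k F" and Q: "Q \<in> places_over R k E P"
  shows "\<And>x. x \<in> F \<Longrightarrow> x \<noteq> \<zero> \<Longrightarrow>
      place_valuation R E Q x = int (ramification_index R F P E Q) * place_valuation R F P x"
    and "1 \<le> ramification_index R F P E Q"
proof -
  have dP: "discrete_place F P" using place_discrete[OF F P] .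
  have dQ: "discrete_place E Q" using place_discrete[OF E] places_overD[OF Q] by blast
  note fP = dp_facts[OF dP] and fQ = dp_facts[OF dQ]
  note r = places_over_restrict[OF assms]
  obtain t where t: "prime_element R F P t" "t \<in> F" "t \<in> carrier R" "t \<noteq> \<zero>" "t \<in> P" by (rule dp_prime[OF dP])
  have vt: "place_valuation R F P t = 1" using dp_val_prime[OF dP t(1)] .
  have tE: "t \<in> E" "t \<in> Q" using t FE places_overD[OF Q] by auto
  have e1: "1 \<le> place_valuation R E Q t" using dp_val_pos_iff[OF dQ tE(1) t(4)] tE by simp
  have unit: "place_valuation R E Q u = 0" if u: "u \<in> F" "u \<noteq> \<zero>" "place_valuation R F P u = 0" for u
  proof -
    have "u \<in> val_of F P" "inv u \<in> val_of F P"
      using dp_val_nonneg_iff[OF dP u(1,2)] dp_val_nonneg_iff[OF dP subfield_inv(1,2)[OF fP(1) u(1,2)]]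
        dp_val_inv[OF dP u(1,2)] u(3) by auto
    then have "u \<in> val_of E Q" "inv u \<in> val_of E Q" using r by auto
    moreover have "u \<in> E" "inv u \<in> E" "inv u \<noteq> \<zero>" using u FE subfield_inv[OF fP(1) u(1,2)] by auto
    ultimately have "0 \<le> place_valuation R E Q u" "0 \<le> - place_valuation R E Q u"
      using dp_val_nonneg_iff[OF dQ] dp_val_inv[OF dQ] u(2) by metis+
    then show ?thesis by simp
  qed
  have pos: "place_valuation R E Q x = place_valuation R E Q t * place_valuation R F P x"
    if x: "x \<in> F" "x \<noteq> \<zero>" "0 \<le> place_valuation R F P x" for x
  proof -
    define n where "n = nat (place_valuation R F P x)"
    have n: "place_valuation R F P x = int n" using x(3) by (simp add: n_def)
    note tnP = dp_val_pow[OF dP t(2,4), of n] and tnQ = dp_val_pow[OF dQ tE(1) t(4), of n]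
    note itn = subfield_inv[OF fP(1) tnP(1,2)]
    define u where "u = x \<otimes> inv (t [^] n)"
    have R: "x \<in> carrier R" "t [^] n \<in> carrier R" "inv (t [^] n) \<in> carrier R" using x tnP itn fP(4) by auto
    have u: "u \<in> F" "u \<noteq> \<zero>" unfolding u_def
      using x itn subringE(6)[OF subfieldE(1)[OF fP(1)]] integral[of x "inv (t [^] n)"] R by auto
    have xu: "x = u \<otimes> t [^] n" unfolding u_def using R itn by (simp add: m_assoc)
    have "place_valuation R F P u = 0"
      unfolding u_def using dp_val_mult[OF dP x(1,2) itn(1,2)] dp_val_inv[OF dP tnP(1,2)] tnP(3) vt n by simp
    then have "place_valuation R E Q u = 0" using unit u by blast
    then show ?thesis
      using dp_val_mult[OF dQ _ u(2) tnQ(1,2)] xu u(1) FE tnQ(3) n by (auto simp: mult.commute)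
  qed
  have all: "place_valuation R E Q x = place_valuation R E Q t * place_valuation R F P x" if x: "x \<in> F" "x \<noteq> \<zero>" for x
  proof (cases "0 \<le> place_valuation R F P x")
    case False
    note ix = subfield_inv[OF fP(1) x]
    have "place_valuation R E Q (inv x) = place_valuation R E Q t * place_valuation R F P (inv x)"
      using pos[OF ix(1,2)] dp_val_inv[OF dP x] False by simp
    then show ?thesis using dp_val_inv[OF dP x] dp_val_inv[OF dQ _ x(2)] x FE by auto
  qed (use pos x in blast)
  have re: "int (ramification_index R F P E Q) = place_valuation R E Q t"
  proof -
    have "ramification_index R F P E Q = nat (place_valuation R E Q t)"
      unfolding ramification_index_def
    proof (rule the_equality)
      show "\<forall>x\<in>F - {\<zero>}. place_valuation R E Q x = int (nat (place_valuation R E Q t)) * place_valuation R F P x"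
        using all e1 by simp
      fix e assume "\<forall>x\<in>F - {\<zero>}. place_valuation R E Q x = int e * place_valuation R F P x"
      then have "place_valuation R E Q t = int e" using t vt by auto
      then show "e = nat (place_valuation R E Q t)" by simp
    qed
    then show ?thesis using e1 by simp
  qed
  show "place_valuation R E Q x = int (ramification_index R F P E Q) * place_valuation R F P x"
    if "x \<in> F" "x \<noteq> \<zero>" for x using all[OF that] re by simp
  show "1 \<le> ramification_index R F P E Q" using re e1 by simp
qed

lemma ramification_tower:
  assumes F: "ff F" and K: "ff K" and E: "ff E" and FK: "F \<subseteq> K" and KE: "K \<subseteq> E"
    and P: "P \<in> places R k F" and S: "S \<in> places_over R k K P" and Q: "Q \<in> places_over R k E S"
  shows "Q \<in> places_over R k E P"
    and "ramification_index R F P E Q = ramification_index R K S E Q * ramification_index R F P K S"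
proof -
  show QP: "Q \<in> places_over R k E P" using Q S by (auto simp: places_over_def)
  have dP: "discrete_place F P" using place_discrete[OF F P] .
  obtain t where t: "prime_element R F P t" "t \<in> F" "t \<in> carrier R" "t \<noteq> \<zero>" "t \<in> P" by (rule dp_prime[OF dP])
  have vt: "place_valuation R F P t = 1" using dp_val_prime[OF dP t(1)] .
  have FE: "F \<subseteq> E" and SK: "S \<in> places R k K" using FK KE places_overD[OF S] by auto
  have tK: "t \<in> K" using t FK by auto
  have "int (ramification_index R F P E Q) = int (ramification_index R K S E Q) * int (ramification_index R F P K S)"
    using ramification(1)[OF F E FE P QP t(2,4)] ramification(1)[OF K E KE SK Q tK t(4)]
      ramification(1)[OF F K FK P S t(2,4)] vt by simp
  then show "ramification_index R F P E Q = ramification_index R K S E Q * ramification_index R F P K S"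
    by (metis of_nat_eq_iff of_nat_mult)
qed

text \<open>Chevalley's theorem gives a valuation ring in which the nonzero element \<open>a\<close>
  of \<open>I\<close> is a non-unit; this makes the ring different from \<open>E\<close> and
  strictly larger than \<open>k\<close>.\<close>

lemma place_of_ideal:
  assumes E: "ff E" and A: "subring A R" "A \<subseteq> E" "k \<subseteq> A" and I: "additive_subgroup I R" "I \<subseteq> A"
    and IA: "\<And>s a. s \<in> A \<Longrightarrow> a \<in> I \<Longrightarrow> s \<otimes> a \<in> I" and one: "\<one> \<notin> I" and a: "a \<in> I" "a \<noteq> \<zero>"
  shows "\<exists>Q\<in>places R k E. A \<subseteq> val_of E Q \<and> I \<subseteq> Q"
proof -
  have Ef: "subfield E R" using ff_subfield[OF E] .
  obtain V where V: "val_ring E V" "A \<subseteq> V" and Iv: "\<And>a. a \<in> I \<Longrightarrow> a = \<zero> \<or> inv a \<notin> V"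
    using chevalley_extension[OF Ef A(1,2) I IA one] by blast
  have kV: "k \<subseteq> V" using A V by blast
  have aV: "a \<in> V" "a \<in> E" "inv a \<notin> V" using a I V A Iv[OF a(1)] by auto
  have "a \<notin> k" using constants_meet_place[OF subfield_k kV, of a] aV a by blast
  then have "k \<noteq> V" using aV by blast
  moreover have "V \<noteq> E" using aV subfield_inv(1)[OF Ef aV(2) a(2)] by blast
  ultimately have VV: "valuation_ring R k E V" using V kV unfolding valuation_ring_def val_ring_def by blast
  show ?thesis
    using place_of_valuation_ring[OF Ef VV] V(2) I(2) Iv
    by (intro bexI[of _ "{z \<in> V. z = \<zero> \<or> inv z \<notin> V}"]) auto
qed

text \<open>For the inclusion from right to left, adjoin w = 1/z to the ring of \<open>P\<close>. If
  \<open>P\<close> and w generated a proper ideal, a place over \<open>P\<close> would contain w,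
  and z would have a pole there. Hence 1 = p + w s with p in \<open>P\<close>, and as 1 - p is a
  unit, z is a polynomial in 1/z, which is an integral equation in disguise.\<close>

lemma integral_closure_eq:
  assumes F: "ff F" and E: "ff E" and FE: "F \<subseteq> E" and P: "P \<in> places R k F"
  shows "integral_closure_in R (val_of F P) E = {z \<in> E. \<forall>Q\<in>places_over R k E P. z \<in> val_of E Q}"
proof (intro equalityI subsetI)
  have dP: "discrete_place F P" using place_discrete[OF F P] .
  note fP = dp_facts[OF dP]
  fix z
  show "z \<in> {z \<in> E. \<forall>Q\<in>places_over R k E P. z \<in> val_of E Q}" if z: "z \<in> integral_closure_in R (val_of F P) E"
  proof -
    obtain p where p: "z \<in> E" "p \<noteq> []" "polynomial (val_of F P) p" "lead_coeff p = \<one>" "eval p z = \<zero>"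
      using z by (auto simp: integral_closure_in_def)
    have "z \<in> val_of E Q" if Q: "Q \<in> places_over R k E P" for Q
    proof -
      have dQ: "discrete_place E Q" using place_discrete[OF E] places_overD[OF Q] by blast
      have "set p \<subseteq> val_of E Q"
        using p(3) places_over_restrict(1)[OF F E FE P Q] by (auto simp: polynomial_def)
      then show ?thesis using integral_in_val_ring[OF dp_facts(6)[OF dQ] p(1) _ p(2,4,5)] by blast
    qed
    then show ?thesis using p(1) by blast
  qed
  assume "z \<in> {z \<in> E. \<forall>Q\<in>places_over R k E P. z \<in> val_of E Q}"
  then have zE: "z \<in> E" and all: "\<And>Q. Q \<in> places_over R k E P \<Longrightarrow> z \<in> val_of E Q" by auto
  have Ef: "subfield E R" using ff_subfield[OF E] .
  note ER = subfieldE(3)[OF Ef]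
  have zR: "z \<in> carrier R" using zE ER by auto
  let ?O = "val_of F P"
  have PO: "P \<subseteq> ?O" using fP(9) .
  have OR: "?O \<subseteq> carrier R" and O1: "\<one> \<in> ?O" "\<zero> \<in> ?O" using fP(5) subringE(2,3)[OF fP(2)] by auto
  have Pz: "\<zero> \<in> P" using vg_1[OF dP] vg_subset(2)[OF dP, of 1] by simp
  have Pg: "additive_subgroup P R" using vg_1[OF dP] vg_subgroup[OF dP, of 1] by simp
  show "z \<in> integral_closure_in R ?O E"
  proof (cases "z = \<zero>")
    case True
    have "eval [\<one>, \<zero>] z = \<zero>" using True by simp
    moreover have "polynomial ?O [\<one>, \<zero>]" using O1 by (simp add: polynomial_def)
    ultimately show ?thesis unfolding integral_closure_in_def using zE by force
  next
    case z0: False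
    define w where "w = inv z"
    note iz = inv_field[OF zR z0]
    have w: "w \<in> carrier R" "w \<noteq> \<zero>" "z \<otimes> w = \<one>" "w \<otimes> z = \<one>" "w \<in> E"
      using iz subfield_inv(1)[OF Ef zE z0] by (auto simp: w_def)
    let ?A = "simple_extension ?O w"
    have A: "subring ?A R" using simple_extension_is_subring[OF fP(2) w(1)] .
    have AE: "?A \<subseteq> E" using simple_extension_subring_incl[OF subfieldE(1)[OF Ef] _ w(5)] fP(3) FE by blast
    have AR: "?A \<subseteq> carrier R" using AE ER by blast
    have OA: "?O \<subseteq> ?A" "w \<in> ?A" using simple_extension_incl[OF OR w(1)] simple_extension_mem[OF fP(2) w(1)] by auto
    define I where "I = {p \<oplus> w \<otimes> s | p s. p \<in> P \<and> s \<in> ?A}"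
    have II: "p \<oplus> w \<otimes> s \<in> I" if "p \<in> P" "s \<in> ?A" for p s using that by (auto simp: I_def)
    have PR: "P \<subseteq> carrier R" using PO OR by blast
    have "\<one> \<in> I"
    proof (rule ccontr)
      assume one: "\<one> \<notin> I"
      have I: "additive_subgroup I R"
      proof (rule additive_subgroupI)
        show "I \<subseteq> carrier R" unfolding I_def using PR AR w by auto
        have "\<zero> = \<zero> \<oplus> w \<otimes> \<zero>" using w by simp
        then show "\<zero> \<in> I" using II[OF Pz subringE(2)[OF A]] by simp
        fix a b assume "a \<in> I" "b \<in> I"
        then obtain p s p' s' where ps: "p \<in> P" "s \<in> ?A" "a = p \<oplus> w \<otimes> s" "p' \<in> P" "s' \<in> ?A" "b = p' \<oplus> w \<otimes> s'"
          by (auto simp: I_def)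
        have R: "p \<in> carrier R" "p' \<in> carrier R" "s \<in> carrier R" "s' \<in> carrier R" using ps PR AR by auto
        have "a \<ominus> b = (p \<ominus> p') \<oplus> w \<otimes> (s \<ominus> s')" unfolding ps(3,6) using R w(1) by algebra
        then show "a \<ominus> b \<in> I" using II[OF additive_subgroup_minus[OF Pg ps(1,4)] subring_minus[OF A ps(2,5)]] by simp
      qed
      have IA: "I \<subseteq> ?A" unfolding I_def using OA PO subringE(6,7)[OF A] by blast
      have mult: "s \<otimes> a \<in> I" if sa: "s \<in> ?A" "a \<in> I" for s a
      proof -
        obtain p s' where ps: "p \<in> P" "s' \<in> ?A" "a = p \<oplus> w \<otimes> s'" using sa(2) by (auto simp: I_def)
        \<comment> \<open>The constant term \<open>s2\<close> multiplies \<open>p\<close> into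
          \<open>P\<close>; the rest of \<open>s\<close> is divisible by \<open>w\<close>.\<close>
        obtain s1 s2 where s12: "s1 \<in> ?A" "s2 \<in> ?O" "s = s1 \<otimes> w \<oplus> s2"
          using sa(1)
        proof (cases rule: simple_extension.cases)
          case zero
          have "s = \<zero> \<otimes> w \<oplus> \<zero>" using zero w by simp
          then show ?thesis using that subringE(2)[OF A] O1 by blast
        qed (use that in blast)
        have R: "p \<in> carrier R" "s' \<in> carrier R" "s \<in> carrier R" "s1 \<in> carrier R" "s2 \<in> carrier R" using ps s12 sa PR AR OR by auto
        have "s \<otimes> a = s \<otimes> p \<oplus> w \<otimes> (s \<otimes> s')" unfolding ps(3) using R w(1) by (simp add: r_distr m_lcomm)
        also have "s \<otimes> p = s2 \<otimes> p \<oplus> w \<otimes> (s1 \<otimes> p)" unfolding s12(3) using R w(1) by (simp add: l_distr r_distr m_ac a_comm)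
        also have "(s2 \<otimes> p \<oplus> w \<otimes> (s1 \<otimes> p)) \<oplus> w \<otimes> (s \<otimes> s') = s2 \<otimes> p \<oplus> w \<otimes> (s1 \<otimes> p \<oplus> s \<otimes> s')"
          using R w(1) by (simp add: r_distr a_assoc)
        finally have e: "s \<otimes> a = s2 \<otimes> p \<oplus> w \<otimes> (s1 \<otimes> p \<oplus> s \<otimes> s')" .
        have "s2 \<otimes> p \<in> P" using val_ring_nonunits_mult[OF fP(6) _ _ s12(2), of p] fP(8) ps(1) subringE(6)[OF fP(2)] s12(2) by auto
        moreover have "s1 \<otimes> p \<oplus> s \<otimes> s' \<in> ?A"
        proof -
          have "p \<in> ?A" using ps(1) PO OA by blast
          then show ?thesis using s12(1) ps(2) sa(1) subringE(6,7)[OF A] by auto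
        qed
        ultimately show ?thesis using e II by simp
      qed
      have "w = \<zero> \<oplus> w \<otimes> \<one>" using w by simp
      then have wI: "w \<in> I" using II[OF Pz subringE(3)[OF A]] by simp
      have kA: "k \<subseteq> ?A" using place_contains_k[OF F P] OA by blast
      obtain Q where Q: "Q \<in> places R k E" "I \<subseteq> Q" using place_of_ideal[OF E A AE kA I IA mult one wI w(2)] by blast
      have "P \<subseteq> I"
      proof
        fix p assume p: "p \<in> P"
        have "p = p \<oplus> w \<otimes> \<zero>" using p PR w by auto
        then show "p \<in> I" using II[OF p subringE(2)[OF A]] by simp
      qed
      then have "Q \<in> places_over R k E P" using Q by (auto simp: places_over_def)
      then have zQ: "z \<in> val_of E Q" using all by blast
      have dQ: "discrete_place E Q" using place_discrete[OF E Q(1)] .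
      have "w \<in> Q" using wI Q by blast
      then have "inv w \<notin> val_of E Q" using dp_facts(8)[OF dQ] w by blast
      then show False using zQ iz(5) by (simp add: w_def)
    qed
    then obtain p s where ps: "p \<in> P" "s \<in> ?A" "\<one> = p \<oplus> w \<otimes> s" by (auto simp: I_def)
    have R: "p \<in> carrier R" "s \<in> carrier R" using ps PR AR by auto
    have mp: "\<one> \<ominus> p \<in> ?O" using ps PO O1 subring_minus[OF fP(2)] by blast
    have unit: "\<one> \<ominus> p \<noteq> \<zero>" "inv (\<one> \<ominus> p) \<in> ?O"
    proof -
      have "\<one> \<ominus> p \<notin> P"
      proof
        assume "\<one> \<ominus> p \<in> P"
        then have "(\<one> \<ominus> p) \<oplus> p \<in> P" using additive_subgroup.a_closed[OF Pg] ps(1) by blast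
        moreover have "(\<one> \<ominus> p) \<oplus> p = \<one>" using R by algebra
        ultimately show False using fP(8)[of \<one>] O1 by simp
      qed
      then show "\<one> \<ominus> p \<noteq> \<zero>" "inv (\<one> \<ominus> p) \<in> ?O" using mp fP(8) by blast+
    qed
    define u where "u = inv (\<one> \<ominus> p)"
    have u: "u \<in> ?O" "u \<in> carrier R" "u \<otimes> (\<one> \<ominus> p) = \<one>"
      using unit inv_field[of "\<one> \<ominus> p"] R OR by (auto simp: u_def)
    have "\<one> \<ominus> p = w \<otimes> s"
    proof -
      have "(p \<oplus> w \<otimes> s) \<ominus> p = w \<otimes> s" using R w(1) by algebra
      then show ?thesis using ps(3) by simp
    qed
    then have "z = z \<otimes> (u \<otimes> (w \<otimes> s))" using u zR by simp
    also have "\<dots> = (z \<otimes> w) \<otimes> (u \<otimes> s)" using zR w(1) u R by (simp add: m_ac)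
    finally have "z = u \<otimes> s" using w u R by simp
    then have "z \<in> ?A" using u ps OA subringE(6)[OF A] by auto
    then have mzA: "\<ominus> z \<in> ?A" using subringE(5)[OF A] by blast
    \<comment> \<open>A polynomial s in 1/z becomes, after multiplication by a suitable z^n, a
      polynomial in z of degree at most n. For s = -z this expresses -z^(n+1) by lower powers of
      z.\<close>
    have claim: "\<exists>q n. set q \<subseteq> ?O \<and> length q = Suc n \<and> z [^] n \<otimes> s = eval q z" if "s \<in> ?A" for s
      using that
    proof (induction s rule: simple_extension.induct)
      case zero
      have "z [^] (0::nat) \<otimes> \<zero> = eval [\<zero>] z" using zR by simp
      then show ?case using O1 by (intro exI[of _ "[\<zero>]"] exI[of _ "0::nat"]) auto
    next
      case (lin s1 s2)
      obtain q n where q: "set q \<subseteq> ?O" "length q = Suc n" "z [^] n \<otimes> s1 = eval q z" using lin by blast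
      have R': "s1 \<in> carrier R" "s2 \<in> carrier R" using lin AR OR by auto
      have "z [^] Suc n \<otimes> (s1 \<otimes> w \<oplus> s2) = (z [^] n \<otimes> s1) \<otimes> (z \<otimes> w) \<oplus> s2 \<otimes> z [^] Suc n"
        using zR R' w(1) by (simp add: r_distr m_ac)
      also have "\<dots> = s2 \<otimes> z [^] Suc n \<oplus> eval q z"
        using zR R' w(3) eval_in_carrier[of q z] q OR by (simp add: a_comm)
      also have "\<dots> = eval (s2 # q) z" using q by simp
      finally show ?case using q lin by (intro exI[of _ "s2 # q"] exI[of _ "Suc n"]) auto
    qed
    obtain q n where q: "set q \<subseteq> ?O" "length q = Suc n" "z [^] n \<otimes> (\<ominus> z) = eval q z" using claim[OF mzA] by blast
    have "eval (\<one> # q) z = z [^] Suc n \<oplus> z [^] n \<otimes> (\<ominus> z)" using q zR by simp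
    also have "\<dots> = \<zero>" using zR by (simp add: r_minus r_neg)
    finally have "eval (\<one> # q) z = \<zero>" .
    moreover have "polynomial ?O (\<one> # q)" using q(1) O1 by (simp add: polynomial_def)
    ultimately show ?thesis unfolding integral_closure_in_def using zE by force
  qed
qed

end

section \<open>Residue fields and degrees\<close>

text \<open>Translates the degrees, which are defined through \<open>dim\<close>, into the
  cardinalities used in the estimates.\<close>

lemma (in field) card_eq_power_dim:
  assumes fin: "finite (carrier R)" and K: "subfield K R"
  shows "card (carrier R) = card K ^ dim K (carrier R)"
proof -
  obtain xs where xs: "set xs = carrier R" using finite_list[OF fin] by blast
  have KR: "K \<subseteq> carrier R" using subfieldE(3)[OF K] .
  have "Span K xs = carrier R"
    using Span_base_incl[OF K, of xs] Span_in_carrier[OF KR, of xs] xs by blast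
  then have "finite_dimension K (carrier R)" using Span_finite_dimension[OF K, of xs] xs by simp
  then have "dimension (dim K (carrier R)) K (carrier R)" using finite_dimensionE[OF K] by (simp add: over_def)
  then obtain Vs where Vs: "set Vs \<subseteq> carrier R" "independent K Vs" "length Vs = dim K (carrier R)" "Span K Vs = carrier R"
    using exists_base[OF K] by blast
  let ?D = "{Ks. set Ks \<subseteq> K \<and> length Ks = length Vs}"
  have "bij_betw (\<lambda>Ks. combine Ks Vs) ?D (carrier R)"
  proof (rule bij_betwI')
    fix Ks assume "Ks \<in> ?D"
    then show "combine Ks Vs \<in> carrier R" using KR Vs(1) by (auto intro!: combine_in_carrier)
  next
    fix y assume "y \<in> carrier R"
    then show "\<exists>Ks\<in>?D. y = combine Ks Vs" using Span_mem_iff_length_version[OF K Vs(1)] Vs(4) by blast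
  next
    fix Ks Ls assume *: "Ks \<in> ?D" "Ls \<in> ?D"
    have "combine Ks Vs \<in> Span K Vs" using Span_mem_iff_length_version[OF K Vs(1)] * by blast
    then show "(combine Ks Vs = combine Ls Vs) = (Ks = Ls)"
      using unique_decomposition[OF K Vs(2)] * by blast
  qed
  then have "card (carrier R) = card ?D" using bij_betw_same_card by metis
  also have "\<dots> = card K ^ length Vs" using card_lists_length_eq[of K "length Vs"] finite_subset[OF KR fin] by simp
  finally show ?thesis using Vs(3) by simp
qed

context constant_field
begin

lemma coset_local_ring: "P +>\<^bsub>local_ring R F P\<^esub> a = P +> a"
  by (simp add: a_r_coset_def r_coset_def)

lemma place_subgroup:
  assumes "ff F" "P \<in> places R k F"
  shows "additive_subgroup P R"
  using vg_1 vg_subgroup place_discrete[OF assms] by metis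

lemma place_finite_index:
  assumes "ff F" "P \<in> places R k F"
  shows "finite_index (val_of F P) P"
proof -
  note d = place_discrete[OF assms]
  obtain t where t: "t \<noteq> \<zero>" "t \<in> P" "P = t <# val_of F P" by (rule dp_prime[OF d])
  have "t \<in> val_of F P - {\<zero>}" using dp_facts(9)[OF d] t(1,2) by blast
  then have "finite_index (val_of F P) (t <# val_of F P)" using d unfolding discrete_place_def by blast
  then show ?thesis unfolding t(3)[symmetric] .
qed

lemma residue_field:
  assumes F: "ff F" and P: "P \<in> places R k F"
  shows "field (residue_field R F P)"
    and "ring_hom_ring (local_ring R F P) (residue_field R F P) (\<lambda>a. P +> a)"
    and "carrier (residue_field R F P) = (\<lambda>a. P +> a) ` val_of F P"
    and "finite (carrier (residue_field R F P))"
    and "card (carrier (residue_field R F P)) = index (val_of F P) P"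
proof -
  have Ff: "subfield F R" using ff_subfield[OF F] .
  obtain V where V: "valuation_ring R k F V" and max: "maximalideal P (R\<lparr>carrier := V\<rparr>)"
    using P by (auto simp: places_def)
  have eq: "val_of F P = V" using valuation_ring_eq_ring_of_place[OF field_axioms Ff V max] by simp
  have max': "maximalideal P (local_ring R F P)" using max eq by simp
  interpret M: maximalideal P "local_ring R F P" by (rule max')
  have Vr: "subring (val_of F P) R" using V eq by (simp add: valuation_ring_def)
  have cr: "cring (local_ring R F P)" using subring_is_domain[OF Vr] by (simp add: domain_def)
  show "field (residue_field R F P)" unfolding residue_field_def using M.quotient_is_field[OF cr] .
  show "ring_hom_ring (local_ring R F P) (residue_field R F P) (\<lambda>a. P +> a)"
  proof -
    have "(\<lambda>a. P +>\<^bsub>local_ring R F P\<^esub> a) = (\<lambda>a. P +> a)" by (rule ext) (rule coset_local_ring)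
    then show ?thesis using M.rcos_ring_hom_ring unfolding residue_field_def by metis
  qed
  show c: "carrier (residue_field R F P) = (\<lambda>a. P +> a) ` val_of F P"
    unfolding residue_field_def FactRing_def A_RCOSETS_def RCOSETS_def
    using coset_local_ring by (auto simp: a_r_coset_def)
  show "finite (carrier (residue_field R F P))"
    using place_finite_index[OF F P] c by (simp add: finite_index_def)
  show "card (carrier (residue_field R F P)) = index (val_of F P) P" using c by (simp add: index_def)
qed

text \<open>Common source of \<open>index_place_degree\<close>, with B = k, and of
  \<open>index_relative_degree\<close>, with B the ring of the place below. The hypothesis
  \<open>inv\<close> makes the image of \<open>B\<close> in the residue field a subfield.\<close>

lemma residue_subfield_dim:
  assumes F: "ff F" and P: "P \<in> places R k F" and B: "subring B R" "B \<subseteq> val_of F P"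
    and inv: "\<And>b. b \<in> B \<Longrightarrow> b \<notin> P \<Longrightarrow> inv b \<in> B"
  shows "index (val_of F P) P =
    index B P ^ ring.dim (residue_field R F P) (residue_image R F P B) (carrier (residue_field R F P))"
proof -
  note r = residue_field[OF F P]
  note d = dp_facts[OF place_discrete[OF F P]]
  interpret K: field "residue_field R F P" by (rule r(1))
  interpret H: ring_hom_ring "local_ring R F P" "residue_field R F P" "\<lambda>a. P +> a" by (rule r(2))
  have im: "residue_image R F P B = (\<lambda>a. P +> a) ` B" using coset_local_ring by (simp add: residue_image_def)
  have BO: "subring B (local_ring R F P)"
  proof (rule ring.subringI)
    show "ring (local_ring R F P)" using H.R.ring_axioms .
    show "\<one>\<^bsub>local_ring R F P\<^esub> \<in> B" using subringE(3)[OF B(1)] by simp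
    show "B \<subseteq> carrier (local_ring R F P)" using B(2) by simp
    fix a b assume ab: "a \<in> B" "b \<in> B"
    have "\<ominus>\<^bsub>local_ring R F P\<^esub> a = \<ominus> a"
    proof (rule H.R.minus_equality)
      show "\<ominus> a \<oplus>\<^bsub>local_ring R F P\<^esub> a = \<zero>\<^bsub>local_ring R F P\<^esub>"
        using ab subringE(1)[OF B(1)] by (auto simp: l_neg)
    qed (use ab B subringE(5)[OF B(1)] in auto)
    then show "\<ominus>\<^bsub>local_ring R F P\<^esub> a \<in> B" using subringE(5)[OF B(1) ab(1)] by simp
    show "a \<otimes>\<^bsub>local_ring R F P\<^esub> b \<in> B" "a \<oplus>\<^bsub>local_ring R F P\<^esub> b \<in> B"
      using subringE(6,7)[OF B(1) ab] by auto
  qed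
  have sf: "subfield ((\<lambda>a. P +> a) ` B) (residue_field R F P)"
  proof (rule K.subfieldI'[OF H.img_is_subring[OF BO]])
    fix x assume "x \<in> (\<lambda>a. P +> a) ` B - {\<zero>\<^bsub>residue_field R F P\<^esub>}"
    then obtain b where b: "b \<in> B" "x = P +> b" "x \<noteq> \<zero>\<^bsub>residue_field R F P\<^esub>" by blast
    have bO: "b \<in> val_of F P" using b B by blast
    have bP: "b \<notin> P"
    proof
      assume "b \<in> P"
      then have "P +> b = P +> \<zero>"
        using coset_eq_iff[OF place_subgroup[OF F P], of b \<zero>] bO d(5) by (auto simp: a_minus_def)
      moreover have "P +> \<zero> = \<zero>\<^bsub>residue_field R F P\<^esub>" using H.hom_zero by simp
      ultimately show False using b by simp
    qed
    have ib: "inv b \<in> B" using inv[OF b(1) bP] .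
    have b0: "b \<noteq> \<zero>" "b \<in> carrier R" using bP d(8)[of \<zero>] bO d(5) subringE(2)[OF d(2)] by auto
    have "(P +> b) \<otimes>\<^bsub>residue_field R F P\<^esub> (P +> inv b) = \<one>\<^bsub>residue_field R F P\<^esub>"
      using H.hom_mult[of b "inv b"] H.hom_one bO ib B(2) inv_field(3)[OF b0(2,1)] by auto
    then have "inv\<^bsub>residue_field R F P\<^esub> x = P +> inv b"
      using K.comm_inv_char[of x "P +> inv b"] H.hom_closed bO ib B(2) b(2) by auto
    then show "inv\<^bsub>residue_field R F P\<^esub> x \<in> (\<lambda>a. P +> a) ` B" using ib by blast
  qed
  show ?thesis using K.card_eq_power_dim[OF r(4) sf] r(5) im by (simp add: index_def)
qed

lemma k_ge_2: "2 \<le> card k"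
proof -
  have "{\<zero>, \<one>} \<subseteq> k" using subringE(2,3)[OF subfieldE(1)[OF subfield_k]] by auto
  then have "card {\<zero>, \<one>} \<le> card k" by (rule card_mono[OF finite_k])
  then show ?thesis using zero_not_one by simp
qed

lemma index_place_degree:
  assumes F: "ff F" and P: "P \<in> places R k F"
  shows "index (val_of F P) P = card k ^ place_degree R k F P" and "1 \<le> place_degree R k F P"
proof -
  note d = dp_facts[OF place_discrete[OF F P]]
  have kO: "k \<subseteq> val_of F P" using place_contains_k[OF F P] .
  have kr: "subring k R" using subfieldE(1)[OF subfield_k] .
  have kP: "b = \<zero>" if "b \<in> k" "b \<in> P" for b
    using constants_meet_place[OF subfield_k kO that(1)] d(8) that(2) by blast
  have "inj_on (\<lambda>a. P +> a) k"
  proof (rule inj_onI)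
    fix a b assume ab: "a \<in> k" "b \<in> k" "P +> a = P +> b"
    have R: "a \<in> carrier R" "b \<in> carrier R" using ab subfieldE(3)[OF subfield_k] by auto
    have "a \<ominus> b = \<zero>" using ab R coset_eq_iff[OF place_subgroup[OF F P]] kP subring_minus[OF kr] by blast
    then show "a = b" using R by (simp add: r_right_minus_eq)
  qed
  then have "index k P = card k" unfolding index_def by (rule card_image)
  moreover have "inv b \<in> k" if "b \<in> k" "b \<notin> P" for b
  proof -
    have "b \<noteq> \<zero>" using that d(8)[of \<zero>] subringE(2)[OF d(2)] by auto
    then show ?thesis using subfield_inv(1)[OF subfield_k that(1)] by blast
  qed
  ultimately show eq: "index (val_of F P) P = card k ^ place_degree R k F P"
    using residue_subfield_dim[OF F P kr kO] unfolding place_degree_def by simp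
  show "1 \<le> place_degree R k F P"
  proof (rule ccontr)
    assume "\<not> 1 \<le> place_degree R k F P"
    then have "index (val_of F P) P = 1" using eq by simp
    moreover have "card k \<le> index (val_of F P) P"
      using \<open>index k P = card k\<close> index_mono(2)[OF place_subgroup[OF F P] d(5) place_finite_index[OF F P] kO] by simp
    ultimately show False using k_ge_2 by simp
  qed
qed

lemma index_relative_degree:
  assumes F: "ff F" and E: "ff E" and FE: "F \<subseteq> E" and P: "P \<in> places R k F" and Q: "Q \<in> places_over R k E P"
  shows "index (val_of E Q) Q = index (val_of F P) P ^ relative_degree R F P E Q"
    and "place_degree R k E Q = place_degree R k F P * relative_degree R F P E Q"
proof -
  note dP = dp_facts[OF place_discrete[OF F P]]
  have Qp: "Q \<in> places R k E" using places_overD[OF Q] by blast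
  note r = places_over_restrict[OF assms]
  have sub: "val_of F P \<subseteq> val_of E Q" using r by blast
  have eq: "Q +> a = Q +> b \<longleftrightarrow> P +> a = P +> b" if ab: "a \<in> val_of F P" "b \<in> val_of F P" for a b
  proof -
    have R: "a \<in> carrier R" "b \<in> carrier R" using ab dP(5) by auto
    have "a \<ominus> b \<in> F" using ab dP(3) subring_minus[OF subfieldE(1)[OF dP(1)]] by blast
    then show ?thesis using coset_eq_iff[OF place_subgroup[OF F P] R] coset_eq_iff[OF place_subgroup[OF E Qp] R] r(2) by blast
  qed
  \<comment> \<open>Because \<open>Q \<inter> F = P\<close>, two elements of the smaller ring are
    congruent modulo \<open>Q\<close> iff they are congruent modulo \<open>P\<close>.\<close>
  have "index (val_of F P) Q = index (val_of F P) P"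
  proof -
    have bij: "bij_betw (\<lambda>c. Q +> (SOME a. a \<in> val_of F P \<and> P +> a = c)) ((\<lambda>a. P +> a) ` val_of F P) ((\<lambda>a. Q +> a) ` val_of F P)"
    proof (rule bij_betw_imageI)
      have s: "(SOME a. a \<in> val_of F P \<and> P +> a = P +> b) \<in> val_of F P \<and> P +> (SOME a. a \<in> val_of F P \<and> P +> a = P +> b) = P +> b"
        if "b \<in> val_of F P" for b using someI[of "\<lambda>a. a \<in> val_of F P \<and> P +> a = P +> b" b] that by blast
      then show "inj_on (\<lambda>c. Q +> (SOME a. a \<in> val_of F P \<and> P +> a = c)) ((\<lambda>a. P +> a) ` val_of F P)"
        using eq by (auto simp: inj_on_def)
      have "Q +> (SOME a. a \<in> val_of F P \<and> P +> a = P +> b) = Q +> b" if "b \<in> val_of F P" for b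
        using s[OF that] eq that by blast
      then show "(\<lambda>c. Q +> (SOME a. a \<in> val_of F P \<and> P +> a = c)) ` (\<lambda>a. P +> a) ` val_of F P = (\<lambda>a. Q +> a) ` val_of F P"
        by (auto simp: image_image)
    qed
    show ?thesis unfolding index_def by (rule bij_betw_same_card[OF bij, symmetric])
  qed
  moreover have "inv b \<in> val_of F P" if "b \<in> val_of F P" "b \<notin> Q" for b
    using that r(2) dP(3,8) by blast
  ultimately show i: "index (val_of E Q) Q = index (val_of F P) P ^ relative_degree R F P E Q"
    using residue_subfield_dim[OF E Qp dP(2) sub] unfolding relative_degree_def by simp
  have "card k ^ place_degree R k E Q = card k ^ (place_degree R k F P * relative_degree R F P E Q)"
    using i index_place_degree(1)[OF F P] index_place_degree(1)[OF E Qp] by (simp add: power_mult)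
  then show "place_degree R k E Q = place_degree R k F P * relative_degree R F P E Q"
    using k_ge_2 by simp
qed

lemma relative_degree_pos:
  assumes F: "ff F" and E: "ff E" and FE: "F \<subseteq> E" and P: "P \<in> places R k F" and Q: "Q \<in> places_over R k E P"
  shows "1 \<le> relative_degree R F P E Q"
proof -
  have "1 \<le> place_degree R k E Q" using index_place_degree(2)[OF E] places_overD[OF Q] by blast
  then show ?thesis using index_relative_degree(2)[OF assms] by (cases "relative_degree R F P E Q") auto
qed

lemma index_ge_2:
  assumes F: "ff F" and P: "P \<in> places R k F"
  shows "2 \<le> index (val_of F P) P"
  using index_place_degree[OF assms] k_ge_2 self_le_power[of "card k" "place_degree R k F P"] by linarith

section \<open>The fundamental inequality\<close>

text \<open>These are t-adic digit expansions: from r to r + t^e s with a new digit s from a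
  transversal modulo \<open>P\<close>. Agreement modulo P^e forces equal r, and agreement modulo
  P^(e+1) then forces equal s.\<close>

lemma separated_powers:
  assumes F: "ff F" and P: "P \<in> places R k F"
  shows "\<exists>S\<subseteq>val_of F P. finite S \<and> card S = index (val_of F P) P ^ e \<and>
    (\<forall>a\<in>S. \<forall>b\<in>S. a \<ominus> b \<in> val_ge F P (int e) \<longrightarrow> a = b)"
proof (induction e)
  case 0
  have "\<zero> \<in> val_of F P" using subringE(2)[OF dp_facts(2)[OF place_discrete[OF F P]]] .
  then show ?case by (intro exI[of _ "{\<zero>}"]) auto
next
  case (Suc e)
  note d = place_discrete[OF F P]
  note f = dp_facts[OF d]
  obtain S where S: "S \<subseteq> val_of F P" "finite S" "card S = index (val_of F P) P ^ e"
    and sepS: "\<And>a b. a \<in> S \<Longrightarrow> b \<in> S \<Longrightarrow> a \<ominus> b \<in> val_ge F P (int e) \<Longrightarrow> a = b" using Suc by blast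
  obtain T where T: "T \<subseteq> val_of F P" "finite T" "card T = index (val_of F P) P"
    and sepT: "\<And>a b. a \<in> T \<Longrightarrow> b \<in> T \<Longrightarrow> a \<ominus> b \<in> P \<Longrightarrow> a = b"
    using index_representatives[OF place_subgroup[OF F P] f(5) place_finite_index[OF F P]] by metis
  obtain t where t: "prime_element R F P t" "t \<in> F" "t \<in> carrier R" "t \<noteq> \<zero>" by (rule dp_prime[OF d])
  note te = dp_val_pow[OF d t(2,4), of e]
  have vte: "place_valuation R F P (t [^] e) = int e" using te(3) dp_val_prime[OF d t(1)] by simp
  have tee: "t [^] e \<in> val_ge F P (int e)" using te vte by (simp add: val_ge_def)
  have teR: "t [^] e \<in> carrier R" using t by simp
  note ite = subfield_inv[OF f(1) te(1,2)]
  define h where "h = (\<lambda>(r, s). r \<oplus> t [^] e \<otimes> s)"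
  have key: "x = y" if x: "x \<in> S \<times> T" and y: "y \<in> S \<times> T" and xy: "h x \<ominus> h y \<in> val_ge F P (int (Suc e))" for x y
  proof -
    obtain r s where rs: "x = (r, s)" "r \<in> S" "s \<in> T" using x by blast
    obtain r' s' where rs': "y = (r', s')" "r' \<in> S" "s' \<in> T" using y by blast
    have O: "r \<in> val_of F P" "s \<in> val_of F P" "r' \<in> val_of F P" "s' \<in> val_of F P" using rs rs' S T by auto
    then have R: "r \<in> carrier R" "s \<in> carrier R" "r' \<in> carrier R" "s' \<in> carrier R" using f(5) by auto
    have e: "h x \<ominus> h y = (r \<ominus> r') \<oplus> t [^] e \<otimes> (s \<ominus> s')"
      unfolding h_def rs(1) rs'(1) prod.case using R teR by algebra
    have ss: "s \<ominus> s' \<in> val_ge F P 0" using O subring_minus[OF f(2)] vg_0[OF d] by simp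
    have ts: "t [^] e \<otimes> (s \<ominus> s') \<in> val_ge F P (int e)" using vg_mult[OF d tee ss] by simp
    have "h x \<ominus> h y \<in> val_ge F P (int e)" using xy vg_mono[OF d, of "int e" "int (Suc e)"] by auto
    then have "(h x \<ominus> h y) \<ominus> t [^] e \<otimes> (s \<ominus> s') \<in> val_ge F P (int e)" using vg_minus[OF d _ ts] by blast
    moreover have "(h x \<ominus> h y) \<ominus> t [^] e \<otimes> (s \<ominus> s') = r \<ominus> r'" unfolding e using R teR by algebra
    ultimately have r: "r = r'" using sepS rs rs' by simp
    have "h x \<ominus> h y = t [^] e \<otimes> (s \<ominus> s')"
    proof -
      have "r \<ominus> r' = \<zero>" using r R by (simp add: r_right_minus_eq)
      then show ?thesis unfolding e using R teR by simp
    qed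
    then have "t [^] e \<otimes> (s \<ominus> s') \<in> val_ge F P (int e + 1)" using xy by (simp add: add.commute)
    moreover have "inv (t [^] e) \<in> val_ge F P (- int e)" using ite dp_val_inv[OF d te(1,2)] vte by (simp add: val_ge_def)
    ultimately have "inv (t [^] e) \<otimes> (t [^] e \<otimes> (s \<ominus> s')) \<in> val_ge F P (- int e + (int e + 1))"
      using vg_mult[OF d] by blast
    moreover have "inv (t [^] e) \<otimes> (t [^] e \<otimes> (s \<ominus> s')) = s \<ominus> s'"
      using ite R teR f(4) by (simp add: m_assoc[symmetric] subset_iff)
    ultimately have "s \<ominus> s' \<in> P" using vg_1[OF d] by simp
    then have "s = s'" using sepT rs rs' by blast
    then show ?thesis using r rs rs' by simp
  qed
  have hO: "h x \<in> val_of F P" if "x \<in> S \<times> T" for x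
  proof -
    have "t [^] e \<in> val_of F P" using tee vg_mono[OF d, of 0 "int e"] vg_0[OF d] by auto
    then show ?thesis using that S T subringE(6,7)[OF f(2)] by (auto simp: h_def subset_iff)
  qed
  have inj: "inj_on h (S \<times> T)"
  proof (rule inj_onI)
    fix x y assume xy: "x \<in> S \<times> T" "y \<in> S \<times> T" "h x = h y"
    have "h y \<in> carrier R" using hO[OF xy(2)] f(5) by auto
    then have "h x \<ominus> h y = \<zero>" using xy(3) by (simp add: r_right_minus_eq)
    then show "x = y" using key[OF xy(1,2)] vg_subset(2)[OF d] by simp
  qed
  have "card (h ` (S \<times> T)) = index (val_of F P) P ^ Suc e"
    using card_image[OF inj] S(3) T(3) by (simp add: card_cartesian_product mult.commute)
  moreover have "a = b" if "a \<in> h ` (S \<times> T)" "b \<in> h ` (S \<times> T)" "a \<ominus> b \<in> val_ge F P (int (Suc e))" for a b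
    using that key by blast
  moreover have "h ` (S \<times> T) \<subseteq> val_of F P" using hO by blast
  ultimately show ?case using S(2) T(2) by (intro exI[of _ "h ` (S \<times> T)"]) auto
qed

text \<open>The multiplicative form of \<Sum> e f \<le> m, for finite sets of places, since the
  finiteness of the whole fibre is deduced from it. In the intersection \<open>C\<close> of the
  rings of the places in \<open>S\<close>, weak approximation realises every choice of classes
  modulo the powers of Q with exponent e(Q|P). Different choices differ modulo tC, and C/tC is
  bounded by the dimension.\<close>

lemma fundamental_index:
  assumes F: "ff F" and E: "ff E" and FE: "F \<subseteq> E" and dim: "dimension m F E" and P: "P \<in> places R k F"
    and S: "finite S" "S \<subseteq> places_over R k E P"
  shows "(\<Prod>Q\<in>S. index (val_of E Q) Q ^ ramification_index R F P E Q) \<le> index (val_of F P) P ^ m"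
proof -
  note dP = place_discrete[OF F P]
  note fP = dp_facts[OF dP]
  obtain t where t: "prime_element R F P t" "t \<in> F" "t \<in> carrier R" "t \<noteq> \<zero>" "t \<in> P" "P = t <# val_of F P"
    by (rule dp_prime[OF dP])
  have Ef: "subfield E R" using ff_subfield[OF E] .
  note Er = subfieldE(1)[OF Ef] and ER = subfieldE(3)[OF Ef]
  let ?e = "ramification_index R F P E"
  have pl: "Q \<in> places R k E" "Q \<in> places_over R k E P" if "Q \<in> S" for Q using that S places_overD by auto
  have dQ: "discrete_place E Q" if "Q \<in> S" for Q using place_discrete[OF E pl(1)[OF that]] .
  define C where "C = {z \<in> E. \<forall>Q\<in>S. z \<in> val_of E Q}"
  have C: "subring C R"
  proof (rule subringI)
    show "C \<subseteq> carrier R" using ER by (auto simp: C_def)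
    show "\<one> \<in> C" using subringE(3)[OF Er] subringE(3)[OF dp_facts(2)[OF dQ]] by (auto simp: C_def)
    fix a b assume ab: "a \<in> C" "b \<in> C"
    show "\<ominus> a \<in> C" using ab subringE(5)[OF Er] subringE(5)[OF dp_facts(2)[OF dQ]] by (auto simp: C_def)
    show "a \<otimes> b \<in> C" using ab subringE(6)[OF Er] subringE(6)[OF dp_facts(2)[OF dQ]] by (auto simp: C_def)
    show "a \<oplus> b \<in> C" using ab subringE(7)[OF Er] subringE(7)[OF dp_facts(2)[OF dQ]] by (auto simp: C_def)
  qed
  have CR: "C \<subseteq> carrier R" and CE: "C \<subseteq> E" using subringE(1)[OF C] by (auto simp: C_def)
  have OC: "val_of F P \<subseteq> C"
    using places_over_restrict(1)[OF F E FE P pl(2)] fP(3) FE by (auto simp: C_def)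
  have one: "\<one> \<notin> t <# val_of F P"
    using fP(8)[of \<one>] equalityD2[OF t(6)] by auto
  have loc: "z \<in> t <# val_of F P" if "z \<in> val_of F P" "z \<noteq> \<zero>" "inv z \<notin> val_of F P" for z
    using fP(8)[of z] that equalityD1[OF t(6)] by blast
  have fin: "finite_index (val_of F P) (t <# val_of F P)" using place_finite_index[OF F P] unfolding t(6)[symmetric] .
  have tO: "t \<in> val_of F P" using t(5) fP(9) by blast
  note bound = index_le_dimension[OF fP(6) tO one loc fin C OC CE dim]
  have IC: "additive_subgroup (t <# C) R" using l_coset_additive_subgroup[OF C t(3)] .
  have vt: "place_valuation R E Q t = int (?e Q)" if "Q \<in> S" for Q
    using ramification(1)[OF F E FE P pl(2)[OF that] t(2,4)] dp_val_prime[OF dP t(1)] by simp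
  have tE: "t \<in> E" using t FE by auto
  have "\<forall>Q\<in>S. \<exists>T\<subseteq>val_of E Q. finite T \<and> card T = index (val_of E Q) Q ^ ?e Q \<and>
    (\<forall>a\<in>T. \<forall>b\<in>T. a \<ominus> b \<in> val_ge E Q (int (?e Q)) \<longrightarrow> a = b)"
    using separated_powers[OF E pl(1)] by blast
  then obtain T where T: "\<And>Q. Q \<in> S \<Longrightarrow> T Q \<subseteq> val_of E Q" "\<And>Q. Q \<in> S \<Longrightarrow> finite (T Q)"
    "\<And>Q. Q \<in> S \<Longrightarrow> card (T Q) = index (val_of E Q) Q ^ ?e Q"
    and sep: "\<And>Q a b. Q \<in> S \<Longrightarrow> a \<in> T Q \<Longrightarrow> b \<in> T Q \<Longrightarrow> a \<ominus> b \<in> val_ge E Q (int (?e Q)) \<Longrightarrow> a = b"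
    by metis
  \<comment> \<open>One precision for all places: the sum bounds each single ramification
    index.\<close>
  define n where "n = (\<Sum>Q\<in>S. int (?e Q))"
  have n: "int (?e Q) \<le> n" if "Q \<in> S" for Q unfolding n_def using that S(1) by (intro member_le_sum) auto
  have ex: "\<exists>c\<in>E. \<forall>Q\<in>S. c \<ominus> \<phi> Q \<in> val_ge E Q n" if p: "\<phi> \<in> Pi\<^sub>E S T" for \<phi>
  proof (rule weak_approximation[OF S(1) dQ Ef])
    fix Q assume Q: "Q \<in> S"
    have "\<phi> Q \<in> T Q" using p Q by auto
    then show "\<phi> Q \<in> E" using T(1)[OF Q] dp_facts(3)[OF dQ[OF Q]] by blast
  qed
  then obtain c where c: "\<And>\<phi>. \<phi> \<in> Pi\<^sub>E S T \<Longrightarrow> c \<phi> \<in> E"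
    "\<And>\<phi> Q. \<phi> \<in> Pi\<^sub>E S T \<Longrightarrow> Q \<in> S \<Longrightarrow> c \<phi> \<ominus> \<phi> Q \<in> val_ge E Q n" by metis
  have c': "c \<phi> \<ominus> \<phi> Q \<in> val_ge E Q (int (?e Q))" if "\<phi> \<in> Pi\<^sub>E S T" "Q \<in> S" for \<phi> Q
    using c(2)[OF that] vg_mono[OF dQ[OF that(2)] n[OF that(2)]] by blast
  have pR: "\<phi> Q \<in> val_of E Q" "\<phi> Q \<in> carrier R" "\<phi> Q \<in> T Q" if "\<phi> \<in> Pi\<^sub>E S T" "Q \<in> S" for \<phi> Q
  proof -
    show 1: "\<phi> Q \<in> T Q" using that by auto
    then show 2: "\<phi> Q \<in> val_of E Q" using T(1)[OF that(2)] by blast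
    then show "\<phi> Q \<in> carrier R" using dp_facts(5)[OF dQ[OF that(2)]] by blast
  qed
  have cC: "c \<phi> \<in> C" if p: "\<phi> \<in> Pi\<^sub>E S T" for \<phi>
  proof -
    have "c \<phi> \<in> val_of E Q" if Q: "Q \<in> S" for Q
    proof -
      have "c \<phi> \<ominus> \<phi> Q \<in> val_ge E Q 0" using c'[OF p Q] vg_mono[OF dQ[OF Q], of 0 "int (?e Q)"] by auto
      moreover have "\<phi> Q \<in> val_ge E Q 0" using pR(1)[OF p Q] vg_0[OF dQ[OF Q]] by simp
      ultimately have "(c \<phi> \<ominus> \<phi> Q) \<oplus> \<phi> Q \<in> val_ge E Q 0" by (rule vg_add[OF dQ[OF Q]])
      moreover have "(c \<phi> \<ominus> \<phi> Q) \<oplus> \<phi> Q = c \<phi>" using c(1)[OF p] ER pR(2)[OF p Q]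
        by (simp add: a_minus_def a_assoc l_neg subset_iff)
      ultimately show ?thesis using vg_0[OF dQ[OF Q]] by simp
    qed
    then show ?thesis using c(1)[OF p] by (simp add: C_def)
  qed
  \<comment> \<open>An element of tC has value at least e(Q|P) at every \<open>Q\<close> in
    \<open>S\<close>, so the two choices agree there up to that order and \<open>sep\<close>
    identifies them.\<close>
  have key: "\<phi> = \<psi>" if p: "\<phi> \<in> Pi\<^sub>E S T" and q: "\<psi> \<in> Pi\<^sub>E S T" and d: "c \<phi> \<ominus> c \<psi> \<in> t <# C" for \<phi> \<psi>
  proof (rule PiE_ext[OF p q])
    fix Q assume Q: "Q \<in> S"
    note dd = dQ[OF Q]
    have R: "c \<phi> \<in> carrier R" "c \<psi> \<in> carrier R" "\<phi> Q \<in> carrier R" "\<psi> Q \<in> carrier R"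
      using cC[OF p] cC[OF q] CR pR(2)[OF p Q] pR(2)[OF q Q] by auto
    obtain a where a: "a \<in> C" "c \<phi> \<ominus> c \<psi> = t \<otimes> a" using d by (auto simp: l_coset_mem)
    have "a \<in> val_of E Q" using a Q by (auto simp: C_def)
    then have "c \<phi> \<ominus> c \<psi> \<in> t <# val_of E Q" using a(2) unfolding l_coset_mem by blast
    then have 1: "c \<phi> \<ominus> c \<psi> \<in> val_ge E Q (int (?e Q))" using vg_l_coset[OF dd tE t(4)] vt[OF Q] by simp
    have 2: "(c \<phi> \<ominus> c \<psi>) \<ominus> (c \<phi> \<ominus> \<phi> Q) \<in> val_ge E Q (int (?e Q))" using vg_minus[OF dd 1 c'[OF p Q]] .
    have 3: "((c \<phi> \<ominus> c \<psi>) \<ominus> (c \<phi> \<ominus> \<phi> Q)) \<oplus> (c \<psi> \<ominus> \<psi> Q) \<in> val_ge E Q (int (?e Q))"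
      using vg_add[OF dd 2 c'[OF q Q]] .
    have "((x \<ominus> y) \<ominus> (x \<ominus> u)) \<oplus> (y \<ominus> v) = u \<ominus> v"
      if "x \<in> carrier R" "y \<in> carrier R" "u \<in> carrier R" "v \<in> carrier R" for x y u v using that by algebra
    then have "\<phi> Q \<ominus> \<psi> Q \<in> val_ge E Q (int (?e Q))" using 3 R by simp
    then show "\<phi> Q = \<psi> Q" using sep[OF Q] pR(3)[OF p Q] pR(3)[OF q Q] by blast
  qed
  have inj: "inj_on c (Pi\<^sub>E S T)"
  proof (rule inj_onI)
    fix \<phi> \<psi> assume *: "\<phi> \<in> Pi\<^sub>E S T" "\<psi> \<in> Pi\<^sub>E S T" "c \<phi> = c \<psi>"
    have "c \<psi> \<in> carrier R" using cC[OF *(2)] CR by blast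
    then have "c \<phi> \<ominus> c \<psi> = \<zero>" using *(3) by (simp add: r_right_minus_eq)
    then show "\<phi> = \<psi>" using key[OF *(1,2)] additive_subgroup.zero_closed[OF IC] by simp
  qed
  have finC: "finite_index C (t <# C)" and boundC: "index C (t <# C) \<le> index (val_of F P) (t <# val_of F P) ^ m"
    using bound by auto
  have "card (c ` Pi\<^sub>E S T) \<le> index C (t <# C)"
  proof (rule index_ge_separated(2)[OF IC CR finC])
    show "c ` Pi\<^sub>E S T \<subseteq> C" using cC by blast
    fix a b assume "a \<in> c ` Pi\<^sub>E S T" "b \<in> c ` Pi\<^sub>E S T" "a \<ominus> b \<in> t <# C"
    then show "a = b" using key by blast
  qed
  also have "\<dots> \<le> index (val_of F P) P ^ m" using boundC unfolding t(6)[symmetric] .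
  finally have "card (Pi\<^sub>E S T) \<le> index (val_of F P) P ^ m" using card_image[OF inj] by simp
  moreover have "card (Pi\<^sub>E S T) = (\<Prod>Q\<in>S. index (val_of E Q) Q ^ ?e Q)"
    using card_PiE[OF S(1), of T] T(3) by simp
  ultimately show ?thesis by simp
qed

text \<open>Comparison of exponents in \<open>fundamental_index\<close>. As every product e f is at
  least 1, a finite set of places over \<open>P\<close> has at most m elements, so there are only
  finitely many.\<close>

theorem fundamental_inequality:
  assumes F: "ff F" and E: "ff E" and FE: "F \<subseteq> E" and dim: "dimension m F E" and P: "P \<in> places R k F"
  shows "finite (places_over R k E P)"
    and "(\<Sum>Q\<in>places_over R k E P. ramification_index R F P E Q * relative_degree R F P E Q) \<le> m"
proof -
  let ?ef = "\<lambda>Q. ramification_index R F P E Q * relative_degree R F P E Q"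
  have le: "(\<Sum>Q\<in>S. ?ef Q) \<le> m" if S: "finite S" "S \<subseteq> places_over R k E P" for S
  proof -
    have "index (val_of F P) P ^ (\<Sum>Q\<in>S. ?ef Q) = (\<Prod>Q\<in>S. index (val_of E Q) Q ^ ramification_index R F P E Q)"
    proof -
      have "index (val_of F P) P ^ ?ef Q = index (val_of E Q) Q ^ ramification_index R F P E Q" if "Q \<in> S" for Q
      proof -
        have "Q \<in> places_over R k E P" using that S by blast
        then show ?thesis
          using index_relative_degree(1)[OF F E FE P] by (simp add: power_mult[symmetric] mult.commute)
      qed
      then show ?thesis by (simp add: power_sum)
    qed
    then have "index (val_of F P) P ^ (\<Sum>Q\<in>S. ?ef Q) \<le> index (val_of F P) P ^ m"
      using fundamental_index[OF F E FE dim P S] by simp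
    then show ?thesis using index_ge_2[OF F P] by (simp add: power_increasing_iff)
  qed
  have "card S \<le> m" if S: "finite S" "S \<subseteq> places_over R k E P" for S
  proof -
    have "1 \<le> ?ef Q" if Q: "Q \<in> S" for Q
    proof -
      have QP: "Q \<in> places_over R k E P" using Q S by blast
      have "1 * 1 \<le> ?ef Q"
        using ramification(2)[OF F E FE P QP] relative_degree_pos[OF F E FE P QP] by (intro mult_le_mono)
      then show ?thesis by simp
    qed
    then have "(\<Sum>Q\<in>S. 1) \<le> (\<Sum>Q\<in>S. ?ef Q)" by (intro sum_mono) auto
    then show ?thesis using le[OF S] by simp
  qed
  then show fin: "finite (places_over R k E P)"
    using infinite_arbitrarily_large[of "places_over R k E P" "Suc m"] by (metis Suc_n_not_le_n)
  show "(\<Sum>Q\<in>places_over R k E P. ?ef Q) \<le> m" using le[OF fin subset_refl] .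
qed

end

section \<open>Frobenius\<close>

lemma (in cring) binomial_expansion:
  assumes a: "a \<in> carrier R" and b: "b \<in> carrier R"
  shows "(a \<oplus> b) [^] n = (\<Oplus>i\<in>{..n}. [(n choose i)] \<cdot> (a [^] i \<otimes> b [^] (n - i)))"
proof (induction n)
  case 0
  then show ?case by simp
next
  case (Suc n)
  let ?f = "\<lambda>i. [(n choose i)] \<cdot> (a [^] i \<otimes> b [^] (n - i))"
  let ?g = "\<lambda>i. [(n choose i)] \<cdot> (a [^] Suc i \<otimes> b [^] (n - i))"
  let ?h = "\<lambda>i. [(n choose i)] \<cdot> (a [^] i \<otimes> b [^] (Suc n - i))"
  let ?h' = "\<lambda>i. [(n choose Suc i)] \<cdot> (a [^] Suc i \<otimes> b [^] (n - i))"
  have f: "?f \<in> {..n} \<rightarrow> carrier R" and g: "?g \<in> {..n} \<rightarrow> carrier R" and h: "?h \<in> {..n} \<rightarrow> carrier R"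
    and h': "?h' \<in> {..n} \<rightarrow> carrier R" and hS: "?h \<in> {..Suc n} \<rightarrow> carrier R"
    using a b by auto
  have fa: "?f i \<otimes> a = ?g i" for i
  proof -
    have "?f i \<otimes> a = [(n choose i)] \<cdot> ((a [^] i \<otimes> b [^] (n - i)) \<otimes> a)" using a b by (intro add_pow_ldistr) auto
    moreover have "(a [^] i \<otimes> b [^] (n - i)) \<otimes> a = a [^] Suc i \<otimes> b [^] (n - i)" using a b by (simp add: m_ac)
    ultimately show ?thesis by simp
  qed
  have fb: "?f i \<otimes> b = ?h i" if "i \<le> n" for i
  proof -
    have "?f i \<otimes> b = [(n choose i)] \<cdot> ((a [^] i \<otimes> b [^] (n - i)) \<otimes> b)" using a b by (intro add_pow_ldistr) auto
    moreover have "(a [^] i \<otimes> b [^] (n - i)) \<otimes> b = a [^] i \<otimes> b [^] (Suc n - i)"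
      using a b that by (simp add: m_assoc Suc_diff_le)
    ultimately show ?thesis by simp
  qed
  have "(a \<oplus> b) [^] Suc n = finsum R ?f {..n} \<otimes> a \<oplus> finsum R ?f {..n} \<otimes> b"
    using a b f Suc by (simp add: r_distr)
  also have "finsum R ?f {..n} \<otimes> a = finsum R ?g {..n}"
    using finsum_ldistr[OF _ a f] fa by simp
  also have "finsum R ?f {..n} \<otimes> b = finsum R ?h {..n}"
  proof -
    have "finsum R ?f {..n} \<otimes> b = (\<Oplus>i\<in>{..n}. ?f i \<otimes> b)" using finsum_ldistr[OF _ b f] by simp
    also have "\<dots> = finsum R ?h {..n}" by (rule finsum_cong'[OF refl h]) (use fb in auto)
    finally show ?thesis .
  qed
  also have "finsum R ?h {..n} = finsum R ?h {..Suc n}"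
    using finsum_Suc[OF hS] a b h by (simp add: binomial_eq_0)
  also have "finsum R ?h {..Suc n} = finsum R ?h' {..n} \<oplus> b [^] Suc n"
    using finsum_Suc2[OF hS] a b by simp
  finally have e1: "(a \<oplus> b) [^] Suc n = finsum R ?g {..n} \<oplus> (finsum R ?h' {..n} \<oplus> b [^] Suc n)" .
  let ?t = "\<lambda>i. [(Suc n choose i)] \<cdot> (a [^] i \<otimes> b [^] (Suc n - i))"
  have tS: "?t \<in> {..Suc n} \<rightarrow> carrier R" using a b by auto
  have "finsum R ?t {..Suc n} = (\<Oplus>i\<in>{..n}. ?t (Suc i)) \<oplus> ?t 0" by (rule finsum_Suc2[OF tS])
  also have "(\<Oplus>i\<in>{..n}. ?t (Suc i)) = (\<Oplus>i\<in>{..n}. ?g i \<oplus> ?h' i)"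
  proof (rule finsum_cong')
    show "(\<lambda>i. ?g i \<oplus> ?h' i) \<in> {..n} \<rightarrow> carrier R" using g h' by auto
    fix i assume "i \<in> {..n}"
    have c: "a [^] Suc i \<otimes> b [^] (n - i) \<in> carrier R" using a b by simp
    show "?t (Suc i) = ?g i \<oplus> ?h' i"
      using add.nat_pow_mult[OF c, of "n choose i" "n choose Suc i"] by simp
  qed simp
  also have "\<dots> = finsum R ?g {..n} \<oplus> finsum R ?h' {..n}" by (rule finsum_addf[OF g h'])
  also have "?t 0 = b [^] Suc n" using b by simp
  finally have "finsum R ?t {..Suc n} = finsum R ?g {..n} \<oplus> finsum R ?h' {..n} \<oplus> b [^] Suc n" .
  then show ?case using e1 finsum_closed[OF g] finsum_closed[OF h'] b by (simp add: a_assoc)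
qed

lemma prime_dvd_binomial:
  assumes "normalization_semidom_class.prime p" "0 < i" "i < p"
  shows "p dvd (p choose i)"
proof -
  have "p dvd fact i * fact (p - i) * (p choose i)"
    using binomial_fact_lemma[of i p] assms dvd_fact[of p p] prime_gt_0_nat[of p] by simp
  moreover have "\<not> p dvd fact i" "\<not> p dvd fact (p - i)" using prime_dvd_fact_iff[OF assms(1)] assms by auto
  ultimately show ?thesis using assms(1) by (simp add: prime_dvd_mult_iff)
qed

lemma (in cring) frobenius:
  assumes p: "normalization_semidom_class.prime (p::nat)" "[p] \<cdot> \<one> = \<zero>" and a: "a \<in> carrier R" and b: "b \<in> carrier R"
  shows "(a \<oplus> b) [^] p = a [^] p \<oplus> b [^] p"
proof -
  have z: "[m] \<cdot> x = \<zero>" if m: "p dvd m" and x: "x \<in> carrier R" for m :: nat and x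
  proof -
    obtain j where j: "m = p * j" using m by auto
    have "[p] \<cdot> x = ([p] \<cdot> \<one>) \<otimes> x" using add_pow_ldistr[of \<one> x p] x by simp
    then have "[p] \<cdot> x = \<zero>" using p x by simp
    then show ?thesis using add.nat_pow_pow[OF x, of j p] j by simp
  qed
  let ?t = "\<lambda>i. [(p choose i)] \<cdot> (a [^] i \<otimes> b [^] (p - i))"
  obtain r where r: "p = Suc (Suc r)" using prime_ge_2_nat[OF p(1)] by (metis add_2_eq_Suc le_Suc_ex)
  have t: "?t \<in> {..Suc (Suc r)} \<rightarrow> carrier R" "?t \<in> {..Suc r} \<rightarrow> carrier R" using a b by auto
  have "finsum R ?t {..Suc (Suc r)} = ?t (Suc (Suc r)) \<oplus> finsum R ?t {..Suc r}" by (rule finsum_Suc[OF t(1)])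
  also have "finsum R ?t {..Suc r} = (\<Oplus>i\<in>{..r}. ?t (Suc i)) \<oplus> ?t 0" by (rule finsum_Suc2[OF t(2)])
  also have "(\<Oplus>i\<in>{..r}. ?t (Suc i)) = (\<Oplus>i\<in>{..r}. \<zero>)"
  proof (rule finsum_cong')
    fix i assume "i \<in> {..r}"
    then have "p dvd (p choose Suc i)" using prime_dvd_binomial[OF p(1), of "Suc i"] r by simp
    then show "?t (Suc i) = \<zero>" using z a b by simp
  qed auto
  also have "?t (Suc (Suc r)) = a [^] p" using a r by simp
  also have "?t 0 = b [^] p" using b by simp
  finally show ?thesis using binomial_expansion[OF a b, of p] r a b by simp
qed

lemma (in cring) frobenius_power:
  assumes p: "normalization_semidom_class.prime (p::nat)" "[p] \<cdot> \<one> = \<zero>" and a: "a \<in> carrier R" and b: "b \<in> carrier R"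
  shows "(a \<oplus> b) [^] (p ^ n) = a [^] (p ^ n) \<oplus> b [^] (p ^ n)"
proof (induction n)
  case (Suc n)
  have "(a \<oplus> b) [^] (p ^ Suc n) = ((a \<oplus> b) [^] (p ^ n)) [^] p"
    using a b by (simp add: nat_pow_pow mult.commute)
  also have "\<dots> = (a [^] (p ^ n)) [^] p \<oplus> (b [^] (p ^ n)) [^] p"
    unfolding Suc using frobenius[OF p] a b by simp
  finally show ?case using a b by (simp add: nat_pow_pow mult.commute)
qed (use a b in simp)

lemma (in field) finite_field_pow_card:
  assumes fin: "finite (carrier R)" and x: "x \<in> carrier R"
  shows "x [^] card (carrier R) = x" "x [^] (card (carrier R) ^ n) = x"
proof -
  have c: "card (carrier R) > 0" using fin x by (auto simp: card_gt_0_iff)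
  show 1: "x [^] card (carrier R) = x"
  proof (cases "x = \<zero>")
    case True
    then show ?thesis using c by (simp add: nat_pow_zero)
  next
    case False
    interpret M: group "Multiplicative_Group.mult_of R" by (rule field_mult_group)
    have "x [^]\<^bsub>Multiplicative_Group.mult_of R\<^esub> order (Multiplicative_Group.mult_of R) = \<one>"
      using M.pow_order_eq_1[of x] x False by simp
    then have "x [^] order (Multiplicative_Group.mult_of R) = \<one>" by (simp only: Multiplicative_Group.nat_pow_mult_of)
    then have "x [^] (card (carrier R) - 1) = \<one>"
      using order_mult_of[OF fin] by (simp add: order_def)
    then have "x [^] Suc (card (carrier R) - 1) = x" using x by simp
    then show ?thesis using c by simp
  qed
  show "x [^] (card (carrier R) ^ n) = x"
  proof (induction n)
    case (Suc n)
    have "x [^] (card (carrier R) ^ Suc n) = (x [^] (card (carrier R) ^ n)) [^] card (carrier R)"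
      using x by (simp add: nat_pow_pow mult.commute)
    then show ?case using Suc 1 by simp
  qed (use x in simp)
qed

text \<open>The multiplicative group is cyclic; a generator a satisfies a^(N-1) = 1, so for N > 1
  the group has at most N - 1 elements.\<close>

lemma (in field) finite_field_card_le:
  assumes fin: "finite (carrier R)" and N: "1 \<le> N" and all: "\<And>x. x \<in> carrier R \<Longrightarrow> x [^] N = x"
  shows "N = 1 \<or> card (carrier R) \<le> N"
proof -
  obtain a where a: "a \<in> carrier (Multiplicative_Group.mult_of R)"
    and gen: "carrier (Multiplicative_Group.mult_of R) = {a [^] i | i::nat. i \<in> UNIV}"
    using finite_field_mult_group_has_gen[OF fin] by blast
  have aR: "a \<in> carrier R" "a \<noteq> \<zero>" using a by auto
  obtain M where M: "N = Suc M" using N by (cases N) auto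
  have "a [^] M \<otimes> a = \<one> \<otimes> a" using all[OF aR(1)] M aR by simp
  then have aM: "a [^] M = \<one>" using m_rcancel[OF aR(2,1), of "a [^] M" \<one>] aR by simp
  show ?thesis
  proof (cases "M = 0")
    case False
    have "carrier (Multiplicative_Group.mult_of R) \<subseteq> (\<lambda>i. a [^] i) ` {..<M}"
    proof
      fix x assume "x \<in> carrier (Multiplicative_Group.mult_of R)"
      then obtain i :: nat where i: "x = a [^] i" using gen by auto
      have "a [^] i = a [^] (M * (i div M)) \<otimes> a [^] (i mod M)"
        using nat_pow_mult[OF aR(1), of "M * (i div M)" "i mod M"] by simp
      also have "a [^] (M * (i div M)) = \<one>" using nat_pow_pow[OF aR(1), of M "i div M"] aM by simp
      finally have "x = a [^] (i mod M)" using i aR by simp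
      then show "x \<in> (\<lambda>i. a [^] i) ` {..<M}" using False by auto
    qed
    then have "card (carrier (Multiplicative_Group.mult_of R)) \<le> card ((\<lambda>i. a [^] i) ` {..<M})"
      by (intro card_mono) auto
    also have "\<dots> \<le> M" using card_image_le[of "{..<M}" "\<lambda>i. a [^] i"] by simp
    finally have "card (carrier R - {\<zero>}) \<le> M" by simp
    then have "card (carrier R) - 1 \<le> M" using fin by simp
    then have "card (carrier R) \<le> Suc M" by linarith
    then show ?thesis using M by simp
  qed (use M in simp)
qed

text \<open>Supplies the characteristic of the constant field, so that raising to powers of
  \<open>card k\<close> becomes additive.\<close>

lemma (in field) finite_field_card_prime_power:
  assumes fin: "finite (carrier R)"
  shows "\<exists>p n. normalization_semidom_class.prime p \<and> card (carrier R) = p ^ n \<and> [p] \<cdot> \<one> = \<zero>"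
proof -
  let ?q = "card (carrier R)"
  have q0: "?q > 0" using fin one_closed by (auto simp: card_gt_0_iff)
  \<comment> \<open>The prime field. In a field with q elements the inverse of a is a^(q-2), so a
    subring of it is closed under inverses.\<close>
  define K where "K = range (\<lambda>n::nat. [n] \<cdot> \<one>)"
  have q1: "[?q] \<cdot> \<one> = \<zero>" using add.pow_order_eq_1[of \<one>] by (simp add: order_def)
  have KR: "K \<subseteq> carrier R" by (auto simp: K_def)
  have K: "subfield K R"
  proof (rule subfieldI')
    show Kr: "subring K R"
    proof (rule subringI[OF KR])
      have "[(1::nat)] \<cdot> \<one> = \<one>" by simp
      then show "\<one> \<in> K" unfolding K_def by (metis rangeI)
      fix a assume "a \<in> K"
      then obtain n :: nat where n: "a = [n] \<cdot> \<one>" by (auto simp: K_def)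
      have "[(n * (?q - 1))] \<cdot> \<one> \<oplus> a = [(n * (?q - 1) + n)] \<cdot> \<one>" unfolding n by (rule add.nat_pow_mult) simp
      also have "n * (?q - 1) + n = ?q * n" using q0 by (cases ?q) auto
      also have "[(?q * n)] \<cdot> \<one> = [n] \<cdot> ([?q] \<cdot> \<one>)" using add.nat_pow_pow[of \<one> n ?q] by simp
      finally have "[(n * (?q - 1))] \<cdot> \<one> \<oplus> a = \<zero>" using q1 by simp
      then have "\<ominus> a = [(n * (?q - 1))] \<cdot> \<one>" using minus_equality[of "[(n * (?q - 1))] \<cdot> \<one>" a] n by simp
      then show "\<ominus> a \<in> K" by (auto simp: K_def)
      fix b assume "b \<in> K"
      then obtain m :: nat where m: "b = [m] \<cdot> \<one>" by (auto simp: K_def)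
      have "a \<oplus> b = [(n + m)] \<cdot> \<one>" unfolding n m by (rule add.nat_pow_mult) simp
      then show "a \<oplus> b \<in> K" by (auto simp: K_def)
      have "a \<otimes> b = [n] \<cdot> ([m] \<cdot> \<one>)" unfolding n m using add_pow_ldistr[of \<one> "[m] \<cdot> \<one>" n] by simp
      also have "\<dots> = [(m * n)] \<cdot> \<one>" using add.nat_pow_pow[of \<one> n m] by simp
      finally show "a \<otimes> b \<in> K" by (auto simp: K_def)
    qed
    fix a assume a: "a \<in> K - {\<zero>}"
    have aR: "a \<in> carrier R" "a \<noteq> \<zero>" using a KR by auto
    have "card {\<zero>, \<one>} \<le> ?q" by (rule card_mono[OF fin]) auto
    then obtain r where r: "?q = Suc (Suc r)" using zero_not_one by (metis add_2_eq_Suc card_2_iff le_Suc_ex)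
    have "a [^] r \<otimes> a \<otimes> a = \<one> \<otimes> a" using finite_field_pow_card(1)[OF fin aR(1)] r aR by simp
    then have "a [^] r \<otimes> a = \<one>" using m_rcancel[OF aR(2,1), of "a [^] r \<otimes> a" \<one>] aR by simp
    then have "inv a = a [^] r" using comm_inv_char[of a "a [^] r"] aR by (simp add: m_comm)
    moreover have "a [^] r \<in> K" by (induction r) (use a subringE(3,6)[OF Kr] in auto)
    ultimately show "inv a \<in> K" by simp
  qed
  have finK: "finite K" using finite_subset[OF KR fin] .
  let ?c = "card K"
  have small: "?c \<le> n" if n: "0 < n" "[n] \<cdot> \<one> = \<zero>" for n :: nat
  proof -
    have "K \<subseteq> (\<lambda>i. [i] \<cdot> \<one>) ` {..<n}"
    proof
      fix x assume "x \<in> K"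
      then obtain i :: nat where i: "x = [i] \<cdot> \<one>" by (auto simp: K_def)
      have "[(n * (i div n))] \<cdot> \<one> \<oplus> [(i mod n)] \<cdot> \<one> = [(n * (i div n) + i mod n)] \<cdot> \<one>"
        by (rule add.nat_pow_mult) simp
      moreover have "[(n * (i div n))] \<cdot> \<one> = \<zero>" using add.nat_pow_pow[of \<one> "i div n" n] n by simp
      ultimately have "x = [(i mod n)] \<cdot> \<one>" using i by simp
      then show "x \<in> (\<lambda>i. [i] \<cdot> \<one>) ` {..<n}" using n by auto
    qed
    then have "?c \<le> card ((\<lambda>i. [i] \<cdot> \<one>) ` {..<n})" by (intro card_mono) auto
    then show ?thesis using card_image_le[of "{..<n}" "\<lambda>i. [i] \<cdot> \<one>"] by simp
  qed
  have c1: "[?c] \<cdot> \<one> = \<zero>"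
  proof -
    interpret KK: field "R\<lparr>carrier := K\<rparr>" using subfield_iff(2)[OF K] .
    have "[?c] \<cdot>\<^bsub>R\<lparr>carrier := K\<rparr>\<^esub> \<one> = \<zero>" using KK.add.pow_order_eq_1[of \<one>] KK.one_closed by (simp add: order_def)
    moreover have "[n] \<cdot>\<^bsub>R\<lparr>carrier := K\<rparr>\<^esub> \<one> = [n] \<cdot> \<one>" for n :: nat
      by (induction n) (simp_all add: add_pow_def nat_pow_def)
    ultimately show ?thesis by simp
  qed
  have K0: "{\<zero>, \<one>} \<subseteq> K" using subringE(2,3)[OF subfieldE(1)[OF K]] by auto
  have "card {\<zero>, \<one>} \<le> ?c" by (rule card_mono[OF finK K0])
  then have c2: "2 \<le> ?c" using zero_not_one by simp
  have "normalization_semidom_class.prime ?c"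
  proof (rule prime_natI)
    show "2 \<le> ?c" by (rule c2)
    fix a b assume "?c dvd a * b"
    then obtain j where j: "a * b = ?c * j" by auto
    \<comment> \<open>\<open>card K\<close> is the additive order of \<one>; it is prime because a
      field has no zero divisors.\<close>
    have dv: "?c dvd n" if n: "[n] \<cdot> \<one> = \<zero>" for n :: nat
    proof (rule ccontr)
      assume "\<not> ?c dvd n"
      then have pos: "0 < n mod ?c" by (simp add: mod_greater_zero_iff_not_dvd)
      have "[(?c * (n div ?c))] \<cdot> \<one> \<oplus> [(n mod ?c)] \<cdot> \<one> = [(?c * (n div ?c) + n mod ?c)] \<cdot> \<one>"
        by (rule add.nat_pow_mult) simp
      moreover have "[(?c * (n div ?c))] \<cdot> \<one> = \<zero>" using add.nat_pow_pow[of \<one> "n div ?c" ?c] c1 by simp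
      ultimately have "[(n mod ?c)] \<cdot> \<one> = \<zero>" using n by simp
      then have "?c \<le> n mod ?c" using small pos by blast
      then show False using c2 mod_less_divisor[of ?c n] by linarith
    qed
    have "[a] \<cdot> \<one> \<otimes> [b] \<cdot> \<one> = [a] \<cdot> ([b] \<cdot> \<one>)" using add_pow_ldistr[of \<one> "[b] \<cdot> \<one>" a] by simp
    also have "\<dots> = [(b * a)] \<cdot> \<one>" using add.nat_pow_pow[of \<one> a b] by simp
    also have "b * a = ?c * j" using j by (simp add: mult.commute)
    also have "[(?c * j)] \<cdot> \<one> = \<zero>" using add.nat_pow_pow[of \<one> j ?c] c1 by simp
    finally have "[a] \<cdot> \<one> = \<zero> \<or> [b] \<cdot> \<one> = \<zero>" using integral by simp
    then show "?c dvd a \<or> ?c dvd b" using dv by blast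
  qed
  then show ?thesis using card_eq_power_dim[OF fin K] c1 by blast
qed

context constant_field
begin

text \<open>\<open>card k\<close> is a power of the characteristic, whose Frobenius map is additive
  by the binomial theorem.\<close>

lemma frobenius_card:
  assumes a: "a \<in> carrier R" and b: "b \<in> carrier R"
  shows "(a \<oplus> b) [^] (card k ^ n) = a [^] (card k ^ n) \<oplus> b [^] (card k ^ n)"
proof -
  interpret K: field "R\<lparr>carrier := k\<rparr>" using subfield_iff(2)[OF subfield_k] .
  obtain p r where p: "normalization_semidom_class.prime p" "card k = p ^ r" "[p] \<cdot>\<^bsub>R\<lparr>carrier := k\<rparr>\<^esub> \<one> = \<zero>"
    using K.finite_field_card_prime_power finite_k by auto
  have "[n] \<cdot>\<^bsub>R\<lparr>carrier := k\<rparr>\<^esub> \<one> = [n] \<cdot> \<one>" for n :: nat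
    by (induction n) (simp_all add: add_pow_def nat_pow_def)
  then have "[p] \<cdot> \<one> = \<zero>" using p(3) by simp
  then show ?thesis using frobenius_power[OF p(1) _ a b, of "r * n"] p(2) by (simp add: power_mult)
qed

lemma residue_pow:
  assumes F: "ff F" and P: "P \<in> places R k F" and a: "a \<in> val_of F P" and n: "place_degree R k F P dvd n"
  shows "a [^] (card k ^ n) \<ominus> a \<in> P"
proof -
  note r = residue_field[OF F P]
  note d = dp_facts[OF place_discrete[OF F P]]
  interpret K: field "residue_field R F P" by (rule r(1))
  interpret H: ring_hom_ring "local_ring R F P" "residue_field R F P" "\<lambda>a. P +> a" by (rule r(2))
  obtain j where j: "n = place_degree R k F P * j" using n by auto
  have c: "card k ^ n = card (carrier (residue_field R F P)) ^ j"
    using r(5) index_place_degree(1)[OF F P] j by (simp add: power_mult)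
  have pw: "P +> a [^] (m::nat) = (P +> a) [^]\<^bsub>residue_field R F P\<^esub> m" for m
  proof (induction m)
    case 0
    then show ?case using H.hom_one by simp
  next
    case (Suc m)
    have "a [^] m \<in> val_of F P" by (induction m) (use a subringE(3,6)[OF d(2)] in auto)
    then show ?case using H.hom_mult[of "a [^] m" a] a Suc by simp
  qed
  have "(P +> a) \<in> carrier (residue_field R F P)" using H.hom_closed a by simp
  then have "P +> a [^] (card k ^ n) = P +> a"
    using pw K.finite_field_pow_card(2)[OF r(4)] c by simp
  moreover have "a \<in> carrier R" using a d(5) by auto
  ultimately show ?thesis using coset_eq_iff[OF place_subgroup[OF F P]] by simp
qed

text \<open>An equation x^N = x, valid in the whole residue field with N > 1, bounds its order by N.
  This turns Frobenius identities into upper bounds for degrees.\<close>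

lemma place_degree_le:
  assumes F: "ff F" and P: "P \<in> places R k F" and l: "1 \<le> l"
    and all: "\<And>a. a \<in> val_of F P \<Longrightarrow> a [^] (card k ^ l) \<ominus> a \<in> P"
  shows "place_degree R k F P \<le> l"
proof -
  note r = residue_field[OF F P]
  note d = dp_facts[OF place_discrete[OF F P]]
  interpret K: field "residue_field R F P" by (rule r(1))
  interpret H: ring_hom_ring "local_ring R F P" "residue_field R F P" "\<lambda>a. P +> a" by (rule r(2))
  have q: "2 \<le> card k ^ l" using k_ge_2 self_le_power[of "card k" l] l by linarith
  have "x [^]\<^bsub>residue_field R F P\<^esub> (card k ^ l) = x" if x: "x \<in> carrier (residue_field R F P)" for x
  proof -
    obtain a where a: "a \<in> val_of F P" "x = P +> a" using x r(3) by blast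
    have pw: "P +> a [^] (m::nat) = (P +> a) [^]\<^bsub>residue_field R F P\<^esub> m" for m
    proof (induction m)
      case 0
      then show ?case using H.hom_one by simp
    next
      case (Suc m)
      have "a [^] m \<in> val_of F P" by (induction m) (use a subringE(3,6)[OF d(2)] in auto)
      then show ?case using H.hom_mult[of "a [^] m" a] a Suc by simp
    qed
    have "a \<in> carrier R" using a d(5) by auto
    then have "P +> a [^] (card k ^ l) = P +> a"
      using coset_eq_iff[OF place_subgroup[OF F P]] all[OF a(1)] by simp
    then show ?thesis using pw a(2) by simp
  qed
  then have "card (carrier (residue_field R F P)) \<le> card k ^ l"
    using K.finite_field_card_le[OF r(4), of "card k ^ l"] q by auto
  then have "card k ^ place_degree R k F P \<le> card k ^ l" using r(5) index_place_degree(1)[OF F P] by simp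
  then show ?thesis using k_ge_2 by (simp add: power_increasing_iff)
qed

end

section \<open>Places above two given places\<close>

lemma (in ring) Span_eq_combine:
  "Span V Us = {combine as Us | as. set as \<subseteq> V \<and> length as = length Us}"
proof (induction Us)
  case (Cons u Us)
  show ?case
  proof (intro equalityI subsetI)
    fix x assume "x \<in> Span V (u # Us)"
    then obtain a as where "a \<in> V" "set as \<subseteq> V" "length as = length Us" "x = a \<otimes> u \<oplus> combine as Us"
      using Cons by (auto simp: line_extension_mem_iff)
    then have "x = combine (a # as) (u # Us)" "set (a # as) \<subseteq> V" "length (a # as) = length (u # Us)" by auto
    then show "x \<in> {combine as (u # Us) | as. set as \<subseteq> V \<and> length as = length (u # Us)}" by blast
  next
    fix x assume "x \<in> {combine as (u # Us) | as. set as \<subseteq> V \<and> length as = length (u # Us)}"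
    then obtain as where as: "set as \<subseteq> V" "length as = length (u # Us)" "x = combine as (u # Us)" by blast
    then obtain b bs where "as = b # bs" by (cases as) auto
    then show "x \<in> Span V (u # Us)" using as Cons by (auto simp: line_extension_mem_iff)
  qed
qed auto

lemma (in cring) Span_module:
  assumes V: "subring V R" and Us: "set Us \<subseteq> carrier R"
  shows "additive_subgroup (Span V Us) R" "\<And>a x. a \<in> V \<Longrightarrow> x \<in> Span V Us \<Longrightarrow> a \<otimes> x \<in> Span V Us"
proof -
  note VR = subringE(1)[OF V]
  show sm: "a \<otimes> x \<in> Span V Us" if a: "a \<in> V" and x: "x \<in> Span V Us" for a x
  proof -
    obtain as where as: "set as \<subseteq> V" "length as = length Us" "x = combine as Us"
      using x unfolding Span_eq_combine by blast
    have aR: "a \<in> carrier R" "set as \<subseteq> carrier R" using a as VR by blast+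
    have "a \<otimes> x = combine (map ((\<otimes>) a) as) Us" using combine_r_distr[OF aR(2) Us] as aR by simp
    moreover have "set (map ((\<otimes>) a) as) \<subseteq> V" using as a subringE(6)[OF V] by auto
    moreover have "length (map ((\<otimes>) a) as) = length Us" using as by simp
    ultimately show ?thesis unfolding Span_eq_combine by blast
  qed
  show "additive_subgroup (Span V Us) R"
  proof (rule additive_subgroupI)
    show sub: "Span V Us \<subseteq> carrier R" using Span_in_carrier[OF VR Us] .
    have "combine (replicate (length Us) \<zero>) Us = \<zero>" using combine_replicate[OF Us] .
    moreover have "set (replicate (length Us) \<zero>) \<subseteq> V" using subringE(2)[OF V] by auto
    moreover have "length (replicate (length Us) \<zero>) = length Us" by simp
    ultimately show "\<zero> \<in> Span V Us" unfolding Span_eq_combine by (metis (mono_tags, lifting) mem_Collect_eq)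
    fix a b assume a: "a \<in> Span V Us" and b: "b \<in> Span V Us"
    have m1: "\<ominus> \<one> \<in> V" using subringE(3,5)[OF V] by blast
    have aR: "a \<in> carrier R" "b \<in> carrier R" using a b sub by blast+
    have "(\<ominus> \<one>) \<otimes> b \<in> Span V Us" using sm[OF m1 b] .
    then have "\<ominus> b \<in> Span V Us" using aR by (simp only: l_minus l_one one_closed)
    then obtain bs where bs: "set bs \<subseteq> V" "length bs = length Us" "\<ominus> b = combine bs Us"
      unfolding Span_eq_combine by blast
    obtain as where as: "set as \<subseteq> V" "length as = length Us" "a = combine as Us"
      using a unfolding Span_eq_combine by blast
    have "set as \<subseteq> carrier R" "set bs \<subseteq> carrier R" using as(1) bs(1) VR by blast+
    then have "a \<ominus> b = combine (map2 (\<oplus>) as bs) Us"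
      using combine_add[OF as(2) bs(2) _ _ Us] as(3) bs(3) by (simp add: a_minus_def)
    moreover have "set (map2 (\<oplus>) as bs) \<subseteq> V"
    proof
      fix x assume "x \<in> set (map2 (\<oplus>) as bs)"
      then obtain p q where "(p, q) \<in> set (zip as bs)" "x = p \<oplus> q" by auto
      moreover from this have "p \<in> V" "q \<in> V"
        using as(1) bs(1) set_zip_leftD[of p q as bs] set_zip_rightD[of p q as bs] by blast+
      ultimately show "x \<in> V" using subringE(7)[OF V] by blast
    qed
    moreover have "length (map2 (\<oplus>) as bs) = length Us" using as bs by simp
    ultimately show "a \<ominus> b \<in> Span V Us" unfolding Span_eq_combine by blast
  qed
qed

lemma (in ring) combine_in_module:
  assumes M: "additive_subgroup M R" and sm: "\<And>a x. a \<in> V \<Longrightarrow> x \<in> M \<Longrightarrow> a \<otimes> x \<in> M"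
  shows "set as \<subseteq> V \<Longrightarrow> set Us \<subseteq> M \<Longrightarrow> combine as Us \<in> M"
  by (induction as Us rule: combine.induct)
    (use sm additive_subgroup.a_closed[OF M] additive_subgroup.zero_closed[OF M] in auto)

text \<open>The diagonal map from A/I to the product of the quotients by the \<open>B i\<close> is
  injective, since inside \<open>A\<close> the \<open>B i\<close> meet within
  \<open>I\<close>.\<close>

lemma (in ring) index_le_prod:
  assumes A: "A \<subseteq> carrier R" and I: "additive_subgroup I R" "finite_index A I"
    and N: "finite N" "\<And>i. i \<in> N \<Longrightarrow> additive_subgroup (B i) R" "\<And>i. i \<in> N \<Longrightarrow> finite_index A (B i)"
    and Am: "\<And>a b. a \<in> A \<Longrightarrow> b \<in> A \<Longrightarrow> a \<ominus> b \<in> A"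
    and sub: "\<And>x. x \<in> A \<Longrightarrow> (\<And>i. i \<in> N \<Longrightarrow> x \<in> B i) \<Longrightarrow> x \<in> I"
  shows "index A I \<le> (\<Prod>i\<in>N. index A (B i))"
proof -
  obtain S where S: "S \<subseteq> A" "finite S" "card S = index A I"
    "\<And>a b. a \<in> S \<Longrightarrow> b \<in> S \<Longrightarrow> a \<ominus> b \<in> I \<Longrightarrow> a = b"
    using index_representatives[OF I(1) A I(2)] by metis
  define h where "h x = (\<lambda>i\<in>N. B i +> x)" for x
  have inj: "inj_on h S"
  proof (rule inj_onI)
    fix a b assume ab: "a \<in> S" "b \<in> S" "h a = h b"
    have AA: "a \<in> A" "b \<in> A" using ab S by auto
    have "a \<ominus> b \<in> B i" if i: "i \<in> N" for i
    proof -
      have "B i +> a = B i +> b" using ab(3) i unfolding h_def by (metis restrict_apply')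
      then show ?thesis using coset_eq_iff[OF N(2)[OF i]] AA A by blast
    qed
    then have "a \<ominus> b \<in> I" using sub Am AA by blast
    then show "a = b" using S(4) ab by blast
  qed
  have "h ` S \<subseteq> (\<Pi>\<^sub>E i\<in>N. (\<lambda>a. B i +> a) ` A)" using S(1) by (auto simp: h_def)
  moreover have fin: "finite (\<Pi>\<^sub>E i\<in>N. (\<lambda>a. B i +> a) ` A)"
    using N(3) by (intro finite_PiE[OF N(1)]) (auto simp: finite_index_def)
  ultimately have "card (h ` S) \<le> card (\<Pi>\<^sub>E i\<in>N. (\<lambda>a. B i +> a) ` A)" by (intro card_mono)
  then have "card S \<le> (\<Prod>i\<in>N. card ((\<lambda>a. B i +> a) ` A))"
    unfolding card_image[OF inj] card_PiE[OF N(1)] .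
  then show ?thesis unfolding S(3) index_def .
qed

text \<open>A reversed inequality of the products leaves no slack in any factor; positivity keeps a
  strict inequality in one factor alive in the product. This extracts local equalities from a global
  chain of estimates.\<close>

lemma prod_le_imp_eq:
  fixes a b :: "'i \<Rightarrow> nat"
  assumes "finite S" "\<And>i. i \<in> S \<Longrightarrow> 0 < a i \<and> a i \<le> b i" "prod b S \<le> prod a S" "j \<in> S"
  shows "a j = b j"
proof (rule ccontr)
  assume "a j \<noteq> b j"
  then have lt: "a j < b j" using assms(2,4) by force
  have "prod a S = a j * prod a (S - {j})" using prod.remove[OF assms(1,4)] .
  also have "\<dots> < b j * prod b (S - {j})"
  proof (rule mult_less_le_imp_less[OF lt])
    show "prod a (S - {j}) \<le> prod b (S - {j})" using assms(2) by (intro prod_mono) auto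
    show "0 < prod a (S - {j})" using assms(2) by (intro prod_pos) auto
  qed simp
  also have "\<dots> = prod b S" using prod.remove[OF assms(1,4), of b] by simp
  finally show False using assms(3) by simp
qed

text \<open>One level of the tower with one place \<open>P'\<close> fixed: \<open>F'\<close> stands
  for F_n and \<open>E'\<close> for E F_n, and linear disjointness has been converted into
  \<open>indep\<close> and \<open>dimE'\<close>. In the terms of the overview, \<open>O1\<close> is
  O', \<open>A0\<close> is A, \<open>A1\<close> is A', \<open>I0\<close> is P' A' and
  \<open>idl (sep Q)\<close> is I_Q; \<open>N Q\<close> consists of the places over both
  \<open>Q\<close> and \<open>P'\<close>.\<close>

locale place_composite = constant_field R k for R (structure) and k +
  fixes F E F' E' P P' :: "'a set" and Us :: "'a list"
  assumes F: "function_field R k F" and E: "function_field R k E"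
    and F': "function_field R k F'" and E': "function_field R k E'"
    and FE: "F \<subseteq> E" and FF': "F \<subseteq> F'" and EE': "E \<subseteq> E'" and F'E': "F' \<subseteq> E'"
    and P: "P \<in> places R k F" and P': "P' \<in> places_over R k F' P"
    and dimE: "dimension (length Us) F E" and dimE': "dimension (length Us) F' E'"
    and Us: "set Us \<subseteq> carrier R" and indep: "independent F' Us"
    and basis: "Span (ring_of_place R F P) Us = integral_closure_in R (ring_of_place R F P) E"
    and cop: "\<And>Q. Q \<in> places_over R k E P \<Longrightarrow>
      coprime (ramification_index R F P E Q) (ramification_index R F P F' P')"
begin

abbreviation "S \<equiv> places_over R k E P"
abbreviation "e \<equiv> ramification_index R F P E"
abbreviation "f \<equiv> relative_degree R F P E"
abbreviation "O0 \<equiv> ring_of_place R F P"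
abbreviation "O1 \<equiv> ring_of_place R F' P'"
abbreviation "A0 \<equiv> integral_closure_in R O0 E"
abbreviation "N Q \<equiv> {Q' \<in> places_over R k E' Q. P' \<subseteq> Q'}"

definition "A1 = Span O1 Us"

lemma P'_place: "P' \<in> places R k F'" "P \<subseteq> P'"
  using places_overD[OF P'] by auto

lemma dP: "discrete_place F P" and dP': "discrete_place F' P'"
  using place_discrete[OF F P] place_discrete[OF F' P'_place(1)] by auto

lemma S_place: assumes "Q \<in> S" shows "Q \<in> places R k E" "P \<subseteq> Q" "discrete_place E Q"
  using places_overD[OF assms] place_discrete[OF E] by auto

lemma finite_S: "finite S"
  using fundamental_inequality(1)[OF F E FE dimE P] .

lemma A0_mem: "z \<in> A0 \<longleftrightarrow> z \<in> E \<and> (\<forall>Q\<in>S. z \<in> val_of E Q)"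
  using integral_closure_eq[OF F E FE P] by blast

lemma A0_subring: "subring A0 R"
proof (rule subringI)
  note Er = subfieldE(1)[OF ff_subfield[OF E]]
  show "A0 \<subseteq> carrier R" using subringE(1)[OF Er] A0_mem by blast
  show "\<one> \<in> A0" using subringE(3)[OF Er] subringE(3)[OF dp_facts(2)[OF S_place(3)]] A0_mem by blast
  fix a b assume ab: "a \<in> A0" "b \<in> A0"
  have vr: "subring (val_of E Q) R" if "Q \<in> S" for Q using dp_facts(2)[OF S_place(3)[OF that]] .
  show "\<ominus> a \<in> A0" using ab subringE(5)[OF Er] subringE(5)[OF vr] A0_mem by auto
  show "a \<otimes> b \<in> A0" using ab subringE(6)[OF Er] subringE(6)[OF vr] A0_mem by auto
  show "a \<oplus> b \<in> A0" using ab subringE(7)[OF Er] subringE(7)[OF vr] A0_mem by auto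
qed

lemma O0_O1: "O0 \<subseteq> O1" "O0 \<subseteq> A0"
proof -
  show "O0 \<subseteq> O1" using places_over_restrict(1)[OF F F' FF' P P'] by blast
  show "O0 \<subseteq> A0"
    using places_over_restrict(1)[OF F E FE P] dp_facts(3)[OF dP] FE A0_mem by blast
qed

lemma A1_mem: "x \<in> A1 \<longleftrightarrow> (\<exists>as. set as \<subseteq> O1 \<and> length as = length Us \<and> x = combine as Us)"
  unfolding A1_def Span_eq_combine by blast

lemma O1R: "O1 \<subseteq> carrier R" and O1r: "subring O1 R"
  using dp_facts(2,5)[OF dP'] by auto

lemma A0_A1: "A0 \<subseteq> A1"
proof
  fix x assume "x \<in> A0"
  then obtain as where "set as \<subseteq> O0" "length as = length Us" "x = combine as Us"
    using basis unfolding Span_eq_combine by blast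
  then show "x \<in> A1" using O0_O1(1) A1_mem by blast
qed

lemma Us_A0: "set Us \<subseteq> A0"
proof -
  have O0r: "subring O0 R" using dp_facts(2)[OF dP] .
  have "set Vs \<subseteq> Span O0 Vs" if "set Vs \<subseteq> carrier R" for Vs
    using that
  proof (induction Vs)
    case (Cons v Vs)
    have z: "\<zero> \<in> O0" "\<one> \<in> O0" using subringE(2,3)[OF O0r] by auto
    have Sc: "Span O0 (v # Vs) = line_extension O0 v (Span O0 Vs)" by simp
    have sR: "Span O0 Vs \<subseteq> carrier R" using Span_in_carrier[of O0 Vs] Cons subringE(1)[OF O0r] by auto
    have "\<zero> \<in> Span O0 Vs"
    proof -
      have "combine (replicate (length Vs) \<zero>) Vs = \<zero>" using combine_replicate Cons by simp
      moreover have "set (replicate (length Vs) \<zero>) \<subseteq> O0" using z by auto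
      ultimately show ?thesis unfolding Span_eq_combine by (metis (mono_tags, lifting) length_replicate mem_Collect_eq)
    qed
    moreover have "v = \<one> \<otimes> v \<oplus> \<zero>" using Cons by simp
    ultimately have "v \<in> Span O0 (v # Vs)" using z unfolding Sc line_extension_mem_iff by blast
    moreover have "x \<in> Span O0 (v # Vs)" if x: "x \<in> Span O0 Vs" for x
    proof -
      have "x = \<zero> \<otimes> v \<oplus> x" using x sR Cons by auto
      then show ?thesis using x z unfolding Sc line_extension_mem_iff by blast
    qed
    moreover have "set Vs \<subseteq> Span O0 Vs" using Cons by simp
    ultimately have "insert v (set Vs) \<subseteq> Span O0 (v # Vs)" by blast
    then show ?case by (simp only: list.set)
  qed simp
  then have "set Us \<subseteq> Span O0 Us" using Us by blast
  then show ?thesis unfolding basis .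
qed

lemma A1_add: "additive_subgroup A1 R"
  unfolding A1_def using Span_module(1)[OF O1r Us] .

lemma A1_smult: "a \<in> O1 \<Longrightarrow> x \<in> A1 \<Longrightarrow> a \<otimes> x \<in> A1"
  unfolding A1_def using Span_module(2)[OF O1r Us] .

lemma A1R: "A1 \<subseteq> carrier R"
  using additive_subgroup.a_subset[OF A1_add] .

text \<open>Products of two members of \<open>Us\<close> lie in the ring \<open>A0\<close>;
  linearity over \<open>O1\<close> does the rest, one factor at a time.\<close>

lemma A1_subring: "subring A1 R"
proof (rule subringI[OF A1R])
  show "\<one> \<in> A1" using A0_A1 subringE(3)[OF A0_subring] by blast
  fix x y assume x: "x \<in> A1" and y: "y \<in> A1"
  show "\<ominus> x \<in> A1" using additive_subgroup.a_inv_closed[OF A1_add x] .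
  show "x \<oplus> y \<in> A1" using additive_subgroup.a_closed[OF A1_add x y] .
  obtain as where as: "set as \<subseteq> O1" "length as = length Us" "x = combine as Us" using x A1_mem by metis
  obtain bs where bs: "set bs \<subseteq> O1" "length bs = length Us" "y = combine bs Us" using y A1_mem by metis
  have uy: "u \<otimes> y \<in> A1" if u: "u \<in> set Us" for u
  proof -
    have uR: "u \<in> carrier R" using u Us by auto
    have "set (map (\<lambda>v. v \<otimes> u) Us) \<subseteq> A1"
    proof
      fix x assume "x \<in> set (map (\<lambda>v. v \<otimes> u) Us)"
      then obtain v where "v \<in> set Us" "x = v \<otimes> u" by auto
      then show "x \<in> A1" using Us_A0 subringE(6)[OF A0_subring] A0_A1 u by blast
    qed
    then have "combine bs (map (\<lambda>v. v \<otimes> u) Us) \<in> A1" using combine_in_module[OF A1_add A1_smult bs(1)] by blast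
    moreover have "combine bs (map (\<lambda>v. v \<otimes> u) Us) = y \<otimes> u"
      using combine_l_distr[of bs Us u] bs O1R Us uR by auto
    moreover have "y \<otimes> u = u \<otimes> y" using m_comm y A1R uR by blast
    ultimately show ?thesis by simp
  qed
  have "set (map (\<lambda>u. u \<otimes> y) Us) \<subseteq> A1" using uy by auto
  then have "combine as (map (\<lambda>u. u \<otimes> y) Us) \<in> A1" using combine_in_module[OF A1_add A1_smult as(1)] by blast
  moreover have "combine as (map (\<lambda>u. u \<otimes> y) Us) = x \<otimes> y"
    using combine_l_distr[of as Us y] as O1R Us y A1R by auto
  ultimately show "x \<otimes> y \<in> A1" by simp
qed

lemma O1_A1: "O1 \<subseteq> A1"
proof
  fix a assume a: "a \<in> O1"
  have "a \<otimes> \<one> \<in> A1" using A1_smult[OF a subringE(3)[OF A1_subring]] .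
  then show "a \<in> A1" using a O1R by auto
qed

lemma A1_E': "A1 \<subseteq> E'"
proof -
  note r = subfieldE(1)[OF ff_subfield[OF E']]
  have "additive_subgroup E' R" using subring_minus[OF r] subringE(1,2)[OF r] by (intro additive_subgroupI) auto
  moreover have "a \<otimes> x \<in> E'" if "a \<in> O1" "x \<in> E'" for a x
    using that subringE(6)[OF r] dp_facts(3)[OF dP'] F'E' by blast
  moreover have "set Us \<subseteq> E'" using Us_A0 A0_mem EE' by blast
  ultimately have "combine as Us \<in> E'" if "set as \<subseteq> O1" for as using combine_in_module[of E' O1 as Us] that by blast
  then show ?thesis by (auto simp: A1_mem)
qed

text \<open>Reduces inclusions of \<open>A1\<close> in an \<open>O1\<close>-module to
  \<open>A0\<close>, which contains the generators \<open>Us\<close>.\<close>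

lemma A1_induct:
  assumes x: "x \<in> A1" and M: "additive_subgroup M R" and sm: "\<And>a x. a \<in> O1 \<Longrightarrow> x \<in> M \<Longrightarrow> a \<otimes> x \<in> M"
    and A0: "A0 \<subseteq> M"
  shows "x \<in> M"
proof -
  obtain as where "set as \<subseteq> O1" "x = combine as Us" using x A1_mem by blast
  moreover have "set Us \<subseteq> M" using Us_A0 A0 by blast
  ultimately show ?thesis using combine_in_module[OF M sm] by blast
qed

end

section \<open>Indices of the ideals of A'\<close>

context place_composite
begin

definition "t1 = (SOME t. prime_element R F' P' t)"

lemma t1: "prime_element R F' P' t1" "t1 \<in> F'" "t1 \<in> carrier R" "t1 \<noteq> \<zero>" "t1 \<in> P'" "P' = t1 <# O1" "t1 \<in> O1"
proof -
  have "\<exists>t. prime_element R F' P' t" using dp_prime[OF dP'] by metis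
  then show p: "prime_element R F' P' t1" unfolding t1_def by (rule someI_ex)
  show tp: "t1 \<in> P'" "P' = t1 <# O1" using iffD1[OF dp_prime_element[OF dP'] p] by blast+
  then show "t1 \<in> O1" "t1 \<in> F'" "t1 \<in> carrier R" using dp_facts(3,4,9)[OF dP'] by blast+
  show "t1 \<noteq> \<zero>" using dp_prime_nonzero[OF dP' p] .
qed

definition "I0 = t1 <# A1"

lemma I0: "additive_subgroup I0 R" "I0 \<subseteq> A1" "P' \<subseteq> I0"
proof -
  show "additive_subgroup I0 R" unfolding I0_def using l_coset_additive_subgroup[OF A1_subring t1(3)] .
  have "t1 \<in> A1" using O1_A1 t1(7) by blast
  then show "I0 \<subseteq> A1" using subringE(6)[OF A1_subring] by (auto simp: I0_def l_coset_mem)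
  show "P' \<subseteq> I0"
  proof
    fix x assume "x \<in> P'"
    then have "x \<in> t1 <# O1" using equalityD1[OF t1(6)] by blast
    then show "x \<in> I0" using O1_A1 unfolding I0_def l_coset_mem by blast
  qed
qed

lemma I0_mult:
  assumes "c \<in> A1" "a \<in> I0"
  shows "c \<otimes> a \<in> I0"
proof -
  obtain x where x: "x \<in> A1" "a = t1 \<otimes> x" using assms(2) by (auto simp: I0_def l_coset_mem)
  have "c \<otimes> a = t1 \<otimes> (c \<otimes> x)" unfolding x(2) using assms(1) x(1) A1R t1(3) by (simp add: m_lcomm subset_iff)
  then show ?thesis using subringE(6)[OF A1_subring assms(1) x(1)] unfolding I0_def l_coset_mem by blast
qed

lemma P'_O1: "additive_subgroup P' R" "finite_index O1 P'"
  using place_subgroup[OF F' P'_place(1)] place_finite_index[OF F' P'_place(1)] by auto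

lemma P'_A1: "a \<in> P' \<Longrightarrow> c \<in> A1 \<Longrightarrow> a \<otimes> c \<in> I0"
  using I0_mult[of c a] I0(3) A1R I0(2) m_comm by (metis subsetD)

lemma finite_index_I0: "finite_index A1 I0"
proof (rule index_le_span(1)[OF P'_O1(1) O1R P'_O1(2) I0(1) A1R Us])
  show "a \<otimes> u \<in> I0" if "a \<in> P'" "u \<in> set Us" for a u using P'_A1 that Us_A0 A0_A1 by blast
  fix c assume c: "c \<in> A1"
  then obtain as where as: "set as \<subseteq> O1" "length as = length Us" "c = combine as Us" using A1_mem by blast
  have "c \<ominus> combine as Us = \<zero>" using as(3) c A1R by (auto simp: a_minus_def r_neg)
  then show "\<exists>as. set as \<subseteq> O1 \<and> length as = length Us \<and> c \<ominus> combine as Us \<in> I0"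
    using as additive_subgroup.zero_closed[OF I0(1)] by (intro exI[of _ as]) simp
qed

text \<open>Coordinates with respect to \<open>Us\<close> are unique over \<open>F'\<close>, so a
  combination divisible by \<open>t1\<close> in \<open>A1\<close> has coefficients divisible by
  \<open>t1\<close>.\<close>

lemma index_I0_ge: "index O1 P' ^ length Us \<le> index A1 I0"
proof (rule index_ge_free[OF P'_O1(1) O1R P'_O1(2) _ I0(1) A1R finite_index_I0 Us])
  show "a \<ominus> b \<in> O1" if "a \<in> O1" "b \<in> O1" for a b using subring_minus[OF O1r that] .
  show "combine as Us \<in> A1" if "set as \<subseteq> O1" "length as = length Us" for as using A1_mem that by blast
  fix as assume as: "set as \<subseteq> O1" "length as = length Us" "combine as Us \<in> I0"
  then obtain x where x: "x \<in> A1" "combine as Us = t1 \<otimes> x" by (auto simp: I0_def l_coset_mem)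
  obtain bs where bs: "set bs \<subseteq> O1" "length bs = length Us" "x = combine bs Us" using x(1) A1_mem by blast
  have bR: "set bs \<subseteq> carrier R" using bs(1) O1R by blast
  have eq: "combine as Us = combine (map ((\<otimes>) t1) bs) Us"
    using x(2) bs(3) combine_r_distr[of bs Us t1] bR Us t1(3) by auto
  have F'f: "subfield F' R" using ff_subfield[OF F'] .
  have O1F: "O1 \<subseteq> F'" using dp_facts(3)[OF dP'] .
  have c: "set (map ((\<otimes>) t1) bs) \<subseteq> F'" "length (map ((\<otimes>) t1) bs) = length Us"
    using bs O1F t1(2) subringE(6)[OF subfieldE(1)[OF F'f]] by auto
  have "combine as Us \<in> Span F' Us"
    using Span_mem_iff_length_version[OF F'f Us] as O1F by blast
  then have "as = map ((\<otimes>) t1) bs"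
  proof -
    assume "combine as Us \<in> Span F' Us"
    then have u: "\<exists>!Ks. set Ks \<subseteq> F' \<and> length Ks = length Us \<and> combine as Us = combine Ks Us"
      by (rule unique_decomposition[OF F'f indep])
    have "set as \<subseteq> F'" using as(1) O1F by (rule subset_trans)
    then show ?thesis using u as(2) c eq by blast
  qed
  then have "x \<in> t1 <# O1" if "x \<in> set as" for x using bs(1) that unfolding l_coset_mem by auto
  then have "set as \<subseteq> t1 <# O1" by blast
  then show "set as \<subseteq> P'" using equalityD2[OF t1(6)] by blast
qed

text \<open>The summand \<open>I0\<close> makes the index in \<open>A1\<close> finite for every s in
  \<open>A1\<close>.\<close>

definition idl :: "'a \<Rightarrow> 'a set"
  where "idl s = {s \<otimes> x \<oplus> i | x i. x \<in> A1 \<and> i \<in> I0}"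

lemma idlI: "x \<in> A1 \<Longrightarrow> i \<in> I0 \<Longrightarrow> s \<otimes> x \<oplus> i \<in> idl s"
  by (auto simp: idl_def)

lemma I0R: "I0 \<subseteq> carrier R"
  using I0(2) A1R by blast

lemma idl:
  assumes s: "s \<in> A1"
  shows "additive_subgroup (idl s) R" "I0 \<subseteq> idl s" "idl s \<subseteq> A1" "s \<in> idl s" "finite_index A1 (idl s)"
    and "\<And>c a. c \<in> A1 \<Longrightarrow> a \<in> idl s \<Longrightarrow> c \<otimes> a \<in> idl s"
    and "\<And>x. x \<in> A1 \<Longrightarrow> s \<otimes> x \<in> idl s"
proof -
  note z = additive_subgroup.zero_closed[OF I0(1)]
  have sR: "s \<in> carrier R" using s A1R by auto
  show sub: "idl s \<subseteq> A1"
  proof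
    fix a assume "a \<in> idl s"
    then obtain x i where "x \<in> A1" "i \<in> I0" "a = s \<otimes> x \<oplus> i" by (auto simp: idl_def)
    then show "a \<in> A1" using s I0(2) subringE(6,7)[OF A1_subring] by blast
  qed
  show I: "I0 \<subseteq> idl s"
  proof
    fix i assume i: "i \<in> I0"
    have "i = s \<otimes> \<zero> \<oplus> i" using sR i I0R by auto
    then show "i \<in> idl s" using idlI[OF subringE(2)[OF A1_subring] i, of s] by simp
  qed
  show sx: "s \<otimes> x \<in> idl s" if x: "x \<in> A1" for x
  proof -
    have "s \<otimes> x = s \<otimes> x \<oplus> \<zero>" using sR x A1R by auto
    then show ?thesis using idlI[OF x z, of s] by simp
  qed
  show "s \<in> idl s" using sx[OF subringE(3)[OF A1_subring]] sR by simp
  show g: "additive_subgroup (idl s) R"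
  proof (rule additive_subgroupI)
    show "idl s \<subseteq> carrier R" using sub A1R by blast
    show "\<zero> \<in> idl s" using I z by blast
    fix a b assume "a \<in> idl s" "b \<in> idl s"
    then obtain x i y j where *: "x \<in> A1" "i \<in> I0" "a = s \<otimes> x \<oplus> i" "y \<in> A1" "j \<in> I0" "b = s \<otimes> y \<oplus> j"
      by (auto simp: idl_def)
    have R: "x \<in> carrier R" "y \<in> carrier R" "i \<in> carrier R" "j \<in> carrier R" using * A1R I0R by auto
    have "a \<ominus> b = s \<otimes> (x \<ominus> y) \<oplus> (i \<ominus> j)" unfolding *(3,6) using R sR by algebra
    then show "a \<ominus> b \<in> idl s"
      using idlI[OF subring_minus[OF A1_subring *(1,4)] additive_subgroup_minus[OF I0(1) *(2,5)], of s] by simp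
  qed
  show "c \<otimes> a \<in> idl s" if c: "c \<in> A1" and a: "a \<in> idl s" for c a
  proof -
    obtain x i where *: "x \<in> A1" "i \<in> I0" "a = s \<otimes> x \<oplus> i" using a by (auto simp: idl_def)
    have R: "x \<in> carrier R" "i \<in> carrier R" "c \<in> carrier R" using * c A1R I0R by auto
    have "c \<otimes> a = s \<otimes> (c \<otimes> x) \<oplus> c \<otimes> i" unfolding *(3) using R sR by (simp add: r_distr m_lcomm)
    then show ?thesis using idlI[OF subringE(6)[OF A1_subring c *(1)] I0_mult[OF c *(2)], of s] by simp
  qed
  show "finite_index A1 (idl s)" using index_antimono(1)[OF I0(1) g A1R finite_index_I0 I] .
qed

text \<open>Division in two stages: reduce x modulo a, then the cofactor modulo b. The pairs of
  remainders cover all classes but may repeat, because multiplication by a need not be injective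
  modulo \<open>I0\<close>.\<close>

lemma index_idl_mult:
  assumes a: "a \<in> A1" and b: "b \<in> A1"
  shows "index A1 (idl (a \<otimes> b)) \<le> index A1 (idl a) * index A1 (idl b)"
proof -
  have ab: "a \<otimes> b \<in> A1" using subringE(6)[OF A1_subring a b] .
  note ia = idl[OF a] and ib = idl[OF b] and iab = idl[OF ab]
  obtain S where S: "S \<subseteq> A1" "finite S" "card S = index A1 (idl a)" "\<And>x. x \<in> A1 \<Longrightarrow> \<exists>r\<in>S. x \<ominus> r \<in> idl a"
    using index_representatives[OF ia(1) A1R ia(5)] by metis
  obtain T where T: "T \<subseteq> A1" "finite T" "card T = index A1 (idl b)" "\<And>x. x \<in> A1 \<Longrightarrow> \<exists>r\<in>T. x \<ominus> r \<in> idl b"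
    using index_representatives[OF ib(1) A1R ib(5)] by metis
  let ?U = "(\<lambda>(r, s). r \<oplus> a \<otimes> s) ` (S \<times> T)"
  have aR: "a \<in> carrier R" "b \<in> carrier R" using a b A1R by auto
  have "S \<subseteq> carrier R" "T \<subseteq> carrier R" using S(1) T(1) A1R by blast+
  then have U: "finite ?U" "?U \<subseteq> carrier R" using S(2) T(2) aR by auto
  have cov: "\<exists>r\<in>?U. x \<ominus> r \<in> idl (a \<otimes> b)" if x: "x \<in> A1" for x
  proof -
    obtain r where r: "r \<in> S" "x \<ominus> r \<in> idl a" using S(4)[OF x] by blast
    obtain z i where z: "z \<in> A1" "i \<in> I0" "x \<ominus> r = a \<otimes> z \<oplus> i" using r(2) by (auto simp: idl_def)
    obtain s where s: "s \<in> T" "z \<ominus> s \<in> idl b" using T(4)[OF z(1)] by blast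
    obtain w j where w: "w \<in> A1" "j \<in> I0" "z \<ominus> s = b \<otimes> w \<oplus> j" using s(2) by (auto simp: idl_def)
    have R: "x \<in> carrier R" "r \<in> carrier R" "z \<in> carrier R" "i \<in> carrier R" "s \<in> carrier R" "w \<in> carrier R" "j \<in> carrier R"
      using x r z s w S(1) T(1) A1R I0R by auto
    have "x \<ominus> (r \<oplus> a \<otimes> s) = (x \<ominus> r) \<ominus> a \<otimes> s" using R aR by algebra
    also have "\<dots> = (a \<otimes> z \<oplus> i) \<ominus> a \<otimes> s" using z(3) by simp
    also have "\<dots> = a \<otimes> (z \<ominus> s) \<oplus> i" using R aR by algebra
    also have "\<dots> = a \<otimes> (b \<otimes> w \<oplus> j) \<oplus> i" using w(3) by simp
    also have "\<dots> = (a \<otimes> b) \<otimes> w \<oplus> (a \<otimes> j \<oplus> i)" using R aR by (simp add: r_distr m_assoc a_assoc)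
    finally have e: "x \<ominus> (r \<oplus> a \<otimes> s) = (a \<otimes> b) \<otimes> w \<oplus> (a \<otimes> j \<oplus> i)" .
    have "a \<otimes> j \<oplus> i \<in> I0" using I0_mult[OF a w(2)] z(2) additive_subgroup.a_closed[OF I0(1)] by blast
    then have "x \<ominus> (r \<oplus> a \<otimes> s) \<in> idl (a \<otimes> b)" using e idlI[OF w(1)] by simp
    moreover have "r \<oplus> a \<otimes> s \<in> ?U" using r(1) s(1) by force
    ultimately show ?thesis by blast
  qed
  have "index A1 (idl (a \<otimes> b)) \<le> card ?U" using index_le_cover(2)[OF iab(1) A1R U cov] .
  also have "\<dots> \<le> card (S \<times> T)" using S T by (intro card_image_le) auto
  finally show ?thesis using S(3) T(3) by (simp add: card_cartesian_product)
qed

lemma index_idl_one: "index A1 (idl \<one>) = 1"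
proof -
  have one: "\<one> \<in> A1" using subringE(3)[OF A1_subring] .
  note i = idl[OF one]
  have "index A1 (idl \<one>) \<le> card {\<zero>}"
  proof (rule index_le_cover(2)[OF i(1) A1R])
    fix x assume x: "x \<in> A1"
    have "x \<ominus> \<zero> = \<one> \<otimes> x" using x A1R by (auto simp: a_minus_def)
    then have "x \<ominus> \<zero> \<in> idl \<one>" using i(7)[OF x] by simp
    then show "\<exists>r\<in>{\<zero>}. x \<ominus> r \<in> idl \<one>" by simp
  qed auto
  moreover have "0 < index A1 (idl \<one>)" using index_pos[OF i(5)] one by blast
  ultimately show ?thesis by simp
qed

lemma index_idl_pow:
  assumes s: "s \<in> A1"
  shows "s [^] (n::nat) \<in> A1" "index A1 (idl (s [^] n)) \<le> index A1 (idl s) ^ n"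
proof -
  show p: "s [^] (n::nat) \<in> A1" for n by (induction n) (use s subringE(3,6)[OF A1_subring] in auto)
  show "index A1 (idl (s [^] n)) \<le> index A1 (idl s) ^ n"
  proof (induction n)
    case 0
    then show ?case using index_idl_one by simp
  next
    case (Suc n)
    have "index A1 (idl (s [^] Suc n)) \<le> index A1 (idl (s [^] n)) * index A1 (idl s)"
      using index_idl_mult[OF p s] by simp
    also have "\<dots> \<le> index A1 (idl s) ^ n * index A1 (idl s)" using Suc by simp
    finally show ?case by (simp add: mult.commute)
  qed
qed

text \<open>Weak approximation of a uniformizer at \<open>Q\<close> and of \<one> at the other
  places over \<open>P\<close>.\<close>

lemma separator:
  assumes Q: "Q \<in> S"
  shows "\<exists>s\<in>A0. s \<noteq> \<zero> \<and> place_valuation R E Q s = 1 \<and> (\<forall>Q2\<in>S. Q2 \<noteq> Q \<longrightarrow> place_valuation R E Q2 s = 0)"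
proof -
  note dQ = S_place(3)
  have Ef: "subfield E R" using ff_subfield[OF E] .
  note ER = subfieldE(3)[OF Ef]
  obtain t where t: "prime_element R E Q t" "t \<in> E" "t \<in> carrier R" "t \<noteq> \<zero>" by (rule dp_prime[OF dQ[OF Q]])
  have one: "\<one> \<in> E" using subringE(3)[OF subfieldE(1)[OF Ef]] .
  define g where "g Q2 = (if Q2 = Q then t else \<one>)" for Q2
  have gE: "\<And>Q2. Q2 \<in> S \<Longrightarrow> g Q2 \<in> E" using t one by (simp add: g_def)
  \<comment> \<open>Precision 2 exceeds the prescribed values 1 and 0, so the approximation has
    exactly these values.\<close>
  have "\<exists>c\<in>E. \<forall>Q\<in>S. c \<ominus> g Q \<in> val_ge E Q 2"
    by (rule weak_approximation[OF finite_S dQ Ef gE])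
  then obtain s where s: "s \<in> E" "\<And>Q2. Q2 \<in> S \<Longrightarrow> s \<ominus> g Q2 \<in> val_ge E Q2 2" by blast
  have sR: "s \<in> carrier R" using s ER by auto
  have sg: "s = g Q2 \<oplus> (s \<ominus> g Q2)" for Q2
  proof -
    have "g Q2 \<in> carrier R" using t by (simp add: g_def)
    then show ?thesis using sR by algebra
  qed
  have gv: "g Q2 \<in> E" "g Q2 \<noteq> \<zero>" "place_valuation R E Q2 (g Q2) = (if Q2 = Q then 1 else 0)" if "Q2 \<in> S" for Q2
    using t one dp_val_prime[OF dQ[OF Q] t(1)] dp_val_one[OF dQ[OF that]] by (auto simp: g_def)
  have v: "s \<noteq> \<zero> \<and> place_valuation R E Q2 s = (if Q2 = Q then 1 else 0)" if Q2: "Q2 \<in> S" for Q2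
  proof -
    have "s \<ominus> g Q2 \<in> val_ge E Q2 (place_valuation R E Q2 (g Q2) + 1)"
    proof -
      have "place_valuation R E Q2 (g Q2) + 1 \<le> 2" using gv(3)[OF Q2] by simp
      then show ?thesis using s(2)[OF Q2] vg_mono[OF dQ[OF Q2]] by blast
    qed
    from dp_val_add_eq[OF dQ[OF Q2] gv(1,2)[OF Q2] this] show ?thesis
      unfolding sg[of Q2, symmetric] gv(3)[OF Q2] by blast
  qed
  have "s \<in> val_of E Q2" if "Q2 \<in> S" for Q2
    using v[OF that] dp_val_nonneg_iff[OF dQ[OF that] s(1)] by simp
  then have "s \<in> A0" using s(1) A0_mem by blast
  then show ?thesis using v[OF Q] v by (intro bexI[of _ s]) auto
qed

definition sep :: "'a set \<Rightarrow> 'a"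
  where "sep Q = (SOME s. s \<in> A0 \<and> s \<noteq> \<zero> \<and> place_valuation R E Q s = 1 \<and>
    (\<forall>Q2\<in>S. Q2 \<noteq> Q \<longrightarrow> place_valuation R E Q2 s = 0))"

lemma sep:
  assumes Q: "Q \<in> S"
  shows "sep Q \<in> A0" "sep Q \<in> A1" "sep Q \<in> E" "sep Q \<noteq> \<zero>" "place_valuation R E Q (sep Q) = 1"
    and "\<And>Q2. Q2 \<in> S \<Longrightarrow> Q2 \<noteq> Q \<Longrightarrow> place_valuation R E Q2 (sep Q) = 0"
    and "sep Q \<in> Q"
proof -
  have "\<exists>s. s \<in> A0 \<and> s \<noteq> \<zero> \<and> place_valuation R E Q s = 1 \<and> (\<forall>Q2\<in>S. Q2 \<noteq> Q \<longrightarrow> place_valuation R E Q2 s = 0)"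
    using separator[OF Q] by blast
  then have *: "sep Q \<in> A0 \<and> sep Q \<noteq> \<zero> \<and> place_valuation R E Q (sep Q) = 1 \<and> (\<forall>Q2\<in>S. Q2 \<noteq> Q \<longrightarrow> place_valuation R E Q2 (sep Q) = 0)"
    unfolding sep_def by (rule someI_ex)
  then show "sep Q \<in> A0" "sep Q \<noteq> \<zero>" "place_valuation R E Q (sep Q) = 1" by auto
  show "place_valuation R E Q2 (sep Q) = 0" if "Q2 \<in> S" "Q2 \<noteq> Q" for Q2 using * that by blast
  show "sep Q \<in> A1" "sep Q \<in> E" using * A0_A1 A0_mem by auto
  then show "sep Q \<in> Q" using dp_val_pos_iff[OF S_place(3)[OF Q], of "sep Q"] * by simp
qed

text \<open>The quotient of a by \<open>sep Q\<close> has a nonnegative value at every place over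
  \<open>P\<close>, which characterises \<open>A0\<close>. So \<open>Q\<close> meets
  \<open>A0\<close> in a principal ideal.\<close>

lemma sep_divides:
  assumes Q: "Q \<in> S" and a: "a \<in> A0" "a \<in> Q"
  shows "\<exists>b\<in>A0. a = sep Q \<otimes> b"
proof -
  note s = sep[OF Q]
  have Ef: "subfield E R" using ff_subfield[OF E] .
  note ER = subfieldE(3)[OF Ef]
  note si = subfield_inv[OF Ef s(3,4)]
  have aE: "a \<in> E" using a A0_mem by blast
  have R: "a \<in> carrier R" "sep Q \<in> carrier R" "inv (sep Q) \<in> carrier R" using aE s si ER by auto
  define b where "b = inv (sep Q) \<otimes> a"
  have bE: "b \<in> E" unfolding b_def using si aE subringE(6)[OF subfieldE(1)[OF Ef]] by blast
  have "b \<in> val_of E Q2" if Q2: "Q2 \<in> S" for Q2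
  proof -
    note d = S_place(3)[OF Q2]
    have a2: "a \<in> val_ge E Q2 (place_valuation R E Q2 (sep Q))"
    proof (cases "Q2 = Q")
      case True
      then show ?thesis using a(2) vg_1[OF d] s(5) by simp
    next
      case False
      then show ?thesis using a(1) A0_mem Q2 vg_0[OF d] s(6)[OF Q2 False] by simp
    qed
    have "inv (sep Q) \<in> val_ge E Q2 (- place_valuation R E Q2 (sep Q))"
      using si dp_val_inv[OF d s(3,4)] by (simp add: val_ge_def)
    then have "b \<in> val_ge E Q2 (- place_valuation R E Q2 (sep Q) + place_valuation R E Q2 (sep Q))"
      unfolding b_def using vg_mult[OF d _ a2] by blast
    then show ?thesis using vg_0[OF d] by simp
  qed
  then have "b \<in> A0" using bE A0_mem by blast
  moreover have "a = sep Q \<otimes> b" unfolding b_def using R si by (simp add: m_assoc[symmetric])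
  ultimately show ?thesis by blast
qed

text \<open>Comparing values at each place over \<open>P\<close> shows that the product \<pi> of the
  powers \<open>sep Q [^] e Q\<close> is divisible in \<open>A0\<close> by a uniformizer t of
  \<open>P\<close>. As t lies in \<open>P'\<close>, \<pi> lies in \<open>I0\<close> and
  \<open>idl \<pi>\<close> is \<open>I0\<close> itself; submultiplicativity of the index splits the
  product.\<close>

lemma index_I0_le: "index A1 I0 \<le> (\<Prod>Q\<in>S. index A1 (idl (sep Q)) ^ e Q)"
proof -
  have Ef: "subfield E R" using ff_subfield[OF E] .
  note ER = subfieldE(3)[OF Ef]
  \<comment> \<open>The product is built factor by factor, carrying along its values and the bound
    for its index.\<close>
  have ex: "\<exists>\<pi>\<in>A0. \<pi> \<noteq> \<zero> \<and> (\<forall>Q\<in>T. int (e Q) \<le> place_valuation R E Q \<pi>) \<and>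
    index A1 (idl \<pi>) \<le> (\<Prod>Q\<in>T. index A1 (idl (sep Q)) ^ e Q)" if "finite T" "T \<subseteq> S" for T
    using that
  proof (induction T rule: finite_induct)
    case empty
    then show ?case using subringE(3)[OF A0_subring] index_idl_one by (intro bexI[of _ \<one>]) auto
  next
    case (insert Q T)
    obtain \<pi> where p: "\<pi> \<in> A0" "\<pi> \<noteq> \<zero>" "\<And>Q. Q \<in> T \<Longrightarrow> int (e Q) \<le> place_valuation R E Q \<pi>"
      "index A1 (idl \<pi>) \<le> (\<Prod>Q\<in>T. index A1 (idl (sep Q)) ^ e Q)" using insert by auto
    have QS: "Q \<in> S" using insert by auto
    note s = sep[OF QS]
    have "sep Q [^] (n::nat) \<in> A0" for n by (induction n) (use s(1) subringE(3,6)[OF A0_subring] in auto)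
    then have sn: "sep Q [^] e Q \<in> A0" .
    have pE: "\<pi> \<in> E" and snE: "sep Q [^] e Q \<in> E" using p sn A0_mem by auto
    have sn0: "sep Q [^] e Q \<noteq> \<zero>" using dp_val_pow(2)[OF S_place(3)[OF QS] s(3,4)] .
    have pi1: "sep Q [^] e Q \<otimes> \<pi> \<in> A0" using subringE(6)[OF A0_subring sn p(1)] .
    have nz: "sep Q [^] e Q \<otimes> \<pi> \<noteq> \<zero>" using integral[of "sep Q [^] e Q" \<pi>] sn0 p(2) pE snE ER by auto
    have val: "int (e Q2) \<le> place_valuation R E Q2 (sep Q [^] e Q \<otimes> \<pi>)" if Q2: "Q2 \<in> insert Q T" for Q2
    proof -
      have Q2S: "Q2 \<in> S" using Q2 insert by auto
      note d = S_place(3)[OF Q2S]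
      have v: "place_valuation R E Q2 (sep Q [^] e Q \<otimes> \<pi>) = int (e Q) * place_valuation R E Q2 (sep Q) + place_valuation R E Q2 \<pi>"
        using dp_val_mult[OF d snE sn0 pE p(2)] dp_val_pow(3)[OF d s(3,4)] by simp
      have pos: "0 \<le> place_valuation R E Q2 \<pi>" using dp_val_nonneg_iff[OF d pE p(2)] p(1) A0_mem Q2S by blast
      show ?thesis
      proof (cases "Q2 = Q")
        case True
        then show ?thesis using v s(5) pos by simp
      next
        case False
        then show ?thesis using v s(6)[OF Q2S False] p(3)[of Q2] Q2 by simp
      qed
    qed
    have "index A1 (idl (sep Q [^] e Q \<otimes> \<pi>)) \<le> index A1 (idl (sep Q [^] e Q)) * index A1 (idl \<pi>)"
      using index_idl_mult sn p(1) A0_A1 by blast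
    also have "\<dots> \<le> index A1 (idl (sep Q)) ^ e Q * (\<Prod>Q\<in>T. index A1 (idl (sep Q)) ^ e Q)"
      using index_idl_pow(2)[OF s(2)] p(4) by (intro mult_le_mono)
    also have "\<dots> = (\<Prod>Q\<in>insert Q T. index A1 (idl (sep Q)) ^ e Q)" using insert by simp
    finally show ?case using pi1 nz val by blast
  qed
  obtain \<pi> where p: "\<pi> \<in> A0" "\<pi> \<noteq> \<zero>" "\<And>Q. Q \<in> S \<Longrightarrow> int (e Q) \<le> place_valuation R E Q \<pi>"
    "index A1 (idl \<pi>) \<le> (\<Prod>Q\<in>S. index A1 (idl (sep Q)) ^ e Q)" using ex[OF finite_S subset_refl] by blast
  obtain t where t: "prime_element R F P t" "t \<in> F" "t \<in> carrier R" "t \<noteq> \<zero>" "t \<in> P" by (rule dp_prime[OF dP])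
  have tE: "t \<in> E" using t FE by auto
  note it = subfield_inv[OF Ef tE t(4)]
  have pE: "\<pi> \<in> E" using p A0_mem by blast
  define b where "b = inv t \<otimes> \<pi>"
  have bE: "b \<in> E" unfolding b_def using it pE subringE(6)[OF subfieldE(1)[OF Ef]] by blast
  have R: "\<pi> \<in> carrier R" "inv t \<in> carrier R" using pE it ER by auto
  have "b \<in> val_of E Q" if Q: "Q \<in> S" for Q
  proof -
    note d = S_place(3)[OF Q]
    have vt: "place_valuation R E Q t = int (e Q)"
      using ramification(1)[OF F E FE P Q t(2,4)] dp_val_prime[OF dP t(1)] by simp
    have "\<pi> \<in> val_ge E Q (int (e Q))" using p(3)[OF Q] pE by (simp add: val_ge_def)
    moreover have "inv t \<in> val_ge E Q (- int (e Q))" using it dp_val_inv[OF d tE t(4)] vt by (simp add: val_ge_def)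
    ultimately have "b \<in> val_ge E Q (- int (e Q) + int (e Q))" unfolding b_def using vg_mult[OF d] by blast
    then show ?thesis using vg_0[OF d] by simp
  qed
  then have "b \<in> A1" using bE A0_mem A0_A1 by blast
  moreover have "t \<in> I0" using t(5) P'_place(2) I0(3) by blast
  ultimately have "b \<otimes> t \<in> I0" by (rule I0_mult)
  moreover have "b \<otimes> t = \<pi>"
  proof -
    have "b \<otimes> t = \<pi> \<otimes> (inv t \<otimes> t)" unfolding b_def using R t(3) by (simp add: m_ac)
    then show ?thesis using it R by simp
  qed
  ultimately have pI: "\<pi> \<in> I0" by simp
  have pA1: "\<pi> \<in> A1" using p(1) A0_A1 by blast
  have "idl \<pi> \<subseteq> I0"
  proof
    fix a assume "a \<in> idl \<pi>"
    then obtain x i where x: "x \<in> A1" "i \<in> I0" "a = \<pi> \<otimes> x \<oplus> i" by (auto simp: idl_def)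
    have "\<pi> \<otimes> x = x \<otimes> \<pi>" using R x(1) A1R by (auto simp: m_comm subset_iff)
    then show "a \<in> I0" using x I0_mult[OF x(1) pI] additive_subgroup.a_closed[OF I0(1)] by simp
  qed
  then have "idl \<pi> = I0" using idl(2)[OF pA1] by blast
  then show ?thesis using p(4) by simp
qed

end

lemma (in constant_field) frobenius_minus:
  assumes a: "a \<in> carrier R" and b: "b \<in> carrier R"
  shows "(a \<ominus> b) [^] (card k ^ n) = a [^] (card k ^ n) \<ominus> b [^] (card k ^ n)"
proof -
  have "((a \<ominus> b) \<oplus> b) [^] (card k ^ n) = (a \<ominus> b) [^] (card k ^ n) \<oplus> b [^] (card k ^ n)"
    using frobenius_card[of "a \<ominus> b" b n] a b by simp
  moreover have "(a \<ominus> b) \<oplus> b = a" using a b by algebra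
  ultimately have e: "a [^] (card k ^ n) = (a \<ominus> b) [^] (card k ^ n) \<oplus> b [^] (card k ^ n)" by simp
  have "(x \<oplus> y) \<ominus> y = x" if "x \<in> carrier R" "y \<in> carrier R" for x y using that by algebra
  then show ?thesis unfolding e using a b by simp
qed

section \<open>Frobenius and the residue rings of A'\<close>

context place_composite
begin

lemma place_mult:
  assumes d: "discrete_place K Q" and "a \<in> ring_of_place R K Q" "b \<in> Q"
  shows "a \<otimes> b \<in> Q"
  using vg_mult[OF d, of a 0 b 1] vg_0[OF d] vg_1[OF d] assms by simp

lemma place_one: "discrete_place K Q \<Longrightarrow> \<one> \<notin> Q"
  using dp_facts(8)[of K Q \<one>] by simp

lemma A0_val: "Q \<in> S \<Longrightarrow> A0 \<subseteq> val_of E Q"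
  using A0_mem by blast

text \<open>A list \<open>Ws\<close> spanning \<open>A0\<close> modulo \<open>Q\<close> over the
  residue field of \<open>P\<close> also spans \<open>A1\<close> modulo \<open>idl (sep Q)\<close>
  over \<open>O1\<close>, because the elements of \<open>A0\<close> in \<open>Q\<close> are the
  multiples of \<open>sep Q\<close>. Its length is at most f(Q|P), as \<open>A0\<close> modulo
  \<open>Q\<close> embeds into the residue field of \<open>Q\<close>.\<close>

lemma index_idl_le:
  assumes Q: "Q \<in> S"
  shows "index A1 (idl (sep Q)) \<le> index O1 P' ^ f Q"
proof -
  note dQ = S_place(3)[OF Q] and QE = S_place(1)[OF Q]
  note fP = dp_facts[OF dP] and fQ = dp_facts[OF dQ]
  note gQ = place_subgroup[OF E QE] and s = sep[OF Q]
  have P0: "\<zero> \<in> P" using additive_subgroup.zero_closed[OF place_subgroup[OF F P]] .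
  have "\<exists>Ws. set Ws \<subseteq> A0 \<and> length Ws \<le> f Q \<and>
    (\<forall>c\<in>A0. \<exists>as. set as \<subseteq> O0 \<and> length as = length Ws \<and> c \<ominus> combine as Ws \<in> Q)"
  proof (rule spanning_list[OF fP(6) A0_subring O0_O1(2) gQ, where J = P])
    show "c \<otimes> a \<in> Q" if "c \<in> A0" "a \<in> Q" for c a using place_mult[OF dQ] A0_val[OF Q] that by blast
    show "a \<otimes> c \<in> Q" if ac: "a \<in> P" "c \<in> A0" for a c
    proof -
      have "c \<otimes> a \<in> Q" using place_mult[OF dQ] A0_val[OF Q] S_place(2)[OF Q] ac by blast
      moreover have "a \<in> carrier R" "c \<in> carrier R" using ac fP(5,9) subringE(1)[OF A0_subring] by blast+
      ultimately show ?thesis by (simp add: m_comm)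
    qed
    show "\<zero> \<in> P" by (rule P0)
    show "z \<in> P" if "z \<in> O0" "z \<noteq> \<zero>" "inv z \<notin> O0" for z using fP(8) that by blast
    fix Vs assume Vs: "set Vs \<subseteq> A0" and free: "\<And>as. set as \<subseteq> O0 \<Longrightarrow> length as = length Vs \<Longrightarrow> combine as Vs \<in> Q \<Longrightarrow> set as \<subseteq> P"
    have A0R: "A0 \<subseteq> carrier R" using subringE(1)[OF A0_subring] .
    note fiQ = index_mono[OF gQ fQ(5) place_finite_index[OF E QE] A0_val[OF Q]]
    \<comment> \<open>An independent list of length l produces p^l classes of \<open>A0\<close>
      modulo \<open>Q\<close>, with p the order of the residue field of \<open>P\<close>; there are
      at most p^f(Q|P) of them.\<close>
    have "index O0 P ^ length Vs \<le> index A0 Q"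
    proof (rule index_ge_free[OF place_subgroup[OF F P] fP(5) place_finite_index[OF F P] _ gQ A0R fiQ(1)])
      show "a \<ominus> b \<in> O0" if "a \<in> O0" "b \<in> O0" for a b using subring_minus[OF fP(2) that] .
      show "set Vs \<subseteq> carrier R" using Vs A0R by (rule subset_trans)
      have gA: "additive_subgroup A0 R"
        using subring_minus[OF A0_subring] subringE(1,2)[OF A0_subring] by (intro additive_subgroupI) auto
      show "combine as Vs \<in> A0" if "set as \<subseteq> O0" for as
        using combine_in_module[OF gA _ that Vs] O0_O1(2) subringE(6)[OF A0_subring] by blast
    qed (use free in blast)
    also have "\<dots> \<le> index O0 P ^ f Q" using fiQ(2) index_relative_degree(1)[OF F E FE P Q] by simp
    finally show "length Vs \<le> f Q" using index_ge_2[OF F P] by (simp add: power_increasing_iff)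
  qed
  then obtain Ws where Ws: "set Ws \<subseteq> A0" "length Ws \<le> f Q"
    "\<And>c. c \<in> A0 \<Longrightarrow> \<exists>as. set as \<subseteq> O0 \<and> length as = length Ws \<and> c \<ominus> combine as Ws \<in> Q" by blast
  have WR: "set Ws \<subseteq> carrier R" using Ws(1) subringE(1)[OF A0_subring] by (rule subset_trans)
  note i = idl[OF s(2)] and sp = Span_module[OF O1r WR]
  define B where "B = Span O1 Ws"
  have B: "additive_subgroup B R" "\<And>a x. a \<in> O1 \<Longrightarrow> x \<in> B \<Longrightarrow> a \<otimes> x \<in> B" using sp by (auto simp only: B_def)
  have BR: "B \<subseteq> carrier R" and IR: "idl (sep Q) \<subseteq> carrier R"
    using additive_subgroup.a_subset[OF B(1)] additive_subgroup.a_subset[OF i(1)] by auto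
  \<comment> \<open>The \<open>O1\<close>-module spanned by \<open>Ws\<close> together with the
    ideal. It contains \<open>A0\<close>, hence all of \<open>A1\<close>.\<close>
  define M where "M = {w \<oplus> j | w j. w \<in> B \<and> j \<in> idl (sep Q)}"
  have MI: "w \<oplus> j \<in> M" if "w \<in> B" "j \<in> idl (sep Q)" for w j using that by (auto simp: M_def)
  have M: "additive_subgroup M R"
  proof (rule additive_subgroupI)
    show "M \<subseteq> carrier R" unfolding M_def using BR IR by auto
    have "\<zero> \<oplus> \<zero> \<in> M" using MI additive_subgroup.zero_closed[OF B(1)] additive_subgroup.zero_closed[OF i(1)] by blast
    then show "\<zero> \<in> M" by simp
    fix a b assume "a \<in> M" "b \<in> M"
    then obtain w j w' j' where *: "w \<in> B" "j \<in> idl (sep Q)" "a = w \<oplus> j" "w' \<in> B" "j' \<in> idl (sep Q)" "b = w' \<oplus> j'"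
      by (auto simp: M_def)
    have R: "w \<in> carrier R" "j \<in> carrier R" "w' \<in> carrier R" "j' \<in> carrier R" using * BR IR by auto
    have "a \<ominus> b = (w \<ominus> w') \<oplus> (j \<ominus> j')" unfolding *(3,6) using R by algebra
    then show "a \<ominus> b \<in> M"
      using MI[OF additive_subgroup_minus[OF B(1) *(1,4)] additive_subgroup_minus[OF i(1) *(2,5)]] by simp
  qed
  have Msm: "a \<otimes> x \<in> M" if a: "a \<in> O1" and x: "x \<in> M" for a x
  proof -
    obtain w j where *: "w \<in> B" "j \<in> idl (sep Q)" "x = w \<oplus> j" using x by (auto simp: M_def)
    have R: "w \<in> carrier R" "j \<in> carrier R" "a \<in> carrier R" using * BR IR a O1R by auto
    have "a \<otimes> x = a \<otimes> w \<oplus> a \<otimes> j" unfolding *(3) using R by (simp add: r_distr)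
    moreover have "a \<otimes> j \<in> idl (sep Q)" using i(6)[OF _ *(2)] O1_A1 a by blast
    ultimately show ?thesis using MI[OF B(2)[OF a *(1)]] by simp
  qed
  have "A0 \<subseteq> M"
  proof
    fix c assume c: "c \<in> A0"
    obtain as where as: "set as \<subseteq> O0" "length as = length Ws" "c \<ominus> combine as Ws \<in> Q" using Ws(3)[OF c] by blast
    have gA: "additive_subgroup A0 R"
      using subring_minus[OF A0_subring] subringE(1,2)[OF A0_subring] by (intro additive_subgroupI) auto
    have cw: "combine as Ws \<in> A0"
      using combine_in_module[OF gA _ as(1) Ws(1)] O0_O1(2) subringE(6)[OF A0_subring] by blast
    have "c \<ominus> combine as Ws \<in> A0" using subring_minus[OF A0_subring c cw] .
    then obtain b where b: "b \<in> A0" "c \<ominus> combine as Ws = sep Q \<otimes> b" using sep_divides[OF Q _ as(3)] by blast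
    have "sep Q \<otimes> b \<in> idl (sep Q)" using i(7) b(1) A0_A1 by blast
    moreover have "combine as Ws \<in> B" unfolding B_def Span_eq_combine using as O0_O1(1) by blast
    ultimately have "combine as Ws \<oplus> (c \<ominus> combine as Ws) \<in> M" using MI b(2) by simp
    moreover have "combine as Ws \<oplus> (c \<ominus> combine as Ws) = c"
    proof -
      have "y \<oplus> (x \<ominus> y) = x" if "x \<in> carrier R" "y \<in> carrier R" for x y using that by algebra
      then show ?thesis using c cw subringE(1)[OF A0_subring] by blast
    qed
    ultimately show "c \<in> M" by simp
  qed
  then have A1M: "A1 \<subseteq> M" using A1_induct[OF _ M Msm] by blast
  have "index A1 (idl (sep Q)) \<le> index O1 P' ^ length Ws"
  proof (rule index_le_span(2)[OF P'_O1(1) O1R P'_O1(2) i(1) A1R WR])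
    show "a \<otimes> u \<in> idl (sep Q)" if "a \<in> P'" "u \<in> set Ws" for a u using P'_A1 that Ws(1) A0_A1 i(2) by blast
    fix c assume "c \<in> A1"
    then obtain w j where *: "w \<in> B" "j \<in> idl (sep Q)" "c = w \<oplus> j" using A1M by (auto simp: M_def)
    obtain as where as: "set as \<subseteq> O1" "length as = length Ws" "w = combine as Ws"
      using *(1) unfolding B_def Span_eq_combine by blast
    have R: "w \<in> carrier R" "j \<in> carrier R" using * BR IR by auto
    have "c \<ominus> combine as Ws = j" unfolding *(3) as(3)[symmetric] using R by algebra
    then show "\<exists>as. set as \<subseteq> O1 \<and> length as = length Ws \<and> c \<ominus> combine as Ws \<in> idl (sep Q)" using as *(2) by auto
  qed
  also have "\<dots> \<le> index O1 P' ^ f Q"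
    using Ws(2) index_ge_2[OF F' P'_place(1)] by (intro power_increasing) auto
  finally show ?thesis .
qed

text \<open>The ring of Q' contains those of \<open>P'\<close> and \<open>Q\<close>, hence
  \<open>O1\<close> and \<open>A0\<close>; the place itself contains the generators
  \<open>t1\<close> and \<open>sep Q\<close> of the ideal.\<close>

lemma N_place:
  assumes Q: "Q \<in> S" and Q': "Q' \<in> N Q"
  shows "Q' \<in> places_over R k E' P'" "Q' \<in> places_over R k E' Q" "Q' \<in> places R k E'" "discrete_place E' Q'"
    "A1 \<subseteq> val_of E' Q'" "idl (sep Q) \<subseteq> Q'"
proof -
  show 1: "Q' \<in> places_over R k E' Q" "Q' \<in> places_over R k E' P'" "Q' \<in> places R k E'"
    using Q' by (auto simp: places_over_def)
  show d: "discrete_place E' Q'" using place_discrete[OF E' 1(3)] .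
  note f' = dp_facts[OF d] and g' = place_subgroup[OF E' 1(3)]
  have gO: "additive_subgroup (val_of E' Q') R"
    using subring_minus[OF f'(2)] subringE(1,2)[OF f'(2)] by (intro additive_subgroupI) auto
  have O: "O1 \<subseteq> val_of E' Q'" using places_over_restrict(1)[OF F' E' F'E' P'_place(1) 1(2)] by blast
  have "A0 \<subseteq> val_of E' Q'"
    using places_over_restrict(1)[OF E E' EE' S_place(1)[OF Q] 1(1)] A0_val[OF Q] by blast
  then show A: "A1 \<subseteq> val_of E' Q'" using A1_induct[OF _ gO] O subringE(6)[OF f'(2)] by blast
  have t: "t1 \<in> Q'" "sep Q \<in> Q'" using t1(5) Q' sep(7)[OF Q] by (auto simp: places_over_def)
  show "idl (sep Q) \<subseteq> Q'"
  proof
    fix a assume "a \<in> idl (sep Q)"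
    then obtain x y where x: "x \<in> A1" "y \<in> A1" "a = sep Q \<otimes> x \<oplus> t1 \<otimes> y"
      by (auto simp: idl_def I0_def l_coset_mem)
    have "x \<otimes> sep Q \<in> Q'" "y \<otimes> t1 \<in> Q'" using place_mult[OF d] A x(1,2) t by blast+
    moreover have "x \<otimes> sep Q = sep Q \<otimes> x" "y \<otimes> t1 = t1 \<otimes> y"
      using x(1,2) A1R t1(3) sep(2)[OF Q] by (auto simp: m_comm subset_iff)
    ultimately show "a \<in> Q'" unfolding x(3) using additive_subgroup.a_closed[OF g'] by simp
  qed
qed

text \<open>Let h = card k ^ n. The elements fixed by the h-th power modulo the ideal form an
  \<open>O1\<close>-module: the h-th power is additive, and (ay)^h - ay = a^h (y^h - y) + (a^h - a)
  y with a^h - a in \<open>P'\<close>. On \<open>A0\<close> the difference x^h - x lies in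
  \<open>Q\<close>, hence is a multiple of \<open>sep Q\<close>.\<close>

lemma A1_frobenius:
  assumes Q: "Q \<in> S" and x: "x \<in> A1"
    and n: "place_degree R k F' P' dvd n" "place_degree R k E Q dvd n"
  shows "x [^] (card k ^ n) \<ominus> x \<in> idl (sep Q)"
proof -
  let ?q = "card k ^ n"
  note i = idl[OF sep(2)[OF Q]]
  have pwA: "a [^] (j::nat) \<in> B" if "subring B R" "a \<in> B" for a B j
    by (induction j) (use that subringE(3,6) in auto)
  define M where "M = {x \<in> A1. x [^] ?q \<ominus> x \<in> idl (sep Q)}"
  have "x \<in> M"
  proof (rule A1_induct[OF x])
    show "additive_subgroup M R"
    proof (rule additive_subgroupI)
      show "M \<subseteq> carrier R" using A1R by (auto simp: M_def)
      have "card k ^ n \<noteq> 0" using k_ge_2 by simp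
      then have "\<zero> [^] ?q \<ominus> \<zero> = \<zero>" by (simp add: nat_pow_zero a_minus_def)
      then show "\<zero> \<in> M"
        unfolding M_def using subringE(2)[OF A1_subring] additive_subgroup.zero_closed[OF i(1)] by (simp add: a_minus_def)
      fix a b assume ab: "a \<in> M" "b \<in> M"
      have R: "a \<in> carrier R" "b \<in> carrier R" using ab A1R by (auto simp: M_def)
      have alg: "(u \<ominus> v) \<ominus> (y \<ominus> z) = (u \<ominus> y) \<ominus> (v \<ominus> z)"
        if "u \<in> carrier R" "v \<in> carrier R" "y \<in> carrier R" "z \<in> carrier R" for u v y z using that by algebra
      have "(a \<ominus> b) [^] ?q \<ominus> (a \<ominus> b) = (a [^] ?q \<ominus> a) \<ominus> (b [^] ?q \<ominus> b)"
        unfolding frobenius_minus[OF R] using R by (intro alg) auto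
      then show "a \<ominus> b \<in> M"
        using ab additive_subgroup_minus[OF i(1)] subring_minus[OF A1_subring] by (auto simp: M_def)
    qed
    fix a y assume a: "a \<in> O1" and y: "y \<in> M"
    have yA: "y \<in> A1" "y [^] ?q \<ominus> y \<in> idl (sep Q)" using y by (auto simp: M_def)
    have R: "a \<in> carrier R" "y \<in> carrier R" using a O1R yA A1R by auto
    have "(a \<otimes> y) [^] ?q \<ominus> a \<otimes> y = a [^] ?q \<otimes> (y [^] ?q \<ominus> y) \<oplus> (a [^] ?q \<ominus> a) \<otimes> y"
    proof -
      have alg: "u \<otimes> v \<ominus> a \<otimes> y = u \<otimes> (v \<ominus> y) \<oplus> (u \<ominus> a) \<otimes> y" if "u \<in> carrier R" "v \<in> carrier R" for u v
        using that R by algebra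
      have "(a \<otimes> y) [^] ?q = a [^] ?q \<otimes> y [^] ?q" using R by (simp add: nat_pow_distrib)
      then show ?thesis using alg R by simp
    qed
    moreover have "a [^] ?q \<otimes> (y [^] ?q \<ominus> y) \<in> idl (sep Q)"
      using i(6)[OF _ yA(2)] pwA[OF O1r a] O1_A1 by blast
    moreover have "(a [^] ?q \<ominus> a) \<otimes> y \<in> idl (sep Q)"
      using P'_A1[OF residue_pow[OF F' P'_place(1) a n(1)] yA(1)] i(2) by blast
    ultimately have "(a \<otimes> y) [^] ?q \<ominus> a \<otimes> y \<in> idl (sep Q)" using additive_subgroup.a_closed[OF i(1)] by simp
    then show "a \<otimes> y \<in> M" using A1_smult[OF a yA(1)] by (simp add: M_def)
  next
    show "A0 \<subseteq> M"
    proof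
      fix a assume a: "a \<in> A0"
      have aQ: "a \<in> val_of E Q" using a A0_val[OF Q] by blast
      have "a [^] ?q \<ominus> a \<in> Q" using residue_pow[OF E S_place(1)[OF Q] aQ n(2)] .
      moreover have "a [^] ?q \<ominus> a \<in> A0" using subring_minus[OF A0_subring pwA[OF A0_subring a] a] .
      ultimately obtain b where "b \<in> A0" "a [^] ?q \<ominus> a = sep Q \<otimes> b" using sep_divides[OF Q] by blast
      then have "a [^] ?q \<ominus> a \<in> idl (sep Q)" using i(7) A0_A1 by auto
      then show "a \<in> M" using a A0_A1 by (auto simp: M_def)
    qed
  qed
  then show ?thesis by (simp add: M_def)
qed

text \<open>The ring \<open>A1 / idl (sep Q)\<close> is reduced, since some power of Frobenius acts on it as the identity.\<close>

lemma idl_kernel: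
  assumes Q: "Q \<in> S" and x: "x \<in> A1" and all: "\<And>Q'. Q' \<in> N Q \<Longrightarrow> x \<in> Q'"
  shows "x \<in> idl (sep Q)"
proof -
  note i = idl[OF sep(2)[OF Q]]
  define n where "n = lcm (place_degree R k F' P') (place_degree R k E Q)"
  have n: "place_degree R k F' P' dvd n" "place_degree R k E Q dvd n" by (auto simp: n_def)
  have "1 \<le> place_degree R k F' P'" "1 \<le> place_degree R k E Q"
    using index_place_degree(2)[OF F' P'_place(1)] index_place_degree(2)[OF E S_place(1)[OF Q]] by auto
  then have "n \<noteq> 0" by (simp add: n_def)
  then have "2 \<le> card k ^ n" using k_ge_2 self_le_power[of "card k" n] by linarith
  then obtain r where r: "card k ^ n = Suc (Suc r)" by (metis add_2_eq_Suc le_Suc_ex)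
  have xR: "x \<in> carrier R" using x A1R by auto
  have fr: "x [^] Suc (Suc r) \<ominus> x \<in> idl (sep Q)" using A1_frobenius[OF Q x n] r by simp
  have xr: "x [^] Suc r \<in> A1"
  proof -
    have "x [^] (j::nat) \<in> A1" for j by (induction j) (use x subringE(3,6)[OF A1_subring] in auto)
    then show ?thesis .
  qed
  \<comment> \<open>As x^(r+2) is congruent to x, the product x c lies in the ideal. If the ideal
    and c did not generate \<one>, some place in \<open>N Q\<close> would contain c as well as x,
    hence \<one>. So 1 = u + c a with u in the ideal, and multiplication by x concludes.\<close>
  define c where "c = \<one> \<ominus> x [^] Suc r"
  have cA: "c \<in> A1" unfolding c_def using subring_minus[OF A1_subring subringE(3)[OF A1_subring] xr] .
  have cR: "c \<in> carrier R" using cA A1R by auto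
  define J where "J = {i \<oplus> c \<otimes> a | i a. i \<in> idl (sep Q) \<and> a \<in> A1}"
  have JI: "i \<oplus> c \<otimes> a \<in> J" if "i \<in> idl (sep Q)" "a \<in> A1" for i a using that by (auto simp: J_def)
  have IR: "idl (sep Q) \<subseteq> carrier R" using i(3) A1R by blast
  have "\<one> \<in> J"
  proof (rule ccontr)
    assume one: "\<one> \<notin> J"
    have J: "additive_subgroup J R"
    proof (rule additive_subgroupI)
      show "J \<subseteq> carrier R" unfolding J_def using IR A1R cR by auto
      have "\<zero> \<oplus> c \<otimes> \<zero> \<in> J" using JI[OF additive_subgroup.zero_closed[OF i(1)] subringE(2)[OF A1_subring]] .
      then show "\<zero> \<in> J" using cR by simp
      fix a b assume "a \<in> J" "b \<in> J"
      then obtain u v y z where *: "u \<in> idl (sep Q)" "v \<in> A1" "a = u \<oplus> c \<otimes> v" "y \<in> idl (sep Q)" "z \<in> A1" "b = y \<oplus> c \<otimes> z"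
        by (auto simp: J_def)
      have R: "u \<in> carrier R" "v \<in> carrier R" "y \<in> carrier R" "z \<in> carrier R" using * IR A1R by auto
      have "a \<ominus> b = (u \<ominus> y) \<oplus> c \<otimes> (v \<ominus> z)" unfolding *(3,6) using R cR by algebra
      then show "a \<ominus> b \<in> J"
        using JI[OF additive_subgroup_minus[OF i(1) *(1,4)] subring_minus[OF A1_subring *(2,5)]] by simp
    qed
    have JA: "J \<subseteq> A1"
    proof
      fix a assume "a \<in> J"
      then obtain u v where "u \<in> idl (sep Q)" "v \<in> A1" "a = u \<oplus> c \<otimes> v" by (auto simp: J_def)
      then show "a \<in> A1" using i(3) cA subringE(6,7)[OF A1_subring] by blast
    qed
    have mult: "b \<otimes> a \<in> J" if b: "b \<in> A1" and a: "a \<in> J" for b a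
    proof -
      obtain u v where *: "u \<in> idl (sep Q)" "v \<in> A1" "a = u \<oplus> c \<otimes> v" using a by (auto simp: J_def)
      have R: "u \<in> carrier R" "v \<in> carrier R" "b \<in> carrier R" using * b IR A1R by auto
      have "b \<otimes> a = b \<otimes> u \<oplus> c \<otimes> (b \<otimes> v)" unfolding *(3) using R cR by (simp add: r_distr m_lcomm)
      then show ?thesis using JI[OF i(6)[OF b *(1)] subringE(6)[OF A1_subring b *(2)]] by simp
    qed
    have IJ: "idl (sep Q) \<subseteq> J"
    proof
      fix u assume u: "u \<in> idl (sep Q)"
      have "u \<oplus> c \<otimes> \<zero> \<in> J" using JI[OF u subringE(2)[OF A1_subring]] .
      moreover have "u \<oplus> c \<otimes> \<zero> = u" using u IR cR by auto
      ultimately show "u \<in> J" by simp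
    qed
    have sJ: "sep Q \<in> J" using IJ i(4) by blast
    have kA: "k \<subseteq> A1" using place_contains_k[OF F' P'_place(1)] O1_A1 by blast
    obtain Q' where Q': "Q' \<in> places R k E'" "J \<subseteq> Q'" "A1 \<subseteq> val_of E' Q'"
      using place_of_ideal[OF E' A1_subring A1_E' kA J JA mult one sJ sep(4)[OF Q]] by blast
    have P'Q': "P' \<subseteq> Q'" using I0(3) i(2) IJ Q'(2) by blast
    have QP: "Q' \<in> places_over R k E' P" using Q'(1) P'Q' P'_place(2) by (auto simp: places_over_def)
    note tr = places_over_trans[OF F E E' FE EE' P QP]
    \<comment> \<open>\<open>sep Q\<close> has value 0 at all other places over \<open>P\<close>, so
      containing it singles out \<open>Q\<close> among them.\<close>
    have "Q' \<inter> E = Q"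
    proof (rule ccontr)
      assume ne: "Q' \<inter> E \<noteq> Q"
      have "sep Q \<in> Q' \<inter> E" using sJ Q'(2) sep(3)[OF Q] by blast
      then have "1 \<le> place_valuation R E (Q' \<inter> E) (sep Q)"
        using dp_val_pos_iff[OF S_place(3)[OF tr(1)] sep(3,4)[OF Q]] by simp
      then show False using sep(6)[OF Q tr(1) ne] by simp
    qed
    then have Q'N: "Q' \<in> N Q" using tr(2) P'Q' by simp
    note d = N_place(4)[OF Q Q'N] and g = place_subgroup[OF E' Q'(1)]
    have xQ: "x \<in> Q'" using all[OF Q'N] .
    have "x [^] r \<in> A1"
    proof -
      have "x [^] (j::nat) \<in> A1" for j by (induction j) (use x subringE(3,6)[OF A1_subring] in auto)
      then show ?thesis .
    qed
    then have "x [^] Suc r \<in> Q'" using place_mult[OF d _ xQ] Q'(3) by auto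
    moreover have "c \<in> Q'"
    proof -
      have "\<zero> \<oplus> c \<otimes> \<one> \<in> J" using JI[OF additive_subgroup.zero_closed[OF i(1)] subringE(3)[OF A1_subring]] .
      then show ?thesis using Q'(2) cR by auto
    qed
    ultimately have "c \<oplus> x [^] Suc r \<in> Q'" using additive_subgroup.a_closed[OF g] by blast
    moreover have "c \<oplus> x [^] Suc r = \<one>"
    proof -
      have "(\<one> \<ominus> y) \<oplus> y = \<one>" if "y \<in> carrier R" for y using that by algebra
      then show ?thesis unfolding c_def using xr A1R by blast
    qed
    ultimately show False using place_one[OF d] by simp
  qed
  then obtain u a where ua: "u \<in> idl (sep Q)" "a \<in> A1" "\<one> = u \<oplus> c \<otimes> a" by (auto simp: J_def)
  have R: "u \<in> carrier R" "a \<in> carrier R" using ua IR A1R by auto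
  have "x = x \<otimes> (u \<oplus> c \<otimes> a)" unfolding ua(3)[symmetric] using xR by simp
  also have "\<dots> = x \<otimes> u \<oplus> (x \<otimes> c) \<otimes> a" using R cR xR by (simp add: r_distr m_assoc)
  also have "x \<otimes> c = \<ominus> (x [^] Suc (Suc r) \<ominus> x)"
  proof -
    have alg: "x \<otimes> (\<one> \<ominus> y) = \<ominus> (y \<otimes> x \<ominus> x)" if "y \<in> carrier R" for y using that xR by algebra
    show ?thesis unfolding c_def using alg[of "x [^] Suc r"] xR by simp
  qed
  finally have e: "x = x \<otimes> u \<oplus> (\<ominus> (x [^] Suc (Suc r) \<ominus> x)) \<otimes> a" .
  have "\<ominus> (x [^] Suc (Suc r) \<ominus> x) \<in> idl (sep Q)" using additive_subgroup.a_inv_closed[OF i(1) fr] .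
  then have "a \<otimes> (\<ominus> (x [^] Suc (Suc r) \<ominus> x)) \<in> idl (sep Q)" using i(6)[OF ua(2)] by blast
  moreover have "a \<otimes> (\<ominus> (x [^] Suc (Suc r) \<ominus> x)) = (\<ominus> (x [^] Suc (Suc r) \<ominus> x)) \<otimes> a"
    using m_comm[OF R(2), of "\<ominus> (x [^] Suc (Suc r) \<ominus> x)"] xR by simp
  ultimately have "x \<otimes> u \<oplus> (\<ominus> (x [^] Suc (Suc r) \<ominus> x)) \<otimes> a \<in> idl (sep Q)"
    using additive_subgroup.a_closed[OF i(1) i(6)[OF x ua(1)]] by simp
  then show ?thesis unfolding e[symmetric] .
qed

end

section \<open>Comparison of the two fundamental inequalities\<close>

context place_composite
begin

text \<open>\<open>idl_kernel\<close> is the injectivity required by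
  \<open>index_le_prod\<close>.\<close>

lemma index_idl_le_prod:
  assumes Q: "Q \<in> S"
  shows "finite (N Q)" "index A1 (idl (sep Q)) \<le> (\<Prod>Q'\<in>N Q. index A1 Q')"
proof -
  have fin: "finite (places_over R k E' P')" using fundamental_inequality(1)[OF F' E' F'E' dimE' P'_place(1)] .
  have "N Q \<subseteq> places_over R k E' P'" using N_place(1)[OF Q] by blast
  then show fN: "finite (N Q)" using fin finite_subset by blast
  note i = idl[OF sep(2)[OF Q]]
  show "index A1 (idl (sep Q)) \<le> (\<Prod>Q'\<in>N Q. index A1 Q')"
  proof (rule index_le_prod[OF A1R i(1,5) fN])
    fix Q' assume Q': "Q' \<in> N Q"
    note n = N_place[OF Q Q']
    show "additive_subgroup Q' R" using place_subgroup[OF E' n(3)] .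
    show "finite_index A1 Q'"
      using index_mono(1)[OF place_subgroup[OF E' n(3)] dp_facts(5)[OF n(4)] place_finite_index[OF E' n(3)] n(5)] .
  next
    show "a \<ominus> b \<in> A1" if "a \<in> A1" "b \<in> A1" for a b using subring_minus[OF A1_subring that] .
    show "x \<in> idl (sep Q)" if "x \<in> A1" "\<And>Q'. Q' \<in> N Q \<Longrightarrow> x \<in> Q'" for x using idl_kernel[OF Q] that by blast
  qed
qed

text \<open>Computing e(Q'|P) through \<open>E\<close> and through \<open>F'\<close> shows that
  e(Q|P) divides e(Q'|P') e(P'|P); coprimality moves it into the first factor.\<close>

lemma ramification_le:
  assumes Q: "Q \<in> S" and Q': "Q' \<in> N Q"
  shows "e Q \<le> ramification_index R F' P' E' Q'"
proof -
  note n = N_place[OF Q Q']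
  have "ramification_index R F P E' Q' = ramification_index R E Q E' Q' * e Q"
    using ramification_tower(2)[OF F E E' FE EE' P Q n(2)] .
  moreover have "ramification_index R F P E' Q' = ramification_index R F' P' E' Q' * ramification_index R F P F' P'"
    using ramification_tower(2)[OF F F' E' FF' F'E' P P' n(1)] .
  ultimately have "e Q dvd ramification_index R F' P' E' Q' * ramification_index R F P F' P'" by (metis dvd_triv_right)
  then have "e Q dvd ramification_index R F' P' E' Q'" using cop[OF Q] by (simp add: coprime_dvd_mult_left_iff)
  moreover have "1 \<le> ramification_index R F' P' E' Q'" using ramification(2)[OF F' E' F'E' P'_place(1) n(1)] .
  ultimately show ?thesis by (intro dvd_imp_le) auto
qed

text \<open>In the proof, \<open>c Q\<close> is the index of I_Q, \<open>\<kappa> Q'\<close> the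
  order of the residue field at Q', and \<open>e' Q'\<close> is e(Q'|P'). Taken over all places, the
  product of the c^e, that of the index of Q' in \<open>A1\<close> to the power e, and that of the
  \<kappa>^e' increase in this order. The first is at least q^m and the last at most q^m, so all
  agree, and they agree factor by factor.\<close>

theorem composite_places:
  assumes Q: "Q \<in> S"
  shows "\<And>Q'. Q' \<in> N Q \<Longrightarrow> place_degree R k E' Q' = lcm (place_degree R k E Q) (place_degree R k F' P')"
    and "card (N Q) * lcm (place_degree R k E Q) (place_degree R k F' P') = f Q * place_degree R k F' P'"
proof -
  define q where "q = index O1 P'"
  define c where "c Q = index A1 (idl (sep Q))" for Q
  define \<kappa> where "\<kappa> Q' = index (val_of E' Q') Q'" for Q'
  define e' where "e' Q' = ramification_index R F' P' E' Q'" for Q'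
  have q2: "2 \<le> q" unfolding q_def using index_ge_2[OF F' P'_place(1)] .
  have cpos: "0 < c Q" if "Q \<in> S" for Q
    unfolding c_def using index_pos[OF idl(5)[OF sep(2)[OF that]]] subringE(3)[OF A1_subring] by blast
  have e1: "1 \<le> e Q" if "Q \<in> S" for Q using ramification(2)[OF F E FE P that] .
  have low: "q ^ length Us \<le> (\<Prod>Q\<in>S. c Q ^ e Q)"
    using index_I0_ge index_I0_le unfolding q_def c_def by linarith
  \<comment> \<open>First squeeze, in E over F: \<open>c Q\<close> is at most q^f(Q|P), and \<Sum> e
    f \<le> m meets the lower bound q^m.\<close>
  have ceq: "c Q = q ^ f Q" if QS: "Q \<in> S" for Q
  proof -
    have "(\<Prod>Q\<in>S. (q ^ f Q) ^ e Q) = q ^ (\<Sum>Q\<in>S. e Q * f Q)"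
      by (simp add: power_sum power_mult[symmetric] mult.commute)
    also have "\<dots> \<le> q ^ length Us"
      using fundamental_inequality(2)[OF F E FE dimE P] q2 by (intro power_increasing) auto
    finally have up: "(\<Prod>Q\<in>S. (q ^ f Q) ^ e Q) \<le> (\<Prod>Q\<in>S. c Q ^ e Q)" using low by linarith
    have "0 < c Q ^ e Q \<and> c Q ^ e Q \<le> (q ^ f Q) ^ e Q" if "Q \<in> S" for Q
      using cpos[OF that] index_idl_le[OF that] unfolding c_def q_def by (simp add: power_mono)
    then have "c Q ^ e Q = (q ^ f Q) ^ e Q" using prod_le_imp_eq[OF finite_S _ up QS] by blast
    then show ?thesis using e1[OF QS] by (metis less_le_trans zero_less_one power_eq_imp_eq_base zero_le)
  qed
  have iota: "0 < index A1 Q' \<and> index A1 Q' \<le> \<kappa> Q'" if "Q \<in> S" "Q' \<in> N Q" for Q Q'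
  proof -
    note n = N_place[OF that]
    note m = index_mono[OF place_subgroup[OF E' n(3)] dp_facts(5)[OF n(4)] place_finite_index[OF E' n(3)] n(5)]
    have "0 < index A1 Q'" using index_pos[OF m(1)] subringE(3)[OF A1_subring] by blast
    then show ?thesis using m(2) by (simp add: \<kappa>_def)
  qed
  have le1: "c Q ^ e Q \<le> (\<Prod>Q'\<in>N Q. index A1 Q' ^ e Q)" if "Q \<in> S" for Q
  proof -
    have "c Q ^ e Q \<le> (\<Prod>Q'\<in>N Q. index A1 Q') ^ e Q"
      unfolding c_def using index_idl_le_prod(2)[OF that] by (intro power_mono) auto
    then show ?thesis by (simp add: prod_power_distrib)
  qed
  have le2: "index A1 Q' ^ e Q \<le> \<kappa> Q' ^ e' Q'" if "Q \<in> S" "Q' \<in> N Q" for Q Q'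
  proof -
    have "index A1 Q' ^ e Q \<le> \<kappa> Q' ^ e Q" using iota[OF that] by (simp add: power_mono)
    also have "\<dots> \<le> \<kappa> Q' ^ e' Q'"
      using ramification_le[OF that] iota[OF that] unfolding e'_def by (intro power_increasing) auto
    finally show ?thesis .
  qed
  \<comment> \<open>Second squeeze, in E' over F'. The sets \<open>N Q\<close> are disjoint because
    each member determines Q as its restriction to E, so their union is a single set of places over
    \<open>P'\<close>.\<close>
  have beq: "c Q ^ e Q = (\<Prod>Q'\<in>N Q. \<kappa> Q' ^ e' Q')"
  proof (rule prod_le_imp_eq[OF finite_S _ _ Q, where a = "\<lambda>Q. c Q ^ e Q" and b = "\<lambda>Q. \<Prod>Q'\<in>N Q. \<kappa> Q' ^ e' Q'"])
    fix Q assume QS: "Q \<in> S"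
    have "(\<Prod>Q'\<in>N Q. index A1 Q' ^ e Q) \<le> (\<Prod>Q'\<in>N Q. \<kappa> Q' ^ e' Q')"
      using le2[OF QS] by (intro prod_mono) auto
    then show "0 < c Q ^ e Q \<and> c Q ^ e Q \<le> (\<Prod>Q'\<in>N Q. \<kappa> Q' ^ e' Q')" using le1[OF QS] cpos[OF QS] by simp
  next
    have disj: "N Q \<inter> N Q2 = {}" if "Q \<in> S" "Q2 \<in> S" "Q \<noteq> Q2" for Q Q2
    proof (rule ccontr)
      assume "N Q \<inter> N Q2 \<noteq> {}"
      then obtain Q' where Q': "Q' \<in> N Q" "Q' \<in> N Q2" by blast
      have "Q' \<inter> E = Q" "Q' \<inter> E = Q2"
        using places_over_restrict(2)[OF E E' EE' S_place(1)[OF that(1)]] places_over_restrict(2)[OF E E' EE' S_place(1)[OF that(2)]] Q' by auto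
      then show False using that(3) by blast
    qed
    let ?U = "\<Union>Q\<in>S. N Q"
    have "(\<Prod>Q\<in>S. \<Prod>Q'\<in>N Q. \<kappa> Q' ^ e' Q') = (\<Prod>Q'\<in>?U. \<kappa> Q' ^ e' Q')"
      using finite_S index_idl_le_prod(1) disj by (intro prod.UNION_disjoint[symmetric]) auto
    also have "\<dots> \<le> q ^ length Us"
      unfolding \<kappa>_def e'_def q_def
    proof (rule fundamental_index[OF F' E' F'E' dimE' P'_place(1)])
      show "finite ?U" using finite_S index_idl_le_prod(1) by blast
      show "?U \<subseteq> places_over R k E' P'" using N_place(1) by blast
    qed
    finally show "(\<Prod>Q\<in>S. \<Prod>Q'\<in>N Q. \<kappa> Q' ^ e' Q') \<le> (\<Prod>Q\<in>S. c Q ^ e Q)" using low by linarith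
  qed
  \<comment> \<open>A strict inequality at one place would survive raising to the power e(Q|P) \<ge>
    1 and contradict the equality of the products. So \<open>A1\<close> maps onto the residue
    field.\<close>
  have surj: "index A1 Q' = \<kappa> Q'" if Q': "Q' \<in> N Q" for Q'
  proof (rule ccontr)
    assume "index A1 Q' \<noteq> \<kappa> Q'"
    then have lt: "index A1 Q' < \<kappa> Q'" using iota[OF Q Q'] by simp
    have up: "(\<Prod>Q'\<in>N Q. \<kappa> Q' ^ e' Q') \<le> (\<Prod>Q'\<in>N Q. index A1 Q' ^ e Q)" using beq le1[OF Q] by simp
    have "0 < index A1 Q' ^ e Q \<and> index A1 Q' ^ e Q \<le> \<kappa> Q' ^ e' Q'" if "Q' \<in> N Q" for Q'
      using iota[OF Q that] le2[OF Q that] by simp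
    then have "index A1 Q' ^ e Q = \<kappa> Q' ^ e' Q'"
      using prod_le_imp_eq[OF index_idl_le_prod(1)[OF Q] _ up Q'] by blast
    moreover have "index A1 Q' ^ e Q < \<kappa> Q' ^ e Q" using lt e1[OF Q] by (intro power_strict_mono) auto
    moreover have "\<kappa> Q' ^ e Q \<le> \<kappa> Q' ^ e' Q'"
      using ramification_le[OF Q Q'] lt unfolding e'_def by (intro power_increasing) auto
    ultimately show False by linarith
  qed
  \<comment> \<open>The equality involves the exponents e(Q'|P'); since these are at least e(Q|P),
    passing to the smaller exponent and taking roots bounds the product of the residue field orders
    by \<open>c Q\<close>.\<close>
  have cprod: "c Q = (\<Prod>Q'\<in>N Q. \<kappa> Q')"
  proof (rule antisym)
    show "c Q \<le> (\<Prod>Q'\<in>N Q. \<kappa> Q')" using index_idl_le_prod(2)[OF Q] surj unfolding c_def by simp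
    have "(\<Prod>Q'\<in>N Q. \<kappa> Q') ^ e Q = (\<Prod>Q'\<in>N Q. \<kappa> Q' ^ e Q)" by (simp add: prod_power_distrib)
    also have "\<dots> \<le> (\<Prod>Q'\<in>N Q. \<kappa> Q' ^ e' Q')"
    proof (intro prod_mono conjI)
      fix Q' assume Q': "Q' \<in> N Q"
      show "\<kappa> Q' ^ e Q \<le> \<kappa> Q' ^ e' Q'"
        using ramification_le[OF Q Q'] iota[OF Q Q'] unfolding e'_def by (intro power_increasing) auto
    qed simp
    finally have "(\<Prod>Q'\<in>N Q. \<kappa> Q') ^ e Q \<le> c Q ^ e Q" using beq by simp
    then show "(\<Prod>Q'\<in>N Q. \<kappa> Q') \<le> c Q"
      using e1[OF Q] power_strict_mono[of "c Q" "\<Prod>Q'\<in>N Q. \<kappa> Q'" "e Q"] by (meson not_le zero_le less_le_trans zero_less_one)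
  qed
  let ?f' = "\<lambda>Q'. relative_degree R F' P' E' Q'"
  have "q ^ f Q = q ^ (\<Sum>Q'\<in>N Q. ?f' Q')"
  proof -
    have "\<kappa> Q' = q ^ ?f' Q'" if "Q' \<in> N Q" for Q'
      unfolding \<kappa>_def q_def using index_relative_degree(1)[OF F' E' F'E' P'_place(1) N_place(1)[OF Q that]] .
    then have "(\<Prod>Q'\<in>N Q. \<kappa> Q') = q ^ (\<Sum>Q'\<in>N Q. ?f' Q')" by (simp add: power_sum)
    then show ?thesis using cprod ceq[OF Q] by simp
  qed
  then have fsum: "f Q = (\<Sum>Q'\<in>N Q. ?f' Q')" using q2 by simp
  define n where "n = lcm (place_degree R k E Q) (place_degree R k F' P')"
  have nd: "place_degree R k F' P' dvd n" "place_degree R k E Q dvd n" by (auto simp: n_def)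
  have "1 \<le> place_degree R k F' P'" "1 \<le> place_degree R k E Q"
    using index_place_degree(2)[OF F' P'_place(1)] index_place_degree(2)[OF E S_place(1)[OF Q]] by auto
  then have n1: "1 \<le> n" using lcm_pos_nat[of "place_degree R k E Q" "place_degree R k F' P'"] by (simp add: n_def)
  \<comment> \<open>Both degrees below divide deg Q'. Conversely every residue class at Q' contains
    an element of \<open>A1\<close>, on which the Frobenius power belonging to the lcm acts
    trivially modulo Q'.\<close>
  show deg: "place_degree R k E' Q' = lcm (place_degree R k E Q) (place_degree R k F' P')" if Q': "Q' \<in> N Q" for Q'
  proof -
    note np = N_place[OF Q Q']
    note d = dp_facts[OF np(4)] and g = place_subgroup[OF E' np(3)]
    have "place_degree R k E' Q' \<le> n"
    proof (rule place_degree_le[OF E' np(3) n1])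
      fix a assume a: "a \<in> val_of E' Q'"
      have "(\<lambda>a. Q' +> a) ` A1 = (\<lambda>a. Q' +> a) ` val_of E' Q'"
      proof (rule card_subset_eq)
        show "finite ((\<lambda>a. Q' +> a) ` val_of E' Q')" using place_finite_index[OF E' np(3)] by (simp add: finite_index_def)
        show "(\<lambda>a. Q' +> a) ` A1 \<subseteq> (\<lambda>a. Q' +> a) ` val_of E' Q'" using np(5) by blast
        show "card ((\<lambda>a. Q' +> a) ` A1) = card ((\<lambda>a. Q' +> a) ` val_of E' Q')"
          using surj[OF Q'] by (simp add: index_def \<kappa>_def)
      qed
      then obtain x where x: "x \<in> A1" "Q' +> a = Q' +> x" using a by blast
      have R: "a \<in> carrier R" "x \<in> carrier R" using a d(5) x A1R by auto
      define z where "z = a \<ominus> x"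
      have z: "z \<in> Q'" unfolding z_def using coset_eq_iff[OF g R] x(2) by simp
      have zR: "z \<in> carrier R" unfolding z_def using R by simp
      have "card k ^ n \<noteq> 0" using k_ge_2 by simp
      then obtain r where r: "card k ^ n = Suc r" by (cases "card k ^ n") auto
      have zr: "z [^] j \<in> val_of E' Q'" for j :: nat
        by (induction j) (use z d(9) subringE(3,6)[OF d(2)] in auto)
      have zp: "z [^] (card k ^ n) \<in> Q'" unfolding r using place_mult[OF np(4) zr z] by simp
      have xp: "x [^] (card k ^ n) \<ominus> x \<in> Q'" using A1_frobenius[OF Q x(1) nd] np(6) by blast
      have "a = x \<oplus> z" unfolding z_def using R by algebra
      then have "a [^] (card k ^ n) \<ominus> a = (x [^] (card k ^ n) \<oplus> z [^] (card k ^ n)) \<ominus> (x \<oplus> z)"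
        using frobenius_card[OF R(2) zR] by simp
      also have "\<dots> = (x [^] (card k ^ n) \<ominus> x) \<oplus> (z [^] (card k ^ n) \<ominus> z)"
      proof -
        have "(u \<oplus> v) \<ominus> (x \<oplus> z) = (u \<ominus> x) \<oplus> (v \<ominus> z)" if "u \<in> carrier R" "v \<in> carrier R" for u v
          using that R zR by algebra
        then show ?thesis using R zR by simp
      qed
      finally show "a [^] (card k ^ n) \<ominus> a \<in> Q'"
        using additive_subgroup.a_closed[OF g xp additive_subgroup_minus[OF g zp z]] by simp
    qed
    moreover have "n dvd place_degree R k E' Q'"
      unfolding n_def
    proof (rule lcm_least)
      show "place_degree R k E Q dvd place_degree R k E' Q'"
        unfolding index_relative_degree(2)[OF E E' EE' S_place(1)[OF Q] np(2)] by simp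
      show "place_degree R k F' P' dvd place_degree R k E' Q'"
        unfolding index_relative_degree(2)[OF F' E' F'E' P'_place(1) np(1)] by simp
    qed
    moreover have "1 \<le> place_degree R k E' Q'" using index_place_degree(2)[OF E' np(3)] .
    ultimately have "place_degree R k E' Q' = n" using dvd_imp_le[of n "place_degree R k E' Q'"] by linarith
    then show ?thesis by (simp add: n_def)
  qed
  \<comment> \<open>Multiplying f(Q|P) = \<Sum> f(Q'|P') by deg P' gives the sum of the deg Q', all
    of which are equal.\<close>
  have "f Q * place_degree R k F' P' = (\<Sum>Q'\<in>N Q. ?f' Q' * place_degree R k F' P')"
    unfolding fsum by (simp add: sum_distrib_right)
  also have "\<dots> = (\<Sum>Q'\<in>N Q. place_degree R k E' Q')"
    using index_relative_degree(2)[OF F' E' F'E' P'_place(1) N_place(1)[OF Q]] by (intro sum.cong) (auto simp: mult.commute)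
  also have "\<dots> = card (N Q) * lcm (place_degree R k E Q) (place_degree R k F' P')" using deg by simp
  finally show "card (N Q) * lcm (place_degree R k E Q) (place_degree R k F' P') = f Q * place_degree R k F' P'" by simp
qed

end

section \<open>Existence of the limits\<close>

text \<open>Interpreted twice in the end, for the given tower and for the composite one.\<close>

locale field_tower = constant_field R k for R (structure) and k +
  fixes T :: "nat \<Rightarrow> 'a set"
  assumes T: "\<And>n. function_field R k (T n)" and T_sub: "\<And>n. T n \<subseteq> T (Suc n)"
    and T_fin: "\<And>n. finite_dimension (T n) (T (Suc n))"
begin

lemma T_mono: "m \<le> n \<Longrightarrow> T m \<subseteq> T n"
  using lift_Suc_mono_le[of T] T_sub by blast

lemma T_dim:
  shows "finite_dimension (T 0) (T n)" "dim (T 0) (T (Suc n)) = dim (T 0) (T n) * dim (T n) (T (Suc n))"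
    "1 \<le> dim (T 0) (T n)"
proof -
  have sf: "subfield (T n) R" for n using ff_subfield[OF T] .
  show fd: "finite_dimension (T 0) (T n)" for n
  proof (induction n)
    case 0
    then show ?case using finite_dimensionI[OF dimension_one[OF sf]] by blast
  next
    case (Suc n)
    then show ?case using telescopic_base_dim(1)[OF sf sf Suc T_fin] by blast
  qed
  show "dim (T 0) (T (Suc n)) = dim (T 0) (T n) * dim (T n) (T (Suc n))"
    using telescopic_base_dim(2)[OF sf sf fd T_fin] by (simp add: over_def)
  show "1 \<le> dim (T 0) (T n)"
  proof (rule ccontr)
    assume "\<not> 1 \<le> dim (T 0) (T n)"
    then have "dim (T 0) (T n) = 0" by simp
    then have "dimension 0 (T 0) (T n)" using finite_dimensionE[OF sf fd, of n] by (simp add: over_def)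
    then have "T n = {\<zero>}" using dimension_zero[OF sf] by blast
    then show False using subringE(3)[OF subfieldE(1)[OF sf[of n]]] by auto
  qed
qed

context
  fixes P
  assumes P: "P \<in> places R k (T 0)"
begin

lemma finite_over: "finite (places_over R k (T n) P)"
proof -
  have "dimension (dim (T 0) (T n)) (T 0) (T n)"
    using finite_dimensionE[OF ff_subfield[OF T] T_dim(1)] by (simp add: over_def)
  then show ?thesis using fundamental_inequality(1)[OF T T T_mono[of 0 n] _ P] by blast
qed

text \<open>The number of points above \<open>P\<close> rational over the extension of degree r of
  the constant field: a place of degree d dividing r accounts for d of them. The count of places of
  degree exactly r need not behave monotonically, since such places can appear above places of
  smaller degree.\<close>

definition points :: "nat \<Rightarrow> nat \<Rightarrow> nat"
  where "points r n = (\<Sum>Q | Q \<in> places_over R k (T n) P \<and> place_degree R k (T n) Q dvd r. place_degree R k (T n) Q)"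

lemma points_eq:
  assumes r: "1 \<le> r"
  shows "points r n = (\<Sum>d | d dvd r. d * num_places_over R k (T n) d P)"
proof -
  let ?S = "{Q. Q \<in> places_over R k (T n) P \<and> place_degree R k (T n) Q dvd r}"
  have fin: "finite ?S" "finite {d. d dvd r}" using finite_over[of n] r by auto
  have "points r n = (\<Sum>d | d dvd r. \<Sum>Q | Q \<in> ?S \<and> place_degree R k (T n) Q = d. place_degree R k (T n) Q)"
    unfolding points_def using fin by (intro sum.group[symmetric]) auto
  also have "\<dots> = (\<Sum>d | d dvd r. d * num_places_over R k (T n) d P)"
  proof (rule sum.cong[OF refl])
    fix d assume d: "d \<in> {d. d dvd r}"
    have "{Q. Q \<in> ?S \<and> place_degree R k (T n) Q = d} = {Q \<in> places_over R k (T n) P. place_degree R k (T n) Q = d}"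
      using d by auto
    then show "(\<Sum>Q | Q \<in> ?S \<and> place_degree R k (T n) Q = d. place_degree R k (T n) Q) = d * num_places_over R k (T n) d P"
      unfolding num_places_over_def by simp
  qed
  finally show ?thesis .
qed

text \<open>Restriction to \<open>T n\<close> maps counted places to counted places, as degrees
  divide. Over each P' the degrees add up to at most deg P' \<Sum> f \<le> deg P' \<Sum> e f, to
  which the fundamental inequality applies.\<close>

lemma points_Suc: "points r (Suc n) \<le> dim (T n) (T (Suc n)) * points r n"
proof -
  let ?X = "\<lambda>n. {Q. Q \<in> places_over R k (T n) P \<and> place_degree R k (T n) Q dvd r}"
  have fX: "finite (?X n)" for n using finite_over[of n] by simp
  have P0: "T 0 \<subseteq> T n" using T_mono by simp
  have tr: "Q \<inter> T n \<in> places_over R k (T n) P" "Q \<in> places_over R k (T (Suc n)) (Q \<inter> T n)"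
    if "Q \<in> places_over R k (T (Suc n)) P" for Q
    using places_over_trans[OF T T T P0 T_sub P that] by auto
  have dim: "dimension (dim (T n) (T (Suc n))) (T n) (T (Suc n))"
    using finite_dimensionE[OF ff_subfield[OF T] T_fin] by (simp add: over_def)
  have "points r (Suc n) = (\<Sum>P'\<in>?X n. \<Sum>Q | Q \<in> ?X (Suc n) \<and> Q \<inter> T n = P'. place_degree R k (T (Suc n)) Q)"
    unfolding points_def
  proof (rule sum.group[OF fX fX, symmetric], rule image_subsetI)
    fix Q assume Q: "Q \<in> ?X (Suc n)"
    have pl: "Q \<inter> T n \<in> places R k (T n)" using places_overD[OF tr(1)] Q by blast
    have "place_degree R k (T n) (Q \<inter> T n) dvd place_degree R k (T (Suc n)) Q"
      using index_relative_degree(2)[OF T T T_sub pl tr(2)] Q by simp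
    then show "Q \<inter> T n \<in> ?X n" using tr(1) Q dvd_trans by blast
  qed
  also have "\<dots> \<le> (\<Sum>P'\<in>?X n. dim (T n) (T (Suc n)) * place_degree R k (T n) P')"
  proof (rule sum_mono)
    fix P' assume P': "P' \<in> ?X n"
    have pl: "P' \<in> places R k (T n)" using P' places_overD by blast
    note fi = fundamental_inequality[OF T T T_sub dim pl]
    let ?f = "relative_degree R (T n) P' (T (Suc n))" and ?e = "ramification_index R (T n) P' (T (Suc n))"
    have "(\<Sum>Q | Q \<in> ?X (Suc n) \<and> Q \<inter> T n = P'. place_degree R k (T (Suc n)) Q)
        \<le> (\<Sum>Q\<in>places_over R k (T (Suc n)) P'. place_degree R k (T (Suc n)) Q)"
      using tr(2) by (intro sum_mono2[OF fi(1)]) auto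
    also have "\<dots> = (\<Sum>Q\<in>places_over R k (T (Suc n)) P'. place_degree R k (T n) P' * ?f Q)"
      using index_relative_degree(2)[OF T T T_sub pl] by simp
    also have "\<dots> \<le> (\<Sum>Q\<in>places_over R k (T (Suc n)) P'. place_degree R k (T n) P' * (?e Q * ?f Q))"
      using ramification(2)[OF T T T_sub pl] by (intro sum_mono) (auto simp: Suc_le_eq)
    also have "\<dots> \<le> place_degree R k (T n) P' * dim (T n) (T (Suc n))"
      using fi(2) by (simp add: sum_distrib_left[symmetric])
    finally show "(\<Sum>Q | Q \<in> ?X (Suc n) \<and> Q \<inter> T n = P'. place_degree R k (T (Suc n)) Q)
        \<le> dim (T n) (T (Suc n)) * place_degree R k (T n) P'" by (simp add: mult.commute)
  qed
  also have "\<dots> = dim (T n) (T (Suc n)) * points r n" unfolding points_def by (simp add: sum_distrib_left)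
  finally show ?thesis .
qed

lemma points_convergent: "convergent (\<lambda>n. real (points r n) / real (dim (T 0) (T n)))"
proof -
  have "decseq (\<lambda>n. real (points r n) / real (dim (T 0) (T n)))"
  proof (rule decseq_SucI)
    fix n
    have d: "0 < dim (T 0) (T n)" "0 < dim (T 0) (T (Suc n))" using T_dim(3)[of n] T_dim(3)[of "Suc n"] by auto
    have "points r (Suc n) * dim (T 0) (T n) \<le> points r n * dim (T 0) (T (Suc n))"
      using mult_right_mono[OF points_Suc[of r n], of "dim (T 0) (T n)"] T_dim(2)[of n] by (simp add: mult_ac)
    then have "real (points r (Suc n)) * real (dim (T 0) (T n)) \<le> real (points r n) * real (dim (T 0) (T (Suc n)))"
      by (metis of_nat_le_iff of_nat_mult)
    then show "real (points r (Suc n)) / real (dim (T 0) (T (Suc n))) \<le> real (points r n) / real (dim (T 0) (T n))"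
      using d by (simp add: divide_simps mult.commute)
  qed
  then obtain l where "(\<lambda>n. real (points r n) / real (dim (T 0) (T n))) \<longlonglongrightarrow> l"
    by (rule decseq_convergent[of _ 0]) simp
  then show ?thesis by (rule convergentI)
qed

text \<open>By \<open>points_eq\<close>, r times the count in degree r is \<open>points r\<close>
  minus the contributions of the proper divisors of r; after normalisation the former converges by
  \<open>points_convergent\<close> and the latter by induction.\<close>

theorem nu_convergent:
  assumes "1 \<le> r"
  shows "convergent (\<lambda>n. real (num_places_over R k (T n) r P) / real (dim (T 0) (T n)))"
  using assms
proof (induction r rule: less_induct)
  case (less r)
  let ?b = "\<lambda>d n. real (num_places_over R k (T n) d P) / real (dim (T 0) (T n))"
  let ?D = "{d. d dvd r} - {r}"
  have fin: "finite {d. d dvd r}" using less by simp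
  have "convergent (\<lambda>n. \<Sum>d\<in>?D. real d * ?b d n)"
  proof (rule convergent_sum)
    fix d assume d: "d \<in> ?D"
    then have "d < r" "1 \<le> d" using less(2) dvd_imp_le[of d r] dvd_pos_nat[of r d] by auto
    then have "convergent (?b d)" by (rule less(1))
    then show "convergent (\<lambda>n. real d * ?b d n)" by (intro convergent_mult convergent_const)
  qed
  then have "convergent (\<lambda>n. real (points r n) / real (dim (T 0) (T n)) - (\<Sum>d\<in>?D. real d * ?b d n))"
    by (intro convergent_diff points_convergent)
  moreover have "real (points r n) / real (dim (T 0) (T n)) - (\<Sum>d\<in>?D. real d * ?b d n) = real r * ?b r n" for n
  proof -
    have "real (points r n) = (\<Sum>d | d dvd r. real d * real (num_places_over R k (T n) d P))"
      using points_eq[OF less(2), of n] by simp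
    also have "\<dots> = real r * real (num_places_over R k (T n) r P) + (\<Sum>d\<in>?D. real d * real (num_places_over R k (T n) d P))"
      using fin by (subst sum.remove[of _ r]) auto
    finally show ?thesis by (simp add: add_divide_distrib sum_divide_distrib)
  qed
  ultimately have c: "convergent (\<lambda>n. real r * ?b r n)" by (simp only:)
  have "real r \<noteq> 0" using less(2) by simp
  then show ?case using c convergent_mult_const_iff[of "real r" "?b r"] by blast
qed

end

end

section \<open>The composite tower\<close>

text \<open>The \<open>K\<close>-span of \<open>Us\<close> is a ring because \<open>E\<close> is
  closed under products, and a field because it is finite-dimensional over \<open>K\<close>;
  containing \<open>E\<close> and \<open>K\<close> and lying in the composite, it is the
  composite.\<close>

lemma (in field) composite_basis:
  assumes F: "subfield F R" and E: "subfield E R" and K: "subfield K R" and FE: "F \<subseteq> E" and FK: "F \<subseteq> K"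
    and Us: "independent F Us" "Span F Us = E" and ind: "independent K Us"
  shows "dimension (length Us) K (composite_field R E K)"
proof -
  have UR: "set Us \<subseteq> carrier R" using independent_in_carrier[OF Us(1)] .
  note KR = subfieldE(3)[OF K] and ER = subfieldE(3)[OF E] and Er = subfieldE(1)[OF E] and Kr = subfieldE(1)[OF K]
  let ?G = "composite_field R E K"
  have EK: "E \<union> K \<subseteq> carrier R" using KR ER by blast
  have G: "subfield ?G R" unfolding composite_field_def using generate_field_is_subfield[OF EK] .
  have sub: "E \<subseteq> ?G" "K \<subseteq> ?G" unfolding composite_field_def by (auto intro: generate_field.incl)
  define D where "D = Span K Us"
  have D: "additive_subgroup D R" "\<And>a x. a \<in> K \<Longrightarrow> x \<in> D \<Longrightarrow> a \<otimes> x \<in> D"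
    unfolding D_def using Span_module[OF Kr UR] by blast+
  have DR: "D \<subseteq> carrier R" using additive_subgroup.a_subset[OF D(1)] .
  have ED: "E \<subseteq> D"
  proof
    fix x assume "x \<in> E"
    then obtain as where "set as \<subseteq> F" "length as = length Us" "x = combine as Us"
      using Us(2) unfolding Span_eq_combine by blast
    then show "x \<in> D" unfolding D_def Span_eq_combine using FK by blast
  qed
  have UE: "set Us \<subseteq> E" using Span_base_incl[OF F UR] Us(2) by simp
  have one: "\<one> \<in> D" using ED subringE(3)[OF Er] by blast
  have KD: "K \<subseteq> D"
  proof
    fix a assume a: "a \<in> K"
    have "a \<otimes> \<one> \<in> D" using D(2)[OF a one] .
    then show "a \<in> D" using a KR by auto
  qed
  have Dr: "subring D R"
  proof (rule subringI[OF DR one])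
    fix x y assume x: "x \<in> D" and y: "y \<in> D"
    show "\<ominus> x \<in> D" using additive_subgroup.a_inv_closed[OF D(1) x] .
    show "x \<oplus> y \<in> D" using additive_subgroup.a_closed[OF D(1) x y] .
    obtain as where as: "set as \<subseteq> K" "length as = length Us" "x = combine as Us" using x unfolding D_def Span_eq_combine by blast
    obtain bs where bs: "set bs \<subseteq> K" "length bs = length Us" "y = combine bs Us" using y unfolding D_def Span_eq_combine by blast
    have asR: "set as \<subseteq> carrier R" "set bs \<subseteq> carrier R" using as(1) bs(1) KR by blast+
    have yR: "y \<in> carrier R" using y DR by blast
    have uy: "u \<otimes> y \<in> D" if u: "u \<in> set Us" for u
    proof -
      have uR: "u \<in> carrier R" using u UR by auto
      have "set (map (\<lambda>v. v \<otimes> u) Us) \<subseteq> D"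
      proof
        fix v assume "v \<in> set (map (\<lambda>v. v \<otimes> u) Us)"
        then obtain w where "w \<in> set Us" "v = w \<otimes> u" by auto
        then show "v \<in> D" using UE u subringE(6)[OF Er] ED by blast
      qed
      then have "combine bs (map (\<lambda>v. v \<otimes> u) Us) \<in> D" using combine_in_module[OF D(1) _ bs(1)] D(2) by blast
      moreover have "combine bs (map (\<lambda>v. v \<otimes> u) Us) = y \<otimes> u"
        using combine_l_distr[OF asR(2) UR uR] bs(3) by simp
      ultimately show ?thesis using m_comm[OF yR uR] by simp
    qed
    have "set (map (\<lambda>u. u \<otimes> y) Us) \<subseteq> D" using uy by auto
    then have "combine as (map (\<lambda>u. u \<otimes> y) Us) \<in> D" using combine_in_module[OF D(1) _ as(1)] D(2) by blast
    moreover have "combine as (map (\<lambda>u. u \<otimes> y) Us) = x \<otimes> y"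
      using combine_l_distr[OF asR(1) UR yR] as(3) by simp
    ultimately show "x \<otimes> y \<in> D" by simp
  qed
  have fd: "finite_dimension K D" unfolding D_def using Span_finite_dimension[OF K UR] .
  have "subfield D R"
  proof (rule subfieldI'[OF Dr])
    fix x assume x: "x \<in> D - {\<zero>}"
    have xR: "x \<in> carrier R" using x DR by blast
    have alg: "(algebraic over K) x" using finite_dimension_imp_algebraic[OF K Dr fd] x by blast
    have sf: "subfield (simple_extension K x) R" using simple_extension_is_subfield[OF K xR] alg by simp
    \<comment> \<open>Since x is algebraic, K[x] is a field, and it lies inside
      \<open>D\<close>.\<close>
    have "inv x \<in> simple_extension K x" using subfield_inv(1)[OF sf simple_extension_mem[OF Kr xR]] x by blast
    then show "inv x \<in> D" using simple_extension_subring_incl[OF Dr KD] x by blast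
  qed
  then have "?G \<subseteq> D" unfolding composite_field_def using generate_field_min_subfield1[OF EK] ED KD by blast
  moreover have "D \<subseteq> ?G"
  proof
    fix x assume "x \<in> D"
    then obtain as where as: "set as \<subseteq> K" "x = combine as Us" unfolding D_def Span_eq_combine by blast
    note Gr = subfieldE(1)[OF G]
    have "additive_subgroup ?G R" using subring_minus[OF Gr] subringE(1,2)[OF Gr] by (intro additive_subgroupI) auto
    moreover have "set Us \<subseteq> ?G" using UE sub(1) by (rule subset_trans)
    ultimately show "x \<in> ?G" unfolding as(2) using combine_in_module[of ?G K as Us] as(1) sub(2) subringE(6)[OF Gr] by blast
  qed
  ultimately have "Span K Us = ?G" unfolding D_def by blast
  then show ?thesis using dimensionI[OF K ind] by blast
qed

theorem theorem3p11:
  fixes L :: "('a, 'b) ring_scheme"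
    and k E P :: "'a set"
    and F :: "nat \<Rightarrow> 'a set"
    and M :: "'a set set"
    and y :: 'a
    and q m :: nat
  assumes "algebraic_closure L (F 0)"
    and "finite k" and "card k = q"
    and "tower L k F"
    and "finite_separable_extension L (F 0) E"
    and "is_composite_tower L k E F"
    and "y \<in> E" and "E = generate_field L (insert y (F 0))"
    and "m = ring.dim L (F 0) E"
    and "M = {P \<in> places L k (F 0).
               integral_basis_at L (F 0) P E (map (\<lambda>i. y [^]\<^bsub>L\<^esub> i) [0..<m])}"
    and "P \<in> M"
    and "\<forall>Q\<in>places_over L k E P. \<forall>n\<ge>1. \<forall>P'\<in>places_over L k (F n) P.
           coprime (ramification_index L (F 0) P E Q) (ramification_index L (F 0) P (F n) P')"
  shows "\<forall>Q\<in>places_over L k E P. \<forall>s\<ge>1.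
           nu L k s Q (composite_sequence L E F) =
             real (relative_degree L (F 0) P E Q) / real s *
               (\<Sum>d | lcm (place_degree L k E Q) d = s. real d * nu L k d P F)"
proof (intro ballI allI impI)
  fix Q s assume Q: "Q \<in> places_over L k E P" and s: "1 \<le> (s::nat)"
  interpret L: field L using assms(1) by (simp add: algebraic_closure_def)
  let ?C = "composite_sequence L E F"
  have tF: "function_field L k (F n)" "F n \<subseteq> F (Suc n)" "L.finite_dimension (F n) (F (Suc n))" for n
    using assms(4) unfolding tower_def finite_separable_extension_def by blast+
  have tC: "function_field L k (?C n)" "?C n \<subseteq> ?C (Suc n)" "L.finite_dimension (?C n) (?C (Suc n))" for n
    using assms(6) unfolding is_composite_tower_def tower_def finite_separable_extension_def by blast+
  have sk: "subfield k L" using tF(1) by (simp add: function_field_def)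
  have cf: "constant_field L k"
    using L.field_axioms sk assms(2) by (intro constant_field.intro constant_field_axioms.intro)
  interpret A: field_tower L k F by (intro field_tower.intro cf field_tower_axioms.intro tF)
  interpret B: field_tower L k ?C by (intro field_tower.intro cf field_tower_axioms.intro tC)
  have Ef: "subfield E L" and F0E: "F 0 \<subseteq> E" and fdE: "L.finite_dimension (F 0) E"
    using assms(5) by (auto simp: finite_separable_extension_def)
  have sF: "subfield (F n) L" for n using A.ff_subfield[OF tF(1)] .
  have sub: "E \<subseteq> ?C n" "F n \<subseteq> ?C n" for n
    unfolding composite_sequence_def composite_field_def by (auto intro: generate_field.incl)
  \<comment> \<open>The normalisation of \<open>nu\<close> refers to the 0-th field, so that of the
    composite tower has to be identified.\<close>
  have C0: "?C 0 = E"
  proof -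
    have "E \<union> F 0 \<subseteq> carrier L" using subfieldE(3)[OF Ef] F0E by auto
    then have "?C 0 \<subseteq> E"
      unfolding composite_sequence_def composite_field_def using L.generate_field_min_subfield1[OF _ Ef] F0E by blast
    then show ?thesis using sub(1)[of 0] by blast
  qed
  have ffE: "function_field L k E" using tC(1)[of 0] C0 by simp
  have P: "P \<in> places L k (F 0)" and ib: "integral_basis_at L (F 0) P E (map (\<lambda>i. y [^]\<^bsub>L\<^esub> i) [0..<m])"
    using assms(10,11) by auto
  define Us where "Us = map (\<lambda>i. y [^]\<^bsub>L\<^esub> i) [0..<m]"
  have len: "length Us = m" by (simp add: Us_def)
  let ?O = "ring_of_place L (F 0) P"
  have UR: "set Us \<subseteq> carrier L" and span: "L.Span ?O Us = integral_closure_in L ?O E"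
    and triv: "\<And>as. set as \<subseteq> ?O \<Longrightarrow> length as = length Us \<Longrightarrow> L.combine as Us = \<zero>\<^bsub>L\<^esub> \<Longrightarrow> set as \<subseteq> {\<zero>\<^bsub>L\<^esub>}"
    using ib unfolding integral_basis_at_def module_basis_def Us_def[symmetric] by auto
  have dP: "L.discrete_place (F 0) P" using A.place_discrete[OF tF(1) P] .
  have UE: "set Us \<subseteq> E"
  proof -
    have "y [^]\<^bsub>L\<^esub> (i::nat) \<in> E" for i
      by (induction i) (use assms(7) subringE(3,6)[OF subfieldE(1)[OF Ef]] in auto)
    then show ?thesis by (auto simp: Us_def)
  qed
  \<comment> \<open>\<open>module_basis\<close> gives independence over the local ring; rescaling of
    coefficients extends it to \<open>F 0\<close>.\<close>
  have ind0: "L.independent (F 0) Us"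
  proof (rule L.trivial_combine_val_ring[OF L.dp_facts(6)[OF dP] UR])
    fix as assume as: "set as \<subseteq> ?O" "length as = length Us" "\<one>\<^bsub>L\<^esub> \<in> set as"
    show "L.combine as Us \<noteq> \<zero>\<^bsub>L\<^esub>" using triv[OF as(1,2)] as(3) L.one_not_zero by blast
  qed
  have dimE: "L.dimension (length Us) (F 0) E"
    using L.finite_dimensionE[OF sF fdE] assms(9) len by (simp add: over_def)
  have spanE: "L.Span (F 0) Us = E" using L.independent_length_eq_dimension[OF sF dimE ind0 UE] by simp
  \<comment> \<open>Linear disjointness is given from level 1 on, so the counting below starts there
    as well.\<close>
  have ind: "L.independent (F n) Us" if "1 \<le> n" for n
    using assms(6) that UE ind0 unfolding is_composite_tower_def linearly_disjoint_def by blast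
  have F0n: "F 0 \<subseteq> F n" for n using A.T_mono by simp
  have dimC: "L.dimension (length Us) (F n) (?C n)" if "1 \<le> n" for n
    unfolding composite_sequence_def using L.composite_basis[OF sF Ef sF F0E F0n ind0 spanE ind[OF that]] .
  have Qp: "Q \<in> places L k E" "P \<subseteq> Q" using A.places_overD[OF Q] by auto
  let ?f = "relative_degree L (F 0) P E Q" and ?dQ = "place_degree L k E Q"
  let ?D = "{d. lcm ?dQ d = s}"
  have finD: "finite ?D"
  proof (rule finite_subset)
    show "?D \<subseteq> {d. d dvd s}" by auto
    show "finite {d. d dvd s}" using s by simp
  qed
  \<comment> \<open>The formula at level n. If lcm(deg Q, deg P') = s, then all places over
    \<open>Q\<close> and P' have degree s, and s times their number is f(Q|P) deg P'; any other P'
    contributes no place of degree s.\<close>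
  have count: "s * num_places_over L k (?C n) s Q = ?f * (\<Sum>d\<in>?D. d * num_places_over L k (F n) d P)"
    if n: "1 \<le> n" for n
  proof -
    let ?N = "\<lambda>P'. {Q' \<in> places_over L k (?C n) Q. P' \<subseteq> Q'}"
    let ?S = "places_over L k (F n) P" and ?X = "{Q' \<in> places_over L k (?C n) Q. place_degree L k (?C n) Q' = s}"
    have fS: "finite ?S" using A.finite_over[OF P] .
    have pc: "place_composite L k (F 0) E (F n) (?C n) P P' Us" if "P' \<in> ?S" for P'
    proof (intro place_composite.intro cf place_composite_axioms.intro tF(1) ffE tC(1) F0E F0n sub P that
        dimE dimC[OF n] UR ind[OF n] span)
      show "coprime (ramification_index L (F 0) P E Q) (ramification_index L (F 0) P (F n) P')"
        if "Q \<in> places_over L k E P" for Q using assms(12) that n \<open>P' \<in> ?S\<close> by blast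
    qed
    have deg: "place_degree L k (?C n) Q' = lcm ?dQ (place_degree L k (F n) P')" if "P' \<in> ?S" "Q' \<in> ?N P'" for P' Q'
      using place_composite.composite_places(1)[OF pc[OF that(1)] Q that(2)] .
    have card: "card (?N P') * lcm ?dQ (place_degree L k (F n) P') = ?f * place_degree L k (F n) P'" if "P' \<in> ?S" for P'
      using place_composite.composite_places(2)[OF pc[OF that] Q] .
    have QP: "Q' \<in> places_over L k (?C n) P" if "Q' \<in> places_over L k (?C n) Q" for Q'
      using that Qp(2) by (auto simp: places_over_def)
    have rs: "Q' \<inter> F n \<in> ?S" "Q' \<in> places_over L k (?C n) (Q' \<inter> F n)" if "Q' \<in> places_over L k (?C n) Q" for Q'
      using A.places_over_trans[OF tF(1) tF(1) tC(1) F0n sub(2) P QP[OF that]] by auto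
    have fX: "finite ?X"
    proof -
      have QC: "Q \<in> places L k (?C 0)" using Qp(1) C0 by simp
      show ?thesis using B.finite_over[OF QC, of n] by simp
    qed
    \<comment> \<open>The places of degree s over \<open>Q\<close> are sorted by their restriction
      to \<open>F n\<close>.\<close>
    have "s * card ?X = s * (\<Sum>P'\<in>?S. card {Q' \<in> ?X. Q' \<inter> F n = P'})"
    proof -
      have "(\<Sum>P'\<in>?S. \<Sum>Q' | Q' \<in> ?X \<and> Q' \<inter> F n = P'. (1::nat)) = (\<Sum>Q'\<in>?X. 1)"
        using rs(1) by (intro sum.group[OF fX fS]) auto
      then show ?thesis by simp
    qed
    also have "\<dots> = (\<Sum>P'\<in>?S. if lcm ?dQ (place_degree L k (F n) P') = s then ?f * place_degree L k (F n) P' else 0)"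
      unfolding sum_distrib_left
    proof (rule sum.cong[OF refl])
      fix P' assume P': "P' \<in> ?S"
      have P'F: "P' \<in> places L k (F n)" using A.places_overD[OF P'] by blast
      have eq: "Q' \<inter> F n = P' \<longleftrightarrow> P' \<subseteq> Q'" if Q': "Q' \<in> places_over L k (?C n) Q" for Q'
      proof
        assume "P' \<subseteq> Q'"
        then have "Q' \<in> places_over L k (?C n) P'" using Q' by (auto simp: places_over_def)
        then show "Q' \<inter> F n = P'" using A.places_over_restrict(2)[OF tF(1) tC(1) sub(2) P'F] by blast
      qed blast
      have set: "{Q' \<in> ?X. Q' \<inter> F n = P'} = {Q' \<in> ?N P'. place_degree L k (?C n) Q' = s}" using eq by blast
      show "s * card {Q' \<in> ?X. Q' \<inter> F n = P'} =
        (if lcm ?dQ (place_degree L k (F n) P') = s then ?f * place_degree L k (F n) P' else 0)"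
      proof (cases "lcm ?dQ (place_degree L k (F n) P') = s")
        case True
        then have "{Q' \<in> ?N P'. place_degree L k (?C n) Q' = s} = ?N P'" using deg[OF P'] by blast
        then show ?thesis unfolding set using card[OF P'] True by (simp add: mult.commute)
      next
        case False
        have "{Q' \<in> ?N P'. place_degree L k (?C n) Q' = s} = {}"
        proof (rule equals0I)
          fix Q' assume Q': "Q' \<in> {Q' \<in> ?N P'. place_degree L k (?C n) Q' = s}"
          then show False using deg[OF P', of Q'] False by simp
        qed
        then show ?thesis unfolding set by (simp only: card.empty mult_0_right False if_False)
      qed
    qed
    also have "\<dots> = (\<Sum>P' | P' \<in> ?S \<and> place_degree L k (F n) P' \<in> ?D. ?f * place_degree L k (F n) P')"
      unfolding mem_Collect_eq by (rule sum.inter_filter[OF fS, symmetric])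
    also have "\<dots> = (\<Sum>d\<in>?D. \<Sum>P' | P' \<in> {P' \<in> ?S. place_degree L k (F n) P' \<in> ?D} \<and> place_degree L k (F n) P' = d. ?f * place_degree L k (F n) P')"
      using fS finD by (intro sum.group[symmetric]) auto
    also have "\<dots> = (\<Sum>d\<in>?D. ?f * (d * num_places_over L k (F n) d P))"
    proof (rule sum.cong[OF refl])
      fix d assume "d \<in> ?D"
      then have "{P'. P' \<in> {P' \<in> ?S. place_degree L k (F n) P' \<in> ?D} \<and> place_degree L k (F n) P' = d}
        = {P' \<in> ?S. place_degree L k (F n) P' = d}" by auto
      then show "(\<Sum>P' | P' \<in> {P' \<in> ?S. place_degree L k (F n) P' \<in> ?D} \<and> place_degree L k (F n) P' = d. ?f * place_degree L k (F n) P')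
        = ?f * (d * num_places_over L k (F n) d P)"
        unfolding num_places_over_def by simp
    qed
    finally show ?thesis unfolding num_places_over_def by (simp add: sum_distrib_left)
  qed
  \<comment> \<open>The degree of the composite over \<open>F 0\<close> is computed through
    \<open>F n\<close> and through \<open>E\<close>, and the common factor m is cancelled.\<close>
  have dims: "L.dim (?C 0) (?C n) = L.dim (F 0) (F n)" if n: "1 \<le> n" for n
  proof -
    have m1: "L.dim (F n) (?C n) = m" using L.dimI[OF sF dimC[OF n]] len by (simp add: over_def)
    have "L.dim (F 0) (?C n) = L.dim (F 0) (F n) * m"
      using L.telescopic_base_dim(2)[OF sF sF A.T_dim(1) L.finite_dimensionI[OF dimC[OF n]]] m1 by (simp add: over_def)
    moreover have "L.dim (F 0) (?C n) = m * L.dim E (?C n)"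
    proof -
      have "L.finite_dimension E (?C n)" using B.T_dim(1)[of n] C0 by simp
      then show ?thesis using L.telescopic_base_dim(2)[OF sF Ef fdE] assms(9) by (simp add: over_def)
    qed
    moreover have "m \<noteq> 0"
    proof
      assume "m = 0"
      then have "L.dimension 0 (F 0) E" using dimE len by simp
      then have "E = {\<zero>\<^bsub>L\<^esub>}" using L.dimension_zero[OF sF] by blast
      then show False using subringE(3)[OF subfieldE(1)[OF Ef]] by auto
    qed
    ultimately show ?thesis using C0 by simp
  qed
  let ?b = "\<lambda>d n. real (num_places_over L k (F n) d P) / real (L.dim (F 0) (F n))"
  have lim: "?b d \<longlonglongrightarrow> nu L k d P F" if d: "d \<in> ?D" for d
  proof -
    \<comment> \<open>An lcm with 0 is 0, which differs from s, so d = 0 does not occur in the index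
      set.\<close>
    have "1 \<le> d" using d s by (cases d) auto
    then have "convergent (?b d)" using A.nu_convergent[OF P] by blast
    then show ?thesis unfolding nu_def by (simp add: convergent_LIMSEQ_iff)
  qed
  have "(\<lambda>n. real ?f / real s * (\<Sum>d\<in>?D. real d * ?b d n))
      \<longlonglongrightarrow> real ?f / real s * (\<Sum>d\<in>?D. real d * nu L k d P F)"
    by (intro tendsto_mult tendsto_const tendsto_sum lim)
  \<comment> \<open>Level 0 is outside the counting formula, hence equality is claimed only
    eventually.\<close>
  moreover have "eventually (\<lambda>n. real ?f / real s * (\<Sum>d\<in>?D. real d * ?b d n)
      = real (num_places_over L k (?C n) s Q) / real (L.dim (?C 0) (?C n))) sequentially"
  proof (rule eventually_sequentiallyI[of 1])
    fix n :: nat assume n: "1 \<le> n"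
    have "real s * real (num_places_over L k (?C n) s Q) = real ?f * (\<Sum>d\<in>?D. real d * real (num_places_over L k (F n) d P))"
      using arg_cong[OF count[OF n], of real] by simp
    then have c: "real (num_places_over L k (?C n) s Q) = real ?f / real s * (\<Sum>d\<in>?D. real d * real (num_places_over L k (F n) d P))"
      using s by (simp add: field_simps)
    show "real ?f / real s * (\<Sum>d\<in>?D. real d * ?b d n)
      = real (num_places_over L k (?C n) s Q) / real (L.dim (?C 0) (?C n))"
      unfolding dims[OF n] c by (simp add: sum_divide_distrib[symmetric])
  qed
  ultimately have "(\<lambda>n. real (num_places_over L k (?C n) s Q) / real (L.dim (?C 0) (?C n)))
      \<longlonglongrightarrow> real ?f / real s * (\<Sum>d\<in>?D. real d * nu L k d P F)"
    by (rule Lim_transform_eventually)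
  then show "nu L k s Q ?C = real ?f / real s * (\<Sum>d | lcm ?dQ d = s. real d * nu L k d P F)"
    unfolding nu_def by (rule limI)
qed

end
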